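(* Let $T$ be a theory. The 2-category $\mathcal{C}$ of small pseudo $T$-algebras admits weighted pseudo limits: for every small 2-category $\mathcal{D}$ and all pseudo functors $J:\mathcal{D}\to Cat$ and $F:\mathcal{D}\to\mathcal{C}$, there exists a $J$-weighted pseudo limit $\{J,F\}_p$ of $F$ in $\mathcal{C}$.
   Context: Weighted pseudo limits. $Cat$ is the 2-category of small categories; pseudo functors and pseudo natural transformations have invertible coherence 2-cells. $Hom[\mathcal{D},Cat]$ is the 2-category of pseudo functors $\mathcal{D}\to Cat$, pseudo natural transformations and modifications. An object $\{J,F\}_p$ of $\mathcal{C}$ is a $J$-weighted pseudo limit of $F$ if the strict 2-functors $\mathcal{C}^{op}\to Cat$, $C\mapsto\mathcal{C}(C,\{J,F\}_p)$ and $C\mapsto Hom[\mathcal{D},Cat](J,\mathcal{C}(C,F-))$, are 2-naturally isomorphic. Theories. A theory $T$ is a category with objects $0,1,2,\dots$ in which $n$ is the product of $n$ copies of $1$, with chosen projections $pr_i:n\to 1$. Put $T(n)=Mor_T(n,1)$ (words of arity $n$). For a function $f:\{1,\dots,k\}\to\{1,\dots,\ell\}$ let $f':\ell\to k$ be the morphism with $pr_i f'=pr_{f(i)}$, and for $w\in T(k)$ put $w_f=w\circ f'\in T(\ell)$. For $w\in T(k)$, $w_i\in T(n_i)$ put $\gamma(w,w_1,\dots,w_k)=w\circ(w_1,\dots,w_k)\in T(n_1+\dots+n_k)$, where $(w_1,\dots,w_k):n_1+\dots+n_k\to k$ has $i$-th component $(w_i)_{\iota_i}$, $\iota_i$ being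 the inclusion onto the $i$-th block. The unit $1\in T(1)$ is the projection $pr_1:1\to1$. For a category $X$, $End(X)$ is the theory with $End(X)(n)=Functors(X^n,X)$; there $\gamma(F,F_1,\dots,F_k)=F\circ(F_1\times\dots\times F_k)$, $F_f(x_1,\dots,x_\ell)=F(x_{f1},\dots,x_{fk})$, and the unit is $1_X$; these operations also apply to natural transformations. Pseudo $T$-algebras. A pseudo $T$-algebra is a category $X$ with functions $\Phi:T(n)\to Functors(X^n,X)$ for all $n\ge 0$ and natural isomorphisms $c_{w,w_1,\dots,w_k}:\Phi(\gamma(w,w_1,\dots,w_k))\Rightarrow\gamma(\Phi(w),\Phi(w_1),\dots,\Phi(w_k))$, $I:\Phi(1)\Rightarrow 1_X$, $s_{w,f}:\Phi(w_f)\Rightarrow\Phi(w)_f$, such that (vertical composition written $\circ$, $i$ = identity 2-cell): (1) $\gamma(c_{w,w_1,\dots,w_k},i,\dots,i)\circ c_{\gamma(w,w_1,\dots,w_k),w_{11},\dots,w_{kn_k}}=\gamma(i_{\Phi(w)},c_{w_1,w_{11},\dots,w_{1n_1}},\dots,c_{w_k,w_{k1},\dots,w_{kn_k}})\circ c_{w,\gamma(w_1,w_{11},\dots),\dots,\gamma(w_k,w_{k1},\dots)}$; (2) $\gamma(i_{\Phi(w)},I,\dots,I)\circ c_{w,1,\dots,1}=i$; (3) $\gamma(I,i_{\Phi(w)})\circ c_{1,w}=i$; (4) for $f:\{1,\dots,k\}\to\{1,\dots,\ell\}$, $w\in T(k)$, $w_j\in T(n_j)$ ($1\le j\le\ell$),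 with $\bar f:\{1,\dots,n_{f1}+\dots+n_{fk}\}\to\{1,\dots,n_1+\dots+n_\ell\}$ carrying the $i$-th block identically onto the $f(i)$-th block: $(c_{w,w_{f1},\dots,w_{fk}})_{\bar f}\circ s_{\gamma(w,w_{f1},\dots,w_{fk}),\bar f}=\gamma(s_{w,f},i,\dots,i)\circ c_{w_f,w_1,\dots,w_\ell}$; (5) for functions $g_i:\{1,\dots,n_i\}\to\{1,\dots,n_i'\}$ with block sum $g=g_1+\dots+g_k$: $(c_{w,w_1,\dots,w_k})_g\circ s_{\gamma(w,w_1,\dots,w_k),g}=\gamma(i_{\Phi(w)},s_{w_1,g_1},\dots,s_{w_k,g_k})\circ c_{w,(w_1)_{g_1},\dots,(w_k)_{g_k}}$; (6) $(s_{w,f})_g\circ s_{w_f,g}=s_{w,g\circ f}$; (7) $s_{w,id}$ is the identity. A morphism $H:(X,\Phi)\to(Y,\Psi)$ of pseudo $T$-algebras is a functor with natural isomorphisms $\rho_w:H\circ\Phi(w)\Rightarrow\Psi(w)\circ(H,\dots,H)$ for all words $w$ such that $(c*i)\circ\rho_{\gamma(w,w_1,\dots,w_k)}=(i_{\Psi(w)}*(\rho_{w_1},\dots,\rho_{w_k}))\circ(\rho_w*i)\circ(i_H*c)$, $(I*i_H)\circ\rho_1=i_H*I$, and $(s_{w,f}*i)\circ\rho_{w_f}=(\rho_w)_f\circ(i_H*s_{w,f})$. Composites have $\rho^{HG}_w=(\rho^H_w*i)\circ(i_H*\rho^G_w)$. A 2-cell $\alpha:G\Rightarrow H$ is a natural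 transformation with $\rho^H_w\circ(\alpha*i_{\Phi(w)})=(i_{\Psi(w)}*(\alpha,\dots,\alpha))\circ\rho^G_w$ for all $w$. *)

theory Defs
  imports "HOL-Library.Equipollence" "HOL-Library.FuncSet"
begin

section \<open>Smallness\<close>

text \<open>
  Small sets are the subsets of a fixed type that are of strictly smaller cardinality than that
  type, whose cardinal is required to be an infinite regular strong limit.  These are the closure
  properties of a Grothendieck universe; they include inaccessible cardinals (the usual meaning of
  ``small''), and the class is inhabited by \<open>nat\<close>, for which small means finite.
\<close>

class universe =
  assumes universe_infinite: "infinite (UNIV :: 'a set)"
    and universe_Pow: "(A :: 'a set) \<prec> (UNIV :: 'a set) \<Longrightarrow> Pow A \<prec> (UNIV :: 'a set)"
    and universe_UN: "(I :: 'a set) \<prec> (UNIV :: 'a set) \<Longrightarrow>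
      (\<And>i. i \<in> I \<Longrightarrow> (B :: 'a \<Rightarrow> 'a set) i \<prec> (UNIV :: 'a set)) \<Longrightarrow>
      (\<Union>i\<in>I. B i) \<prec> (UNIV :: 'a set)"

instance nat :: universe
proof
  have fin: "A \<prec> (UNIV :: nat set) \<longleftrightarrow> finite A" for A :: "'b set"
  proof
    assume "A \<prec> (UNIV :: nat set)"
    then show "finite A"
      using infinite_le_lepoll lesspoll_def lepoll_antisym by metis
  next
    assume "finite A"
    then show "A \<prec> (UNIV :: nat set)"
      by (simp add: finite_lesspoll_infinite)
  qed
  show "infinite (UNIV :: nat set)" by simp
  show "Pow A \<prec> (UNIV :: nat set)" if "A \<prec> (UNIV :: nat set)" for A :: "nat set"
    using that by (simp add: fin)
  show "(\<Union>i\<in>I. B i) \<prec> (UNIV :: nat set)"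
    if "I \<prec> (UNIV :: nat set)" "\<And>i. i \<in> I \<Longrightarrow> B i \<prec> (UNIV :: nat set)"
    for I :: "nat set" and B :: "nat \<Rightarrow> nat set"
    using that by (simp add: fin)
qed

definition small :: "'u::universe set \<Rightarrow> bool" where
  "small A \<longleftrightarrow> A \<prec> (UNIV :: 'u set)"


section \<open>Categories, functors, natural transformations\<close>

text \<open>
  Composition is in applicative order: \<open>Comp C g f\<close> is \<open>g\<close> after \<open>f\<close>.
  Functors and natural transformations carry their boundaries, and their maps are \<open>extensional\<close>
  (that is, \<open>undefined\<close> outside their domain), so that HOL equality is the intended equality.
\<close>

record ('o, 'a) cat =
  Obj :: "'o set"
  Arr :: "'a set"
  Dom :: "'a \<Rightarrow> 'o"
  Cod :: "'a \<Rightarrow> 'o"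
  Ide :: "'o \<Rightarrow> 'a"
  Comp :: "'a \<Rightarrow> 'a \<Rightarrow> 'a"

locale category =
  fixes C :: "('o, 'a) cat"
  assumes dom_obj: "f \<in> Arr C \<Longrightarrow> Dom C f \<in> Obj C"
    and cod_obj: "f \<in> Arr C \<Longrightarrow> Cod C f \<in> Obj C"
    and ide_arr: "x \<in> Obj C \<Longrightarrow> Ide C x \<in> Arr C"
    and ide_dom: "x \<in> Obj C \<Longrightarrow> Dom C (Ide C x) = x"
    and ide_cod: "x \<in> Obj C \<Longrightarrow> Cod C (Ide C x) = x"
    and comp_arr: "\<lbrakk>f \<in> Arr C; g \<in> Arr C; Dom C g = Cod C f\<rbrakk> \<Longrightarrow> Comp C g f \<in> Arr C"
    and comp_dom: "\<lbrakk>f \<in> Arr C; g \<in> Arr C; Dom C g = Cod C f\<rbrakk> \<Longrightarrow> Dom C (Comp C g f) = Dom C f"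
    and comp_cod: "\<lbrakk>f \<in> Arr C; g \<in> Arr C; Dom C g = Cod C f\<rbrakk> \<Longrightarrow> Cod C (Comp C g f) = Cod C g"
    and comp_ide_right: "f \<in> Arr C \<Longrightarrow> Comp C f (Ide C (Dom C f)) = f"
    and comp_ide_left: "f \<in> Arr C \<Longrightarrow> Comp C (Ide C (Cod C f)) f = f"
    and comp_assoc: "\<lbrakk>f \<in> Arr C; g \<in> Arr C; h \<in> Arr C; Dom C g = Cod C f; Dom C h = Cod C g\<rbrakk>
      \<Longrightarrow> Comp C h (Comp C g f) = Comp C (Comp C h g) f"

definition iso_arr :: "('o, 'a) cat \<Rightarrow> 'a \<Rightarrow> bool" where
  "iso_arr C f \<longleftrightarrow> f \<in> Arr C \<and>
    (\<exists>g\<in>Arr C. Dom C g = Cod C f \<and> Cod C g = Dom C f \<and>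
      Comp C g f = Ide C (Dom C f) \<and> Comp C f g = Ide C (Cod C f))"

record ('o, 'a, 'p, 'b) func =
  FDom :: "('o, 'a) cat"
  FCod :: "('p, 'b) cat"
  FO :: "'o \<Rightarrow> 'p"
  FA :: "'a \<Rightarrow> 'b"

locale is_functor =
  fixes A :: "('o, 'a) cat" and B :: "('p, 'b) cat" and F :: "('o, 'a, 'p, 'b) func"
  assumes dom_cat: "category A" and cod_cat: "category B"
    and FDom: "FDom F = A" and FCod: "FCod F = B"
    and FO_ext: "FO F \<in> extensional (Obj A)" and FA_ext: "FA F \<in> extensional (Arr A)"
    and FO_obj: "x \<in> Obj A \<Longrightarrow> FO F x \<in> Obj B"
    and FA_arr: "f \<in> Arr A \<Longrightarrow> FA F f \<in> Arr B"
    and FA_dom: "f \<in> Arr A \<Longrightarrow> Dom B (FA F f) = FO F (Dom A f)"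
    and FA_cod: "f \<in> Arr A \<Longrightarrow> Cod B (FA F f) = FO F (Cod A f)"
    and FA_ide: "x \<in> Obj A \<Longrightarrow> FA F (Ide A x) = Ide B (FO F x)"
    and FA_comp: "\<lbrakk>f \<in> Arr A; g \<in> Arr A; Dom A g = Cod A f\<rbrakk> \<Longrightarrow>
      FA F (Comp A g f) = Comp B (FA F g) (FA F f)"

definition id_func :: "('o, 'a) cat \<Rightarrow> ('o, 'a, 'o, 'a) func" where
  "id_func A = \<lparr>FDom = A, FCod = A, FO = (\<lambda>x\<in>Obj A. x), FA = (\<lambda>f\<in>Arr A. f)\<rparr>"

definition comp_func ::
  "('p, 'b, 'q, 'c) func \<Rightarrow> ('o, 'a, 'p, 'b) func \<Rightarrow> ('o, 'a, 'q, 'c) func" where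
  "comp_func G F = \<lparr>FDom = FDom F, FCod = FCod G,
    FO = (\<lambda>x\<in>Obj (FDom F). FO G (FO F x)), FA = (\<lambda>f\<in>Arr (FDom F). FA G (FA F f))\<rparr>"

definition cat_iso :: "('o, 'a) cat \<Rightarrow> ('p, 'b) cat \<Rightarrow> ('o, 'a, 'p, 'b) func \<Rightarrow> bool" where
  "cat_iso A B F \<longleftrightarrow> is_functor A B F \<and>
    (\<exists>G. is_functor B A G \<and> comp_func G F = id_func A \<and> comp_func F G = id_func B)"

record ('o, 'a, 'p, 'b) ntrans =
  NDom :: "('o, 'a, 'p, 'b) func"
  NCod :: "('o, 'a, 'p, 'b) func"
  NC :: "'o \<Rightarrow> 'b"

locale nat_trans =
  fixes A :: "('o, 'a) cat" and B :: "('p, 'b) cat"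
    and F G :: "('o, 'a, 'p, 'b) func" and \<alpha> :: "('o, 'a, 'p, 'b) ntrans"
  assumes dom_functor: "is_functor A B F" and cod_functor: "is_functor A B G"
    and NDom: "NDom \<alpha> = F" and NCod: "NCod \<alpha> = G"
    and NC_ext: "NC \<alpha> \<in> extensional (Obj A)"
    and NC_arr: "x \<in> Obj A \<Longrightarrow> NC \<alpha> x \<in> Arr B"
    and NC_dom: "x \<in> Obj A \<Longrightarrow> Dom B (NC \<alpha> x) = FO F x"
    and NC_cod: "x \<in> Obj A \<Longrightarrow> Cod B (NC \<alpha> x) = FO G x"
    and naturality: "f \<in> Arr A \<Longrightarrow>
      Comp B (NC \<alpha> (Cod A f)) (FA F f) = Comp B (FA G f) (NC \<alpha> (Dom A f))"

locale nat_iso = nat_trans A B F G \<alpha>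
  for A :: "('o, 'a) cat" and B :: "('p, 'b) cat"
    and F G :: "('o, 'a, 'p, 'b) func" and \<alpha> :: "('o, 'a, 'p, 'b) ntrans" +
  assumes NC_iso: "x \<in> Obj A \<Longrightarrow> iso_arr B (NC \<alpha> x)"

definition id_nat :: "('o, 'a, 'p, 'b) func \<Rightarrow> ('o, 'a, 'p, 'b) ntrans" where
  "id_nat F = \<lparr>NDom = F, NCod = F, NC = (\<lambda>x\<in>Obj (FDom F). Ide (FCod F) (FO F x))\<rparr>"

definition vcomp_nat ::
  "('o, 'a, 'p, 'b) ntrans \<Rightarrow> ('o, 'a, 'p, 'b) ntrans \<Rightarrow> ('o, 'a, 'p, 'b) ntrans" where
  "vcomp_nat \<beta> \<alpha> = \<lparr>NDom = NDom \<alpha>, NCod = NCod \<beta>,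
    NC = (\<lambda>x\<in>Obj (FDom (NDom \<alpha>)). Comp (FCod (NDom \<alpha>)) (NC \<beta> x) (NC \<alpha> x))\<rparr>"

definition hcomp_nat ::
  "('p, 'b, 'q, 'c) ntrans \<Rightarrow> ('o, 'a, 'p, 'b) ntrans \<Rightarrow> ('o, 'a, 'q, 'c) ntrans" where
  "hcomp_nat \<beta> \<alpha> = \<lparr>NDom = comp_func (NDom \<beta>) (NDom \<alpha>), NCod = comp_func (NCod \<beta>) (NCod \<alpha>),
    NC = (\<lambda>x\<in>Obj (FDom (NDom \<alpha>)).
      Comp (FCod (NDom \<beta>)) (NC \<beta> (FO (NCod \<alpha>) x)) (FA (NDom \<beta>) (NC \<alpha> x)))\<rparr>"


section \<open>2-categories and pseudo functors\<close>

record ('o, 'm, 'c) two_cat =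
  Cell0 :: "'o set"
  Cell1 :: "'m set"
  Cell2 :: "'c set"
  Src :: "'m \<Rightarrow> 'o"
  Trg :: "'m \<Rightarrow> 'o"
  Dom2 :: "'c \<Rightarrow> 'm"
  Cod2 :: "'c \<Rightarrow> 'm"
  Ide1 :: "'o \<Rightarrow> 'm"
  Comp1 :: "'m \<Rightarrow> 'm \<Rightarrow> 'm"
  Ide2 :: "'m \<Rightarrow> 'c"
  VComp :: "'c \<Rightarrow> 'c \<Rightarrow> 'c"
  HComp :: "'c \<Rightarrow> 'c \<Rightarrow> 'c"

definition under_cat :: "('o, 'm, 'c) two_cat \<Rightarrow> ('o, 'm) cat" where
  "under_cat C = \<lparr>Obj = Cell0 C, Arr = Cell1 C, Dom = Src C, Cod = Trg C,
    Ide = Ide1 C, Comp = Comp1 C\<rparr>"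

definition vert_cat :: "('o, 'm, 'c) two_cat \<Rightarrow> ('m, 'c) cat" where
  "vert_cat C = \<lparr>Obj = Cell1 C, Arr = Cell2 C, Dom = Dom2 C, Cod = Cod2 C,
    Ide = Ide2 C, Comp = VComp C\<rparr>"

definition horiz_cat :: "('o, 'm, 'c) two_cat \<Rightarrow> ('o, 'c) cat" where
  "horiz_cat C = \<lparr>Obj = Cell0 C, Arr = Cell2 C,
    Dom = (\<lambda>a. Src C (Dom2 C a)), Cod = (\<lambda>a. Trg C (Dom2 C a)),
    Ide = (\<lambda>x. Ide2 C (Ide1 C x)), Comp = HComp C\<rparr>"

locale two_category =
  fixes C :: "('o, 'm, 'c) two_cat"
  assumes under_category: "category (under_cat C)"
    and vert_category: "category (vert_cat C)"
    and horiz_category: "category (horiz_cat C)"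
    and Src_globular: "a \<in> Cell2 C \<Longrightarrow> Src C (Dom2 C a) = Src C (Cod2 C a)"
    and Trg_globular: "a \<in> Cell2 C \<Longrightarrow> Trg C (Dom2 C a) = Trg C (Cod2 C a)"
    and HComp_dom: "\<lbrakk>a \<in> Cell2 C; b \<in> Cell2 C; Src C (Dom2 C b) = Trg C (Dom2 C a)\<rbrakk> \<Longrightarrow>
      Dom2 C (HComp C b a) = Comp1 C (Dom2 C b) (Dom2 C a)"
    and HComp_cod: "\<lbrakk>a \<in> Cell2 C; b \<in> Cell2 C; Src C (Dom2 C b) = Trg C (Dom2 C a)\<rbrakk> \<Longrightarrow>
      Cod2 C (HComp C b a) = Comp1 C (Cod2 C b) (Cod2 C a)"
    and HComp_ide: "\<lbrakk>f \<in> Cell1 C; g \<in> Cell1 C; Src C g = Trg C f\<rbrakk> \<Longrightarrow>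
      HComp C (Ide2 C g) (Ide2 C f) = Ide2 C (Comp1 C g f)"
    and interchange: "\<lbrakk>a \<in> Cell2 C; a' \<in> Cell2 C; b \<in> Cell2 C; b' \<in> Cell2 C;
      Dom2 C a' = Cod2 C a; Dom2 C b' = Cod2 C b; Src C (Dom2 C b) = Trg C (Dom2 C a)\<rbrakk> \<Longrightarrow>
      HComp C (VComp C b' b) (VComp C a' a) = VComp C (HComp C b' a') (HComp C b a)"

definition small_two_category :: "('u::universe, 'u, 'u) two_cat \<Rightarrow> bool" where
  "small_two_category D \<longleftrightarrow>
    two_category D \<and> small (Cell0 D) \<and> small (Cell1 D) \<and> small (Cell2 D)"

definition hom_cat :: "('o, 'm, 'c) two_cat \<Rightarrow> 'o \<Rightarrow> 'o \<Rightarrow> ('m, 'c) cat" where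
  "hom_cat C X Y = \<lparr>
    Obj = {f \<in> Cell1 C. Src C f = X \<and> Trg C f = Y},
    Arr = {a \<in> Cell2 C. Src C (Dom2 C a) = X \<and> Trg C (Dom2 C a) = Y},
    Dom = Dom2 C, Cod = Cod2 C, Ide = Ide2 C, Comp = VComp C\<rparr>"

definition op_two_cat :: "('o, 'm, 'c) two_cat \<Rightarrow> ('o, 'm, 'c) two_cat" where
  "op_two_cat C = C\<lparr>Src := Trg C, Trg := Src C,
    Comp1 := (\<lambda>g f. Comp1 C f g), HComp := (\<lambda>b a. HComp C a b)\<rparr>"

text \<open>
  The coherence cells are \<open>PComp P g f : P g \<circ> P f \<Rightarrow> P (g \<circ> f)\<close> and
  \<open>PUnit P x : 1 \<Rightarrow> P 1\<^sub>x\<close>.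
\<close>

record ('o, 'm, 'c, 'o2, 'm2, 'c2) psfun =
  P0 :: "'o \<Rightarrow> 'o2"
  P1 :: "'m \<Rightarrow> 'm2"
  P2 :: "'c \<Rightarrow> 'c2"
  PComp :: "'m \<Rightarrow> 'm \<Rightarrow> 'c2"
  PUnit :: "'o \<Rightarrow> 'c2"

locale pseudo_functor =
  fixes D :: "('o, 'm, 'c) two_cat" and E :: "('o2, 'm2, 'c2) two_cat"
    and P :: "('o, 'm, 'c, 'o2, 'm2, 'c2) psfun"
  assumes P0_cell: "x \<in> Cell0 D \<Longrightarrow> P0 P x \<in> Cell0 E"
    and P1_cell: "f \<in> Cell1 D \<Longrightarrow> P1 P f \<in> Cell1 E"
    and P1_src: "f \<in> Cell1 D \<Longrightarrow> Src E (P1 P f) = P0 P (Src D f)"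
    and P1_trg: "f \<in> Cell1 D \<Longrightarrow> Trg E (P1 P f) = P0 P (Trg D f)"
    and P2_cell: "a \<in> Cell2 D \<Longrightarrow> P2 P a \<in> Cell2 E"
    and P2_dom: "a \<in> Cell2 D \<Longrightarrow> Dom2 E (P2 P a) = P1 P (Dom2 D a)"
    and P2_cod: "a \<in> Cell2 D \<Longrightarrow> Cod2 E (P2 P a) = P1 P (Cod2 D a)"
    and P2_ide: "f \<in> Cell1 D \<Longrightarrow> P2 P (Ide2 D f) = Ide2 E (P1 P f)"
    and P2_vcomp: "\<lbrakk>a \<in> Cell2 D; b \<in> Cell2 D; Dom2 D b = Cod2 D a\<rbrakk> \<Longrightarrow>
      P2 P (VComp D b a) = VComp E (P2 P b) (P2 P a)"
    and PComp_iso: "\<lbrakk>f \<in> Cell1 D; g \<in> Cell1 D; Src D g = Trg D f\<rbrakk> \<Longrightarrow>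
      iso_arr (vert_cat E) (PComp P g f)"
    and PComp_dom: "\<lbrakk>f \<in> Cell1 D; g \<in> Cell1 D; Src D g = Trg D f\<rbrakk> \<Longrightarrow>
      Dom2 E (PComp P g f) = Comp1 E (P1 P g) (P1 P f)"
    and PComp_cod: "\<lbrakk>f \<in> Cell1 D; g \<in> Cell1 D; Src D g = Trg D f\<rbrakk> \<Longrightarrow>
      Cod2 E (PComp P g f) = P1 P (Comp1 D g f)"
    and PUnit_iso: "x \<in> Cell0 D \<Longrightarrow> iso_arr (vert_cat E) (PUnit P x)"
    and PUnit_dom: "x \<in> Cell0 D \<Longrightarrow> Dom2 E (PUnit P x) = Ide1 E (P0 P x)"
    and PUnit_cod: "x \<in> Cell0 D \<Longrightarrow> Cod2 E (PUnit P x) = P1 P (Ide1 D x)"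
    and PComp_natural: "\<lbrakk>a \<in> Cell2 D; b \<in> Cell2 D; Src D (Dom2 D b) = Trg D (Dom2 D a)\<rbrakk> \<Longrightarrow>
      VComp E (P2 P (HComp D b a)) (PComp P (Dom2 D b) (Dom2 D a)) =
      VComp E (PComp P (Cod2 D b) (Cod2 D a)) (HComp E (P2 P b) (P2 P a))"
    and PComp_assoc: "\<lbrakk>f \<in> Cell1 D; g \<in> Cell1 D; h \<in> Cell1 D; Src D g = Trg D f;
      Src D h = Trg D g\<rbrakk> \<Longrightarrow>
      VComp E (PComp P (Comp1 D h g) f) (HComp E (PComp P h g) (Ide2 E (P1 P f))) =
      VComp E (PComp P h (Comp1 D g f)) (HComp E (Ide2 E (P1 P h)) (PComp P g f))"
    and PUnit_right: "f \<in> Cell1 D \<Longrightarrow>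
      VComp E (PComp P f (Ide1 D (Src D f))) (HComp E (Ide2 E (P1 P f)) (PUnit P (Src D f))) =
      Ide2 E (P1 P f)"
    and PUnit_left: "f \<in> Cell1 D \<Longrightarrow>
      VComp E (PComp P (Ide1 D (Trg D f)) f) (HComp E (PUnit P (Trg D f)) (Ide2 E (P1 P f))) =
      Ide2 E (P1 P f)"

definition small_category :: "('u::universe, 'u) cat \<Rightarrow> bool" where
  "small_category X \<longleftrightarrow> category X \<and> small (Obj X) \<and> small (Arr X)"

definition Cat ::
  "(('u::universe, 'u) cat, ('u, 'u, 'u, 'u) func, ('u, 'u, 'u, 'u) ntrans) two_cat" where
  "Cat = \<lparr>
    Cell0 = Collect small_category,
    Cell1 = {F. small_category (FDom F) \<and> small_category (FCod F) \<and>
      is_functor (FDom F) (FCod F) F},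
    Cell2 = {\<alpha>. small_category (FDom (NDom \<alpha>)) \<and> small_category (FCod (NDom \<alpha>)) \<and>
      nat_trans (FDom (NDom \<alpha>)) (FCod (NDom \<alpha>)) (NDom \<alpha>) (NCod \<alpha>) \<alpha>},
    Src = FDom, Trg = FCod, Dom2 = NDom, Cod2 = NCod,
    Ide1 = id_func, Comp1 = comp_func,
    Ide2 = id_nat, VComp = vcomp_nat, HComp = hcomp_nat\<rparr>"


section \<open>Pseudo natural transformations and modifications\<close>

text \<open>
  In HOL the categories \<open>J x\<close> and the hom categories \<open>K x = \<C>(X, F x)\<close> live on different types, so
  the data of a \<open>Cat\<close>-valued pseudo functor is typed with arbitrary object and arrow types, and \<open>J\<close>
  and \<open>K\<close> below may have different ones.  Smallness of the values plays no role in these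
  definitions, because small categories form a full sub-2-category of all categories.
\<close>

type_synonym ('d0, 'd1, 'd2, 'o, 'a) cat_psfun =
  "('d0, 'd1, 'd2, ('o, 'a) cat, ('o, 'a, 'o, 'a) func, ('o, 'a, 'o, 'a) ntrans) psfun"

text \<open>
  \<open>PN \<alpha> x : J x \<rightarrow> K x\<close> and \<open>PT \<alpha> f : K f \<circ> \<alpha>\<^sub>x \<Rightarrow> \<alpha>\<^sub>y \<circ> J f\<close> for \<open>f : x \<rightarrow> y\<close>.
\<close>

record ('d0, 'd1, 'o, 'a, 'p, 'b) pnat =
  PN :: "'d0 \<Rightarrow> ('o, 'a, 'p, 'b) func"
  PT :: "'d1 \<Rightarrow> ('o, 'a, 'p, 'b) ntrans"

locale pseudo_nat =
  fixes D :: "('d0, 'd1, 'd2) two_cat"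
    and J :: "('d0, 'd1, 'd2, 'o, 'a) cat_psfun" and K :: "('d0, 'd1, 'd2, 'p, 'b) cat_psfun"
    and \<alpha> :: "('d0, 'd1, 'o, 'a, 'p, 'b) pnat"
  assumes PN_ext: "PN \<alpha> \<in> extensional (Cell0 D)" and PT_ext: "PT \<alpha> \<in> extensional (Cell1 D)"
    and PN_functor: "x \<in> Cell0 D \<Longrightarrow> is_functor (P0 J x) (P0 K x) (PN \<alpha> x)"
    and PT_iso: "f \<in> Cell1 D \<Longrightarrow> nat_iso (P0 J (Src D f)) (P0 K (Trg D f))
      (comp_func (P1 K f) (PN \<alpha> (Src D f))) (comp_func (PN \<alpha> (Trg D f)) (P1 J f)) (PT \<alpha> f)"
    and PT_natural: "\<sigma> \<in> Cell2 D \<Longrightarrow>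
      vcomp_nat (PT \<alpha> (Cod2 D \<sigma>))
        (hcomp_nat (P2 K \<sigma>) (id_nat (PN \<alpha> (Src D (Dom2 D \<sigma>))))) =
      vcomp_nat (hcomp_nat (id_nat (PN \<alpha> (Trg D (Dom2 D \<sigma>)))) (P2 J \<sigma>)) (PT \<alpha> (Dom2 D \<sigma>))"
    and PT_comp: "\<lbrakk>f \<in> Cell1 D; g \<in> Cell1 D; Src D g = Trg D f\<rbrakk> \<Longrightarrow>
      vcomp_nat (PT \<alpha> (Comp1 D g f)) (hcomp_nat (PComp K g f) (id_nat (PN \<alpha> (Src D f)))) =
      vcomp_nat (hcomp_nat (id_nat (PN \<alpha> (Trg D g))) (PComp J g f))
        (vcomp_nat (hcomp_nat (PT \<alpha> g) (id_nat (P1 J f)))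
          (hcomp_nat (id_nat (P1 K g)) (PT \<alpha> f)))"
    and PT_unit: "x \<in> Cell0 D \<Longrightarrow>
      vcomp_nat (PT \<alpha> (Ide1 D x)) (hcomp_nat (PUnit K x) (id_nat (PN \<alpha> x))) =
      hcomp_nat (id_nat (PN \<alpha> x)) (PUnit J x)"

definition pnat_comp :: "('d0, 'd1, 'd2) two_cat \<Rightarrow> ('d0, 'd1, 'p, 'b, 'q, 'c) pnat \<Rightarrow>
    ('d0, 'd1, 'o, 'a, 'p, 'b) pnat \<Rightarrow> ('d0, 'd1, 'o, 'a, 'q, 'c) pnat" where
  "pnat_comp D \<beta> \<alpha> = \<lparr>
    PN = (\<lambda>x\<in>Cell0 D. comp_func (PN \<beta> x) (PN \<alpha> x)),
    PT = (\<lambda>f\<in>Cell1 D. vcomp_nat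
      (hcomp_nat (id_nat (PN \<beta> (Trg D f))) (PT \<alpha> f))
      (hcomp_nat (PT \<beta> f) (id_nat (PN \<alpha> (Src D f)))))\<rparr>"

record ('d0, 'd1, 'o, 'a, 'p, 'b) modif =
  MDom :: "('d0, 'd1, 'o, 'a, 'p, 'b) pnat"
  MCod :: "('d0, 'd1, 'o, 'a, 'p, 'b) pnat"
  MC :: "'d0 \<Rightarrow> ('o, 'a, 'p, 'b) ntrans"

locale modification =
  fixes D :: "('d0, 'd1, 'd2) two_cat"
    and J :: "('d0, 'd1, 'd2, 'o, 'a) cat_psfun" and K :: "('d0, 'd1, 'd2, 'p, 'b) cat_psfun"
    and \<Gamma> :: "('d0, 'd1, 'o, 'a, 'p, 'b) modif"
  assumes MDom: "pseudo_nat D J K (MDom \<Gamma>)" and MCod: "pseudo_nat D J K (MCod \<Gamma>)"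
    and MC_ext: "MC \<Gamma> \<in> extensional (Cell0 D)"
    and MC_nat: "x \<in> Cell0 D \<Longrightarrow>
      nat_trans (P0 J x) (P0 K x) (PN (MDom \<Gamma>) x) (PN (MCod \<Gamma>) x) (MC \<Gamma> x)"
    and MC_compat: "f \<in> Cell1 D \<Longrightarrow>
      vcomp_nat (PT (MCod \<Gamma>) f) (hcomp_nat (id_nat (P1 K f)) (MC \<Gamma> (Src D f))) =
      vcomp_nat (hcomp_nat (MC \<Gamma> (Trg D f)) (id_nat (P1 J f))) (PT (MDom \<Gamma>) f)"

definition modif_id :: "('d0, 'd1, 'd2) two_cat \<Rightarrow> ('d0, 'd1, 'o, 'a, 'p, 'b) pnat \<Rightarrow>
    ('d0, 'd1, 'o, 'a, 'p, 'b) modif" where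
  "modif_id D \<alpha> = \<lparr>MDom = \<alpha>, MCod = \<alpha>, MC = (\<lambda>x\<in>Cell0 D. id_nat (PN \<alpha> x))\<rparr>"

definition modif_vcomp :: "('d0, 'd1, 'd2) two_cat \<Rightarrow> ('d0, 'd1, 'o, 'a, 'p, 'b) modif \<Rightarrow>
    ('d0, 'd1, 'o, 'a, 'p, 'b) modif \<Rightarrow> ('d0, 'd1, 'o, 'a, 'p, 'b) modif" where
  "modif_vcomp D \<Delta> \<Gamma> = \<lparr>MDom = MDom \<Gamma>, MCod = MCod \<Delta>,
    MC = (\<lambda>x\<in>Cell0 D. vcomp_nat (MC \<Delta> x) (MC \<Gamma> x))\<rparr>"

definition modif_hcomp :: "('d0, 'd1, 'd2) two_cat \<Rightarrow> ('d0, 'd1, 'p, 'b, 'q, 'c) modif \<Rightarrow>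
    ('d0, 'd1, 'o, 'a, 'p, 'b) modif \<Rightarrow> ('d0, 'd1, 'o, 'a, 'q, 'c) modif" where
  "modif_hcomp D \<Delta> \<Gamma> = \<lparr>MDom = pnat_comp D (MDom \<Delta>) (MDom \<Gamma>),
    MCod = pnat_comp D (MCod \<Delta>) (MCod \<Gamma>),
    MC = (\<lambda>x\<in>Cell0 D. hcomp_nat (MC \<Delta> x) (MC \<Gamma> x))\<rparr>"

definition Hom_cat :: "('d0, 'd1, 'd2) two_cat \<Rightarrow>
    ('d0, 'd1, 'd2, 'o, 'a) cat_psfun \<Rightarrow> ('d0, 'd1, 'd2, 'p, 'b) cat_psfun \<Rightarrow>
    (('d0, 'd1, 'o, 'a, 'p, 'b) pnat, ('d0, 'd1, 'o, 'a, 'p, 'b) modif) cat" where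
  "Hom_cat D J K = \<lparr>Obj = Collect (pseudo_nat D J K), Arr = Collect (modification D J K),
    Dom = MDom, Cod = MCod, Ide = modif_id D, Comp = modif_vcomp D\<rparr>"

text \<open>The 2-functor \<open>Hom[D,Cat](J,-)\<close> on 1-cells \<open>\<beta> : K \<rightarrow> K'\<close> and on 2-cells.\<close>

definition Hom_func :: "('d0, 'd1, 'd2) two_cat \<Rightarrow> ('d0, 'd1, 'd2, 'o, 'a) cat_psfun \<Rightarrow>
    ('d0, 'd1, 'd2, 'p, 'b) cat_psfun \<Rightarrow> ('d0, 'd1, 'd2, 'q, 'c) cat_psfun \<Rightarrow>
    ('d0, 'd1, 'p, 'b, 'q, 'c) pnat \<Rightarrow>
    (('d0, 'd1, 'o, 'a, 'p, 'b) pnat, ('d0, 'd1, 'o, 'a, 'p, 'b) modif,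
     ('d0, 'd1, 'o, 'a, 'q, 'c) pnat, ('d0, 'd1, 'o, 'a, 'q, 'c) modif) func" where
  "Hom_func D J K K' \<beta> = \<lparr>FDom = Hom_cat D J K, FCod = Hom_cat D J K',
    FO = (\<lambda>\<alpha>\<in>Obj (Hom_cat D J K). pnat_comp D \<beta> \<alpha>),
    FA = (\<lambda>\<Gamma>\<in>Arr (Hom_cat D J K). modif_hcomp D (modif_id D \<beta>) \<Gamma>)\<rparr>"

definition Hom_nat :: "('d0, 'd1, 'd2) two_cat \<Rightarrow> ('d0, 'd1, 'd2, 'o, 'a) cat_psfun \<Rightarrow>
    ('d0, 'd1, 'd2, 'p, 'b) cat_psfun \<Rightarrow> ('d0, 'd1, 'd2, 'q, 'c) cat_psfun \<Rightarrow>
    ('d0, 'd1, 'p, 'b, 'q, 'c) modif \<Rightarrow>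
    (('d0, 'd1, 'o, 'a, 'p, 'b) pnat, ('d0, 'd1, 'o, 'a, 'p, 'b) modif,
     ('d0, 'd1, 'o, 'a, 'q, 'c) pnat, ('d0, 'd1, 'o, 'a, 'q, 'c) modif) ntrans" where
  "Hom_nat D J K K' \<Delta> = \<lparr>NDom = Hom_func D J K K' (MDom \<Delta>), NCod = Hom_func D J K K' (MCod \<Delta>),
    NC = (\<lambda>\<alpha>\<in>Obj (Hom_cat D J K). modif_hcomp D \<Delta> (modif_id D \<alpha>))\<rparr>"


section \<open>Weighted pseudo limits\<close>

definition post_func :: "('o, 'm, 'c) two_cat \<Rightarrow> 'o \<Rightarrow> 'm \<Rightarrow> ('m, 'c, 'm, 'c) func" where
  "post_func C X g = \<lparr>FDom = hom_cat C X (Src C g), FCod = hom_cat C X (Trg C g),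
    FO = (\<lambda>k\<in>Obj (hom_cat C X (Src C g)). Comp1 C g k),
    FA = (\<lambda>a\<in>Arr (hom_cat C X (Src C g)). HComp C (Ide2 C g) a)\<rparr>"

definition post_nat :: "('o, 'm, 'c) two_cat \<Rightarrow> 'o \<Rightarrow> 'c \<Rightarrow> ('m, 'c, 'm, 'c) ntrans" where
  "post_nat C X \<theta> = \<lparr>NDom = post_func C X (Dom2 C \<theta>), NCod = post_func C X (Cod2 C \<theta>),
    NC = (\<lambda>k\<in>Obj (hom_cat C X (Src C (Dom2 C \<theta>))). HComp C \<theta> (Ide2 C k))\<rparr>"

definition pre_func :: "('o, 'm, 'c) two_cat \<Rightarrow> 'm \<Rightarrow> 'o \<Rightarrow> ('m, 'c, 'm, 'c) func" where
  "pre_func C h Z = \<lparr>FDom = hom_cat C (Trg C h) Z, FCod = hom_cat C (Src C h) Z,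
    FO = (\<lambda>k\<in>Obj (hom_cat C (Trg C h) Z). Comp1 C k h),
    FA = (\<lambda>a\<in>Arr (hom_cat C (Trg C h) Z). HComp C a (Ide2 C h))\<rparr>"

definition pre_nat :: "('o, 'm, 'c) two_cat \<Rightarrow> 'c \<Rightarrow> 'o \<Rightarrow> ('m, 'c, 'm, 'c) ntrans" where
  "pre_nat C \<sigma> Z = \<lparr>NDom = pre_func C (Dom2 C \<sigma>) Z, NCod = pre_func C (Cod2 C \<sigma>) Z,
    NC = (\<lambda>k\<in>Obj (hom_cat C (Trg C (Dom2 C \<sigma>)) Z). HComp C (Ide2 C k) \<sigma>)\<rparr>"

text \<open>
  The pseudo functor \<open>\<C>(X,F-)\<close>: the composite of \<open>F\<close> with the strict 2-functor \<open>\<C>(X,-)\<close>.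
  For \<open>h : X' \<rightarrow> X\<close>, the strict transformation \<open>\<C>(h,F-) : \<C>(X,F-) \<Rightarrow> \<C>(X',F-)\<close> is regarded as a
  pseudo natural transformation with identity 2-cells.
\<close>

definition rep_psfun :: "('o, 'm, 'c) two_cat \<Rightarrow> 'o \<Rightarrow> ('d0, 'd1, 'd2, 'o, 'm, 'c) psfun \<Rightarrow>
    ('d0, 'd1, 'd2, 'm, 'c) cat_psfun" where
  "rep_psfun C X F = \<lparr>P0 = (\<lambda>x. hom_cat C X (P0 F x)), P1 = (\<lambda>f. post_func C X (P1 F f)),
    P2 = (\<lambda>\<sigma>. post_nat C X (P2 F \<sigma>)), PComp = (\<lambda>g f. post_nat C X (PComp F g f)),
    PUnit = (\<lambda>x. post_nat C X (PUnit F x))\<rparr>"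

definition rep_pnat :: "('d0, 'd1, 'd2) two_cat \<Rightarrow> ('o, 'm, 'c) two_cat \<Rightarrow>
    ('d0, 'd1, 'd2, 'o, 'm, 'c) psfun \<Rightarrow> 'm \<Rightarrow> ('d0, 'd1, 'm, 'c, 'm, 'c) pnat" where
  "rep_pnat D C F h = \<lparr>PN = (\<lambda>x\<in>Cell0 D. pre_func C h (P0 F x)),
    PT = (\<lambda>f\<in>Cell1 D.
      id_nat (comp_func (post_func C (Src C h) (P1 F f)) (pre_func C h (P0 F (Src D f)))))\<rparr>"

definition rep_modif :: "('d0, 'd1, 'd2) two_cat \<Rightarrow> ('o, 'm, 'c) two_cat \<Rightarrow>
    ('d0, 'd1, 'd2, 'o, 'm, 'c) psfun \<Rightarrow> 'c \<Rightarrow> ('d0, 'd1, 'm, 'c, 'm, 'c) modif" where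
  "rep_modif D C F \<sigma> = \<lparr>MDom = rep_pnat D C F (Dom2 C \<sigma>), MCod = rep_pnat D C F (Cod2 C \<sigma>),
    MC = (\<lambda>x\<in>Cell0 D. pre_nat C \<sigma> (P0 F x))\<rparr>"

text \<open>Data of a strict 2-functor from a 2-category to categories.\<close>

record ('o, 'm, 'c, 'p, 'b) cat_two_functor =
  T0 :: "'o \<Rightarrow> ('p, 'b) cat"
  T1 :: "'m \<Rightarrow> ('p, 'b, 'p, 'b) func"
  T2 :: "'c \<Rightarrow> ('p, 'b, 'p, 'b) ntrans"

definition rep_two_functor :: "('o, 'm, 'c) two_cat \<Rightarrow> 'o \<Rightarrow> ('o, 'm, 'c, 'm, 'c) cat_two_functor"
  where
  "rep_two_functor C L = \<lparr>T0 = (\<lambda>X. hom_cat C X L), T1 = (\<lambda>h. pre_func C h L),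
    T2 = (\<lambda>\<sigma>. pre_nat C \<sigma> L)\<rparr>"

definition cone_two_functor :: "('d0, 'd1, 'd2) two_cat \<Rightarrow> ('o, 'm, 'c) two_cat \<Rightarrow>
    ('d0, 'd1, 'd2, 'p, 'b) cat_psfun \<Rightarrow> ('d0, 'd1, 'd2, 'o, 'm, 'c) psfun \<Rightarrow>
    ('o, 'm, 'c, ('d0, 'd1, 'p, 'b, 'm, 'c) pnat, ('d0, 'd1, 'p, 'b, 'm, 'c) modif)
      cat_two_functor" where
  "cone_two_functor D C J F = \<lparr>
    T0 = (\<lambda>X. Hom_cat D J (rep_psfun C X F)),
    T1 = (\<lambda>h. Hom_func D J (rep_psfun C (Trg C h) F) (rep_psfun C (Src C h) F) (rep_pnat D C F h)),
    T2 = (\<lambda>\<sigma>. Hom_nat D J (rep_psfun C (Trg C (Dom2 C \<sigma>)) F) (rep_psfun C (Src C (Dom2 C \<sigma>)) F)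
      (rep_modif D C F \<sigma>))\<rparr>"

definition two_natural_iso :: "('o, 'm, 'c) two_cat \<Rightarrow> ('o, 'm, 'c, 'p, 'b) cat_two_functor \<Rightarrow>
    ('o, 'm, 'c, 'q, 'e) cat_two_functor \<Rightarrow> ('o \<Rightarrow> ('p, 'b, 'q, 'e) func) \<Rightarrow> bool" where
  "two_natural_iso A P Q \<Theta> \<longleftrightarrow>
    (\<forall>X\<in>Cell0 A. cat_iso (T0 P X) (T0 Q X) (\<Theta> X)) \<and>
    (\<forall>f\<in>Cell1 A. comp_func (T1 Q f) (\<Theta> (Src A f)) = comp_func (\<Theta> (Trg A f)) (T1 P f)) \<and>
    (\<forall>\<sigma>\<in>Cell2 A. hcomp_nat (T2 Q \<sigma>) (id_nat (\<Theta> (Src A (Dom2 A \<sigma>)))) =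
      hcomp_nat (id_nat (\<Theta> (Trg A (Dom2 A \<sigma>)))) (T2 P \<sigma>))"

definition weighted_pseudo_limit :: "('d0, 'd1, 'd2) two_cat \<Rightarrow> ('o, 'm, 'c) two_cat \<Rightarrow>
    ('d0, 'd1, 'd2, 'p, 'b) cat_psfun \<Rightarrow> ('d0, 'd1, 'd2, 'o, 'm, 'c) psfun \<Rightarrow> 'o \<Rightarrow> bool" where
  "weighted_pseudo_limit D C J F L \<longleftrightarrow> L \<in> Cell0 C \<and>
    (\<exists>\<Theta>. two_natural_iso (op_two_cat C) (rep_two_functor C L) (cone_two_functor D C J F) \<Theta>)"


section \<open>Theories\<close>

text \<open>
  Indices start at \<open>0\<close>.  A function \<open>f : {0..<k} \<rightarrow> {0..<l}\<close> is represented by the list of its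
  values, a list \<open>fs\<close> of length \<open>k\<close> with \<open>set fs \<subseteq> {..<l}\<close>; the composite \<open>g \<circ> f\<close> is then
  \<open>map ((!) gs) fs\<close> and the identity is \<open>[0..<k]\<close>.
\<close>

record 't alg_theory =
  TCat :: "(nat, 't) cat"
  Prj :: "nat \<Rightarrow> nat \<Rightarrow> 't"

definition words :: "'t alg_theory \<Rightarrow> nat \<Rightarrow> 't set" where
  "words T n = {w \<in> Arr (TCat T). Dom (TCat T) w = n \<and> Cod (TCat T) w = 1}"

definition all_words :: "'t alg_theory \<Rightarrow> 't set" where
  "all_words T = (\<Union>n. words T n)"

abbreviation arity :: "'t alg_theory \<Rightarrow> 't \<Rightarrow> nat" where
  "arity T w \<equiv> Dom (TCat T) w"

definition is_tuple :: "'t alg_theory \<Rightarrow> nat \<Rightarrow> 't list \<Rightarrow> 't \<Rightarrow> bool" where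
  "is_tuple T m ws h \<longleftrightarrow> h \<in> Arr (TCat T) \<and> Dom (TCat T) h = m \<and> Cod (TCat T) h = length ws \<and>
    (\<forall>i<length ws. Comp (TCat T) (Prj T (length ws) i) h = ws ! i)"

definition tuple :: "'t alg_theory \<Rightarrow> nat \<Rightarrow> 't list \<Rightarrow> 't" where
  "tuple T m ws = (THE h. is_tuple T m ws h)"

locale is_theory =
  fixes T :: "'t alg_theory"
  assumes T_category: "category (TCat T)"
    and T_Obj: "Obj (TCat T) = UNIV"
    and Prj_words: "i < n \<Longrightarrow> Prj T n i \<in> words T n"
    and T_product: "set ws \<subseteq> words T m \<Longrightarrow> \<exists>!h. is_tuple T m ws h"

text \<open>\<open>subst_word T l fs w\<close> is the word written \<open>w\<^sub>f\<close> for \<open>f : {0..<k} \<rightarrow> {0..<l}\<close>.\<close>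

definition subst_word :: "'t alg_theory \<Rightarrow> nat \<Rightarrow> nat list \<Rightarrow> 't \<Rightarrow> 't" where
  "subst_word T l fs w = Comp (TCat T) w (tuple T l (map (Prj T l) fs))"

definition offset :: "nat list \<Rightarrow> nat \<Rightarrow> nat" where
  "offset ns i = sum_list (take i ns)"

definition block_incl :: "nat list \<Rightarrow> nat \<Rightarrow> nat list" where
  "block_incl ns i = [offset ns i ..< offset ns i + ns ! i]"

definition block_map :: "nat list \<Rightarrow> nat list \<Rightarrow> nat list" where
  "block_map ns fs = concat (map (block_incl ns) fs)"

text \<open>The block sum of the functions \<open>gss ! i : {0..<k\<^sub>i} \<rightarrow> {0..<ms ! i}\<close>.\<close>

definition block_sum :: "nat list \<Rightarrow> nat list list \<Rightarrow> nat list" where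
  "block_sum ms gss = concat (map (\<lambda>i. map (\<lambda>j. offset ms i + j) (gss ! i)) [0..<length gss])"

definition gam :: "'t alg_theory \<Rightarrow> 't \<Rightarrow> 't list \<Rightarrow> 't" where
  "gam T w ws = (let ns = map (arity T) ws; N = sum_list ns in
    Comp (TCat T) w
      (tuple T N (map (\<lambda>i. subst_word T N (block_incl ns i) (ws ! i)) [0..<length ws])))"

definition unit_word :: "'t alg_theory \<Rightarrow> 't" where
  "unit_word T = Prj T 1 0"


section \<open>Powers of categories and the endomorphism theory\<close>

definition pow_cat :: "('o, 'a) cat \<Rightarrow> nat \<Rightarrow> ('o list, 'a list) cat" where
  "pow_cat X n = \<lparr>Obj = {xs. length xs = n \<and> set xs \<subseteq> Obj X},
    Arr = {fs. length fs = n \<and> set fs \<subseteq> Arr X},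
    Dom = map (Dom X), Cod = map (Cod X), Ide = map (Ide X), Comp = map2 (Comp X)\<rparr>"

definition pow_func ::
  "nat \<Rightarrow> ('o, 'a, 'p, 'b) func \<Rightarrow> ('o list, 'a list, 'p list, 'b list) func" where
  "pow_func n H = \<lparr>FDom = pow_cat (FDom H) n, FCod = pow_cat (FCod H) n,
    FO = (\<lambda>xs\<in>Obj (pow_cat (FDom H) n). map (FO H) xs),
    FA = (\<lambda>fs\<in>Arr (pow_cat (FDom H) n). map (FA H) fs)\<rparr>"

definition pow_nat ::
  "nat \<Rightarrow> ('o, 'a, 'p, 'b) ntrans \<Rightarrow> ('o list, 'a list, 'p list, 'b list) ntrans" where
  "pow_nat n \<alpha> = \<lparr>NDom = pow_func n (NDom \<alpha>), NCod = pow_func n (NCod \<alpha>),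
    NC = (\<lambda>xs\<in>Obj (pow_cat (FDom (NDom \<alpha>)) n). map (NC \<alpha>) xs)\<rparr>"

fun blocks :: "nat list \<Rightarrow> 'x list \<Rightarrow> 'x list list" where
  "blocks [] xs = []"
| "blocks (n # ns) xs = take n xs # blocks ns (drop n xs)"

text \<open>
  The product \<open>F\<^sub>1 \<times> \<dots> \<times> F\<^sub>k : X\<^bsup>n\<^sub>1+\<dots>+n\<^sub>k\<^esup> \<rightarrow> Y\<^bsup>k\<^esup>\<close> of functors \<open>F\<^sub>i : X\<^bsup>n\<^sub>i\<^esup> \<rightarrow> Y\<close>.  The categories and
  the arities are arguments because they cannot be read off from the list of functors in general
  (the list, or the categories, may be empty).
\<close>

definition prod_func :: "('o, 'a) cat \<Rightarrow> ('p, 'b) cat \<Rightarrow> nat list \<Rightarrow>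
    ('o list, 'a list, 'p, 'b) func list \<Rightarrow> ('o list, 'a list, 'p list, 'b list) func" where
  "prod_func X Y ns Fs = \<lparr>FDom = pow_cat X (sum_list ns), FCod = pow_cat Y (length ns),
    FO = (\<lambda>xs\<in>Obj (pow_cat X (sum_list ns)). map2 FO Fs (blocks ns xs)),
    FA = (\<lambda>fs\<in>Arr (pow_cat X (sum_list ns)). map2 FA Fs (blocks ns fs))\<rparr>"

definition prod_nat :: "('o, 'a) cat \<Rightarrow> ('p, 'b) cat \<Rightarrow> nat list \<Rightarrow>
    ('o list, 'a list, 'p, 'b) ntrans list \<Rightarrow> ('o list, 'a list, 'p list, 'b list) ntrans" where
  "prod_nat X Y ns \<alpha>s = \<lparr>NDom = prod_func X Y ns (map NDom \<alpha>s), NCod = prod_func X Y ns (map NCod \<alpha>s),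
    NC = (\<lambda>xs\<in>Obj (pow_cat X (sum_list ns)). map2 NC \<alpha>s (blocks ns xs))\<rparr>"

definition end_gam :: "('o, 'a) cat \<Rightarrow> nat list \<Rightarrow> ('o list, 'a list, 'o, 'a) func \<Rightarrow>
    ('o list, 'a list, 'o, 'a) func list \<Rightarrow> ('o list, 'a list, 'o, 'a) func" where
  "end_gam X ns F Fs = comp_func F (prod_func X X ns Fs)"

definition end_gam2 :: "('o, 'a) cat \<Rightarrow> nat list \<Rightarrow> ('o list, 'a list, 'o, 'a) ntrans \<Rightarrow>
    ('o list, 'a list, 'o, 'a) ntrans list \<Rightarrow> ('o list, 'a list, 'o, 'a) ntrans" where
  "end_gam2 X ns \<alpha> \<alpha>s = hcomp_nat \<alpha> (prod_nat X X ns \<alpha>s)"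

definition reindex :: "('o, 'a) cat \<Rightarrow> nat \<Rightarrow> nat list \<Rightarrow>
    ('o list, 'a list, 'o list, 'a list) func" where
  "reindex X l fs = \<lparr>FDom = pow_cat X l, FCod = pow_cat X (length fs),
    FO = (\<lambda>xs\<in>Obj (pow_cat X l). map ((!) xs) fs),
    FA = (\<lambda>as\<in>Arr (pow_cat X l). map ((!) as) fs)\<rparr>"

definition end_subst :: "('o, 'a) cat \<Rightarrow> nat \<Rightarrow> nat list \<Rightarrow> ('o list, 'a list, 'o, 'a) func \<Rightarrow>
    ('o list, 'a list, 'o, 'a) func" where
  "end_subst X l fs F = comp_func F (reindex X l fs)"

definition end_subst2 :: "('o, 'a) cat \<Rightarrow> nat \<Rightarrow> nat list \<Rightarrow> ('o list, 'a list, 'o, 'a) ntrans \<Rightarrow>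
    ('o list, 'a list, 'o, 'a) ntrans" where
  "end_subst2 X l fs \<alpha> = hcomp_nat \<alpha> (id_nat (reindex X l fs))"

definition end_unit :: "('o, 'a) cat \<Rightarrow> ('o list, 'a list, 'o, 'a) func" where
  "end_unit X = \<lparr>FDom = pow_cat X 1, FCod = X,
    FO = (\<lambda>xs\<in>Obj (pow_cat X 1). hd xs), FA = (\<lambda>fs\<in>Arr (pow_cat X 1). hd fs)\<rparr>"


section \<open>Pseudo algebras over a theory\<close>

record ('o, 'a, 't) psalg =
  Car :: "('o, 'a) cat"
  Phi :: "'t \<Rightarrow> ('o list, 'a list, 'o, 'a) func"
  CohC :: "'t \<Rightarrow> 't list \<Rightarrow> ('o list, 'a list, 'o, 'a) ntrans"
  CohI :: "('o list, 'a list, 'o, 'a) ntrans"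
  CohS :: "'t \<Rightarrow> nat \<Rightarrow> nat list \<Rightarrow> ('o list, 'a list, 'o, 'a) ntrans"

text \<open>\<open>CohS A w l fs\<close> is the isomorphism \<open>s\<^sub>w\<^sub>,\<^sub>f\<close> for \<open>f : {0..<k} \<rightarrow> {0..<l}\<close>.\<close>

locale pseudo_algebra =
  fixes T :: "'t alg_theory" and A :: "('o, 'a, 't) psalg"
  assumes Car_category: "category (Car A)"
    and Phi_functor: "w \<in> words T n \<Longrightarrow> is_functor (pow_cat (Car A) n) (Car A) (Phi A w)"
    and CohC_iso: "\<lbrakk>w \<in> words T (length ws); set ws \<subseteq> all_words T\<rbrakk> \<Longrightarrow>
      nat_iso (pow_cat (Car A) (sum_list (map (arity T) ws))) (Car A)
        (Phi A (gam T w ws)) (end_gam (Car A) (map (arity T) ws) (Phi A w) (map (Phi A) ws))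
        (CohC A w ws)"
    and CohI_iso: "nat_iso (pow_cat (Car A) 1) (Car A)
        (Phi A (unit_word T)) (end_unit (Car A)) (CohI A)"
    and CohS_iso: "\<lbrakk>w \<in> words T (length fs); set fs \<subseteq> {..<l}\<rbrakk> \<Longrightarrow>
      nat_iso (pow_cat (Car A) l) (Car A)
        (Phi A (subst_word T l fs w)) (end_subst (Car A) l fs (Phi A w)) (CohS A w l fs)"
    and coh_assoc: "\<lbrakk>w \<in> words T (length ws); set ws \<subseteq> all_words T;
        map length wss = map (arity T) ws; \<forall>us\<in>set wss. set us \<subseteq> all_words T\<rbrakk> \<Longrightarrow>
      vcomp_nat
        (end_gam2 (Car A) (map (arity T) (concat wss)) (CohC A w ws)
          (map (\<lambda>u. id_nat (Phi A u)) (concat wss)))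
        (CohC A (gam T w ws) (concat wss)) =
      vcomp_nat
        (end_gam2 (Car A) (map (\<lambda>us. sum_list (map (arity T) us)) wss) (id_nat (Phi A w))
          (map2 (CohC A) ws wss))
        (CohC A w (map2 (gam T) ws wss))"
    and coh_unit_right: "w \<in> words T k \<Longrightarrow>
      vcomp_nat
        (end_gam2 (Car A) (replicate k 1) (id_nat (Phi A w)) (replicate k (CohI A)))
        (CohC A w (replicate k (unit_word T))) = id_nat (Phi A w)"
    and coh_unit_left: "w \<in> words T k \<Longrightarrow>
      vcomp_nat
        (end_gam2 (Car A) [k] (CohI A) [id_nat (Phi A w)])
        (CohC A (unit_word T) [w]) = id_nat (Phi A w)"
    and coh_subst_outer: "\<lbrakk>w \<in> words T (length fs); set fs \<subseteq> {..<length vs};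
        set vs \<subseteq> all_words T; ns = map (arity T) vs\<rbrakk> \<Longrightarrow>
      vcomp_nat
        (end_subst2 (Car A) (sum_list ns) (block_map ns fs) (CohC A w (map ((!) vs) fs)))
        (CohS A (gam T w (map ((!) vs) fs)) (sum_list ns) (block_map ns fs)) =
      vcomp_nat
        (end_gam2 (Car A) ns (CohS A w (length vs) fs) (map (\<lambda>v. id_nat (Phi A v)) vs))
        (CohC A (subst_word T (length vs) fs w) vs)"
    and coh_subst_inner: "\<lbrakk>w \<in> words T (length ws); set ws \<subseteq> all_words T;
        length gss = length ws; length ms = length ws;
        \<forall>i<length ws. length (gss ! i) = arity T (ws ! i) \<and> set (gss ! i) \<subseteq> {..<ms ! i}\<rbrakk> \<Longrightarrow>
      vcomp_nat
        (end_subst2 (Car A) (sum_list ms) (block_sum ms gss) (CohC A w ws))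
        (CohS A (gam T w ws) (sum_list ms) (block_sum ms gss)) =
      vcomp_nat
        (end_gam2 (Car A) ms (id_nat (Phi A w))
          (map (\<lambda>i. CohS A (ws ! i) (ms ! i) (gss ! i)) [0..<length ws]))
        (CohC A w (map (\<lambda>i. subst_word T (ms ! i) (gss ! i) (ws ! i)) [0..<length ws]))"
    and coh_subst_comp: "\<lbrakk>w \<in> words T (length fs); set fs \<subseteq> {..<length gs}; set gs \<subseteq> {..<m}\<rbrakk> \<Longrightarrow>
      vcomp_nat
        (end_subst2 (Car A) m gs (CohS A w (length gs) fs))
        (CohS A (subst_word T (length gs) fs w) m gs) =
      CohS A w m (map ((!) gs) fs)"
    and coh_subst_id: "w \<in> words T k \<Longrightarrow> CohS A w k [0..<k] = id_nat (Phi A w)"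

record ('o, 'a, 't) algmor =
  ADom :: "('o, 'a, 't) psalg"
  ACod :: "('o, 'a, 't) psalg"
  AFun :: "('o, 'a, 'o, 'a) func"
  ARho :: "'t \<Rightarrow> ('o list, 'a list, 'o, 'a) ntrans"

locale algebra_morphism =
  fixes T :: "'t alg_theory" and A B :: "('o, 'a, 't) psalg" and H :: "('o, 'a, 't) algmor"
  assumes A_alg: "pseudo_algebra T A" and B_alg: "pseudo_algebra T B"
    and ADom: "ADom H = A" and ACod: "ACod H = B"
    and AFun: "is_functor (Car A) (Car B) (AFun H)"
    and ARho_ext: "ARho H \<in> extensional (all_words T)"
    and ARho_iso: "w \<in> words T n \<Longrightarrow> nat_iso (pow_cat (Car A) n) (Car B)
      (comp_func (AFun H) (Phi A w)) (comp_func (Phi B w) (pow_func n (AFun H))) (ARho H w)"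
    and ARho_gam: "\<lbrakk>w \<in> words T (length ws); set ws \<subseteq> all_words T; ns = map (arity T) ws\<rbrakk> \<Longrightarrow>
      vcomp_nat
        (hcomp_nat (CohC B w ws) (id_nat (pow_func (sum_list ns) (AFun H))))
        (ARho H (gam T w ws)) =
      vcomp_nat
        (hcomp_nat (id_nat (Phi B w)) (prod_nat (Car A) (Car B) ns (map (ARho H) ws)))
        (vcomp_nat
          (hcomp_nat (ARho H w) (id_nat (prod_func (Car A) (Car A) ns (map (Phi A) ws))))
          (hcomp_nat (id_nat (AFun H)) (CohC A w ws)))"
    and ARho_unit:
      "vcomp_nat (hcomp_nat (CohI B) (id_nat (pow_func 1 (AFun H)))) (ARho H (unit_word T)) =
       hcomp_nat (id_nat (AFun H)) (CohI A)"
    and ARho_subst: "\<lbrakk>w \<in> words T (length fs); set fs \<subseteq> {..<l}\<rbrakk> \<Longrightarrow>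
      vcomp_nat
        (hcomp_nat (CohS B w l fs) (id_nat (pow_func l (AFun H))))
        (ARho H (subst_word T l fs w)) =
      vcomp_nat
        (hcomp_nat (ARho H w) (id_nat (reindex (Car A) l fs)))
        (hcomp_nat (id_nat (AFun H)) (CohS A w l fs))"

definition algmor_id :: "'t alg_theory \<Rightarrow> ('o, 'a, 't) psalg \<Rightarrow> ('o, 'a, 't) algmor" where
  "algmor_id T A = \<lparr>ADom = A, ACod = A, AFun = id_func (Car A),
    ARho = (\<lambda>w\<in>all_words T. id_nat (Phi A w))\<rparr>"

definition algmor_comp ::
  "'t alg_theory \<Rightarrow> ('o, 'a, 't) algmor \<Rightarrow> ('o, 'a, 't) algmor \<Rightarrow> ('o, 'a, 't) algmor" where
  "algmor_comp T H G = \<lparr>ADom = ADom G, ACod = ACod H, AFun = comp_func (AFun H) (AFun G),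
    ARho = (\<lambda>w\<in>all_words T. vcomp_nat
      (hcomp_nat (ARho H w) (id_nat (pow_func (arity T w) (AFun G))))
      (hcomp_nat (id_nat (AFun H)) (ARho G w)))\<rparr>"

record ('o, 'a, 't) algcell =
  CDom :: "('o, 'a, 't) algmor"
  CCod :: "('o, 'a, 't) algmor"
  CNat :: "('o, 'a, 'o, 'a) ntrans"

locale algebra_cell =
  fixes T :: "'t alg_theory" and A B :: "('o, 'a, 't) psalg" and G H :: "('o, 'a, 't) algmor"
    and \<alpha> :: "('o, 'a, 't) algcell"
  assumes G_mor: "algebra_morphism T A B G" and H_mor: "algebra_morphism T A B H"
    and CDom: "CDom \<alpha> = G" and CCod: "CCod \<alpha> = H"
    and CNat: "nat_trans (Car A) (Car B) (AFun G) (AFun H) (CNat \<alpha>)"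
    and CNat_rho: "w \<in> words T n \<Longrightarrow>
      vcomp_nat (ARho H w) (hcomp_nat (CNat \<alpha>) (id_nat (Phi A w))) =
      vcomp_nat (hcomp_nat (id_nat (Phi B w)) (pow_nat n (CNat \<alpha>))) (ARho G w)"

definition small_algebra :: "'t alg_theory \<Rightarrow> ('u::universe, 'u, 't) psalg \<Rightarrow> bool" where
  "small_algebra T A \<longleftrightarrow> pseudo_algebra T A \<and> small_category (Car A)"

definition PsAlg :: "'t alg_theory \<Rightarrow>
    (('u::universe, 'u, 't) psalg, ('u, 'u, 't) algmor, ('u, 'u, 't) algcell) two_cat" where
  "PsAlg T = \<lparr>
    Cell0 = Collect (small_algebra T),
    Cell1 = {H. small_algebra T (ADom H) \<and> small_algebra T (ACod H) \<and>
      algebra_morphism T (ADom H) (ACod H) H},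
    Cell2 = {\<alpha>. small_algebra T (ADom (CDom \<alpha>)) \<and> small_algebra T (ACod (CDom \<alpha>)) \<and>
      algebra_cell T (ADom (CDom \<alpha>)) (ACod (CDom \<alpha>)) (CDom \<alpha>) (CCod \<alpha>) \<alpha>},
    Src = ADom, Trg = ACod, Dom2 = CDom, Cod2 = CCod,
    Ide1 = algmor_id T, Comp1 = algmor_comp T,
    Ide2 = (\<lambda>H. \<lparr>CDom = H, CCod = H, CNat = id_nat (AFun H)\<rparr>),
    VComp = (\<lambda>\<beta> \<alpha>. \<lparr>CDom = CDom \<alpha>, CCod = CCod \<beta>, CNat = vcomp_nat (CNat \<beta>) (CNat \<alpha>)\<rparr>),
    HComp = (\<lambda>\<beta> \<alpha>. \<lparr>CDom = algmor_comp T (CDom \<beta>) (CDom \<alpha>),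
      CCod = algmor_comp T (CCod \<beta>) (CCod \<alpha>), CNat = hcomp_nat (CNat \<beta>) (CNat \<alpha>)\<rparr>)\<rparr>"

end

theory Submission imports Defs
begin

text \<open>Let \<open>U\<close> be the forgetful functor to \<open>Cat\<close>. The limit lives on the category \<open>LC\<close> of cones, that is of pseudo
 natural transformations \<open>J \<Rightarrow> U F\<close> and modifications, coded by elements of the universe \<open>'u\<close> of small sets.
 Words act on cones pointwise, the 2-cells of a cone being corrected by the coherences \<open>rho\<close> of the morphisms
 \<open>F f\<close>. The coherence isomorphisms are those of the algebras \<open>F x\<close>, applied pointwise; their axioms hold since an
 isomorphism of cones is determined by its domain and its components. The evaluations \<open>LC \<rightarrow> F x\<close> are strict
 morphisms, and together they form the universal cone: a cone from an algebra \<open>A\<close> is a family of elements of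
 \<open>LC\<close> indexed by \<open>A\<close>, and the coherences of its members assemble into those of a morphism \<open>A \<rightarrow> LC\<close>.
 By the Yoneda lemma, bijectivity of composition with this cone on 1-cells and 2-cells yields the 2-natural
 isomorphism.\<close>

section \<open>Categories, functors and natural transformations\<close>

text \<open>The obstacle is that equality of natural transformations here includes equality of their
  boundaries. Checking an axiom of the algebra of cones literally would mean comparing functors such
  as two bracketings of an iterated substitution on powers of \<open>LC\<close>, with the arrow
  values and 2-cells of all cones that they produce. Invertibility removes this: if two isomorphisms
  of cones have the same domain and the same components, then naturality and compatibility with the
  2-cells allow the components to be cancelled, so the codomains coincide as well. Hence only
  domains are compared, and these are actions of words, which agree by identities in
  \<open>T\<close> such as associativity of \<open>gam\<close>. The relation
  \<open>strict_over\<close> packages this argument. The second device is to replace records by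
  their values: \<open>pcone\<close> and \<open>pmod\<close> state all conditions as equations in
  the categories \<open>K x\<close>, so a cone is composed, acted on or evaluated by transforming
  its values. Since cones are records of functions, they need codes in \<open>'u\<close>, and such
  codes exist because small sets are closed under dependent products.\<close>

definition in_hom :: "('o, 'a) cat \<Rightarrow> 'a \<Rightarrow> 'o \<Rightarrow> 'o \<Rightarrow> bool" where
 "in_hom C f x y \<longleftrightarrow> f \<in> Arr C \<and> Dom C f = x \<and> Cod C f = y"

abbreviation "AO a \<equiv> FO (AFun a)"
abbreviation "AA a \<equiv> FA (AFun a)"
abbreviation "rho a b \<equiv> NC (ARho a b)"
abbreviation "cN a \<equiv> NC (CNat a)"
abbreviation "PhiO a b \<equiv> FO (Phi a b)"
abbreviation "PhiF a b \<equiv> FA (Phi a b)"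
abbreviation "powO a b \<equiv> Obj (pow_cat a b)"
abbreviation "powA a b \<equiv> Arr (pow_cat a b)"
abbreviation "powH a b \<equiv> in_hom (pow_cat a b)"
abbreviation "O0 a b \<equiv> Obj (P0 a b)"
abbreviation "A0 a b \<equiv> Arr (P0 a b)"
abbreviation "hom0 a b \<equiv> in_hom (P0 a b)"
abbreviation "cmp0 a b \<equiv> Comp (P0 a b)"
abbreviation "cmp a \<equiv> Comp (Car a)"
abbreviation "chom a \<equiv> in_hom (Car a)"
abbreviation "O1 a b \<equiv> FO (P1 a b)"
abbreviation "A1 a b \<equiv> FA (P1 a b)"
abbreviation "ars T ws \<equiv> map (arity T) ws"

lemma in_homI: "f \<in> Arr C ==> in_hom C f (Dom C f) (Cod C f)" by (simp add: in_hom_def)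

lemma in_homD: "in_hom C f x y ==> f \<in> Arr C" "in_hom C f x y ==> Dom C f = x" "in_hom C f x y ==> Cod C f = y"
 by (simp_all add: in_hom_def)

context category
begin

lemma in_hom_obj: "in_hom C f x y ==> x \<in> Obj C" "in_hom C f x y ==> y \<in> Obj C"
 using dom_obj cod_obj by (auto simp: in_hom_def)

lemma in_hom_ide: "x \<in> Obj C ==> in_hom C (Ide C x) x x" by (simp add: in_hom_def ide_arr ide_dom ide_cod)

lemma in_hom_comp: "in_hom C f x y ==> in_hom C g y z ==> in_hom C (Comp C g f) x z"
 by (simp add: in_hom_def comp_arr comp_dom comp_cod)

lemma in_hom_assoc: "in_hom C f x y ==> in_hom C g y z ==> in_hom C h z w ==>
  Comp C h (Comp C g f) = Comp C (Comp C h g) f" by (auto simp: in_hom_def intro: comp_assoc)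

lemma in_hom_ide_left: "in_hom C f x y ==> Comp C (Ide C y) f = f" by (auto simp: in_hom_def comp_ide_left)

lemma in_hom_ide_right: "in_hom C f x y ==> Comp C f (Ide C x) = f" by (auto simp: in_hom_def comp_ide_right)

text \<open>The rules \<open>comp_simps\<close> nest composites to the right, where two adjacent
  arrows at the head do not form a subterm; this form applies a known equation between them inside a
  longer composite.\<close>

lemma comp_assoc_eq:
 "[|Comp C h g = k; f \<in> Arr C; g \<in> Arr C; h \<in> Arr C; Dom C g = Cod C f; Dom C h = Cod C g|] ==>
  Comp C h (Comp C g f) = Comp C k f" by (simp add: comp_assoc)

lemma comp_ide': "f \<in> Arr C ==> Cod C f = y ==> Comp C (Ide C y) f = f"
 "f \<in> Arr C ==> Dom C f = x ==> Comp C f (Ide C x) = f" using comp_ide_left comp_ide_right by auto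

lemmas comp_simps = in_hom_def comp_arr comp_dom comp_cod comp_assoc[symmetric] comp_ide' ide_arr ide_dom ide_cod

lemma iso_arrE: assumes "iso_arr C f" "in_hom C f x y"
 obtains g where "in_hom C g y x" "Comp C g f = Ide C x" "Comp C f g = Ide C y"
 using assms by (auto simp: in_hom_def iso_arr_def)

lemma iso_arrI: assumes "in_hom C f x y" "in_hom C g y x" "Comp C g f = Ide C x" "Comp C f g = Ide C y"
 shows "iso_arr C f" using assms by (auto simp: in_hom_def iso_arr_def)

text \<open>Insert \<open>m n = 1\<close> to the right of \<open>n' g\<close>, replace
  \<open>g m\<close> by \<open>m' f\<close>, and cancel \<open>n' m'\<close>. This is what makes
  pointwise inverses of modifications and of algebra 2-cells satisfy the same compatibility
  squares.\<close>

lemma inverse_square: assumes m: "in_hom C m x y" "in_hom C n y x" "Comp C m n = Ide C y"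
  and m': "in_hom C m' x' y'" "in_hom C n' y' x'" "Comp C n' m' = Ide C x'"
  and f: "in_hom C f x x'" and g: "in_hom C g y y'" and e: "Comp C m' f = Comp C g m" shows "Comp C n' g = Comp C f n"
proof -
 have "Comp C n' g = Comp C n' (Comp C g (Comp C m n))" using g m by (simp add: m(3) in_hom_ide_right)
 also have "\<dots> = Comp C n' (Comp C (Comp C g m) n)" by (simp only: in_hom_assoc[OF m(2,1) g])
 also have "\<dots> = Comp C (Comp C n' m') (Comp C f n)" unfolding e[symmetric]
  by (simp only: in_hom_assoc[OF m(2) f m'(1), symmetric] in_hom_assoc[OF in_hom_comp[OF m(2) f] m'(1,2)])
 finally show ?thesis using in_hom_ide_left[OF in_hom_comp[OF m(2) f]] by (simp add: m'(3))
qed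

text \<open>Two squares pasted along the common edge \<open>g\<close>. The 2-cells of a cone acted
  on by a word have two factors, and each factor contributes one of the squares.\<close>

lemma square_paste: assumes f: "in_hom C f x x'" and g: "in_hom C g y y'" and h: "in_hom C h z z'"
  and m: "in_hom C m x y" "in_hom C m' x' y'" and n: "in_hom C n y z" "in_hom C n' y' z'"
  and e: "Comp C m' f = Comp C g m" "Comp C n' g = Comp C h n" shows "Comp C (Comp C n' m') f = Comp C h (Comp C n m)"
 unfolding in_hom_assoc[OF f m(2) n(2), symmetric] in_hom_assoc[OF m(1) n(1) h] e(2)[symmetric] e(1)
 by (rule in_hom_assoc[OF m(1) g n(2)])

lemma iso_ide: "x \<in> Obj C ==> iso_arr C (Ide C x)"
 by (rule iso_arrI[of _ x x "Ide C x"]) (auto intro: in_hom_ide in_hom_ide_left)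

lemma iso_comp: assumes f: "in_hom C f x y" "iso_arr C f" and g: "in_hom C g y z" "iso_arr C g"
 shows "iso_arr C (Comp C g f)"
proof -
 obtain f' where f': "in_hom C f' y x" "Comp C f' f = Ide C x" "Comp C f f' = Ide C y" using iso_arrE f by blast
 obtain g' where g': "in_hom C g' z y" "Comp C g' g = Ide C y" "Comp C g g' = Ide C z" using iso_arrE g by blast
 have 1: "Comp C g' (Comp C g f) = f" "Comp C f (Comp C f' g') = g'"
  using f f' g g' by (simp_all add: comp_simps comp_assoc_eq)
 show ?thesis by (rule iso_arrI[of _ x z "Comp C f' g'"]) (use f f' g g' 1 in \<open>simp_all add: comp_simps\<close>)
qed

text \<open>The codomains \<open>z\<close> and \<open>z'\<close> may differ a priori: composing with
  the inverse of \<open>m\<close> recovers both arrows, boundary included. This is how codomains are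
  later identified.\<close>

lemma iso_cancel_right: assumes m: "in_hom C m x y" "iso_arr C m" and f: "in_hom C f y z" and g: "in_hom C g y z'"
  and eq: "Comp C f m = Comp C g m" shows "f = g"
proof -
 obtain m' where m': "in_hom C m' y x" "Comp C m m' = Ide C y" using iso_arrE m by blast
 have "f = Comp C (Comp C f m) m'" using f m m' by (simp add: comp_simps)
 also have "\<dots> = Comp C g (Comp C m m')" using eq g m m' by (simp add: comp_simps)
 finally show ?thesis using g m' by (simp add: comp_simps)
qed

end

context is_functor
begin

lemma FA_in_hom: "in_hom A f x y ==> in_hom B (FA F f) (FO F x) (FO F y)"
 by (auto simp: in_hom_def FA_arr FA_dom FA_cod)

lemma FA_comp_hom: "in_hom A f x y ==> in_hom A g y z ==> FA F (Comp A g f) = Comp B (FA F g) (FA F f)"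
 by (auto simp: in_hom_def FA_comp)

lemma FA_square:
 "[|in_hom A g x x'; in_hom A n' x' y'; in_hom A n x y; in_hom A h y y'; Comp A n' g = Comp A h n|] ==>
  Comp B (FA F n') (FA F g) = Comp B (FA F h) (FA F n)"
 using FA_comp_hom[of g x x' n' y'] FA_comp_hom[of n x y h y'] by simp

lemma FA_iso: assumes "iso_arr A f" shows "iso_arr B (FA F f)"
proof -
 interpret A: category A by (rule dom_cat)
 interpret B: category B by (rule cod_cat)
 have f: "in_hom A f (Dom A f) (Cod A f)" using assms by (simp add: iso_arr_def in_hom_def)
 obtain g where g: "in_hom A g (Cod A f) (Dom A f)" "Comp A g f = Ide A (Dom A f)" "Comp A f g = Ide A (Cod A f)"
  using A.iso_arrE[OF assms f] .
 show ?thesis by (rule B.iso_arrI[OF FA_in_hom[OF f] FA_in_hom[OF g(1)]])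
   (use f g A.in_hom_obj[OF f] in \<open>simp_all add: FA_comp_hom[symmetric] FA_ide\<close>)
qed

end

lemmas fun_obj = is_functor.FO_obj and fun_dom = is_functor.FDom and fun_cod = is_functor.FCod
 and fun_hom = is_functor.FA_in_hom and hom_obj = category.in_hom_obj

lemma is_functorI: assumes "category A" "category B" "FDom F = A" "FCod F = B"
  "FO F \<in> extensional (Obj A)" "FA F \<in> extensional (Arr A)" "\<And>x. x \<in> Obj A ==> FO F x \<in> Obj B"
  and h: "\<And>f x y. in_hom A f x y ==> in_hom B (FA F f) (FO F x) (FO F y)"
  and "\<And>x. x \<in> Obj A ==> FA F (Ide A x) = Ide B (FO F x)"
  and c: "\<And>f g x y z. in_hom A f x y ==> in_hom A g y z ==> FA F (Comp A g f) = Comp B (FA F g) (FA F f)"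
 shows "is_functor A B F"
proof (rule is_functor.intro)
 fix f assume "f \<in> Arr A"
 then show "FA F f \<in> Arr B" "Dom B (FA F f) = FO F (Dom A f)" "Cod B (FA F f) = FO F (Cod A f)"
  using h[OF in_homI] by (auto simp: in_hom_def)
next
 fix f g assume "f \<in> Arr A" "g \<in> Arr A" "Dom A g = Cod A f"
 then show "FA F (Comp A g f) = Comp B (FA F g) (FA F f)"
  using c[OF in_homI, of f g "Cod A g"] by (auto simp: in_hom_def)
qed (use assms in auto)

lemma func_eqI: assumes "is_functor A B F" "is_functor A B G"
  "\<And>x. x \<in> Obj A ==> FO F x = FO G x" "\<And>f. f \<in> Arr A ==> FA F f = FA G f" shows "F = G"
proof -
 interpret F: is_functor A B F by fact
 interpret G: is_functor A B G by fact
 show ?thesis using F.FDom F.FCod G.FDom G.FCod extensionalityI[OF F.FO_ext G.FO_ext assms(3)]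
   extensionalityI[OF F.FA_ext G.FA_ext assms(4)] by (auto intro: func.equality)
qed

lemma comp_func_simps [simp]: "FDom (comp_func G F) = FDom F" "FCod (comp_func G F) = FCod G"
 "x \<in> Obj (FDom F) ==> FO (comp_func G F) x = FO G (FO F x)"
 "f \<in> Arr (FDom F) ==> FA (comp_func G F) f = FA G (FA F f)" "FO (comp_func G F) \<in> extensional (Obj (FDom F))"
 "FA (comp_func G F) \<in> extensional (Arr (FDom F))" by (simp_all add: comp_func_def)

lemma id_func_simps [simp]: "FDom (id_func A) = A" "FCod (id_func A) = A"
 "x \<in> Obj A ==> FO (id_func A) x = x" "f \<in> Arr A ==> FA (id_func A) f = f"
 "FO (id_func A) \<in> extensional (Obj A)" "FA (id_func A) \<in> extensional (Arr A)" by (simp_all add: id_func_def)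

lemma id_nat_simps [simp]: "NDom (id_nat F) = F" "NCod (id_nat F) = F"
 "x \<in> Obj (FDom F) ==> NC (id_nat F) x = Ide (FCod F) (FO F x)" "NC (id_nat F) \<in> extensional (Obj (FDom F))"
 by (simp_all add: id_nat_def)

lemma vcomp_nat_simps [simp]: "NDom (vcomp_nat be al) = NDom al" "NCod (vcomp_nat be al) = NCod be"
 "x \<in> Obj (FDom (NDom al)) ==> NC (vcomp_nat be al) x = Comp (FCod (NDom al)) (NC be x) (NC al x)"
 "NC (vcomp_nat be al) \<in> extensional (Obj (FDom (NDom al)))" by (simp_all add: vcomp_nat_def)

lemma hcomp_nat_simps [simp]: "NDom (hcomp_nat be al) = comp_func (NDom be) (NDom al)"
 "NCod (hcomp_nat be al) = comp_func (NCod be) (NCod al)"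
 "NC (hcomp_nat be al) \<in> extensional (Obj (FDom (NDom al)))" by (simp_all add: hcomp_nat_def)

lemma hcomp_nat_NC: "x \<in> Obj (FDom (NDom al)) ==> NC (hcomp_nat be al) x =
  Comp (FCod (NDom be)) (NC be (FO (NCod al) x)) (FA (NDom be) (NC al x))" by (simp add: hcomp_nat_def)

lemma id_functor: "category A ==> is_functor A A (id_func A)"
 by (rule is_functorI) (auto simp: in_hom_def category.ide_arr category.comp_arr category.dom_obj category.cod_obj)

lemma comp_functor: assumes "is_functor A B F" "is_functor B C G" shows "is_functor A C (comp_func G F)"
proof -
 interpret F: is_functor A B F by fact
 interpret G: is_functor B C G by fact
 interpret A: category A by (rule F.dom_cat)
 note [simp] = F.FDom F.FCod G.FDom G.FCod
 show ?thesis
 proof (rule is_functorI)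
  show "in_hom C (FA (comp_func G F) f) (FO (comp_func G F) x) (FO (comp_func G F) y)" if "in_hom A f x y" for f x y
   using G.FA_in_hom[OF F.FA_in_hom[OF that]] that A.in_hom_obj[OF that] by (simp add: in_hom_def)
  show "FA (comp_func G F) (Comp A g f) = Comp C (FA (comp_func G F) g) (FA (comp_func G F) f)"
   if "in_hom A f x y" "in_hom A g y z" for f g x y z using A.in_hom_comp[OF that] F.FA_comp_hom[OF that]
    G.FA_comp_hom[OF F.FA_in_hom[OF that(1)] F.FA_in_hom[OF that(2)]] that by (simp add: in_hom_def)
 qed (auto simp: F.FO_obj G.FO_obj F.FA_ide G.FA_ide A.ide_arr F.dom_cat G.cod_cat
   intro: extensional_restrict comp_func_simps(5,6)[of G F, unfolded F.FDom])
qed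

lemma comp_func_assoc: assumes "is_functor A B F" "is_functor B C G"
 shows "comp_func H (comp_func G F) = comp_func (comp_func H G) F" using assms unfolding comp_func_def
 by (auto simp: fun_dom fun_cod fun_obj is_functor.FA_arr intro!: restrict_ext)

lemma comp_func_id: assumes "is_functor A B F" shows "comp_func F (id_func A) = F" "comp_func (id_func B) F = F"
 by (rule func_eqI[OF comp_functor[OF id_functor assms] assms], insert assms, auto simp: is_functor.dom_cat fun_dom)
  (rule func_eqI[OF comp_functor[OF assms id_functor] assms],
   insert assms, auto simp: is_functor.cod_cat fun_dom fun_obj is_functor.FA_arr)

context nat_trans
begin

sublocale DF: is_functor A B F by (rule dom_functor)
sublocale CF: is_functor A B G by (rule cod_functor)

lemma NC_in_hom: "x \<in> Obj A ==> in_hom B (NC \<alpha> x) (FO F x) (FO G x)"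
 by (simp add: in_hom_def NC_arr NC_dom NC_cod)

lemma naturality_hom: "in_hom A f x y ==> Comp B (NC \<alpha> y) (FA F f) = Comp B (FA G f) (NC \<alpha> x)"
 using naturality by (auto simp: in_hom_def)

lemmas boundary = NDom NCod DF.FDom DF.FCod CF.FDom CF.FCod

end

lemmas nat_hom = nat_trans.NC_in_hom

lemma nat_transI: assumes "is_functor A B F" "is_functor A B G" "NDom al = F" "NCod al = G"
  "NC al \<in> extensional (Obj A)" "\<And>x. x \<in> Obj A ==> in_hom B (NC al x) (FO F x) (FO G x)"
  "\<And>f x y. in_hom A f x y ==> Comp B (NC al y) (FA F f) = Comp B (FA G f) (NC al x)" shows "nat_trans A B F G al"
 by (rule nat_trans.intro) (use assms in \<open>auto simp: in_hom_def\<close>)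

lemma nat_isoI: assumes "nat_trans A B F G al" "\<And>x. x \<in> Obj A ==> iso_arr B (NC al x)"
 shows "nat_iso A B F G al" using assms by (simp add: nat_iso_def nat_iso_axioms_def)

lemma nat_eqI: assumes "nat_trans A B F G al" "nat_trans A B F G be" "\<And>x. x \<in> Obj A ==> NC al x = NC be x"
 shows "al = be"
proof -
 interpret a: nat_trans A B F G al by fact
 interpret b: nat_trans A B F G be by fact
 show ?thesis using a.NDom a.NCod b.NDom b.NCod extensionalityI[OF a.NC_ext b.NC_ext assms(3)]
  by (auto intro: ntrans.equality)
qed

lemma nat_eq_iff:
 "nat_trans A B F G al ==> nat_trans A B F G be ==> al = be \<longleftrightarrow> (\<forall>x\<in>Obj A. NC al x = NC be x)"
 using nat_eqI by blast

lemmas iso_nat = nat_iso.axioms(1)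

lemma id_nat_iso: assumes "is_functor A B F" shows "nat_iso A B F F (id_nat F)"
proof -
 interpret F: is_functor A B F by fact
 interpret B: category B by (rule F.cod_cat)
 interpret A: category A by (rule F.dom_cat)
 show ?thesis
 proof (intro nat_isoI nat_transI)
  show "Comp B (NC (id_nat F) y) (FA F f) = Comp B (FA F f) (NC (id_nat F) x)" if "in_hom A f x y" for f x y
   using F.FA_in_hom[OF that] A.in_hom_obj[OF that] by (simp add: F.FDom F.FCod B.in_hom_ide_left B.in_hom_ide_right)
 qed (use assms id_nat_simps(4)[of F, unfolded F.FDom]
   in \<open>auto simp: F.FDom F.FCod F.FO_obj B.in_hom_ide B.iso_ide\<close>)
qed

lemma vcomp_nat_trans: assumes "nat_trans A B F G al" "nat_trans A B G H be"
 shows "nat_trans A B F H (vcomp_nat be al)"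
proof -
 interpret a: nat_trans A B F G al by fact
 interpret b: nat_trans A B G H be by fact
 interpret B: category B by (rule a.DF.cod_cat)
 interpret A: category A by (rule a.DF.dom_cat)
 note [simp] = a.boundary b.boundary
 show ?thesis
 proof (rule nat_transI)
  show "Comp B (NC (vcomp_nat be al) y) (FA F f) = Comp B (FA H f) (NC (vcomp_nat be al) x)"
   if f: "in_hom A f x y" for f x y
  proof -
   have xy: "x \<in> Obj A" "y \<in> Obj A" using A.in_hom_obj[OF f] .
   note h = a.NC_in_hom[OF xy(1)] a.NC_in_hom[OF xy(2)] b.NC_in_hom[OF xy(1)]
    b.NC_in_hom[OF xy(2)] a.DF.FA_in_hom[OF f] a.CF.FA_in_hom[OF f] b.CF.FA_in_hom[OF f]
   have "Comp B (Comp B (NC be y) (NC al y)) (FA F f) = Comp B (NC be y) (Comp B (FA G f) (NC al x))"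
    using B.in_hom_assoc[OF h(5) h(2) h(4)] a.naturality_hom[OF f] by simp
   also have "\<dots> = Comp B (Comp B (FA H f) (NC be x)) (NC al x)"
    using B.in_hom_assoc[OF h(1) h(6) h(4)] b.naturality_hom[OF f] by simp
   also have "\<dots> = Comp B (FA H f) (Comp B (NC be x) (NC al x))" using B.in_hom_assoc[OF h(1) h(3) h(7)] by simp
   finally show ?thesis using xy by simp
  qed
 qed (use vcomp_nat_simps(4)[of be al] in \<open>auto intro: B.in_hom_comp a.NC_in_hom b.NC_in_hom
   a.dom_functor b.cod_functor\<close>)
qed

lemma vcomp_nat_iso: assumes "nat_iso A B F G al" "nat_iso A B G H be" shows "nat_iso A B F H (vcomp_nat be al)"
proof -
 interpret a: nat_iso A B F G al by fact
 interpret b: nat_iso A B G H be by fact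
 interpret B: category B by (rule a.DF.cod_cat)
 show ?thesis by (intro nat_isoI vcomp_nat_trans[OF a.nat_trans_axioms b.nat_trans_axioms])
   (simp add: a.boundary B.iso_comp[OF a.NC_in_hom a.NC_iso b.NC_in_hom b.NC_iso])
qed

lemma hcomp_nat_trans: assumes "nat_trans A B F F' al" "nat_trans B C G G' be"
 shows "nat_trans A C (comp_func G F) (comp_func G' F') (hcomp_nat be al)"
proof -
 interpret a: nat_trans A B F F' al by fact
 interpret b: nat_trans B C G G' be by fact
 interpret C: category C by (rule b.DF.cod_cat)
 interpret B: category B by (rule a.DF.cod_cat)
 interpret A: category A by (rule a.DF.dom_cat)
 note [simp] = a.boundary b.boundary
 show ?thesis
 proof (rule nat_transI)
  show "Comp C (NC (hcomp_nat be al) y) (FA (comp_func G F) f) =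
    Comp C (FA (comp_func G' F') f) (NC (hcomp_nat be al) x)" if f: "in_hom A f x y" for f x y
  proof -
   have xy: "x \<in> Obj A" "y \<in> Obj A" and f': "f \<in> Arr A"
    using A.in_hom_obj[OF f] f by (auto simp: in_hom_def)
   note Gay = b.DF.FA_in_hom[OF a.NC_in_hom[OF xy(2)]]
   note Gax = b.DF.FA_in_hom[OF a.NC_in_hom[OF xy(1)]]
   note GFf = b.DF.FA_in_hom[OF a.DF.FA_in_hom[OF f]]
   note GF'f = b.DF.FA_in_hom[OF a.CF.FA_in_hom[OF f]]
   note G'F'f = b.CF.FA_in_hom[OF a.CF.FA_in_hom[OF f]]
   note bx = b.NC_in_hom[OF a.CF.FO_obj[OF xy(1)]]
   note by' = b.NC_in_hom[OF a.CF.FO_obj[OF xy(2)]]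
   have "Comp C (Comp C (NC be (FO F' y)) (FA G (NC al y))) (FA G (FA F f)) =
     Comp C (NC be (FO F' y)) (FA G (Comp B (NC al y) (FA F f)))" using C.in_hom_assoc[OF GFf Gay by']
     b.DF.FA_comp_hom[OF a.DF.FA_in_hom[OF f] a.NC_in_hom[OF xy(2)]] by simp
   also have "\<dots> = Comp C (NC be (FO F' y)) (Comp C (FA G (FA F' f)) (FA G (NC al x)))"
    using a.naturality_hom[OF f] b.DF.FA_comp_hom[OF a.NC_in_hom[OF xy(1)] a.CF.FA_in_hom[OF f]] by simp
   also have "\<dots> = Comp C (Comp C (FA G' (FA F' f)) (NC be (FO F' x))) (FA G (NC al x))"
    using C.in_hom_assoc[OF Gax GF'f by'] b.naturality_hom[OF a.CF.FA_in_hom[OF f]] by simp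
   also have "\<dots> = Comp C (FA G' (FA F' f)) (Comp C (NC be (FO F' x)) (FA G (NC al x)))"
    using C.in_hom_assoc[OF Gax bx G'F'f] by simp
   finally show ?thesis using xy f' by (simp add: hcomp_nat_NC)
  qed
 qed (use hcomp_nat_simps(3)[of be al] in \<open>auto simp: hcomp_nat_NC intro!: C.in_hom_comp b.DF.FA_in_hom a.NC_in_hom
   b.NC_in_hom comp_functor a.dom_functor b.cod_functor b.dom_functor a.cod_functor a.CF.FO_obj\<close>)
qed

lemma hcomp_nat_iso: assumes "nat_iso A B F F' al" "nat_iso B C G G' be"
 shows "nat_iso A C (comp_func G F) (comp_func G' F') (hcomp_nat be al)"
proof -
 interpret a: nat_iso A B F F' al by fact
 interpret b: nat_iso B C G G' be by fact
 interpret C: category C by (rule b.DF.cod_cat)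
 show ?thesis by (intro nat_isoI hcomp_nat_trans[OF a.nat_trans_axioms b.nat_trans_axioms])
   (simp add: a.boundary b.boundary a.CF.FO_obj hcomp_nat_NC C.iso_comp[OF b.DF.FA_in_hom[OF a.NC_in_hom]
    b.DF.FA_iso[OF a.NC_iso] b.NC_in_hom b.NC_iso])
qed

lemma hcomp_id_left: assumes "nat_trans A B F F' al" "is_functor B C G" "x \<in> Obj A"
 shows "NC (hcomp_nat (id_nat G) al) x = FA G (NC al x)"
proof -
 interpret a: nat_trans A B F F' al by fact
 interpret G: is_functor B C G by fact
 interpret C: category C by (rule G.cod_cat)
 show ?thesis using assms(3) C.in_hom_ide_left[OF G.FA_in_hom[OF a.NC_in_hom]]
  by (simp add: a.boundary G.FDom G.FCod a.CF.FO_obj hcomp_nat_NC)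
qed

lemma hcomp_id_right: assumes "nat_trans B C G G' be" "is_functor A B F" "x \<in> Obj A"
 shows "NC (hcomp_nat be (id_nat F)) x = NC be (FO F x)"
proof -
 interpret b: nat_trans B C G G' be by fact
 interpret F: is_functor A B F by fact
 interpret C: category C by (rule b.DF.cod_cat)
 show ?thesis using assms(3) C.in_hom_ide_right[OF b.NC_in_hom[OF F.FO_obj]]
  by (simp add: b.boundary F.FDom F.FCod F.FO_obj b.DF.FA_ide hcomp_nat_NC)
qed

lemma hcomp_id_left_trans: assumes "nat_trans A B F F' al" "is_functor B C G"
 shows "nat_trans A C (comp_func G F) (comp_func G F') (hcomp_nat (id_nat G) al)"
 using hcomp_nat_trans[OF assms(1) iso_nat[OF id_nat_iso[OF assms(2)]]] .

lemma hcomp_id_right_trans: assumes "nat_trans B C G G' be" "is_functor A B F"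
 shows "nat_trans A C (comp_func G F) (comp_func G' F) (hcomp_nat be (id_nat F))"
 using hcomp_nat_trans[OF iso_nat[OF id_nat_iso[OF assms(2)]] assms(1)] .

text \<open>An invertible natural transformation determines its codomain: on objects it is the
  codomain of the components, on arrows the naturality square can be solved for
  \<open>FA G f\<close> by cancelling the invertible component at the domain of
  \<open>f\<close>.\<close>

lemma nat_iso_cod_unique:
 assumes "nat_iso A B F G al" "nat_iso A B F G' be" "\<And>x. x \<in> Obj A ==> NC al x = NC be x" shows "al = be"
proof -
 interpret a: nat_iso A B F G al by fact
 interpret b: nat_iso A B F G' be by fact
 interpret B: category B by (rule a.DF.cod_cat)
 interpret A: category A by (rule a.DF.dom_cat)
 have "G = G'"
 proof (rule func_eqI[OF a.cod_functor b.cod_functor])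
  show "FO G x = FO G' x" if "x \<in> Obj A" for x using that a.NC_cod b.NC_cod assms(3) by metis
  show "FA G f = FA G' f" if "f \<in> Arr A" for f
  proof -
   have f: "in_hom A f (Dom A f) (Cod A f)" using that by (rule in_homI)
   have x: "Dom A f \<in> Obj A" "Cod A f \<in> Obj A" using A.in_hom_obj[OF f] .
   have e: "Comp B (FA G f) (NC al (Dom A f)) = Comp B (FA G' f) (NC al (Dom A f))"
    using a.naturality_hom[OF f] b.naturality_hom[OF f] assms(3) x by simp
   have "FO G (Dom A f) = FO G' (Dom A f)" using x a.NC_cod b.NC_cod assms(3) by metis
   then show ?thesis using B.iso_cancel_right[OF a.NC_in_hom[OF x(1)] a.NC_iso[OF x(1)] a.CF.FA_in_hom[OF f] _ e]
     b.CF.FA_in_hom[OF f] by simp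
  qed
 qed
 then show ?thesis using nat_eqI[OF a.nat_trans_axioms _ assms(3)] b.nat_trans_axioms by simp
qed

lemma vcomp_nat_assoc: assumes "nat_trans A B F G al" "nat_trans A B G H be" "nat_trans A B H K ga"
 shows "vcomp_nat ga (vcomp_nat be al) = vcomp_nat (vcomp_nat ga be) al"
proof (rule nat_eqI)
 show "nat_trans A B F K (vcomp_nat ga (vcomp_nat be al))" using assms vcomp_nat_trans by blast
 show "nat_trans A B F K (vcomp_nat (vcomp_nat ga be) al)" using assms vcomp_nat_trans by blast
 interpret a: nat_trans A B F G al by fact
 interpret b: nat_trans A B G H be by fact
 interpret c: nat_trans A B H K ga by fact
 interpret B: category B by (rule a.DF.cod_cat)
 show "NC (vcomp_nat ga (vcomp_nat be al)) x = NC (vcomp_nat (vcomp_nat ga be) al) x" if "x \<in> Obj A" for x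
  using that B.in_hom_assoc[OF a.NC_in_hom b.NC_in_hom c.NC_in_hom] by (simp add: a.boundary b.boundary c.boundary)
qed

lemma vcomp_nat_id: assumes "nat_trans A B F G al" shows "vcomp_nat al (id_nat F) = al" "vcomp_nat (id_nat G) al = al"
proof -
 interpret a: nat_trans A B F G al by fact
 interpret B: category B by (rule a.DF.cod_cat)
 note i = id_nat_iso[OF a.dom_functor, THEN iso_nat] id_nat_iso[OF a.cod_functor, THEN iso_nat]
 show "vcomp_nat al (id_nat F) = al" by (rule nat_eqI[OF vcomp_nat_trans[OF i(1) assms] assms])
   (simp add: a.boundary B.in_hom_ide_right[OF a.NC_in_hom])
 show "vcomp_nat (id_nat G) al = al" by (rule nat_eqI[OF vcomp_nat_trans[OF assms i(2)] assms])
   (simp add: a.boundary B.in_hom_ide_left[OF a.NC_in_hom])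
qed

lemma hcomp_nat_assoc: assumes "nat_trans A B F F' al" "nat_trans B C G G' be" "nat_trans C E H H' ga"
 shows "hcomp_nat ga (hcomp_nat be al) = hcomp_nat (hcomp_nat ga be) al"
proof (rule nat_eqI)
 interpret a: nat_trans A B F F' al by fact
 interpret b: nat_trans B C G G' be by fact
 interpret c: nat_trans C E H H' ga by fact
 interpret C: category C by (rule b.DF.cod_cat)
 interpret E: category E by (rule c.DF.cod_cat)
 show "nat_trans A E (comp_func H (comp_func G F)) (comp_func H' (comp_func G' F')) (hcomp_nat ga (hcomp_nat be al))"
  using hcomp_nat_trans[OF hcomp_nat_trans[OF assms(1,2)] assms(3)] .
 show "nat_trans A E (comp_func H (comp_func G F)) (comp_func H' (comp_func G' F')) (hcomp_nat (hcomp_nat ga be) al)"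
  using hcomp_nat_trans[OF assms(1) hcomp_nat_trans[OF assms(2,3)]]
  by (simp add: comp_func_assoc[OF a.dom_functor b.dom_functor] comp_func_assoc[OF a.cod_functor b.cod_functor])
 show "NC (hcomp_nat ga (hcomp_nat be al)) x = NC (hcomp_nat (hcomp_nat ga be) al) x" if x: "x \<in> Obj A" for x
 proof -
  note G = b.DF.FA_in_hom[OF a.NC_in_hom[OF x]]
  note bb = b.NC_in_hom[OF a.CF.FO_obj[OF x]]
  note cc = c.NC_in_hom[OF b.CF.FO_obj[OF a.CF.FO_obj[OF x]]]
  show ?thesis using x E.in_hom_assoc[OF c.DF.FA_in_hom[OF G] c.DF.FA_in_hom[OF bb] cc]
    c.DF.FA_comp_hom[OF G bb] a.NC_arr[OF x] by (simp add: a.boundary b.boundary c.boundary a.CF.FO_obj hcomp_nat_NC)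
 qed
qed

lemma hcomp_nat_id: assumes "nat_trans A B F G al"
 shows "hcomp_nat al (id_nat (id_func A)) = al" "hcomp_nat (id_nat (id_func B)) al = al"
proof -
 interpret a: nat_trans A B F G al by fact
 note idA = id_functor[OF a.DF.dom_cat] and idB = id_functor[OF a.DF.cod_cat]
 note c = comp_func_id[OF a.dom_functor] comp_func_id[OF a.cod_functor]
 show "hcomp_nat al (id_nat (id_func A)) = al"
  by (rule nat_eqI[OF hcomp_id_right_trans[OF assms idA, unfolded c] assms]) (simp add: hcomp_id_right[OF assms idA])
 show "hcomp_nat (id_nat (id_func B)) al = al"
  by (rule nat_eqI[OF hcomp_id_left_trans[OF assms idB, unfolded c] assms])
   (simp add: hcomp_id_left[OF assms idB] a.NC_arr)
qed

lemma hcomp_id_id: assumes "is_functor A B F" "is_functor B C G"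
 shows "hcomp_nat (id_nat G) (id_nat F) = id_nat (comp_func G F)"
proof (rule nat_eqI)
 note i = id_nat_iso[THEN iso_nat]
 show "nat_trans A C (comp_func G F) (comp_func G F) (hcomp_nat (id_nat G) (id_nat F))"
  using hcomp_nat_trans[OF i i] assms by blast
 show "nat_trans A C (comp_func G F) (comp_func G F) (id_nat (comp_func G F))" using i comp_functor assms by blast
 interpret F: is_functor A B F by fact
 interpret G: is_functor B C G by fact
 show "NC (hcomp_nat (id_nat G) (id_nat F)) x = NC (id_nat (comp_func G F)) x" if "x \<in> Obj A" for x
  using that hcomp_id_right[OF i[OF assms(2)] assms(1) that] by (simp add: F.FDom F.FCod G.FDom G.FCod F.FO_obj)
qed

text \<open>The two middle factors are exchanged by naturality of \<open>be\<close> at the component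
  of \<open>al'\<close>.\<close>

lemma interchange_nat: assumes "nat_trans A B F F' al" "nat_trans A B F' F'' al'"
  "nat_trans B C G G' be" "nat_trans B C G' G'' be'" shows "hcomp_nat (vcomp_nat be' be) (vcomp_nat al' al) =
  vcomp_nat (hcomp_nat be' al') (hcomp_nat be al)"
proof (rule nat_eqI)
 interpret a: nat_trans A B F F' al by fact
 interpret a': nat_trans A B F' F'' al' by fact
 interpret b: nat_trans B C G G' be by fact
 interpret b': nat_trans B C G' G'' be' by fact
 interpret C: category C by (rule b.DF.cod_cat)
 show "nat_trans A C (comp_func G F) (comp_func G'' F'') (hcomp_nat (vcomp_nat be' be) (vcomp_nat al' al))"
  using hcomp_nat_trans[OF vcomp_nat_trans[OF assms(1,2)] vcomp_nat_trans[OF assms(3,4)]] .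
 show "nat_trans A C (comp_func G F) (comp_func G'' F'') (vcomp_nat (hcomp_nat be' al') (hcomp_nat be al))"
  using vcomp_nat_trans[OF hcomp_nat_trans[OF assms(1,3)] hcomp_nat_trans[OF assms(2,4)]] .
 show "NC (hcomp_nat (vcomp_nat be' be) (vcomp_nat al' al)) x =
   NC (vcomp_nat (hcomp_nat be' al') (hcomp_nat be al)) x" if x: "x \<in> Obj A" for x
 proof -
  note o' = a.CF.FO_obj[OF x] and o'' = a'.CF.FO_obj[OF x]
  note Ga = b.DF.FA_in_hom[OF a.NC_in_hom[OF x]] and Ga' = b.DF.FA_in_hom[OF a'.NC_in_hom[OF x]]
  note G'a' = b.CF.FA_in_hom[OF a'.NC_in_hom[OF x]]
  note b1 = b.NC_in_hom[OF o'] and b2 = b.NC_in_hom[OF o''] and b3 = b'.NC_in_hom[OF o'']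
  have "Comp C (Comp C (NC be' (FO F'' x)) (NC be (FO F'' x))) (Comp C (FA G (NC al' x)) (FA G (NC al x))) =
   Comp C (NC be' (FO F'' x)) (Comp C (Comp C (NC be (FO F'' x)) (FA G (NC al' x))) (FA G (NC al x)))"
   using C.in_hom_assoc[OF C.in_hom_comp[OF Ga Ga'] b2 b3] C.in_hom_assoc[OF Ga Ga' b2] by simp
  also have "\<dots> = Comp C (NC be' (FO F'' x)) (Comp C (Comp C (FA G' (NC al' x)) (NC be (FO F' x)))
    (FA G (NC al x)))" using b.naturality_hom[OF a'.NC_in_hom[OF x]] by simp
  also have "\<dots> = Comp C (Comp C (NC be' (FO F'' x)) (FA G' (NC al' x)))
    (Comp C (NC be (FO F' x)) (FA G (NC al x)))"
   using C.in_hom_assoc[OF C.in_hom_comp[OF Ga b1] G'a' b3] C.in_hom_assoc[OF Ga b1 G'a'] by simp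
  finally show ?thesis using x o'' b.DF.FA_comp_hom[OF a.NC_in_hom[OF x] a'.NC_in_hom[OF x]]
   by (simp add: a.boundary b.boundary a'.boundary b'.boundary hcomp_nat_NC)
 qed
qed

text \<open>The set-theoretic inverses form a functor: injectivity on objects makes the inverse on
  arrows respect domains and codomains, injectivity on arrows makes it respect composites and
  identities.\<close>

lemma cat_isoI: assumes F: "is_functor A B F"
  and bo: "bij_betw (FO F) (Obj A) (Obj B)" and ba: "bij_betw (FA F) (Arr A) (Arr B)" shows "cat_iso A B F"
proof -
 interpret F: is_functor A B F by fact
 interpret A: category A by (rule F.dom_cat)
 interpret B: category B by (rule F.cod_cat)
 define o' where "o' = inv_into (Obj A) (FO F)"
 define a' where "a' = inv_into (Arr A) (FA F)"
 have o1: "o' y \<in> Obj A" "FO F (o' y) = y" if "y \<in> Obj B" for y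
  using that bo by (auto simp: o'_def bij_betw_def inv_into_into f_inv_into_f)
 have o2: "o' (FO F x) = x" if "x \<in> Obj A" for x using that bo by (auto simp: o'_def bij_betw_def)
 have a1: "a' g \<in> Arr A" "FA F (a' g) = g" if "g \<in> Arr B" for g
  using that ba by (auto simp: a'_def bij_betw_def inv_into_into f_inv_into_f)
 have a2: "a' (FA F f) = f" if "f \<in> Arr A" for f using that ba by (auto simp: a'_def bij_betw_def)
 have h: "in_hom A (a' g) (o' x) (o' y)" if "in_hom B g x y" for g x y
  using that a1[of g] F.FA_dom[of "a' g"] F.FA_cod[of "a' g"] o2[of "Dom A (a' g)"]
   o2[of "Cod A (a' g)"] A.dom_obj A.cod_obj by (auto simp: in_hom_def)
 define G where "G = \<lparr>FDom = B, FCod = A, FO = (\<lambda>y\<in>Obj B. o' y), FA = (\<lambda>g\<in>Arr B. a' g)\<rparr>"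
 have G: "is_functor B A G"
 proof (rule is_functorI)
  show "in_hom A (FA G f) (FO G x) (FO G y)" if "in_hom B f x y" for f x y
   using h[OF that] B.in_hom_obj[OF that] that by (simp add: G_def in_hom_def)
  show "FA G (Ide B x) = Ide A (FO G x)" if "x \<in> Obj B" for x
   using that a2[of "Ide A (o' x)"] o1[OF that] by (simp add: G_def B.ide_arr A.ide_arr F.FA_ide)
  show "FA G (Comp B g f) = Comp A (FA G g) (FA G f)" if "in_hom B f x y" "in_hom B g y z" for f g x y z
   using a2[of "Comp A (a' g) (a' f)"] A.in_hom_comp[OF h h, OF that] B.in_hom_comp[OF that]
    F.FA_comp_hom[OF h h, OF that] that a1 by (simp add: G_def in_hom_def)
 qed (auto simp: G_def A.category_axioms B.category_axioms o1)
 have "comp_func G F = id_func A" by (rule func_eqI[OF comp_functor[OF F G] id_functor[OF F.dom_cat]])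
   (simp_all add: F.FDom G_def F.FO_obj F.FA_arr o2 a2)
 moreover have "comp_func F G = id_func B" by (rule func_eqI[OF comp_functor[OF G F] id_functor[OF F.cod_cat]])
   (simp_all add: G_def o1 a1)
 ultimately show ?thesis using F G by (auto simp: cat_iso_def)
qed

section \<open>Powers of categories\<close>

lemma powO_iff: "xs \<in> powO X n \<longleftrightarrow> length xs = n \<and> (\<forall>i<n. xs ! i \<in> Obj X)"
 by (simp add: pow_cat_def subset_eq all_set_conv_all_nth conj_commute cong: conj_cong)

lemma powA_iff: "fs \<in> powA X n \<longleftrightarrow> length fs = n \<and> (\<forall>i<n. fs ! i \<in> Arr X)"
 by (simp add: pow_cat_def subset_eq all_set_conv_all_nth conj_commute cong: conj_cong)

lemma powH_iff:
 "powH X n fs xs ys \<longleftrightarrow> length fs = n \<and> length xs = n \<and> length ys = n \<and>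
  (\<forall>i<n. in_hom X (fs ! i) (xs ! i) (ys ! i))"
 by (auto simp: in_hom_def powA_iff) (auto simp: pow_cat_def intro!: nth_equalityI)

lemma pow_cat_simps [simp]: "Ide (pow_cat X n) xs = map (Ide X) xs" "Comp (pow_cat X n) gs fs = map2 (Comp X) gs fs"
 "Dom (pow_cat X n) fs = map (Dom X) fs" "Cod (pow_cat X n) fs = map (Cod X) fs" by (simp_all add: pow_cat_def)

lemma pow_category: assumes "category X" shows "category (pow_cat X n)"
proof -
 interpret X: category X by fact
 show ?thesis
 proof
  fix f g h
  assume a: "f \<in> powA X n" "g \<in> powA X n" "Dom (pow_cat X n) g = Cod (pow_cat X n) f"
  then have e: "length f = n" "length g = n" "\<And>i. i < n ==> Dom X (g ! i) = Cod X (f ! i)"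
   by (auto simp: powA_iff dest: arg_cong[where f = "\<lambda>xs. xs ! _"]) (metis nth_map)
  show "Comp (pow_cat X n) g f \<in> powA X n" using a e by (simp add: powA_iff X.comp_arr)
  show "Dom (pow_cat X n) (Comp (pow_cat X n) g f) = Dom (pow_cat X n) f"
   using a e by (auto simp: powA_iff X.comp_dom intro!: nth_equalityI)
  show "Cod (pow_cat X n) (Comp (pow_cat X n) g f) = Cod (pow_cat X n) g"
   using a e by (auto simp: powA_iff X.comp_cod intro!: nth_equalityI)
  assume b: "h \<in> powA X n" "Dom (pow_cat X n) h = Cod (pow_cat X n) g"
  then have "length h = n" "\<And>i. i < n ==> Dom X (h ! i) = Cod X (g ! i)"
   using e by (auto simp: powA_iff dest: arg_cong[where f = "\<lambda>xs. xs ! _"]) (metis nth_map)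
  then show "Comp (pow_cat X n) h (Comp (pow_cat X n) g f) = Comp (pow_cat X n) (Comp (pow_cat X n) h g) f"
   using a b e by (auto simp: powA_iff X.comp_assoc intro!: nth_equalityI)
 qed (auto simp: powO_iff powA_iff X.dom_obj X.cod_obj X.ide_arr X.ide_dom X.ide_cod
   X.comp_ide_left X.comp_ide_right intro!: nth_equalityI)
qed

lemma iso_arr_pow: assumes "length fs = n" "\<And>i. i < n ==> iso_arr X (fs ! i)" shows "iso_arr (pow_cat X n) fs"
proof -
 have "\<forall>i. \<exists>g. i < n \<longrightarrow> g \<in> Arr X \<and> Dom X g = Cod X (fs ! i) \<and> Cod X g = Dom X (fs ! i) \<and>
   Comp X g (fs ! i) = Ide X (Dom X (fs ! i)) \<and> Comp X (fs ! i) g = Ide X (Cod X (fs ! i))"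
  using assms(2) unfolding iso_arr_def by blast
 then obtain g where g: "\<And>i. i < n ==> g i \<in> Arr X \<and> Dom X (g i) = Cod X (fs ! i) \<and>
   Cod X (g i) = Dom X (fs ! i) \<and> Comp X (g i) (fs ! i) = Ide X (Dom X (fs ! i)) \<and>
   Comp X (fs ! i) (g i) = Ide X (Cod X (fs ! i))" by metis
 show ?thesis unfolding iso_arr_def
 proof (intro conjI bexI[of _ "map g [0..<n]"])
  show "fs \<in> powA X n" using assms by (auto simp: powA_iff iso_arr_def)
 qed (use assms(1) g in \<open>auto simp: powA_iff intro!: nth_equalityI\<close>)
qed

subsection \<open>Blocks of lists\<close>

lemma length_blocks [simp]: "length (blocks ns xs) = length ns" by (induction ns xs rule: blocks.induct) auto

lemma offset_Suc: "offset (n # ns) (Suc i) = n + offset ns i" by (simp add: offset_def)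

lemma blocks_nth: "i < length ns ==> blocks ns xs ! i = take (ns ! i) (drop (offset ns i) xs)"
proof (induction ns xs arbitrary: i rule: blocks.induct)
 case (2 n ns xs)
 then show ?case by (cases i) (auto simp: offset_Suc offset_def add.commute)
qed simp

lemma offset_less: "i < length ns ==> k < ns ! i ==> offset ns i + k < sum_list ns"
proof (induction ns arbitrary: i)
 case (Cons n ns)
 then show ?case by (cases i) (auto simp: offset_Suc offset_def)
qed simp

lemma offset_add_le: "i < length ns ==> offset ns i + ns ! i \<le> sum_list ns"
proof (induction ns arbitrary: i)
 case (Cons n ns)
 then show ?case by (cases i) (auto simp: offset_Suc offset_def)
qed simp

lemma blocks_nth_length: "i < length ns ==> length xs = sum_list ns ==> length (blocks ns xs ! i) = ns ! i"
 using offset_add_le[of i ns] by (simp add: blocks_nth)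

lemma blocks_nth_nth:
 "i < length ns ==> length xs = sum_list ns ==> k < ns ! i ==> blocks ns xs ! i ! k = xs ! (offset ns i + k)"
 using offset_add_le[of i ns] by (simp add: blocks_nth)

lemma blocks_map: "blocks ns (map f xs) = map (map f) (blocks ns xs)"
 by (induction ns xs rule: blocks.induct) (auto simp: take_map drop_map)

lemma blocks_map2: "length xs = length ys ==> blocks ns (map2 f xs ys) = map2 (map2 f) (blocks ns xs) (blocks ns ys)"
proof (induction ns arbitrary: xs ys)
 case (Cons n ns)
 then show ?case by (simp add: take_map drop_map take_zip drop_zip)
qed simp

lemma blocks_Obj: assumes "xs \<in> powO X (sum_list ns)" "i < length ns"
 shows "blocks ns xs ! i \<in> powO X (ns ! i)"
 using assms by (auto simp: powO_iff blocks_nth_length blocks_nth_nth offset_less)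

lemma blocks_in_hom: assumes "powH X (sum_list ns) fs xs ys" "i < length ns"
 shows "powH X (ns ! i) (blocks ns fs ! i) (blocks ns xs ! i) (blocks ns ys ! i)"
 using assms by (auto simp: powH_iff blocks_nth_length blocks_nth_nth offset_less)

lemma blocks_Arr: assumes "fs \<in> powA X (sum_list ns)" "i < length ns"
 shows "blocks ns fs ! i \<in> powA X (ns ! i)"
 using assms by (auto simp: powA_iff blocks_nth_length blocks_nth_nth offset_less)

subsection \<open>Functors between powers\<close>

lemma pow_func_simps [simp]: "FDom (pow_func n H) = pow_cat (FDom H) n" "FCod (pow_func n H) = pow_cat (FCod H) n"
 "xs \<in> powO (FDom H) n ==> FO (pow_func n H) xs = map (FO H) xs"
 "fs \<in> powA (FDom H) n ==> FA (pow_func n H) fs = map (FA H) fs" by (simp_all add: pow_func_def)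

lemma prod_func_simps [simp]: "FDom (prod_func X Y ns Fs) = pow_cat X (sum_list ns)"
 "FCod (prod_func X Y ns Fs) = pow_cat Y (length ns)"
 "xs \<in> powO X (sum_list ns) ==> FO (prod_func X Y ns Fs) xs = map2 FO Fs (blocks ns xs)"
 "fs \<in> powA X (sum_list ns) ==> FA (prod_func X Y ns Fs) fs = map2 FA Fs (blocks ns fs)"
 by (simp_all add: prod_func_def)

lemma reindex_simps [simp]: "FDom (reindex X l fs) = pow_cat X l" "FCod (reindex X l fs) = pow_cat X (length fs)"
 "xs \<in> powO X l ==> FO (reindex X l fs) xs = map ((!) xs) fs"
 "as \<in> powA X l ==> FA (reindex X l fs) as = map ((!) as) fs" by (simp_all add: reindex_def)

lemma end_unit_simps [simp]: "FDom (end_unit X) = pow_cat X 1" "FCod (end_unit X) = X"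
 "xs \<in> powO X 1 ==> FO (end_unit X) xs = hd xs" "fs \<in> powA X 1 ==> FA (end_unit X) fs = hd fs"
 by (simp_all add: end_unit_def)

lemma pow_nat_simps [simp]: "NDom (pow_nat n al) = pow_func n (NDom al)" "NCod (pow_nat n al) = pow_func n (NCod al)"
 "xs \<in> powO (FDom (NDom al)) n ==> NC (pow_nat n al) xs = map (NC al) xs" by (simp_all add: pow_nat_def)

lemma prod_nat_simps [simp]: "NDom (prod_nat X Y ns als) = prod_func X Y ns (map NDom als)"
 "NCod (prod_nat X Y ns als) = prod_func X Y ns (map NCod als)"
 "xs \<in> powO X (sum_list ns) ==> NC (prod_nat X Y ns als) xs = map2 NC als (blocks ns xs)"
 by (simp_all add: prod_nat_def)

lemma pow_functor: assumes "is_functor A B H" shows "is_functor (pow_cat A n) (pow_cat B n) (pow_func n H)"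
proof -
 interpret H: is_functor A B H by fact
 interpret P: category "pow_cat A n" by (rule pow_category[OF H.dom_cat])
 show ?thesis
 proof (rule is_functorI)
  show "powH B n (FA (pow_func n H) f) (FO (pow_func n H) x) (FO (pow_func n H) y)" if "powH A n f x y" for f x y
   using that P.in_hom_obj[OF that] in_homD(1)[OF that] by (auto simp: H.FDom powH_iff H.FA_in_hom)
  show "FA (pow_func n H) (Comp (pow_cat A n) g f) = Comp (pow_cat B n) (FA (pow_func n H) g) (FA (pow_func n H) f)"
   if h: "powH A n f x y" "powH A n g y z" for f g x y z
  proof -
   have "FA H (Comp A (g ! i) (f ! i)) = Comp B (FA H (g ! i)) (FA H (f ! i))" if "i < n" for i
    using h that by (auto simp: powH_iff intro!: H.FA_comp_hom[of _ "x ! i" "y ! i" _ "z ! i"])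
   then show ?thesis using in_homD(1)[OF P.in_hom_comp[OF h]] in_homD(1)[OF h(1)] in_homD(1)[OF h(2)] h
    by (auto simp: H.FDom powH_iff intro!: nth_equalityI)
  qed
  show "FA (pow_func n H) (Ide (pow_cat A n) x) = Ide (pow_cat B n) (FO (pow_func n H) x)"
   if x: "x \<in> powO A n" for x using P.ide_arr[OF x] x by (auto simp: H.FDom powO_iff H.FA_ide in_set_conv_nth)
  show "FO (pow_func n H) x \<in> powO B n" if x: "x \<in> powO A n" for x
   using x by (auto simp: H.FDom H.FO_obj powO_iff)
  show "FO (pow_func n H) \<in> extensional (powO A n)" "FA (pow_func n H) \<in> extensional (powA A n)"
   by (auto simp: pow_func_def H.FDom)
 qed (auto simp: pow_category H.dom_cat H.cod_cat H.FDom H.FCod)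
qed

lemma prod_functor: assumes X: "category X" and Y: "category Y" and len: "length Fs = length ns"
  and F: "\<And>i. i < length ns ==> is_functor (pow_cat X (ns ! i)) Y (Fs ! i)"
 shows "is_functor (pow_cat X (sum_list ns)) (pow_cat Y (length ns)) (prod_func X Y ns Fs)"
proof -
 interpret P: category "pow_cat X (sum_list ns)" by (rule pow_category[OF X])
 show ?thesis
 proof (rule is_functorI)
  show "powH Y (length ns) (FA (prod_func X Y ns Fs) f) (FO (prod_func X Y ns Fs) x) (FO (prod_func X Y ns Fs) y)"
   if f: "powH X (sum_list ns) f x y" for f x y
   using P.in_hom_obj[OF f] in_homD(1)[OF f] blocks_in_hom[OF f] fun_hom[OF F] len by (auto simp: powH_iff)
  show "FA (prod_func X Y ns Fs) (Comp (pow_cat X (sum_list ns)) g f) =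
    Comp (pow_cat Y (length ns)) (FA (prod_func X Y ns Fs) g) (FA (prod_func X Y ns Fs) f)"
   if h: "powH X (sum_list ns) f x y" "powH X (sum_list ns) g y z" for f g x y z
   using in_homD(1)[OF P.in_hom_comp[OF h]] in_homD(1)[OF h(1)] in_homD(1)[OF h(2)] len
    is_functor.FA_comp_hom[OF F blocks_in_hom[OF h(1)] blocks_in_hom[OF h(2)]] h[unfolded powH_iff]
   by (auto simp: blocks_map2 intro!: nth_equalityI)
  show "FA (prod_func X Y ns Fs) (Ide (pow_cat X (sum_list ns)) x) =
    Ide (pow_cat Y (length ns)) (FO (prod_func X Y ns Fs) x)" if x: "x \<in> powO X (sum_list ns)" for x
   using P.ide_arr[OF x] x is_functor.FA_ide[OF F blocks_Obj[OF x]] len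
   by (auto simp: blocks_map intro!: nth_equalityI)
  show "FO (prod_func X Y ns Fs) x \<in> powO Y (length ns)" if x: "x \<in> powO X (sum_list ns)" for x
   using x fun_obj[OF F blocks_Obj[OF x]] len by (auto simp: powO_iff[of _ Y])
 qed (auto simp: X Y pow_category prod_func_def)
qed

lemma reindex_functor: assumes X: "category X" and fs: "set fs \<subseteq> {..<l}"
 shows "is_functor (pow_cat X l) (pow_cat X (length fs)) (reindex X l fs)"
proof -
 interpret P: category "pow_cat X l" by (rule pow_category[OF X])
 have l: "fs ! i < l" if "i < length fs" for i using fs that nth_mem by blast
 show ?thesis
 proof (rule is_functorI)
  show "powH X (length fs) (FA (reindex X l fs) f) (FO (reindex X l fs) x) (FO (reindex X l fs) y)"
   if f: "powH X l f x y" for f x y using P.in_hom_obj[OF f] in_homD(1)[OF f] f l by (auto simp: powH_iff)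
  show "FA (reindex X l fs) (Comp (pow_cat X l) g f) =
    Comp (pow_cat X (length fs)) (FA (reindex X l fs) g) (FA (reindex X l fs) f)"
   if h: "powH X l f x y" "powH X l g y z" for f g x y z
   using in_homD(1)[OF P.in_hom_comp[OF h]] in_homD(1)[OF h(1)] in_homD(1)[OF h(2)] l h[unfolded powH_iff]
   by (auto intro!: nth_equalityI)
  show "FA (reindex X l fs) (Ide (pow_cat X l) x) = Ide (pow_cat X (length fs)) (FO (reindex X l fs) x)"
   if x: "x \<in> powO X l" for x using P.ide_arr[OF x] x[unfolded powO_iff] x subsetD[OF fs] by auto
  show "FO (reindex X l fs) x \<in> powO X (length fs)" if x: "x \<in> powO X l" for x
   using x l by (auto simp: powO_iff[of _ _ "length fs"]) (auto simp: powO_iff)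
 qed (auto simp: X pow_category reindex_def)
qed

lemma end_unit_functor: assumes X: "category X" shows "is_functor (pow_cat X 1) X (end_unit X)"
proof -
 interpret P: category "pow_cat X 1" by (rule pow_category[OF X])
 interpret X: category X by fact
 have hd: "hd xs = xs ! 0" if "length xs = 1" for xs :: "'x list" using that by (cases xs) auto
 show ?thesis
 proof (rule is_functorI)
  show "in_hom X (FA (end_unit X) f) (FO (end_unit X) x) (FO (end_unit X) y)" if f: "powH X 1 f x y" for f x y
   using P.in_hom_obj[OF f] in_homD(1)[OF f] f by (auto simp: powH_iff hd)
  show "FA (end_unit X) (Comp (pow_cat X 1) g f) = Comp X (FA (end_unit X) g) (FA (end_unit X) f)"
   if h: "powH X 1 f x y" "powH X 1 g y z" for f g x y z
   using in_homD(1)[OF P.in_hom_comp[OF h]] in_homD(1)[OF h(1)] in_homD(1)[OF h(2)] h[unfolded powH_iff]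
   by (simp add: hd)
  show "FA (end_unit X) (Ide (pow_cat X 1) x) = Ide X (FO (end_unit X) x)" if x: "x \<in> powO X 1" for x
   using P.ide_arr[OF x] x by (auto simp: powO_iff hd)
  show "FO (end_unit X) x \<in> Obj X" if x: "x \<in> powO X 1" for x using x by (auto simp: powO_iff hd)
 qed (auto simp: X pow_category[OF X, of 1, simplified] end_unit_def)
qed

lemma pow_nat_trans: assumes "nat_trans A B F G al"
 shows "nat_trans (pow_cat A n) (pow_cat B n) (pow_func n F) (pow_func n G) (pow_nat n al)"
proof -
 interpret a: nat_trans A B F G al by fact
 interpret P: category "pow_cat A n" by (rule pow_category[OF a.DF.dom_cat])
 show ?thesis
 proof (rule nat_transI)
  show "powH B n (NC (pow_nat n al) x) (FO (pow_func n F) x) (FO (pow_func n G) x)" if "x \<in> powO A n" for x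
   using that by (auto simp: a.boundary powO_iff powH_iff a.NC_in_hom)
  show "Comp (pow_cat B n) (NC (pow_nat n al) y) (FA (pow_func n F) f) =
    Comp (pow_cat B n) (FA (pow_func n G) f) (NC (pow_nat n al) x)" if f: "powH A n f x y" for f x y
   using P.in_hom_obj[OF f] in_homD(1)[OF f] f
   by (auto simp: a.boundary powH_iff a.naturality_hom intro!: nth_equalityI)
 qed (auto simp: a.boundary pow_functor a.dom_functor a.cod_functor pow_nat_def)
qed

lemma prod_nat_trans: assumes X: "category X" and Y: "category Y" and len: "length als = length ns"
  and a: "\<And>i. i < length ns ==> nat_trans (pow_cat X (ns ! i)) Y (NDom (als ! i)) (NCod (als ! i)) (als ! i)"
 shows "nat_trans (pow_cat X (sum_list ns)) (pow_cat Y (length ns))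
  (prod_func X Y ns (map NDom als)) (prod_func X Y ns (map NCod als)) (prod_nat X Y ns als)"
proof -
 interpret P: category "pow_cat X (sum_list ns)" by (rule pow_category[OF X])
 show ?thesis
 proof (rule nat_transI)
  show "powH Y (length ns) (NC (prod_nat X Y ns als) x)
    (FO (prod_func X Y ns (map NDom als)) x) (FO (prod_func X Y ns (map NCod als)) x)"
   if x: "x \<in> powO X (sum_list ns)" for x using x len nat_hom[OF a blocks_Obj[OF x]] by (auto simp: powH_iff)
  show "Comp (pow_cat Y (length ns)) (NC (prod_nat X Y ns als) y) (FA (prod_func X Y ns (map NDom als)) f) =
    Comp (pow_cat Y (length ns)) (FA (prod_func X Y ns (map NCod als)) f) (NC (prod_nat X Y ns als) x)"
   if f: "powH X (sum_list ns) f x y" for f x y using P.in_hom_obj[OF f] in_homD(1)[OF f] len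
    nat_trans.naturality_hom[OF a blocks_in_hom[OF f]] by (auto intro!: nth_equalityI)
  show "is_functor (pow_cat X (sum_list ns)) (pow_cat Y (length ns)) (prod_func X Y ns (map NDom als))"
   using prod_functor[OF X Y, of "map NDom als" ns] len nat_trans.dom_functor[OF a] by simp
  show "is_functor (pow_cat X (sum_list ns)) (pow_cat Y (length ns)) (prod_func X Y ns (map NCod als))"
   using prod_functor[OF X Y, of "map NCod als" ns] len nat_trans.cod_functor[OF a] by simp
 qed (auto simp: prod_nat_def)
qed

lemma prod_nat_iso: assumes X: "category X" and Y: "category Y" and len: "length als = length ns"
  and a: "\<And>i. i < length ns ==> nat_iso (pow_cat X (ns ! i)) Y (NDom (als ! i)) (NCod (als ! i)) (als ! i)"
 shows "nat_iso (pow_cat X (sum_list ns)) (pow_cat Y (length ns))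
  (prod_func X Y ns (map NDom als)) (prod_func X Y ns (map NCod als)) (prod_nat X Y ns als)"
 using nat_iso.NC_iso[OF a blocks_Obj] len by (intro nat_isoI[OF prod_nat_trans[OF X Y len iso_nat[OF a]]])
  (auto intro!: iso_arr_pow)

lemma end_gam2_iso: assumes X: "category X" and len: "length als = length ns" and a: "\<And>i. i < length ns ==>
   nat_iso (pow_cat X (ns ! i)) X (NDom (als ! i)) (NCod (als ! i)) (als ! i)"
  and b: "nat_iso (pow_cat X (length ns)) X (NDom be) (NCod be) be"
 shows "nat_iso (pow_cat X (sum_list ns)) X (end_gam X ns (NDom be) (map NDom als))
  (end_gam X ns (NCod be) (map NCod als)) (end_gam2 X ns be als)"
 unfolding end_gam2_def end_gam_def by (rule hcomp_nat_iso[OF prod_nat_iso[OF X X len a] b])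

lemma end_subst2_iso: assumes X: "category X" and fs: "set fs \<subseteq> {..<l}"
  and b: "nat_iso (pow_cat X (length fs)) X (NDom be) (NCod be) be"
 shows "nat_iso (pow_cat X l) X (end_subst X l fs (NDom be)) (end_subst X l fs (NCod be)) (end_subst2 X l fs be)"
 unfolding end_subst2_def end_subst_def by (rule hcomp_nat_iso[OF id_nat_iso[OF reindex_functor[OF X fs]] b])

section \<open>Small sets\<close>

lemma small_image: "A \<prec> (UNIV :: 'u::universe set) ==> f ` A \<prec> (UNIV :: 'u::universe set)"
 using image_lepoll lesspoll_trans1 by blast

lemma small_subset: "B \<prec> (UNIV :: 'u::universe set) ==> A \<subseteq> B ==> A \<prec> (UNIV :: 'u::universe set)"
 using subset_imp_lepoll lesspoll_trans1 by blast

text \<open>The closure axioms of \<open>universe\<close> speak only of sets of elements of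
  \<open>'u\<close>. An injective code moves a small set of any other type there, with small image,
  so that the closure properties extend to all types.\<close>

lemma small_encode: assumes "A \<prec> (UNIV :: 'u::universe set)"
 obtains f :: "'a \<Rightarrow> 'u::universe" where "inj_on f A" "small (f ` A)"
proof -
 obtain f :: "'a \<Rightarrow> 'u" where f: "inj_on f A" using assms by (auto simp: lesspoll_def lepoll_def)
 show ?thesis using that[OF f] small_image[OF assms, of f] by (simp add: small_def)
qed

text \<open>A pair is coded by the code of its index together with the code of its second entry, so
  the sum embeds into a small union of small sets of elements of \<open>'u\<close>.\<close>

lemma small_Sigma:
 assumes I: "I \<prec> (UNIV :: 'u::universe set)" and B: "\<And>i. i \<in> I ==> B i \<prec> (UNIV :: 'u::universe set)"
 shows "Sigma I B \<prec> (UNIV :: 'u::universe set)"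
proof -
 \<comment> \<open>A pairing map exists because an infinite cardinal equals its square.\<close>
 obtain c :: "'u \<times> 'u \<Rightarrow> 'u" where c: "inj c"
  using card_of_Times_same_infinite[OF universe_infinite[where 'a = 'u]]
  unfolding card_of_ordIso[symmetric] by (auto simp: bij_betw_def)
 obtain e :: "'a \<Rightarrow> 'u" where e: "inj_on e I" using small_encode[OF I] by metis
 have "\<forall>i\<in>I. \<exists>h :: 'b \<Rightarrow> 'u. inj_on h (B i)" using small_encode[OF B] by metis
 then obtain h :: "'a \<Rightarrow> 'b \<Rightarrow> 'u" where h: "\<And>i. i \<in> I ==> inj_on (h i) (B i)" by metis
 define g where "g = (\<lambda>(i, b). c (e i, h i b))"
 have "inj_on g (Sigma I B)"
 proof (rule inj_onI)
  fix p q assume pq: "p \<in> Sigma I B" "q \<in> Sigma I B" "g p = g q"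
  obtain i b i' b' where [simp]: "p = (i, b)" "q = (i', b')" by (cases p; cases q)
  have "e i = e i'" "h i b = h i' b'" using injD[OF c] pq(3) by (auto simp: g_def)
  moreover from this have "i = i'" using inj_onD[OF e] pq(1,2) by auto
  ultimately show "p = q" using inj_onD[OF h] pq(1,2) by auto
 qed
 then have 1: "Sigma I B \<lesssim> g ` Sigma I B" by (auto simp: lepoll_def)
 \<comment> \<open>The axiom \<open>universe_UN\<close> wants its indices in \<open>'u\<close>, so
   the union runs over the codes \<open>k\<close>, and \<open>inv_into I e\<close> recovers the
   index.\<close>
 let ?U = "\<Union>k\<in>e ` I. (\<lambda>b. c (k, h (inv_into I e k) b)) ` B (inv_into I e k)"
 have 2: "g ` Sigma I B \<subseteq> ?U"
 proof (rule subsetI)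
  fix y assume "y \<in> g ` Sigma I B"
  then obtain i b where ib: "i \<in> I" "b \<in> B i" "y = c (e i, h i b)" by (auto simp: g_def)
  then have "y \<in> (\<lambda>b. c (e i, h (inv_into I e (e i)) b)) ` B (inv_into I e (e i))" using e by auto
  then show "y \<in> ?U" using ib(1) by (rule_tac UN_I[of "e i"]) simp_all
 qed
 have 3: "?U \<prec> (UNIV :: 'u set)"
 proof (rule universe_UN)
  show "e ` I \<prec> (UNIV :: 'u set)" by (rule small_image[OF I])
  fix k assume "k \<in> e ` I"
  then have "inv_into I e k \<in> I" by (rule inv_into_into)
  then show "(\<lambda>b. c (k, h (inv_into I e k) b)) ` B (inv_into I e k) \<prec> (UNIV :: 'u set)"
   by (intro small_image B)
 qed
 show ?thesis by (rule lesspoll_trans1[OF 1 small_subset[OF 3 2]])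
qed

lemma small_Times:
 "A \<prec> (UNIV :: 'u::universe set) ==> B \<prec> (UNIV :: 'u::universe set) ==> A \<times> B \<prec> (UNIV :: 'u::universe set)"
 by (rule small_Sigma)

lemma small_Pow: assumes "A \<prec> (UNIV :: 'u::universe set)" shows "Pow A \<prec> (UNIV :: 'u::universe set)"
proof -
 obtain e :: "'a \<Rightarrow> 'u" where e: "inj_on e A" "small (e ` A)" using small_encode[OF assms] .
 have "Pow A \<lesssim> Pow (e ` A)"
  unfolding lepoll_def using inj_on_image_Pow[OF e(1)] by (intro exI[of _ "(`) e"]) auto
 then show ?thesis using universe_Pow[of "e ` A"] e(2) lesspoll_trans1 by (auto simp: small_def)
qed

text \<open>An extensional function is determined by its graph over \<open>I\<close>, which is a
  subset of the dependent sum.\<close>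

lemma small_PiE:
 assumes "I \<prec> (UNIV :: 'u::universe set)" "\<And>i. i \<in> I ==> B i \<prec> (UNIV :: 'u::universe set)"
 shows "PiE I B \<prec> (UNIV :: 'u::universe set)"
proof -
 have "PiE I B \<lesssim> Pow (Sigma I B)" unfolding lepoll_def
 proof (intro exI conjI)
  let ?g = "\<lambda>f. (\<lambda>i. (i, f i)) ` I"
  show "inj_on ?g (PiE I B)"
  proof (rule inj_onI)
   fix f f' assume f: "f \<in> PiE I B" "f' \<in> PiE I B" and e: "?g f = ?g f'"
   have "f i = f' i" if "i \<in> I" for i using e that by (auto simp: set_eq_iff image_iff)
   then show "f = f'" using f by (auto intro: PiE_ext)
  qed
  show "?g ` PiE I B \<subseteq> Pow (Sigma I B)" by auto
 qed
 then show ?thesis by (rule lesspoll_trans1[OF _ small_Pow[OF small_Sigma[OF assms]]])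
qed

section \<open>Categories of pseudo natural transformations\<close>

context two_category
begin

lemmas cell1 = category.dom_obj[OF under_category, unfolded under_cat_def, simplified]
 category.cod_obj[OF under_category, unfolded under_cat_def, simplified]
 category.ide_arr[OF under_category, unfolded under_cat_def, simplified]
 category.ide_dom[OF under_category, unfolded under_cat_def, simplified]
 category.ide_cod[OF under_category, unfolded under_cat_def, simplified]
 category.comp_arr[OF under_category, unfolded under_cat_def, simplified]
 category.comp_dom[OF under_category, unfolded under_cat_def, simplified]
 category.comp_cod[OF under_category, unfolded under_cat_def, simplified]

lemmas cell2 = category.dom_obj[OF vert_category, unfolded vert_cat_def, simplified]
 category.cod_obj[OF vert_category, unfolded vert_cat_def, simplified]
 category.ide_arr[OF vert_category, unfolded vert_cat_def, simplified]
 category.ide_dom[OF vert_category, unfolded vert_cat_def, simplified]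
 category.ide_cod[OF vert_category, unfolded vert_cat_def, simplified]
 category.comp_arr[OF vert_category, unfolded vert_cat_def, simplified]
 category.comp_dom[OF vert_category, unfolded vert_cat_def, simplified]
 category.comp_cod[OF vert_category, unfolded vert_cat_def, simplified]

end

text \<open>The typing of a \<open>Cat\<close>-valued pseudo functor over arbitrary object and arrow
  types, so that one development covers \<open>J\<close>, the underlying categories of
  \<open>F\<close>, and each \<open>C(X, F-)\<close>.\<close>

locale cat_valued = fixes D :: "('d0, 'd1, 'd2) two_cat" and K :: "('d0, 'd1, 'd2, 'p, 'b) cat_psfun"
 assumes P0_cat: "x \<in> Cell0 D ==> category (P0 K x)"
  and P1_func: "f \<in> Cell1 D ==> is_functor (P0 K (Src D f)) (P0 K (Trg D f)) (P1 K f)"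
  and P2_nat: "si \<in> Cell2 D ==> nat_trans (P0 K (Src D (Dom2 D si))) (P0 K (Trg D (Dom2 D si)))
   (P1 K (Dom2 D si)) (P1 K (Cod2 D si)) (P2 K si)"
  and PComp_nat: "[|f \<in> Cell1 D; g \<in> Cell1 D; Src D g = Trg D f|] ==>
   nat_trans (P0 K (Src D f)) (P0 K (Trg D g)) (comp_func (P1 K g) (P1 K f)) (P1 K (Comp1 D g f)) (PComp K g f)"
  and PUnit_nat: "x \<in> Cell0 D ==> nat_trans (P0 K x) (P0 K x) (id_func (P0 K x)) (P1 K (Ide1 D x)) (PUnit K x)"

text \<open>The pointwise data of a pseudo natural transformation \<open>J \<Rightarrow> K\<close>: its values \<open>ob x j\<close> on objects
 and \<open>ar x u\<close> on arrows, and the components \<open>tr f j\<close> of its 2-cells.\<close>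

locale pcone = fixes D :: "('d0, 'd1, 'd2) two_cat"
  and J :: "('d0, 'd1, 'd2, 'o, 'a) cat_psfun" and K :: "('d0, 'd1, 'd2, 'p, 'b) cat_psfun"
  and ob :: "'d0 \<Rightarrow> 'o \<Rightarrow> 'p" and ar :: "'d0 \<Rightarrow> 'a \<Rightarrow> 'b" and tr :: "'d1 \<Rightarrow> 'o \<Rightarrow> 'b"
 assumes ob_obj: "[|x \<in> Cell0 D; j \<in> O0 J x|] ==> ob x j \<in> O0 K x"
  and ar_hom: "[|x \<in> Cell0 D; hom0 J x u i j|] ==> hom0 K x (ar x u) (ob x i) (ob x j)"
  and ar_ide: "[|x \<in> Cell0 D; j \<in> O0 J x|] ==> ar x (Ide (P0 J x) j) = Ide (P0 K x) (ob x j)"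
  and ar_comp: "[|x \<in> Cell0 D; hom0 J x u i j; hom0 J x v j k|] ==>
   ar x (cmp0 J x v u) = cmp0 K x (ar x v) (ar x u)"
  and tr_hom: "[|f \<in> Cell1 D; j \<in> O0 J (Src D f)|] ==> hom0 K (Trg D f) (tr f j)
   (O1 K f (ob (Src D f) j)) (ob (Trg D f) (O1 J f j))"
  and tr_iso: "[|f \<in> Cell1 D; j \<in> O0 J (Src D f)|] ==> iso_arr (P0 K (Trg D f)) (tr f j)"
  and tr_nat: "[|f \<in> Cell1 D; hom0 J (Src D f) u i j|] ==> cmp0 K (Trg D f) (tr f j) (A1 K f (ar (Src D f) u)) =
   cmp0 K (Trg D f) (ar (Trg D f) (A1 J f u)) (tr f i)"
  and tr_cell: "[|si \<in> Cell2 D; j \<in> O0 J (Src D (Dom2 D si))|] ==>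
   cmp0 K (Trg D (Dom2 D si)) (tr (Cod2 D si) j) (NC (P2 K si) (ob (Src D (Dom2 D si)) j)) =
   cmp0 K (Trg D (Dom2 D si)) (ar (Trg D (Dom2 D si)) (NC (P2 J si) j)) (tr (Dom2 D si) j)"
  and tr_comp: "[|f \<in> Cell1 D; g \<in> Cell1 D; Src D g = Trg D f; j \<in> O0 J (Src D f)|] ==>
   cmp0 K (Trg D g) (tr (Comp1 D g f) j) (NC (PComp K g f) (ob (Src D f) j)) =
   cmp0 K (Trg D g) (ar (Trg D g) (NC (PComp J g f) j)) (cmp0 K (Trg D g) (tr g (O1 J f j)) (A1 K g (tr f j)))"
  and tr_unit: "[|x \<in> Cell0 D; j \<in> O0 J x|] ==>
   cmp0 K x (tr (Ide1 D x) j) (NC (PUnit K x) (ob x j)) = ar x (NC (PUnit J x) j)"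

text \<open>Stated for bare families of values, so that the same conditions apply to assembled
  transformations, to coded cones, and to the values at one object of an algebra.\<close>

locale pmod = fixes D :: "('d0, 'd1, 'd2) two_cat"
  and J :: "('d0, 'd1, 'd2, 'o, 'a) cat_psfun" and K :: "('d0, 'd1, 'd2, 'p, 'b) cat_psfun"
  and ob :: "'d0 \<Rightarrow> 'o \<Rightarrow> 'p" and ar :: "'d0 \<Rightarrow> 'a \<Rightarrow> 'b" and tr :: "'d1 \<Rightarrow> 'o \<Rightarrow> 'b"
  and ob' :: "'d0 \<Rightarrow> 'o \<Rightarrow> 'p" and ar' :: "'d0 \<Rightarrow> 'a \<Rightarrow> 'b" and tr' :: "'d1 \<Rightarrow> 'o \<Rightarrow> 'b"
  and m :: "'d0 \<Rightarrow> 'o \<Rightarrow> 'b"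
 assumes m_hom: "[|x \<in> Cell0 D; j \<in> O0 J x|] ==> hom0 K x (m x j) (ob x j) (ob' x j)"
  and m_nat: "[|x \<in> Cell0 D; hom0 J x u i j|] ==> cmp0 K x (m x j) (ar x u) = cmp0 K x (ar' x u) (m x i)"
  and m_compat: "[|f \<in> Cell1 D; j \<in> O0 J (Src D f)|] ==> cmp0 K (Trg D f) (tr' f j) (A1 K f (m (Src D f) j)) =
   cmp0 K (Trg D f) (m (Trg D f) (O1 J f j)) (tr f j)"

abbreviation "pob al \<equiv> (\<lambda>x j. FO (PN al x) j)"
abbreviation "par al \<equiv> (\<lambda>x u. FA (PN al x) u)"
abbreviation "ptr al \<equiv> (\<lambda>f j. NC (PT al f) j)"
abbreviation "mcomp Ga \<equiv> (\<lambda>x j. NC (MC Ga x) j)"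

text \<open>The restrictions make the result extensional, as \<open>pseudo_nat\<close> demands;
  equality of assembled records is then agreement of the values on the cells of
  \<open>D\<close>.\<close>

definition mk_pnat :: "('d0, 'd1, 'd2) two_cat \<Rightarrow> ('d0, 'd1, 'd2, 'o, 'a) cat_psfun \<Rightarrow>
  ('d0, 'd1, 'd2, 'p, 'b) cat_psfun \<Rightarrow> ('d0 \<Rightarrow> 'o \<Rightarrow> 'p) \<Rightarrow> ('d0 \<Rightarrow> 'a \<Rightarrow> 'b) \<Rightarrow> ('d1 \<Rightarrow> 'o \<Rightarrow> 'b) \<Rightarrow>
  ('d0, 'd1, 'o, 'a, 'p, 'b) pnat" where "mk_pnat D J K ob ar tr = (let
  N = (\<lambda>x\<in>Cell0 D. \<lparr>FDom = P0 J x, FCod = P0 K x,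
   FO = (\<lambda>j\<in>O0 J x. ob x j), FA = (\<lambda>u\<in>A0 J x. ar x u)\<rparr>) in
  \<lparr>PN = N, PT = (\<lambda>f\<in>Cell1 D. \<lparr>NDom = comp_func (P1 K f) (N (Src D f)),
   NCod = comp_func (N (Trg D f)) (P1 J f), NC = (\<lambda>j\<in>O0 J (Src D f). tr f j)\<rparr>)\<rparr>)"

definition mk_modif :: "('d0, 'd1, 'd2) two_cat \<Rightarrow> ('d0, 'd1, 'd2, 'o, 'a) cat_psfun \<Rightarrow>
  ('d0, 'd1, 'o, 'a, 'p, 'b) pnat \<Rightarrow> ('d0, 'd1, 'o, 'a, 'p, 'b) pnat \<Rightarrow> ('d0 \<Rightarrow> 'o \<Rightarrow> 'b) \<Rightarrow>
  ('d0, 'd1, 'o, 'a, 'p, 'b) modif" where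
 "mk_modif D J al be m = \<lparr>MDom = al, MCod = be, MC = (\<lambda>x\<in>Cell0 D. \<lparr>NDom = PN al x, NCod = PN be x,
  NC = (\<lambda>j\<in>O0 J x. m x j)\<rparr>)\<rparr>"

locale hom_setting = D: two_category D + J: cat_valued D J + K: cat_valued D K for D :: "('d0, 'd1, 'd2) two_cat"
  and J :: "('d0, 'd1, 'd2, 'o, 'a) cat_psfun" and K :: "('d0, 'd1, 'd2, 'p, 'b) cat_psfun"
begin

text \<open>Once the boundaries are known, both sides of each axiom are natural transformations
  between the same functors, so the axiom is equivalent to its components. The equivalences serve
  both to take a transformation apart and to assemble one.\<close>

lemma pnat_iffs: assumes N: "\<And>x. x \<in> Cell0 D ==> is_functor (P0 J x) (P0 K x) (PN al x)"
  and T: "\<And>f. f \<in> Cell1 D ==> nat_trans (P0 J (Src D f)) (P0 K (Trg D f))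
   (comp_func (P1 K f) (PN al (Src D f))) (comp_func (PN al (Trg D f)) (P1 J f)) (PT al f)" shows "x \<in> Cell0 D ==>
   vcomp_nat (PT al (Ide1 D x)) (hcomp_nat (PUnit K x) (id_nat (PN al x))) = hcomp_nat (id_nat (PN al x)) (PUnit J x) \<longleftrightarrow>
   (\<forall>j\<in>O0 J x. cmp0 K x (ptr al (Ide1 D x) j) (NC (PUnit K x) (pob al x j)) = par al x (NC (PUnit J x) j))"
  "[|f \<in> Cell1 D; g \<in> Cell1 D; Src D g = Trg D f|] ==>
   vcomp_nat (PT al (Comp1 D g f)) (hcomp_nat (PComp K g f) (id_nat (PN al (Src D f)))) =
   vcomp_nat (hcomp_nat (id_nat (PN al (Trg D g))) (PComp J g f))
    (vcomp_nat (hcomp_nat (PT al g) (id_nat (P1 J f))) (hcomp_nat (id_nat (P1 K g)) (PT al f))) \<longleftrightarrow>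
   (\<forall>j\<in>O0 J (Src D f). cmp0 K (Trg D g) (ptr al (Comp1 D g f) j) (NC (PComp K g f) (pob al (Src D f) j)) =
    cmp0 K (Trg D g) (par al (Trg D g) (NC (PComp J g f) j))
     (cmp0 K (Trg D g) (ptr al g (O1 J f j)) (A1 K g (ptr al f j))))" "si \<in> Cell2 D ==>
   vcomp_nat (PT al (Cod2 D si)) (hcomp_nat (P2 K si) (id_nat (PN al (Src D (Dom2 D si))))) =
   vcomp_nat (hcomp_nat (id_nat (PN al (Trg D (Dom2 D si)))) (P2 J si)) (PT al (Dom2 D si)) \<longleftrightarrow>
   (\<forall>j\<in>O0 J (Src D (Dom2 D si)).
    cmp0 K (Trg D (Dom2 D si)) (ptr al (Cod2 D si) j) (NC (P2 K si) (pob al (Src D (Dom2 D si)) j)) =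
    cmp0 K (Trg D (Dom2 D si)) (par al (Trg D (Dom2 D si)) (NC (P2 J si) j)) (ptr al (Dom2 D si) j))"
proof -
 assume x: "x \<in> Cell0 D"
 note u = K.PUnit_nat[OF x] and uJ = J.PUnit_nat[OF x] and n = N[OF x] and e = D.cell1(3,4,5)[OF x]
 show "vcomp_nat (PT al (Ide1 D x)) (hcomp_nat (PUnit K x) (id_nat (PN al x))) = hcomp_nat (id_nat (PN al x)) (PUnit J x) \<longleftrightarrow>
   (\<forall>j\<in>O0 J x. cmp0 K x (ptr al (Ide1 D x) j) (NC (PUnit K x) (pob al x j)) = par al x (NC (PUnit J x) j))"
  by (subst nat_eq_iff[OF vcomp_nat_trans[OF hcomp_id_right_trans[OF u n] T[OF e(1), unfolded e(2,3)], unfolded comp_func_id[OF n]]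
     hcomp_id_left_trans[OF uJ n, unfolded comp_func_id[OF n]]])
   (simp add: hcomp_id_right[OF u n] hcomp_id_left[OF uJ n] nat_trans.boundary[OF u] fun_dom[OF n] fun_cod[OF n])
next
 assume f: "f \<in> Cell1 D" and g: "g \<in> Cell1 D" "Src D g = Trg D f"
 note xy = D.cell1(1,2)[OF f] and gf = D.cell1(6,7,8)[OF f g]
 note n = N[OF xy(1)] N[OF xy(2)] N[OF D.cell1(2)[OF g(1)]]
 note C = K.PComp_nat[OF f g] and CJ = J.PComp_nat[OF f g] and tf = T[OF f] and tg = T[OF g(1), unfolded g(2)]
 note Kf = K.P1_func[OF f] and Jf = J.P1_func[OF f] and Kg = K.P1_func[OF g(1), unfolded g(2)]
  and Jg = J.P1_func[OF g(1), unfolded g(2)]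
 show "vcomp_nat (PT al (Comp1 D g f)) (hcomp_nat (PComp K g f) (id_nat (PN al (Src D f)))) =
   vcomp_nat (hcomp_nat (id_nat (PN al (Trg D g))) (PComp J g f))
    (vcomp_nat (hcomp_nat (PT al g) (id_nat (P1 J f))) (hcomp_nat (id_nat (P1 K g)) (PT al f))) \<longleftrightarrow>
   (\<forall>j\<in>O0 J (Src D f). cmp0 K (Trg D g) (ptr al (Comp1 D g f) j) (NC (PComp K g f) (pob al (Src D f) j)) =
    cmp0 K (Trg D g) (par al (Trg D g) (NC (PComp J g f) j))
     (cmp0 K (Trg D g) (ptr al g (O1 J f j)) (A1 K g (ptr al f j))))"
  by (subst nat_eq_iff[OF vcomp_nat_trans[OF hcomp_id_right_trans[OF C n(1)] T[OF gf(1), unfolded gf(2,3)]]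
     vcomp_nat_trans[OF vcomp_nat_trans[OF
      hcomp_id_left_trans[OF tf Kg, unfolded comp_func_assoc[OF n(1) Kf] comp_func_assoc[OF Jf n(2)]]
      hcomp_id_right_trans[OF tg Jf]] hcomp_id_left_trans[OF CJ n(3), unfolded comp_func_assoc[OF Jf Jg]]]])
   (simp add: hcomp_id_right[OF C n(1)] hcomp_id_left[OF CJ n(3)] hcomp_id_right[OF tg Jf] hcomp_id_left[OF tf Kg]
    nat_trans.boundary[OF C] nat_trans.boundary[OF tf] nat_trans.boundary[OF tg] fun_dom[OF n(1)]
    fun_cod[OF n(1)] fun_dom[OF Kg] fun_cod[OF Kg] fun_dom[OF Jf])
next
 assume si: "si \<in> Cell2 D"
 note f = D.cell2(1,2)[OF si]
 note xy = D.cell1(1,2)[OF f(1)] and gl = D.Src_globular[OF si, symmetric] D.Trg_globular[OF si, symmetric]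
 note n = N[OF xy(1)] N[OF xy(2)] and S = K.P2_nat[OF si] and SJ = J.P2_nat[OF si] and t = T[OF f(1)]
 show "vcomp_nat (PT al (Cod2 D si)) (hcomp_nat (P2 K si) (id_nat (PN al (Src D (Dom2 D si))))) =
   vcomp_nat (hcomp_nat (id_nat (PN al (Trg D (Dom2 D si)))) (P2 J si)) (PT al (Dom2 D si)) \<longleftrightarrow>
   (\<forall>j\<in>O0 J (Src D (Dom2 D si)).
    cmp0 K (Trg D (Dom2 D si)) (ptr al (Cod2 D si) j) (NC (P2 K si) (pob al (Src D (Dom2 D si)) j)) =
    cmp0 K (Trg D (Dom2 D si)) (par al (Trg D (Dom2 D si)) (NC (P2 J si) j)) (ptr al (Dom2 D si) j))"
  by (subst nat_eq_iff[OF vcomp_nat_trans[OF hcomp_id_right_trans[OF S n(1)] T[OF f(2), unfolded gl]]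
     vcomp_nat_trans[OF t hcomp_id_left_trans[OF SJ n(2)]]])
   (simp add: hcomp_id_right[OF S n(1)] hcomp_id_left[OF SJ n(2)] nat_trans.boundary[OF S] nat_trans.boundary[OF t]
    fun_dom[OF n(1)] fun_cod[OF n(1)])
qed

lemma pnat_pcone: assumes "pseudo_nat D J K al" shows "pcone D J K (pob al) (par al) (ptr al)"
proof -
 interpret al: pseudo_nat D J K al by fact
 note iffs = pnat_iffs[OF al.PN_functor iso_nat[OF al.PT_iso]]
 show ?thesis
 proof
  fix x assume x: "x \<in> Cell0 D"
  interpret N: is_functor "P0 J x" "P0 K x" "PN al x" by (rule al.PN_functor[OF x])
  show "pob al x j \<in> O0 K x" "par al x (Ide (P0 J x) j) = Ide (P0 K x) (pob al x j)"
   "cmp0 K x (ptr al (Ide1 D x) j) (NC (PUnit K x) (pob al x j)) = par al x (NC (PUnit J x) j)"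
   if "j \<in> O0 J x" for j
   using N.FO_obj[OF that] N.FA_ide[OF that] iffs(1)[OF _ _ x] al.PT_unit[OF x] that by blast+
  show "hom0 K x (par al x u) (pob al x i) (pob al x j)" if "hom0 J x u i j" for u i j
   using that by (rule N.FA_in_hom)
  show "par al x (cmp0 J x v u) = cmp0 K x (par al x v) (par al x u)"
   if "hom0 J x u i j" "hom0 J x v j k" for u v i j k using that by (rule N.FA_comp_hom)
 next
  fix f assume f: "f \<in> Cell1 D"
  interpret t: nat_iso "P0 J (Src D f)" "P0 K (Trg D f)" "comp_func (P1 K f) (PN al (Src D f))"
   "comp_func (PN al (Trg D f)) (P1 J f)" "PT al f" by (rule al.PT_iso[OF f])
  note d = fun_dom[OF al.PN_functor[OF D.cell1(1)[OF f]]] fun_dom[OF J.P1_func[OF f]]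
  show "hom0 K (Trg D f) (ptr al f j) (O1 K f (pob al (Src D f) j)) (pob al (Trg D f) (O1 J f j))"
   "iso_arr (P0 K (Trg D f)) (ptr al f j)" if "j \<in> O0 J (Src D f)" for j
   using t.NC_in_hom[OF that] t.NC_iso[OF that] that by (simp_all add: d)
  show "cmp0 K (Trg D f) (ptr al f j) (A1 K f (par al (Src D f) u)) =
   cmp0 K (Trg D f) (par al (Trg D f) (A1 J f u)) (ptr al f i)" if "hom0 J (Src D f) u i j" for u i j
   using t.naturality_hom[OF that] in_homD(1)[OF that] by (simp add: d)
 qed (use iffs(2,3) al.PT_comp al.PT_natural in blast)+
qed

lemma mk_pnat_simps: "x \<in> Cell0 D ==> j \<in> O0 J x ==> pob (mk_pnat D J K ob ar tr) x j = ob x j"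
 "x \<in> Cell0 D ==> u \<in> A0 J x ==> par (mk_pnat D J K ob ar tr) x u = ar x u"
 "f \<in> Cell1 D ==> j \<in> O0 J (Src D f) ==> ptr (mk_pnat D J K ob ar tr) f j = tr f j"
 by (simp_all add: mk_pnat_def Let_def)

text \<open>The functors are identified first because they form the boundaries of the 2-cells; only
  then can the 2-cells be compared by components.\<close>

lemma pnat_eqI: assumes "pseudo_nat D J K al" "pseudo_nat D J K be"
  and ob: "\<And>x j. x \<in> Cell0 D ==> j \<in> O0 J x ==> pob al x j = pob be x j"
  and ar: "\<And>x u. x \<in> Cell0 D ==> u \<in> A0 J x ==> par al x u = par be x u"
  and tr: "\<And>f j. f \<in> Cell1 D ==> j \<in> O0 J (Src D f) ==> ptr al f j = ptr be f j" shows "al = be"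
proof -
 interpret al: pseudo_nat D J K al by fact
 interpret be: pseudo_nat D J K be by fact
 have N: "PN al = PN be" by (rule extensionalityI[OF al.PN_ext be.PN_ext])
   (rule func_eqI[OF al.PN_functor be.PN_functor], simp_all add: ob ar)
 have "PT al f = PT be f" if f: "f \<in> Cell1 D" for f by (rule nat_eqI[OF iso_nat[OF al.PT_iso[OF f]]
     iso_nat[OF be.PT_iso[OF f], folded N]]) (simp add: tr f)
 then have "PT al = PT be" by (rule extensionalityI[OF al.PT_ext be.PT_ext])
 with N show ?thesis by (auto intro: pnat.equality)
qed

lemma modif_pmod: assumes "modification D J K Ga" shows "pmod D J K (pob (MDom Ga)) (par (MDom Ga)) (ptr (MDom Ga))
  (pob (MCod Ga)) (par (MCod Ga)) (ptr (MCod Ga)) (mcomp Ga)"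
proof -
 interpret G: modification D J K Ga by fact
 interpret a: pseudo_nat D J K "MDom Ga" by (rule G.MDom)
 interpret b: pseudo_nat D J K "MCod Ga" by (rule G.MCod)
 show ?thesis
 proof
  fix x assume x: "x \<in> Cell0 D"
  interpret n: nat_trans "P0 J x" "P0 K x" "PN (MDom Ga) x" "PN (MCod Ga) x" "MC Ga x" by (rule G.MC_nat[OF x])
  show "hom0 K x (NC (MC Ga x) j) (FO (PN (MDom Ga) x) j) (FO (PN (MCod Ga) x) j)"
   if "j \<in> O0 J x" for j using n.NC_in_hom[OF that] .
  show "cmp0 K x (NC (MC Ga x) j) (FA (PN (MDom Ga) x) u) = cmp0 K x (FA (PN (MCod Ga) x) u) (NC (MC Ga x) i)"
   if "hom0 J x u i j" for u i j using n.naturality_hom[OF that] .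
 next
  fix f j assume f: "f \<in> Cell1 D" and j: "j \<in> O0 J (Src D f)"
  note xy = D.cell1(1,2)[OF f]
  interpret Kf: is_functor "P0 K (Src D f)" "P0 K (Trg D f)" "P1 K f" by (rule K.P1_func[OF f])
  interpret Jf: is_functor "P0 J (Src D f)" "P0 J (Trg D f)" "P1 J f" by (rule J.P1_func[OF f])
  interpret n: nat_trans "P0 J (Src D f)" "P0 K (Src D f)" "PN (MDom Ga) (Src D f)"
   "PN (MCod Ga) (Src D f)" "MC Ga (Src D f)" by (rule G.MC_nat[OF xy(1)])
  interpret n': nat_trans "P0 J (Trg D f)" "P0 K (Trg D f)" "PN (MDom Ga) (Trg D f)"
   "PN (MCod Ga) (Trg D f)" "MC Ga (Trg D f)" by (rule G.MC_nat[OF xy(2)])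
  interpret t: nat_iso "P0 J (Src D f)" "P0 K (Trg D f)" "comp_func (P1 K f) (PN (MDom Ga) (Src D f))"
   "comp_func (PN (MDom Ga) (Trg D f)) (P1 J f)" "PT (MDom Ga) f" by (rule a.PT_iso[OF f])
  show "cmp0 K (Trg D f) (NC (PT (MCod Ga) f) j) (A1 K f (NC (MC Ga (Src D f)) j)) =
   cmp0 K (Trg D f) (NC (MC Ga (Trg D f)) (O1 J f j)) (NC (PT (MDom Ga) f) j)"
   using arg_cong[OF G.MC_compat[OF f], of "\<lambda>al. NC al j"] j
   by (simp add: n.boundary t.boundary Kf.FDom Kf.FCod hcomp_id_left[OF n.nat_trans_axioms Kf.is_functor_axioms j]
     hcomp_id_right[OF n'.nat_trans_axioms Jf.is_functor_axioms j])
 qed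
qed

lemma modif_eqI: assumes "modification D J K Ga" "modification D J K De" "MDom Ga = MDom De" "MCod Ga = MCod De"
  and "\<And>x j. x \<in> Cell0 D ==> j \<in> O0 J x ==> mcomp Ga x j = mcomp De x j" shows "Ga = De"
proof -
 interpret G: modification D J K Ga by fact
 interpret H: modification D J K De by fact
 have "MC Ga = MC De" by (rule extensionalityI[OF G.MC_ext H.MC_ext])
   (rule nat_eqI[OF G.MC_nat H.MC_nat[folded assms(3,4)]], simp_all add: assms(5))
 then show ?thesis using assms(3,4) by (auto intro: modif.equality)
qed

lemma mk_modif_simps [simp]: "MDom (mk_modif D J al be m) = al" "MCod (mk_modif D J al be m) = be"
 "x \<in> Cell0 D ==> j \<in> O0 J x ==> mcomp (mk_modif D J al be m) x j = m x j" by (simp_all add: mk_modif_def)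

lemma mk_modif_modification: assumes "pseudo_nat D J K al" "pseudo_nat D J K be"
  and m: "pmod D J K (pob al) (par al) (ptr al) (pob be) (par be) (ptr be) m"
 shows "modification D J K (mk_modif D J al be m)"
proof -
 interpret a: pseudo_nat D J K al by fact
 interpret b: pseudo_nat D J K be by fact
 interpret m: pmod D J K "pob al" "par al" "ptr al" "pob be" "par be" "ptr be" m by fact
 have n: "nat_trans (P0 J x) (P0 K x) (PN al x) (PN be x) (MC (mk_modif D J al be m) x)" if x: "x \<in> Cell0 D" for x
 proof (rule nat_transI[OF a.PN_functor[OF x] b.PN_functor[OF x]])
  interpret Jx: category "P0 J x" by (rule J.P0_cat[OF x])
  show "cmp0 K x (NC (MC (mk_modif D J al be m) x) j) (FA (PN al x) u) =
    cmp0 K x (FA (PN be x) u) (NC (MC (mk_modif D J al be m) x) i)" if "hom0 J x u i j" for u i j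
   using m.m_nat[OF x that] Jx.in_hom_obj[OF that] x by simp
 qed (use x m.m_hom in \<open>simp_all add: mk_modif_def\<close>)
 show ?thesis
 proof (rule modification.intro)
  show "MC (mk_modif D J al be m) \<in> extensional (Cell0 D)" by (simp add: mk_modif_def)
  fix f assume f: "f \<in> Cell1 D"
  note xy = D.cell1(1,2)[OF f]
  interpret Kf: is_functor "P0 K (Src D f)" "P0 K (Trg D f)" "P1 K f" by (rule K.P1_func[OF f])
  interpret Jf: is_functor "P0 J (Src D f)" "P0 J (Trg D f)" "P1 J f" by (rule J.P1_func[OF f])
  note n1 = n[OF xy(1)] and n2 = n[OF xy(2)]
  interpret n1: nat_trans "P0 J (Src D f)" "P0 K (Src D f)" "PN al (Src D f)" "PN be (Src D f)"
   "MC (mk_modif D J al be m) (Src D f)" by (rule n1)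
  note ta = a.PT_iso[OF f, THEN iso_nat] and tb = b.PT_iso[OF f, THEN iso_nat]
  interpret ta: nat_trans "P0 J (Src D f)" "P0 K (Trg D f)" "comp_func (P1 K f) (PN al (Src D f))"
   "comp_func (PN al (Trg D f)) (P1 J f)" "PT al f" by (rule ta)
  have "vcomp_nat (PT be f) (hcomp_nat (id_nat (P1 K f)) (MC (mk_modif D J al be m) (Src D f))) =
   vcomp_nat (hcomp_nat (MC (mk_modif D J al be m) (Trg D f)) (id_nat (P1 J f))) (PT al f)"
  proof (rule nat_eqI[OF vcomp_nat_trans[OF hcomp_id_left_trans[OF n1 Kf.is_functor_axioms] tb]
      vcomp_nat_trans[OF ta hcomp_id_right_trans[OF n2 Jf.is_functor_axioms]]])
   fix j assume j: "j \<in> O0 J (Src D f)"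
   show "NC (vcomp_nat (PT be f) (hcomp_nat (id_nat (P1 K f)) (MC (mk_modif D J al be m) (Src D f)))) j =
    NC (vcomp_nat (hcomp_nat (MC (mk_modif D J al be m) (Trg D f)) (id_nat (P1 J f))) (PT al f)) j"
    using m.m_compat[OF f j] j xy by (simp add: n1.boundary ta.boundary Kf.FDom Kf.FCod Jf.FO_obj
     hcomp_id_left[OF n1 Kf.is_functor_axioms j] hcomp_id_right[OF n2 Jf.is_functor_axioms j])
  qed
  then show "vcomp_nat (PT (MCod (mk_modif D J al be m)) f)
    (hcomp_nat (id_nat (P1 K f)) (MC (mk_modif D J al be m) (Src D f))) =
   vcomp_nat (hcomp_nat (MC (mk_modif D J al be m) (Trg D f)) (id_nat (P1 J f))) (PT (MDom (mk_modif D J al be m)) f)"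
   by simp
 qed (use assms n in simp_all)
qed

lemma mk_pnat_pseudo_nat: assumes "pcone D J K ob ar tr"
 shows "pseudo_nat D J K (mk_pnat D J K ob ar tr)" (is "pseudo_nat D J K ?al")
proof -
 interpret c: pcone D J K ob ar tr by fact
 note s = mk_pnat_simps[of _ _ ob ar tr]
 have N: "is_functor (P0 J x) (P0 K x) (PN ?al x)" if x: "x \<in> Cell0 D" for x
 proof -
  interpret Jx: category "P0 J x" by (rule J.P0_cat[OF x])
  show ?thesis
  proof (rule is_functorI)
   show "hom0 K x (FA (PN ?al x) u) (FO (PN ?al x) i) (FO (PN ?al x) j)" if "hom0 J x u i j" for u i j
    using c.ar_hom[OF x that] Jx.in_hom_obj[OF that] in_homD(1)[OF that] x by (simp add: s)
   show "FA (PN ?al x) (cmp0 J x v u) = cmp0 K x (FA (PN ?al x) v) (FA (PN ?al x) u)"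
    if "hom0 J x u i j" "hom0 J x v j k" for u v i j k
    using c.ar_comp[OF x that] in_homD(1)[OF that(1)] in_homD(1)[OF that(2)]
     in_homD(1)[OF Jx.in_hom_comp[OF that]] x by (simp add: s)
  qed (use x in \<open>simp_all add: s J.P0_cat K.P0_cat c.ob_obj c.ar_ide Jx.ide_arr\<close>,
    simp_all add: mk_pnat_def Let_def)
 qed
 have T: "nat_iso (P0 J (Src D f)) (P0 K (Trg D f))
   (comp_func (P1 K f) (PN ?al (Src D f))) (comp_func (PN ?al (Trg D f)) (P1 J f)) (PT ?al f)"
  if f: "f \<in> Cell1 D" for f
 proof -
  note xy = D.cell1(1,2)[OF f]
  interpret Jx: category "P0 J (Src D f)" by (rule J.P0_cat[OF xy(1)])
  interpret Jf: is_functor "P0 J (Src D f)" "P0 J (Trg D f)" "P1 J f" by (rule J.P1_func[OF f])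
  interpret N1: is_functor "P0 J (Src D f)" "P0 K (Src D f)" "PN ?al (Src D f)" by (rule N[OF xy(1)])
  show ?thesis
  proof (intro nat_isoI nat_transI)
   show "is_functor (P0 J (Src D f)) (P0 K (Trg D f)) (comp_func (P1 K f) (PN ?al (Src D f)))"
    using comp_functor[OF N[OF xy(1)] K.P1_func[OF f]] .
   show "is_functor (P0 J (Src D f)) (P0 K (Trg D f)) (comp_func (PN ?al (Trg D f)) (P1 J f))"
    using comp_functor[OF J.P1_func[OF f] N[OF xy(2)]] .
   show "NDom (PT ?al f) = comp_func (P1 K f) (PN ?al (Src D f))"
    "NCod (PT ?al f) = comp_func (PN ?al (Trg D f)) (P1 J f)" "NC (PT ?al f) \<in> extensional (O0 J (Src D f))"
    using f by (simp_all add: mk_pnat_def Let_def)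
   show "iso_arr (P0 K (Trg D f)) (NC (PT ?al f) j)" if "j \<in> O0 J (Src D f)" for j
    using c.tr_iso[OF f that] f that by (simp add: s)
   show "hom0 K (Trg D f) (NC (PT ?al f) j) (FO (comp_func (P1 K f) (PN ?al (Src D f))) j)
     (FO (comp_func (PN ?al (Trg D f)) (P1 J f)) j)" if "j \<in> O0 J (Src D f)" for j
    using c.tr_hom[OF f that] f xy that by (simp add: s N1.FDom Jf.FDom Jf.FO_obj)
   show "cmp0 K (Trg D f) (NC (PT ?al f) j) (FA (comp_func (P1 K f) (PN ?al (Src D f))) u) =
    cmp0 K (Trg D f) (FA (comp_func (PN ?al (Trg D f)) (P1 J f)) u) (NC (PT ?al f) i)"
    if "hom0 J (Src D f) u i j" for u i j using c.tr_nat[OF f that] f xy Jx.in_hom_obj[OF that] in_homD(1)[OF that]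
    by (simp add: s N1.FDom Jf.FDom Jf.FA_arr)
  qed
 qed
 note iffs = pnat_iffs[OF N iso_nat[OF T]]
 show ?thesis
 proof (rule pseudo_nat.intro)
  show "PN ?al \<in> extensional (Cell0 D)" "PT ?al \<in> extensional (Cell1 D)"
   by (simp_all add: mk_pnat_def Let_def)
  show "vcomp_nat (PT ?al (Ide1 D x)) (hcomp_nat (PUnit K x) (id_nat (PN ?al x))) = hcomp_nat (id_nat (PN ?al x)) (PUnit J x)"
   if x: "x \<in> Cell0 D" for x by (rule iffs(1)[OF _ _ x, THEN iffD2])
    (use c.tr_unit[OF x] x D.cell1(3,4,5)[OF x] nat_trans.NC_arr[OF J.PUnit_nat[OF x]] in \<open>simp_all add: s\<close>)
 next
  fix f g assume f: "f \<in> Cell1 D" and g: "g \<in> Cell1 D" "Src D g = Trg D f"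
  show "vcomp_nat (PT ?al (Comp1 D g f)) (hcomp_nat (PComp K g f) (id_nat (PN ?al (Src D f)))) =
   vcomp_nat (hcomp_nat (id_nat (PN ?al (Trg D g))) (PComp J g f))
    (vcomp_nat (hcomp_nat (PT ?al g) (id_nat (P1 J f))) (hcomp_nat (id_nat (P1 K g)) (PT ?al f)))"
   by (rule iffs(2)[OF _ _ f g, THEN iffD2])
    (use c.tr_comp[OF f g] D.cell1(1,2)[OF f] D.cell1(2)[OF g(1)] D.cell1(6,7,8)[OF f g] f g
    nat_trans.NC_arr[OF J.PComp_nat[OF f g]] fun_obj[OF J.P1_func[OF f]] in \<open>simp_all add: s\<close>)
 next
  fix si assume si: "si \<in> Cell2 D"
  show "vcomp_nat (PT ?al (Cod2 D si)) (hcomp_nat (P2 K si) (id_nat (PN ?al (Src D (Dom2 D si))))) =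
   vcomp_nat (hcomp_nat (id_nat (PN ?al (Trg D (Dom2 D si)))) (P2 J si)) (PT ?al (Dom2 D si))"
   by (rule iffs(3)[OF _ _ si, THEN iffD2])
    (use c.tr_cell[OF si] D.cell2(1,2)[OF si] D.cell1(1,2)[OF D.cell2(1)[OF si]] D.Src_globular[OF si, symmetric]
     D.Trg_globular[OF si, symmetric] nat_trans.NC_arr[OF J.P2_nat[OF si]] in \<open>simp_all add: s\<close>)
 qed (erule N T)+
qed

end

section \<open>The category of pseudo natural transformations and modifications between two fixed
  pseudo functors\<close>

context hom_setting
begin

lemma pmod_comp: assumes "pcone D J K o1 a1 t1" "pcone D J K o2 a2 t2" "pcone D J K o3 a3 t3"
  and "pmod D J K o1 a1 t1 o2 a2 t2 m" "pmod D J K o2 a2 t2 o3 a3 t3 n"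
 shows "pmod D J K o1 a1 t1 o3 a3 t3 (\<lambda>x j. cmp0 K x (n x j) (m x j))"
proof -
 interpret c1: pcone D J K o1 a1 t1 by fact
 interpret c2: pcone D J K o2 a2 t2 by fact
 interpret c3: pcone D J K o3 a3 t3 by fact
 interpret m: pmod D J K o1 a1 t1 o2 a2 t2 m by fact
 interpret n: pmod D J K o2 a2 t2 o3 a3 t3 n by fact
 show ?thesis
 proof
  fix x assume x: "x \<in> Cell0 D"
  interpret Kx: category "P0 K x" by (rule K.P0_cat[OF x])
  interpret Jx: category "P0 J x" by (rule J.P0_cat[OF x])
  show "hom0 K x (cmp0 K x (n x j) (m x j)) (o1 x j) (o3 x j)" if "j \<in> O0 J x" for j
   by (rule Kx.in_hom_comp[OF m.m_hom[OF x that] n.m_hom[OF x that]])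
  show "cmp0 K x (cmp0 K x (n x j) (m x j)) (a1 x u) = cmp0 K x (a3 x u) (cmp0 K x (n x i) (m x i))"
   if u: "hom0 J x u i j" for u i j using Kx.comp_assoc_eq[OF n.m_nat[OF x u], of "m x i"] m.m_nat[OF x u]
    c1.ar_hom[OF x u] c2.ar_hom[OF x u] c3.ar_hom[OF x u]
    m.m_hom[OF x Jx.in_hom_obj(1)[OF u]] m.m_hom[OF x Jx.in_hom_obj(2)[OF u]]
    n.m_hom[OF x Jx.in_hom_obj(1)[OF u]] n.m_hom[OF x Jx.in_hom_obj(2)[OF u]] by (simp add: Kx.comp_simps)
 next
  fix f j assume f: "f \<in> Cell1 D" and j: "j \<in> O0 J (Src D f)"
  note xy = D.cell1(1,2)[OF f]
  interpret Ky: category "P0 K (Trg D f)" by (rule K.P0_cat[OF xy(2)])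
  interpret Kf: is_functor "P0 K (Src D f)" "P0 K (Trg D f)" "P1 K f" by (rule K.P1_func[OF f])
  interpret Jf: is_functor "P0 J (Src D f)" "P0 J (Trg D f)" "P1 J f" by (rule J.P1_func[OF f])
  note j' = Jf.FO_obj[OF j]
  note mh = m.m_hom[OF xy(1) j] and nh = n.m_hom[OF xy(1) j]
  show "cmp0 K (Trg D f) (t3 f j) (A1 K f (cmp0 K (Src D f) (n (Src D f) j) (m (Src D f) j))) =
   cmp0 K (Trg D f) (cmp0 K (Trg D f) (n (Trg D f) (O1 J f j)) (m (Trg D f) (O1 J f j))) (t1 f j)"
   using Ky.comp_assoc_eq[OF n.m_compat[OF f j], of "A1 K f (m (Src D f) j)"]
    m.m_compat[OF f j] Kf.FA_comp_hom[OF mh nh]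
    Kf.FA_in_hom[OF mh] Kf.FA_in_hom[OF nh] m.m_hom[OF xy(2) j'] n.m_hom[OF xy(2) j']
    c1.tr_hom[OF f j] c2.tr_hom[OF f j] c3.tr_hom[OF f j] by (simp add: Ky.comp_simps)
 qed
qed

lemma pmod_ide: assumes "pcone D J K ob ar tr"
 shows "pmod D J K ob ar tr ob ar tr (\<lambda>x j. Ide (P0 K x) (ob x j))"
proof -
 interpret c: pcone D J K ob ar tr by fact
 show ?thesis
 proof
  fix x assume x: "x \<in> Cell0 D"
  interpret Kx: category "P0 K x" by (rule K.P0_cat[OF x])
  show "hom0 K x (Ide (P0 K x) (ob x j)) (ob x j) (ob x j)" if "j \<in> O0 J x" for j
   by (rule Kx.in_hom_ide[OF c.ob_obj[OF x that]])
  show "cmp0 K x (Ide (P0 K x) (ob x j)) (ar x u) = cmp0 K x (ar x u) (Ide (P0 K x) (ob x i))"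
   if u: "hom0 J x u i j" for u i j using c.ar_hom[OF x u] by (simp add: Kx.comp_simps)
 next
  fix f j assume f: "f \<in> Cell1 D" and j: "j \<in> O0 J (Src D f)"
  note xy = D.cell1(1,2)[OF f]
  interpret Ky: category "P0 K (Trg D f)" by (rule K.P0_cat[OF xy(2)])
  interpret Kf: is_functor "P0 K (Src D f)" "P0 K (Trg D f)" "P1 K f" by (rule K.P1_func[OF f])
  show "cmp0 K (Trg D f) (tr f j) (A1 K f (Ide (P0 K (Src D f)) (ob (Src D f) j))) =
   cmp0 K (Trg D f) (Ide (P0 K (Trg D f)) (ob (Trg D f) (O1 J f j))) (tr f j)"
   using c.tr_hom[OF f j] by (simp add: Ky.comp_simps Kf.FA_ide[OF c.ob_obj[OF xy(1) j]])
 qed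
qed

text \<open>Inverting two opposite sides of a commuting square keeps it commuting. In the
  compatibility with the 2-cells one of these sides is an image under \<open>P1 K f\<close>, and
  functoriality carries the identity \<open>m n = 1\<close> along.\<close>

lemma pmod_inverse: assumes "pcone D J K o1 a1 t1" "pcone D J K o2 a2 t2" "pmod D J K o1 a1 t1 o2 a2 t2 m"
  and n: "\<And>x j. x \<in> Cell0 D ==> j \<in> O0 J x ==> hom0 K x (n x j) (o2 x j) (o1 x j)"
  and nm: "\<And>x j. x \<in> Cell0 D ==> j \<in> O0 J x ==> cmp0 K x (n x j) (m x j) = Ide (P0 K x) (o1 x j)"
  and mn: "\<And>x j. x \<in> Cell0 D ==> j \<in> O0 J x ==> cmp0 K x (m x j) (n x j) = Ide (P0 K x) (o2 x j)"
 shows "pmod D J K o2 a2 t2 o1 a1 t1 n"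
proof -
 interpret c1: pcone D J K o1 a1 t1 by fact
 interpret c2: pcone D J K o2 a2 t2 by fact
 interpret m: pmod D J K o1 a1 t1 o2 a2 t2 m by fact
 show ?thesis
 proof
  fix x assume x: "x \<in> Cell0 D"
  interpret Kx: category "P0 K x" by (rule K.P0_cat[OF x])
  interpret Jx: category "P0 J x" by (rule J.P0_cat[OF x])
  show "hom0 K x (n x j) (o2 x j) (o1 x j)" if "j \<in> O0 J x" for j using n x that .
  show "cmp0 K x (n x j) (a2 x u) = cmp0 K x (a1 x u) (n x i)" if u: "hom0 J x u i j" for u i j
  proof -
   note i = Jx.in_hom_obj(1)[OF u] and j = Jx.in_hom_obj(2)[OF u]
   show ?thesis
    by (rule Kx.inverse_square[OF m.m_hom[OF x i] n[OF x i] mn[OF x i] m.m_hom[OF x j] n[OF x j] nm[OF x j]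
       c1.ar_hom[OF x u] c2.ar_hom[OF x u] m.m_nat[OF x u]])
  qed
 next
  fix f j assume f: "f \<in> Cell1 D" and j: "j \<in> O0 J (Src D f)"
  note xy = D.cell1(1,2)[OF f]
  interpret Kf: is_functor "P0 K (Src D f)" "P0 K (Trg D f)" "P1 K f" by (rule K.P1_func[OF f])
  note j' = fun_obj[OF J.P1_func[OF f] j]
  note mh = m.m_hom[OF xy(1) j] and nh = n[OF xy(1) j]
  show "cmp0 K (Trg D f) (t1 f j) (A1 K f (n (Src D f) j)) = cmp0 K (Trg D f) (n (Trg D f) (O1 J f j)) (t2 f j)"
   by (rule category.inverse_square[OF K.P0_cat[OF xy(2)] Kf.FA_in_hom[OF mh] Kf.FA_in_hom[OF nh] _
      m.m_hom[OF xy(2) j'] n[OF xy(2) j'] nm[OF xy(2) j'] c1.tr_hom[OF f j] c2.tr_hom[OF f j] m.m_compat[OF f j, symmetric],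
      symmetric]) (use Kf.FA_comp_hom[OF nh mh] mn[OF xy(1) j] Kf.FA_ide[OF c2.ob_obj[OF xy(1) j]] in simp)
 qed
qed

text \<open>Brings the composite into the assembled form, for which being a modification reduces to
  \<open>pmod_comp\<close> and the components can be read off.\<close>

lemma modif_vcomp_eq: assumes "modification D J K Ga" "modification D J K De"
 shows "modif_vcomp D De Ga = mk_modif D J (MDom Ga) (MCod De) (\<lambda>x j. cmp0 K x (mcomp De x j) (mcomp Ga x j))"
proof -
 interpret G: modification D J K Ga by fact
 interpret H: modification D J K De by fact
 have "vcomp_nat (MC De x) (MC Ga x) = \<lparr>NDom = PN (MDom Ga) x, NCod = PN (MCod De) x,
   NC = (\<lambda>j\<in>O0 J x. cmp0 K x (mcomp De x j) (mcomp Ga x j))\<rparr>" if x: "x \<in> Cell0 D" for x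
 proof -
  interpret g: nat_trans "P0 J x" "P0 K x" "PN (MDom Ga) x" "PN (MCod Ga) x" "MC Ga x" by (rule G.MC_nat[OF x])
  interpret h: nat_trans "P0 J x" "P0 K x" "PN (MDom De) x" "PN (MCod De) x" "MC De x" by (rule H.MC_nat[OF x])
  show ?thesis by (simp add: vcomp_nat_def g.boundary h.boundary)
 qed
 then show ?thesis by (auto simp: modif_vcomp_def mk_modif_def intro!: restrict_ext)
qed

lemma modif_id_eq: assumes "pseudo_nat D J K al"
 shows "modif_id D al = mk_modif D J al al (\<lambda>x j. Ide (P0 K x) (pob al x j))"
proof -
 interpret al: pseudo_nat D J K al by fact
 have "id_nat (PN al x) = \<lparr>NDom = PN al x, NCod = PN al x,
   NC = (\<lambda>j\<in>O0 J x. Ide (P0 K x) (pob al x j))\<rparr>" if x: "x \<in> Cell0 D" for x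
  using fun_dom[OF al.PN_functor[OF x]] fun_cod[OF al.PN_functor[OF x]] by (simp add: id_nat_def)
 then show ?thesis by (auto simp: modif_id_def mk_modif_def intro!: restrict_ext)
qed

lemma modif_vcomp_modification: assumes "modification D J K Ga" "modification D J K De" "MDom De = MCod Ga"
 shows "modification D J K (modif_vcomp D De Ga)" unfolding modif_vcomp_eq[OF assms(1,2)]
 by (rule mk_modif_modification[OF modification.MDom[OF assms(1)] modification.MCod[OF assms(2)]
    pmod_comp[OF _ _ _ modif_pmod[OF assms(1)] modif_pmod[OF assms(2), unfolded assms(3)]]])
  (intro pnat_pcone modification.MDom[OF assms(1)] modification.MCod[OF assms(1)] modification.MCod[OF assms(2)])+

lemma modif_id_modification: assumes "pseudo_nat D J K al" shows "modification D J K (modif_id D al)"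
 unfolding modif_id_eq[OF assms] by (rule mk_modif_modification[OF assms assms pmod_ide[OF pnat_pcone[OF assms]]])

lemma modif_in_hom: "modification D J K Ga ==> x \<in> Cell0 D ==> j \<in> O0 J x ==>
  hom0 K x (mcomp Ga x j) (pob (MDom Ga) x j) (pob (MCod Ga) x j)" using pmod.m_hom[OF modif_pmod] .

lemma modif_boundary [simp]: "MDom (modif_vcomp D De Ga) = MDom Ga" "MCod (modif_vcomp D De Ga) = MCod De"
 "MDom (modif_id D al) = al" "MCod (modif_id D al) = al" by (simp_all add: modif_vcomp_def modif_id_def)

lemma Hom_cat_simps [simp]: "al \<in> Obj (Hom_cat D J K) \<longleftrightarrow> pseudo_nat D J K al"
 "Ga \<in> Arr (Hom_cat D J K) \<longleftrightarrow> modification D J K Ga"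
 "Dom (Hom_cat D J K) Ga = MDom Ga" "Cod (Hom_cat D J K) Ga = MCod Ga"
 "Ide (Hom_cat D J K) = modif_id D" "Comp (Hom_cat D J K) = modif_vcomp D" by (simp_all add: Hom_cat_def)

lemma modif_vcomp_mcomp: "modification D J K Ga ==> modification D J K De ==> x \<in> Cell0 D ==> j \<in> O0 J x ==>
  mcomp (modif_vcomp D De Ga) x j = cmp0 K x (mcomp De x j) (mcomp Ga x j)" by (simp add: modif_vcomp_eq)

lemma modif_id_mcomp: "pseudo_nat D J K al ==> x \<in> Cell0 D ==> j \<in> O0 J x ==>
  mcomp (modif_id D al) x j = Ide (P0 K x) (pob al x j)" by (simp add: modif_id_eq)

lemma Hom_category: "category (Hom_cat D J K)"
proof (rule category.intro; unfold Hom_cat_simps)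
 fix Ga assume G: "modification D J K Ga"
 note dc = modification.MDom[OF G] modification.MCod[OF G]
 note i = dc[THEN modif_id_modification]
 show "pseudo_nat D J K (MDom Ga)" "pseudo_nat D J K (MCod Ga)" by (fact dc)+
 show "modif_vcomp D Ga (modif_id D (MDom Ga)) = Ga" by (rule modif_eqI[OF modif_vcomp_modification[OF i(1) G] G])
   (simp_all add: modif_vcomp_mcomp[OF i(1) G] modif_id_mcomp[OF dc(1)]
    category.in_hom_ide_right[OF K.P0_cat modif_in_hom[OF G]])
 show "modif_vcomp D (modif_id D (MCod Ga)) Ga = Ga" by (rule modif_eqI[OF modif_vcomp_modification[OF G i(2)] G])
   (simp_all add: modif_vcomp_mcomp[OF G i(2)] modif_id_mcomp[OF dc(2)]
    category.in_hom_ide_left[OF K.P0_cat modif_in_hom[OF G]])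
 fix De assume H: "modification D J K De" "MDom De = MCod Ga"
 note HG = modif_vcomp_modification[OF G H]
 show "modification D J K (modif_vcomp D De Ga)" by (rule HG)
 fix La assume L: "modification D J K La" "MDom La = MCod De"
 note LH = modif_vcomp_modification[OF H(1) L]
 have 1: "modification D J K (modif_vcomp D La (modif_vcomp D De Ga))"
  by (rule modif_vcomp_modification[OF HG L(1)]) (simp add: L)
 have 2: "modification D J K (modif_vcomp D (modif_vcomp D La De) Ga)"
  by (rule modif_vcomp_modification[OF G LH]) (simp add: H)
 show "modif_vcomp D La (modif_vcomp D De Ga) = modif_vcomp D (modif_vcomp D La De) Ga" by (rule modif_eqI[OF 1 2])
   (simp_all add: modif_vcomp_mcomp[OF HG L(1)] modif_vcomp_mcomp[OF G H(1)] modif_vcomp_mcomp[OF G LH]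
    modif_vcomp_mcomp[OF H(1) L(1)] category.in_hom_assoc[OF K.P0_cat modif_in_hom[OF G]
    modif_in_hom[OF H(1), unfolded H(2)] modif_in_hom[OF L(1), unfolded L(2)]])
qed (simp_all add: modif_id_modification)

end

section \<open>Composition with a strict natural transformation, whose 2-cells are
  identities\<close>

locale strict_trans = KK: hom_setting D J K + KK': hom_setting D J K'
 for D :: "('d0, 'd1, 'd2) two_cat" and J :: "('d0, 'd1, 'd2, 'o, 'a) cat_psfun"
  and K :: "('d0, 'd1, 'd2, 'p, 'b) cat_psfun" and K' :: "('d0, 'd1, 'd2, 'q, 'c) cat_psfun" +
 fixes be :: "('d0, 'd1, 'p, 'b, 'q, 'c) pnat"
 assumes PN_func: "x \<in> Cell0 D ==> is_functor (P0 K x) (P0 K' x) (PN be x)"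
  and PT_id: "f \<in> Cell1 D ==> PT be f = id_nat (comp_func (P1 K' f) (PN be (Src D f)))"
  and square: "f \<in> Cell1 D ==> comp_func (P1 K' f) (PN be (Src D f)) = comp_func (PN be (Trg D f)) (P1 K f)"
  and strict_cell: "si \<in> Cell2 D ==> k \<in> O0 K (Src D (Dom2 D si)) ==>
   NC (P2 K' si) (pob be (Src D (Dom2 D si)) k) = par be (Trg D (Dom2 D si)) (NC (P2 K si) k)"
  and strict_comp: "f \<in> Cell1 D ==> g \<in> Cell1 D ==> Src D g = Trg D f ==> k \<in> O0 K (Src D f) ==>
   NC (PComp K' g f) (pob be (Src D f) k) = par be (Trg D g) (NC (PComp K g f) k)"
  and strict_unit: "x \<in> Cell0 D ==> k \<in> O0 K x ==> NC (PUnit K' x) (pob be x k) = par be x (NC (PUnit K x) k)"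
begin

lemma square_FO: "f \<in> Cell1 D ==> k \<in> O0 K (Src D f) ==>
  O1 K' f (pob be (Src D f) k) = pob be (Trg D f) (O1 K f k)"
 using arg_cong[OF square, of f "\<lambda>F. FO F k"] fun_dom[OF PN_func, of "Src D f"]
  fun_dom[OF KK.K.P1_func, of f] KK.D.cell1(1) by simp

lemma square_FA: "f \<in> Cell1 D ==> k \<in> A0 K (Src D f) ==>
  A1 K' f (par be (Src D f) k) = par be (Trg D f) (A1 K f k)"
 using arg_cong[OF square, of f "\<lambda>F. FA F k"] fun_dom[OF PN_func, of "Src D f"]
  fun_dom[OF KK.K.P1_func, of f] KK.D.cell1(1) by simp

text \<open>Every cone condition lives in some \<open>K x\<close>. Applying the functor
  \<open>PN be x\<close> to it, and moving the structure cells across by strictness, gives the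
  condition for \<open>K'\<close>.\<close>

lemma strict_pcone: assumes "pcone D J K ob ar tr"
 shows "pcone D J K' (\<lambda>x j. pob be x (ob x j)) (\<lambda>x u. par be x (ar x u))
  (\<lambda>f j. par be (Trg D f) (tr f j))"
proof -
 interpret c: pcone D J K ob ar tr by fact
 show ?thesis
 proof
  fix x assume x: "x \<in> Cell0 D"
  interpret N: is_functor "P0 K x" "P0 K' x" "PN be x" by (rule PN_func[OF x])
  show "pob be x (ob x j) \<in> O0 K' x" if "j \<in> O0 J x" for j using c.ob_obj[OF x that] by (rule N.FO_obj)
  show "hom0 K' x (par be x (ar x u)) (pob be x (ob x i)) (pob be x (ob x j))" if "hom0 J x u i j" for u i j
   using c.ar_hom[OF x that] by (rule N.FA_in_hom)
  show "par be x (ar x (Ide (P0 J x) j)) = Ide (P0 K' x) (pob be x (ob x j))" if "j \<in> O0 J x" for j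
   using c.ar_ide[OF x that] c.ob_obj[OF x that] by (simp add: N.FA_ide)
  show "par be x (ar x (cmp0 J x v u)) = cmp0 K' x (par be x (ar x v)) (par be x (ar x u))"
   if "hom0 J x u i j" "hom0 J x v j k" for u v i j k
   using N.FA_comp_hom[OF c.ar_hom[OF x that(1)] c.ar_hom[OF x that(2)]] c.ar_comp[OF x that] by simp
  fix j assume j: "j \<in> O0 J x"
  note e = KK.D.cell1(3,4,5)[OF x]
  interpret U: nat_trans "P0 K x" "P0 K x" "id_func (P0 K x)" "P1 K (Ide1 D x)" "PUnit K x"
   by (rule KK.K.PUnit_nat[OF x])
  show "cmp0 K' x (par be (Trg D (Ide1 D x)) (tr (Ide1 D x) j))
    (NC (PUnit K' x) (pob be x (ob x j))) = par be x (ar x (NC (PUnit J x) j))"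
   using N.FA_comp_hom[OF U.NC_in_hom[OF c.ob_obj[OF x j]] c.tr_hom[OF e(1), unfolded e(2,3), OF j]]
    c.tr_unit[OF x j] by (simp add: e strict_unit[OF x c.ob_obj[OF x j]])
 next
  fix f assume f: "f \<in> Cell1 D"
  note xy = KK.D.cell1(1,2)[OF f]
  interpret N: is_functor "P0 K (Trg D f)" "P0 K' (Trg D f)" "PN be (Trg D f)" by (rule PN_func[OF xy(2)])
  show "hom0 K' (Trg D f) (par be (Trg D f) (tr f j)) (O1 K' f (pob be (Src D f) (ob (Src D f) j)))
    (pob be (Trg D f) (ob (Trg D f) (O1 J f j)))" if "j \<in> O0 J (Src D f)" for j
   using N.FA_in_hom[OF c.tr_hom[OF f that]] square_FO[OF f c.ob_obj[OF xy(1) that]] by simp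
  show "iso_arr (P0 K' (Trg D f)) (par be (Trg D f) (tr f j))" if "j \<in> O0 J (Src D f)" for j
   using N.FA_iso[OF c.tr_iso[OF f that]] .
  show "cmp0 K' (Trg D f) (par be (Trg D f) (tr f j)) (A1 K' f (par be (Src D f) (ar (Src D f) u))) =
   cmp0 K' (Trg D f) (par be (Trg D f) (ar (Trg D f) (A1 J f u))) (par be (Trg D f) (tr f i))"
   if u: "hom0 J (Src D f) u i j" for u i j
  proof -
   note ij = hom_obj[OF KK.J.P0_cat[OF xy(1)] u]
   note a = c.ar_hom[OF xy(1) u]
   show ?thesis unfolding square_FA[OF f in_homD(1)[OF a]]
    using N.FA_comp_hom[OF fun_hom[OF KK.K.P1_func[OF f] a] c.tr_hom[OF f ij(2)]]
     N.FA_comp_hom[OF c.tr_hom[OF f ij(1)] c.ar_hom[OF xy(2)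
       fun_hom[OF KK.J.P1_func[OF f] u]]] c.tr_nat[OF f u] by simp
  qed
  fix g j assume g: "g \<in> Cell1 D" "Src D g = Trg D f" and j: "j \<in> O0 J (Src D f)"
  note z = KK.D.cell1(2)[OF g(1)] and gf = KK.D.cell1(6,7,8)[OF f g]
  interpret Ng: is_functor "P0 K (Trg D g)" "P0 K' (Trg D g)" "PN be (Trg D g)" by (rule PN_func[OF z])
  interpret C: nat_trans "P0 K (Src D f)" "P0 K (Trg D g)" "comp_func (P1 K g) (P1 K f)"
   "P1 K (Comp1 D g f)" "PComp K g f" by (rule KK.K.PComp_nat[OF f g])
  interpret CJ: nat_trans "P0 J (Src D f)" "P0 J (Trg D g)" "comp_func (P1 J g) (P1 J f)"
   "P1 J (Comp1 D g f)" "PComp J g f" by (rule KK.J.PComp_nat[OF f g])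
  interpret Kg: is_functor "P0 K (Trg D f)" "P0 K (Trg D g)" "P1 K g" using KK.K.P1_func[OF g(1)] g by simp
  interpret Jf: is_functor "P0 J (Src D f)" "P0 J (Trg D f)" "P1 J f" by (rule KK.J.P1_func[OF f])
  interpret Kf: is_functor "P0 K (Src D f)" "P0 K (Trg D f)" "P1 K f" by (rule KK.K.P1_func[OF f])
  interpret Jg: is_functor "P0 J (Src D g)" "P0 J (Trg D g)" "P1 J g" by (rule KK.J.P1_func[OF g(1)])
  note j' = Jf.FO_obj[OF j] and o1 = c.ob_obj[OF xy(1) j]
  note tf = c.tr_hom[OF f j] and tg = c.tr_hom[OF g(1), unfolded g(2), OF j']
  note h1 = C.NC_in_hom[OF o1] and h2 = c.tr_hom[OF gf(1), unfolded gf(2,3), OF j]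
  note h3 = c.ar_hom[OF z CJ.NC_in_hom[OF j]]
  note h4 = Kg.FA_in_hom[OF tf]
  have o1': "FO (comp_func (P1 K g) (P1 K f)) (ob (Src D f) j) = O1 K g (O1 K f (ob (Src D f) j))"
   "FO (comp_func (P1 J g) (P1 J f)) j = O1 J g (O1 J f j)" using o1 j by (simp_all add: Kf.FDom Jf.FDom)
  interpret KZ: category "P0 K (Trg D g)" by (rule KK.K.P0_cat[OF z])
  show "cmp0 K' (Trg D g) (par be (Trg D (Comp1 D g f)) (tr (Comp1 D g f) j))
     (NC (PComp K' g f) (pob be (Src D f) (ob (Src D f) j))) =
   cmp0 K' (Trg D g) (par be (Trg D g) (ar (Trg D g) (NC (PComp J g f) j)))
    (cmp0 K' (Trg D g) (par be (Trg D g) (tr g (O1 J f j))) (A1 K' g (par be (Trg D f) (tr f j))))"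
   unfolding gf(3) strict_comp[OF f g o1] square_FA[OF g(1), unfolded g(2), OF in_homD(1)[OF tf]]
    Ng.FA_comp_hom[OF h1 h2, symmetric] c.tr_comp[OF f g j]
   using Ng.FA_comp_hom[OF KZ.in_hom_comp[OF h4 tg] h3[unfolded o1']] Ng.FA_comp_hom[OF h4 tg] by simp
 next
  fix si j assume si: "si \<in> Cell2 D" and j: "j \<in> O0 J (Src D (Dom2 D si))"
  note f = KK.D.cell2(1,2)[OF si]
  note xy = KK.D.cell1(1,2)[OF f(1)]
  note gl = KK.D.Src_globular[OF si, symmetric] KK.D.Trg_globular[OF si, symmetric]
  interpret M: is_functor "P0 K (Trg D (Dom2 D si))" "P0 K' (Trg D (Dom2 D si))"
   "PN be (Trg D (Dom2 D si))" by (rule PN_func[OF xy(2)])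
  interpret S: nat_trans "P0 K (Src D (Dom2 D si))" "P0 K (Trg D (Dom2 D si))"
   "P1 K (Dom2 D si)" "P1 K (Cod2 D si)" "P2 K si" by (rule KK.K.P2_nat[OF si])
  interpret SJ: nat_trans "P0 J (Src D (Dom2 D si))" "P0 J (Trg D (Dom2 D si))"
   "P1 J (Dom2 D si)" "P1 J (Cod2 D si)" "P2 J si" by (rule KK.J.P2_nat[OF si])
  note o1 = c.ob_obj[OF xy(1) j]
  show "cmp0 K' (Trg D (Dom2 D si)) (par be (Trg D (Cod2 D si)) (tr (Cod2 D si) j))
    (NC (P2 K' si) (pob be (Src D (Dom2 D si)) (ob (Src D (Dom2 D si)) j))) =
   cmp0 K' (Trg D (Dom2 D si)) (par be (Trg D (Dom2 D si)) (ar (Trg D (Dom2 D si)) (NC (P2 J si) j)))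
    (par be (Trg D (Dom2 D si)) (tr (Dom2 D si) j))" unfolding gl strict_cell[OF si o1]
   using M.FA_comp_hom[OF S.NC_in_hom[OF o1] c.tr_hom[OF f(2), unfolded gl, OF j]]
    M.FA_comp_hom[OF c.tr_hom[OF f(1) j] c.ar_hom[OF xy(2) SJ.NC_in_hom[OF j]]] c.tr_cell[OF si j] by simp
 qed
qed

text \<open>In the 2-cell of a composite transformation the factor coming from \<open>be\<close> is
  an identity, so what remains is the image under \<open>be\<close> of the 2-cell of
  \<open>al\<close>.\<close>

lemma pnat_comp_eq: assumes "pseudo_nat D J K al"
 shows "pnat_comp D be al = mk_pnat D J K' (\<lambda>x j. pob be x (pob al x j)) (\<lambda>x u. par be x (par al x u))
  (\<lambda>f j. par be (Trg D f) (ptr al f j))"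
proof -
 interpret al: pseudo_nat D J K al by fact
 have 1: "comp_func (PN be x) (PN al x) = \<lparr>FDom = P0 J x, FCod = P0 K' x,
   FO = (\<lambda>j\<in>O0 J x. pob be x (pob al x j)), FA = (\<lambda>u\<in>A0 J x. par be x (par al x u))\<rparr>"
  if x: "x \<in> Cell0 D" for x using fun_dom[OF al.PN_functor[OF x]] fun_cod[OF PN_func[OF x]]
  by (simp add: comp_func_def)
 have 2: "vcomp_nat (hcomp_nat (id_nat (PN be (Trg D f))) (PT al f))
    (hcomp_nat (PT be f) (id_nat (PN al (Src D f)))) =
   \<lparr>NDom = comp_func (P1 K' f) (comp_func (PN be (Src D f)) (PN al (Src D f))),
    NCod = comp_func (comp_func (PN be (Trg D f)) (PN al (Trg D f))) (P1 J f),
    NC = (\<lambda>j\<in>O0 J (Src D f). par be (Trg D f) (ptr al f j))\<rparr>" (is "?l = ?r")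
  if f: "f \<in> Cell1 D" for f
 proof -
  note xy = KK.D.cell1(1,2)[OF f]
  note t = iso_nat[OF al.PT_iso[OF f]]
  interpret t: nat_trans "P0 J (Src D f)" "P0 K (Trg D f)" "comp_func (P1 K f) (PN al (Src D f))"
   "comp_func (PN al (Trg D f)) (P1 J f)" "PT al f" by (rule t)
  note b1 = PN_func[OF xy(1)] and b2 = PN_func[OF xy(2)]
  note K'f = KK'.K.P1_func[OF f] and Jf = KK.J.P1_func[OF f] and Kf = KK.K.P1_func[OF f]
  note a1 = al.PN_functor[OF xy(1)] and a2 = al.PN_functor[OF xy(2)]
  note i = iso_nat[OF id_nat_iso[OF comp_functor[OF b1 K'f]], folded PT_id[OF f]]
  interpret K'y: category "P0 K' (Trg D f)" using KK'.K.P0_cat xy by blast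
  interpret b2: is_functor "P0 K (Trg D f)" "P0 K' (Trg D f)" "PN be (Trg D f)" by (rule b2)
  show ?thesis
  proof (rule ntrans.equality)
   show "NDom ?l = NDom ?r" by (simp add: PT_id[OF f] comp_func_assoc[OF a1 b1, symmetric])
   show "NCod ?l = NCod ?r" using comp_func_assoc[OF Jf a2] by (simp add: t.boundary)
   have "NC ?l j = par be (Trg D f) (ptr al f j)" if j: "j \<in> O0 J (Src D f)" for j
   proof -
    have "NC ?l j = cmp0 K' (Trg D f) (par be (Trg D f) (ptr al f j)) (NC (PT be f) (pob al (Src D f) j))"
     using j hcomp_id_left[OF t b2 j] hcomp_id_right[OF i a1 j]
     by (simp add: fun_dom[OF a1] fun_cod[OF K'f] PT_id[OF f])
    \<comment> \<open>\<open>PT_id\<close> gives the identity at an object in the image of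
      \<open>P1 K' f\<close>; \<open>square\<close> rewrites this object as the domain of the other
      factor, so that the unit law applies.\<close>
    also have "NC (PT be f) (pob al (Src D f) j) =
      Ide (P0 K' (Trg D f)) (FO (PN be (Trg D f)) (O1 K f (pob al (Src D f) j)))"
     using fun_obj[OF a1 j] fun_dom[OF b1] fun_dom[OF Kf] by (simp add: PT_id[OF f] square[OF f] b2.FCod)
    finally show ?thesis using K'y.in_hom_ide_right[OF b2.FA_in_hom[OF t.NC_in_hom[OF j]]] j fun_dom[OF a1] by simp
   qed
   then show "NC ?l = NC ?r" by (intro extensionalityI[of _ "O0 J (Src D f)"])
     (simp_all add: vcomp_nat_def fun_dom[OF a1])
  qed simp
 qed
 show ?thesis unfolding pnat_comp_def mk_pnat_def Let_def
  by (rule pnat.equality) (auto simp: 1 2 KK.D.cell1(1,2) intro!: restrict_ext)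
qed

lemma strict_pseudo_nat: assumes "pseudo_nat D J K al" shows "pseudo_nat D J K' (pnat_comp D be al)"
 unfolding pnat_comp_eq[OF assms] by (rule KK'.mk_pnat_pseudo_nat[OF strict_pcone[OF KK.pnat_pcone[OF assms]]])

lemma pnat_comp_simps: assumes "pseudo_nat D J K al"
 shows "x \<in> Cell0 D ==> j \<in> O0 J x ==> pob (pnat_comp D be al) x j = pob be x (pob al x j)"
  "x \<in> Cell0 D ==> u \<in> A0 J x ==> par (pnat_comp D be al) x u = par be x (par al x u)"
  "f \<in> Cell1 D ==> j \<in> O0 J (Src D f) ==> ptr (pnat_comp D be al) f j = par be (Trg D f) (ptr al f j)"
 unfolding pnat_comp_eq[OF assms] using KK'.mk_pnat_simps by simp_all

lemma Hom_func_id: assumes "pseudo_nat D J K al"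
 shows "FA (Hom_func D J K K' be) (modif_id D al) = modif_id D (pnat_comp D be al)"
proof -
 have "(\<lambda>x\<in>Cell0 D. hcomp_nat (MC (modif_id D be) x) (MC (modif_id D al) x)) =
   (\<lambda>x\<in>Cell0 D. id_nat (PN (pnat_comp D be al) x))"
  by (rule restrict_ext) (simp add: modif_id_def pnat_comp_def
   hcomp_id_id[OF pseudo_nat.PN_functor[OF assms] PN_func])
 then show ?thesis using KK.modif_id_modification[OF assms]
  by (simp add: Hom_func_def modif_hcomp_def) (simp add: modif_id_def)
qed

end

context strict_trans
begin

lemma modif_hcomp_eq: assumes "modification D J K Ga"
 shows "modif_hcomp D (modif_id D be) Ga = mk_modif D J (pnat_comp D be (MDom Ga)) (pnat_comp D be (MCod Ga))
  (\<lambda>x j. par be x (mcomp Ga x j))"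
proof -
 interpret G: modification D J K Ga by fact
 have "hcomp_nat (id_nat (PN be x)) (MC Ga x) = \<lparr>NDom = PN (pnat_comp D be (MDom Ga)) x,
   NCod = PN (pnat_comp D be (MCod Ga)) x, NC = (\<lambda>j\<in>O0 J x. par be x (mcomp Ga x j))\<rparr>"
  if x: "x \<in> Cell0 D" for x
 proof (rule ntrans.equality)
  interpret n: nat_trans "P0 J x" "P0 K x" "PN (MDom Ga) x" "PN (MCod Ga) x" "MC Ga x" by (rule G.MC_nat[OF x])
  show "NC (hcomp_nat (id_nat (PN be x)) (MC Ga x)) = NC \<lparr>NDom = PN (pnat_comp D be (MDom Ga)) x,
    NCod = PN (pnat_comp D be (MCod Ga)) x, NC = (\<lambda>j\<in>O0 J x. par be x (mcomp Ga x j))\<rparr>"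
   using hcomp_id_left[OF n.nat_trans_axioms PN_func[OF x]]
   by (intro extensionalityI[of _ "O0 J x"]) (auto simp: hcomp_nat_def n.boundary)
  show "NDom (hcomp_nat (id_nat (PN be x)) (MC Ga x)) = NDom \<lparr>NDom = PN (pnat_comp D be (MDom Ga)) x,
    NCod = PN (pnat_comp D be (MCod Ga)) x, NC = (\<lambda>j\<in>O0 J x. par be x (mcomp Ga x j))\<rparr>"
   "NCod (hcomp_nat (id_nat (PN be x)) (MC Ga x)) = NCod \<lparr>NDom = PN (pnat_comp D be (MDom Ga)) x,
    NCod = PN (pnat_comp D be (MCod Ga)) x, NC = (\<lambda>j\<in>O0 J x. par be x (mcomp Ga x j))\<rparr>"
   using x by (simp_all add: pnat_comp_def n.boundary)
 qed simp
 then show ?thesis by (auto simp: modif_hcomp_def mk_modif_def modif_id_def intro!: restrict_ext)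
qed

end

section \<open>Representable pseudo functors and the Yoneda form of weighted pseudo limits\<close>

context two_category
begin

lemma Src2 [simp]: "a \<in> Cell2 C ==> Src C (Cod2 C a) = Src C (Dom2 C a)"
 "a \<in> Cell2 C ==> Trg C (Cod2 C a) = Trg C (Dom2 C a)" by (simp_all add: Src_globular Trg_globular)

lemmas comp1_assoc = category.comp_assoc[OF under_category, unfolded under_cat_def, simplified]
lemmas comp1_ide = category.comp_ide_right[OF under_category, unfolded under_cat_def, simplified]
 category.comp_ide_left[OF under_category, unfolded under_cat_def, simplified]
lemmas vcomp_assoc = category.comp_assoc[OF vert_category, unfolded vert_cat_def, simplified]
lemmas vcomp_ide = category.comp_ide'[OF vert_category, unfolded vert_cat_def, simplified]
lemmas hcomp2_cell = category.comp_arr[OF horiz_category, unfolded horiz_cat_def, simplified]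
lemmas hcomp2_assoc = category.comp_assoc[OF horiz_category, unfolded horiz_cat_def, simplified]
lemmas hcomp2_ide = category.comp_ide_right[OF horiz_category, unfolded horiz_cat_def, simplified]
 category.comp_ide_left[OF horiz_category, unfolded horiz_cat_def, simplified]

lemmas two_simps = cell1 cell2 hcomp2_cell HComp_dom HComp_cod vcomp_ide

lemma hom_cat_simps [simp]:
 "k \<in> Obj (hom_cat C X Y) \<longleftrightarrow> k \<in> Cell1 C \<and> Src C k = X \<and> Trg C k = Y"
 "a \<in> Arr (hom_cat C X Y) \<longleftrightarrow> a \<in> Cell2 C \<and> Src C (Dom2 C a) = X \<and> Trg C (Dom2 C a) = Y"
 "Dom (hom_cat C X Y) = Dom2 C" "Cod (hom_cat C X Y) = Cod2 C"
 "Ide (hom_cat C X Y) = Ide2 C" "Comp (hom_cat C X Y) = VComp C" by (simp_all add: hom_cat_def)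

lemma hom_category: "category (hom_cat C X Y)" by (rule category.intro) (auto simp: two_simps vcomp_assoc)

lemma whisker_left: assumes "g \<in> Cell1 C" "a \<in> Cell2 C" "b \<in> Cell2 C" "Dom2 C b = Cod2 C a"
  "Src C g = Trg C (Dom2 C a)"
 shows "HComp C (Ide2 C g) (VComp C b a) = VComp C (HComp C (Ide2 C g) b) (HComp C (Ide2 C g) a)"
 using interchange[of a b "Ide2 C g" "Ide2 C g"] assms by (simp add: two_simps)

lemma whisker_right: assumes "g \<in> Cell1 C" "a \<in> Cell2 C" "b \<in> Cell2 C" "Dom2 C b = Cod2 C a"
  "Trg C g = Src C (Dom2 C a)"
 shows "HComp C (VComp C b a) (Ide2 C g) = VComp C (HComp C b (Ide2 C g)) (HComp C a (Ide2 C g))"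
 using interchange[of "Ide2 C g" "Ide2 C g" a b] assms by (simp add: two_simps)

text \<open>Interchange with identity 2-cells on either side. The equality of the two composites is
  the naturality square of \<open>post_nat\<close> and of \<open>pre_nat\<close>.\<close>

lemma whisker_exchange: assumes "a \<in> Cell2 C" "b \<in> Cell2 C" "Src C (Dom2 C b) = Trg C (Dom2 C a)"
 shows "VComp C (HComp C b (Ide2 C (Cod2 C a))) (HComp C (Ide2 C (Dom2 C b)) a) = HComp C b a"
  "VComp C (HComp C (Ide2 C (Cod2 C b)) a) (HComp C b (Ide2 C (Dom2 C a))) = HComp C b a"
 using interchange[of a "Ide2 C (Cod2 C a)" "Ide2 C (Dom2 C b)" b]
  interchange[of "Ide2 C (Dom2 C a)" a b "Ide2 C (Cod2 C b)"] assms by (simp_all add: two_simps)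

lemma post_func_simps [simp]:
 "FDom (post_func C X g) = hom_cat C X (Src C g)" "FCod (post_func C X g) = hom_cat C X (Trg C g)"
 "k \<in> Cell1 C ==> Src C k = X ==> Trg C k = Src C g ==> FO (post_func C X g) k = Comp1 C g k"
 "a \<in> Cell2 C ==> Src C (Dom2 C a) = X ==> Trg C (Dom2 C a) = Src C g ==>
  FA (post_func C X g) a = HComp C (Ide2 C g) a" by (simp_all add: post_func_def)

lemma pre_func_simps [simp]:
 "FDom (pre_func C h Z) = hom_cat C (Trg C h) Z" "FCod (pre_func C h Z) = hom_cat C (Src C h) Z"
 "k \<in> Cell1 C ==> Src C k = Trg C h ==> Trg C k = Z ==> FO (pre_func C h Z) k = Comp1 C k h"
 "a \<in> Cell2 C ==> Src C (Dom2 C a) = Trg C h ==> Trg C (Dom2 C a) = Z ==>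
  FA (pre_func C h Z) a = HComp C a (Ide2 C h)" by (simp_all add: pre_func_def)

lemma post_nat_simps [simp]:
 "NDom (post_nat C X th) = post_func C X (Dom2 C th)" "NCod (post_nat C X th) = post_func C X (Cod2 C th)"
 "k \<in> Cell1 C ==> Src C k = X ==> Trg C k = Src C (Dom2 C th) ==> NC (post_nat C X th) k = HComp C th (Ide2 C k)"
 by (simp_all add: post_nat_def)

lemma pre_nat_simps [simp]:
 "NDom (pre_nat C si Z) = pre_func C (Dom2 C si) Z" "NCod (pre_nat C si Z) = pre_func C (Cod2 C si) Z"
 "k \<in> Cell1 C ==> Src C k = Trg C (Dom2 C si) ==> Trg C k = Z ==> NC (pre_nat C si Z) k = HComp C (Ide2 C k) si"
 by (simp_all add: pre_nat_def)

lemma post_functor: assumes "g \<in> Cell1 C"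
 shows "is_functor (hom_cat C X (Src C g)) (hom_cat C X (Trg C g)) (post_func C X g)" by (rule is_functorI)
  (use assms in \<open>auto simp: hom_category in_hom_def two_simps HComp_ide whisker_left\<close>,
   auto simp: post_func_def)

lemma pre_functor: assumes "h \<in> Cell1 C"
 shows "is_functor (hom_cat C (Trg C h) Z) (hom_cat C (Src C h) Z) (pre_func C h Z)" by (rule is_functorI)
  (use assms in \<open>auto simp: hom_category in_hom_def two_simps HComp_ide whisker_right\<close>,
   auto simp: pre_func_def)

lemma post_nat_trans: assumes "th \<in> Cell2 C"
 shows "nat_trans (hom_cat C X (Src C (Dom2 C th))) (hom_cat C X (Trg C (Dom2 C th)))
  (post_func C X (Dom2 C th)) (post_func C X (Cod2 C th)) (post_nat C X th)"
proof (rule nat_transI)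
 show "Comp (hom_cat C X (Trg C (Dom2 C th))) (NC (post_nat C X th) y) (FA (post_func C X (Dom2 C th)) f) =
  Comp (hom_cat C X (Trg C (Dom2 C th))) (FA (post_func C X (Cod2 C th)) f) (NC (post_nat C X th) x)"
  if "in_hom (hom_cat C X (Src C (Dom2 C th))) f x y" for f x y
  using that assms whisker_exchange[of f th] by (auto simp: in_hom_def two_simps)
qed (use assms post_functor[of "Dom2 C th" X] post_functor[of "Cod2 C th" X]
  in \<open>auto simp: in_hom_def two_simps\<close>, auto simp: post_nat_def)

lemma pre_nat_trans: assumes "si \<in> Cell2 C"
 shows "nat_trans (hom_cat C (Trg C (Dom2 C si)) Z) (hom_cat C (Src C (Dom2 C si)) Z)
  (pre_func C (Dom2 C si) Z) (pre_func C (Cod2 C si) Z) (pre_nat C si Z)"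
proof (rule nat_transI)
 show "Comp (hom_cat C (Src C (Dom2 C si)) Z) (NC (pre_nat C si Z) y) (FA (pre_func C (Dom2 C si) Z) f) =
  Comp (hom_cat C (Src C (Dom2 C si)) Z) (FA (pre_func C (Cod2 C si) Z) f) (NC (pre_nat C si Z) x)"
  if "in_hom (hom_cat C (Trg C (Dom2 C si)) Z) f x y" for f x y
  using that assms whisker_exchange[of si f] by (auto simp: in_hom_def two_simps)
qed (use assms pre_functor[of "Dom2 C si" Z] pre_functor[of "Cod2 C si" Z]
  in \<open>auto simp: in_hom_def two_simps\<close>, auto simp: pre_nat_def)

text \<open>Composition in \<open>C\<close> is strictly associative, so \<open>C(X, -)\<close>
  preserves composites on the nose. Thus the image of \<open>PComp F g f\<close> starts at the
  composite of the two hom functors, as the composition cell of \<open>rep_psfun\<close>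
  must.\<close>

lemma post_func_comp: assumes "f \<in> Cell1 C" "g \<in> Cell1 C" "Src C g = Trg C f"
 shows "post_func C X (Comp1 C g f) = comp_func (post_func C X g) (post_func C X f)"
proof (rule func_eqI)
 show "is_functor (hom_cat C X (Src C f)) (hom_cat C X (Trg C g)) (post_func C X (Comp1 C g f))"
  using post_functor[of "Comp1 C g f" X] assms by (simp add: two_simps)
 show "is_functor (hom_cat C X (Src C f)) (hom_cat C X (Trg C g)) (comp_func (post_func C X g) (post_func C X f))"
  using comp_functor[OF post_functor[OF assms(1)] post_functor[OF assms(2), unfolded assms(3)]] .
qed (use assms in \<open>auto simp: two_simps comp1_assoc hcomp2_assoc HComp_ide[symmetric]\<close>)

lemma post_func_ide: assumes "Y \<in> Cell0 C" shows "post_func C X (Ide1 C Y) = id_func (hom_cat C X Y)"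
proof (rule func_eqI)
 show "is_functor (hom_cat C X Y) (hom_cat C X Y) (post_func C X (Ide1 C Y))"
  using post_functor[of "Ide1 C Y" X] assms by (simp add: two_simps)
 show "is_functor (hom_cat C X Y) (hom_cat C X Y) (id_func (hom_cat C X Y))" by (rule id_functor[OF hom_category])
 show "FO (post_func C X (Ide1 C Y)) k = FO (id_func (hom_cat C X Y)) k" if "k \<in> Obj (hom_cat C X Y)" for k
  using that assms comp1_ide(2)[of k] by (auto simp: two_simps)
 show "FA (post_func C X (Ide1 C Y)) a = FA (id_func (hom_cat C X Y)) a" if "a \<in> Arr (hom_cat C X Y)" for a
  using that assms hcomp2_ide(2)[of a] by (auto simp: two_simps)
qed

lemma rep_psfun_simps [simp]:
 "P0 (rep_psfun C X F) x = hom_cat C X (P0 F x)" "P1 (rep_psfun C X F) f = post_func C X (P1 F f)"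
 "P2 (rep_psfun C X F) si = post_nat C X (P2 F si)" "PComp (rep_psfun C X F) g f = post_nat C X (PComp F g f)"
 "PUnit (rep_psfun C X F) x = post_nat C X (PUnit F x)" by (simp_all add: rep_psfun_def)

end

lemma comp_func_eqI: assumes "FDom F = FDom F'" "FCod G = FCod G'"
  "\<And>x. x \<in> Obj (FDom F) ==> FO G (FO F x) = FO G' (FO F' x)"
  "\<And>f. f \<in> Arr (FDom F) ==> FA G (FA F f) = FA G' (FA F' f)" shows "comp_func G F = comp_func G' F'"
 using assms by (auto simp: comp_func_def intro!: restrict_ext)

lemma psfun_cells: assumes "pseudo_functor D C F"
 shows "f \<in> Cell1 D ==> g \<in> Cell1 D ==> Src D g = Trg D f ==> PComp F g f \<in> Cell2 C"
  "x \<in> Cell0 D ==> PUnit F x \<in> Cell2 C"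
 using pseudo_functor.PComp_iso[OF assms, of f g] pseudo_functor.PUnit_iso[OF assms, of x]
 by (auto simp: iso_arr_def vert_cat_def)

locale rep_setting = D: two_category D + C: two_category C + J: cat_valued D J + F: pseudo_functor D C F
 for D :: "('d0, 'd1, 'd2) two_cat" and C :: "('o, 'm, 'c) two_cat"
  and J :: "('d0, 'd1, 'd2, 'p, 'b) cat_psfun" and F :: "('d0, 'd1, 'd2, 'o, 'm, 'c) psfun"
begin

abbreviation "Rp A \<equiv> rep_psfun C A F"
abbreviation "pre k \<equiv> pnat_comp D (rep_pnat D C F k)"

lemmas F_simps = F.P0_cell F.P1_cell F.P1_src F.P1_trg F.P2_cell F.P2_dom F.P2_cod
 F.PComp_dom F.PComp_cod F.PUnit_dom F.PUnit_cod psfun_cells[OF F.pseudo_functor_axioms] D.cell1 D.cell2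

lemma rep_cat_valued: "cat_valued D (Rp X)"
proof (rule cat_valued.intro)
 show "nat_trans (P0 (Rp X) (Src D f)) (P0 (Rp X) (Trg D g)) (comp_func (P1 (Rp X) g) (P1 (Rp X) f))
    (P1 (Rp X) (Comp1 D g f)) (PComp (Rp X) g f)" if "f \<in> Cell1 D" "g \<in> Cell1 D" "Src D g = Trg D f" for f g
  using C.post_nat_trans[of "PComp F g f" X] that by (simp add: F_simps C.post_func_comp[symmetric] C.two_simps)
 show "nat_trans (P0 (Rp X) x) (P0 (Rp X) x) (id_func (P0 (Rp X) x)) (P1 (Rp X) (Ide1 D x)) (PUnit (Rp X) x)"
  if "x \<in> Cell0 D" for x using C.post_nat_trans[of "PUnit F x" X] that
  by (simp add: F_simps C.post_func_ide[symmetric] C.two_simps)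
 show "is_functor (P0 (Rp X) (Src D f)) (P0 (Rp X) (Trg D f)) (P1 (Rp X) f)" if "f \<in> Cell1 D" for f
  using C.post_functor[of "P1 F f" X] that by (simp add: F_simps)
 show "nat_trans (P0 (Rp X) (Src D (Dom2 D si))) (P0 (Rp X) (Trg D (Dom2 D si)))
   (P1 (Rp X) (Dom2 D si)) (P1 (Rp X) (Cod2 D si)) (P2 (Rp X) si)" if "si \<in> Cell2 D" for si
  using C.post_nat_trans[of "P2 F si" X] that by (simp add: F_simps)
qed (simp add: C.hom_category)

sublocale R: hom_setting D J "Rp X" for X by (intro hom_setting.intro rep_cat_valued) unfold_locales

text \<open>Precomposition with \<open>h\<close> commutes with postcomposition by strict
  associativity of 1-cells and of horizontal composition; the three strictness conditions on
  structure cells are instances of the latter.\<close>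

lemma rep_strict_trans: assumes h: "h \<in> Cell1 C"
 shows "strict_trans D J (Rp (Trg C h)) (Rp (Src C h)) (rep_pnat D C F h)"
proof (intro strict_trans.intro strict_trans_axioms.intro)
 fix f assume f: "f \<in> Cell1 D"
 note pre = C.pre_functor[OF h, of "P0 F (Src D f)"] C.pre_functor[OF h, of "P0 F (Trg D f)"]
 show "comp_func (P1 (Rp (Src C h)) f) (PN (rep_pnat D C F h) (Src D f)) =
   comp_func (PN (rep_pnat D C F h) (Trg D f)) (P1 (Rp (Trg C h)) f)"
 proof (rule func_eqI)
  show "is_functor (hom_cat C (Trg C h) (P0 F (Src D f))) (hom_cat C (Src C h) (P0 F (Trg D f)))
    (comp_func (P1 (Rp (Src C h)) f) (PN (rep_pnat D C F h) (Src D f)))"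
   using comp_functor[OF pre(1)] C.post_functor[of "P1 F f" "Src C h"] f by (simp add: rep_pnat_def F_simps)
  show "is_functor (hom_cat C (Trg C h) (P0 F (Src D f))) (hom_cat C (Src C h) (P0 F (Trg D f)))
    (comp_func (PN (rep_pnat D C F h) (Trg D f)) (P1 (Rp (Trg C h)) f))"
   using comp_functor[OF _ pre(2)] C.post_functor[of "P1 F f" "Trg C h"] f by (simp add: rep_pnat_def F_simps)
 qed (use f h in \<open>auto simp: rep_pnat_def F_simps C.two_simps C.comp1_assoc C.hcomp2_assoc\<close>)
qed (use h in \<open>auto simp: rep_pnat_def F_simps C.two_simps C.hcomp2_assoc C.HComp_ide[symmetric]
  R.hom_setting_axioms C.pre_functor\<close>)

lemma rep_pnat_simps: assumes "h \<in> Cell1 C"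
 shows "x \<in> Cell0 D ==> k \<in> Obj (hom_cat C (Trg C h) (P0 F x)) ==> pob (rep_pnat D C F h) x k = Comp1 C k h"
  "x \<in> Cell0 D ==> a \<in> Arr (hom_cat C (Trg C h) (P0 F x)) ==>
   par (rep_pnat D C F h) x a = HComp C a (Ide2 C h)" by (simp_all add: rep_pnat_def)

lemma rep_cone_simps: assumes h: "k \<in> Cell1 C" "Trg C k = L" and et: "pseudo_nat D J (Rp L) et"
 shows "x \<in> Cell0 D ==> j \<in> O0 J x ==> pob (pre k et) x j = Comp1 C (pob et x j) k"
  "x \<in> Cell0 D ==> u \<in> A0 J x ==> par (pre k et) x u = HComp C (par et x u) (Ide2 C k)"
  "f \<in> Cell1 D ==> j \<in> O0 J (Src D f) ==> ptr (pre k et) f j = HComp C (ptr et f j) (Ide2 C k)"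
proof -
 interpret et: pcone D J "Rp L" "pob et" "par et" "ptr et" by (rule R.pnat_pcone[OF et])
 note s = strict_trans.pnat_comp_simps[OF rep_strict_trans[OF h(1)], of et, unfolded h(2), OF et]
 show "pob (pre k et) x j = Comp1 C (pob et x j) k" if "x \<in> Cell0 D" "j \<in> O0 J x"
  using s(1)[OF that] et.ob_obj[OF that] that h by (simp add: rep_pnat_simps)
 show "par (pre k et) x u = HComp C (par et x u) (Ide2 C k)" if "x \<in> Cell0 D" "u \<in> A0 J x"
  using s(2)[OF that] in_homD(1)[OF et.ar_hom[OF that(1) in_homI[OF that(2)]]] that h by (simp add: rep_pnat_simps)
 show "ptr (pre k et) f j = HComp C (ptr et f j) (Ide2 C k)" if "f \<in> Cell1 D" "j \<in> O0 J (Src D f)"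
  using s(3)[OF that] in_homD(1)[OF et.tr_hom[OF that]] that h D.cell1(2)[OF that(1)] by (simp add: rep_pnat_simps)
qed

end

text \<open>For an object \<open>L\<close>, a pseudo natural transformation \<open>et : J \<Rightarrow> C(L, F-)\<close> exhibits \<open>L\<close> as a
 weighted pseudo limit if composition with \<open>et\<close> is bijective on 1-cells and on 2-cells.\<close>

locale universal_cone = rep_setting D C J F for D :: "('d0, 'd1, 'd2) two_cat" and C :: "('o, 'm, 'c) two_cat"
  and J :: "('d0, 'd1, 'd2, 'p, 'b) cat_psfun" and F :: "('d0, 'd1, 'd2, 'o, 'm, 'c) psfun" +
 fixes L :: 'o and et :: "('d0, 'd1, 'p, 'b, 'm, 'c) pnat"
 assumes L: "L \<in> Cell0 C" and et: "pseudo_nat D J (Rp L) et"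
  and one_inj: "[|k \<in> Cell1 C; k' \<in> Cell1 C; Src C k = Src C k'; Trg C k = L; Trg C k' = L;
   \<And>x j. x \<in> Cell0 D ==> j \<in> O0 J x ==> Comp1 C (pob et x j) k = Comp1 C (pob et x j) k';
   \<And>x u. x \<in> Cell0 D ==> u \<in> A0 J x ==>
    HComp C (par et x u) (Ide2 C k) = HComp C (par et x u) (Ide2 C k');
   \<And>f j. f \<in> Cell1 D ==> j \<in> O0 J (Src D f) ==>
    HComp C (ptr et f j) (Ide2 C k) = HComp C (ptr et f j) (Ide2 C k')|] ==> k = k'"
  and one_surj: "[|X \<in> Cell0 C; pseudo_nat D J (Rp X) al|] ==>
   \<exists>k\<in>Cell1 C. Src C k = X \<and> Trg C k = L \<and>
   (\<forall>x\<in>Cell0 D. \<forall>j\<in>O0 J x. Comp1 C (pob et x j) k = pob al x j) \<and>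
   (\<forall>x\<in>Cell0 D. \<forall>u\<in>A0 J x. HComp C (par et x u) (Ide2 C k) = par al x u) \<and>
   (\<forall>f\<in>Cell1 D. \<forall>j\<in>O0 J (Src D f). HComp C (ptr et f j) (Ide2 C k) = ptr al f j)"
  and two_inj: "[|si \<in> Cell2 C; ta \<in> Cell2 C; Dom2 C si = Dom2 C ta; Cod2 C si = Cod2 C ta;
   Trg C (Dom2 C si) = L; \<And>x j. x \<in> Cell0 D ==> j \<in> O0 J x ==>
    HComp C (Ide2 C (pob et x j)) si = HComp C (Ide2 C (pob et x j)) ta|] ==> si = ta"
  and two_surj: "[|k \<in> Cell1 C; k' \<in> Cell1 C; Src C k = Src C k'; Trg C k = L; Trg C k' = L;
   pmod D J (Rp (Src C k)) (pob (pre k et)) (par (pre k et)) (ptr (pre k et)) (pob (pre k' et)) (par (pre k' et))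
    (ptr (pre k' et)) m|] ==> \<exists>si\<in>Cell2 C. Dom2 C si = k \<and> Cod2 C si = k' \<and>
   (\<forall>x\<in>Cell0 D. \<forall>j\<in>O0 J x. HComp C (Ide2 C (pob et x j)) si = m x j)"
begin

sublocale et: pcone D J "Rp L" "pob et" "par et" "ptr et" by (rule R.pnat_pcone[OF et])

lemma et_cells: "x \<in> Cell0 D ==> j \<in> O0 J x ==>
  pob et x j \<in> Cell1 C \<and> Src C (pob et x j) = L \<and> Trg C (pob et x j) = P0 F x"
 "x \<in> Cell0 D ==> u \<in> A0 J x ==> par et x u \<in> Cell2 C \<and>
  Src C (Dom2 C (par et x u)) = L \<and> Trg C (Dom2 C (par et x u)) = P0 F x"
 "f \<in> Cell1 D ==> j \<in> O0 J (Src D f) ==> ptr et f j \<in> Cell2 C \<and>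
  Src C (Dom2 C (ptr et f j)) = L \<and> Trg C (Dom2 C (ptr et f j)) = P0 F (Trg D f)"
 using et.ob_obj[of x j] et.ar_hom[OF _ in_homI, of x u] et.tr_hom[of f j] by (auto simp: in_hom_def)

lemma par_et_boundary: "x \<in> Cell0 D ==> hom0 J x u i j ==>
  Dom2 C (par et x u) = pob et x i \<and> Cod2 C (par et x u) = pob et x j"
 using et.ar_hom[of x u] by (auto simp: in_hom_def)

definition cone1 :: "'m \<Rightarrow> ('d0, 'd1, 'p, 'b, 'm, 'c) pnat" where "cone1 k = pre k et"

text \<open>The whiskering of \<open>et\<close> by a 2-cell, given through the very expressions that
  occur in \<open>two_inj\<close> and \<open>two_surj\<close>.\<close>

definition cone2 :: "'c \<Rightarrow> ('d0, 'd1, 'p, 'b, 'm, 'c) modif" where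
 "cone2 si = mk_modif D J (cone1 (Dom2 C si)) (cone1 (Cod2 C si)) (\<lambda>x j. HComp C (Ide2 C (pob et x j)) si)"

text \<open>The transformation that the Yoneda lemma attaches to \<open>et\<close>, viewed as an
  element of the category of cones with vertex \<open>L\<close>.\<close>

definition Theta where "Theta X = \<lparr>FDom = hom_cat C X L, FCod = Hom_cat D J (Rp X),
  FO = (\<lambda>k\<in>Obj (hom_cat C X L). cone1 k), FA = (\<lambda>si\<in>Arr (hom_cat C X L). cone2 si)\<rparr>"

lemma cone1_pseudo_nat: "k \<in> Cell1 C ==> Trg C k = L ==> pseudo_nat D J (Rp (Src C k)) (cone1 k)"
 unfolding cone1_def using strict_trans.strict_pseudo_nat[OF rep_strict_trans] et by auto

lemma cone1_simps: assumes "k \<in> Cell1 C" "Trg C k = L"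
 shows "x \<in> Cell0 D ==> j \<in> O0 J x ==> pob (cone1 k) x j = Comp1 C (pob et x j) k"
  "x \<in> Cell0 D ==> u \<in> A0 J x ==> par (cone1 k) x u = HComp C (par et x u) (Ide2 C k)"
  "f \<in> Cell1 D ==> j \<in> O0 J (Src D f) ==> ptr (cone1 k) f j = HComp C (ptr et f j) (Ide2 C k)"
 unfolding cone1_def by (rule rep_cone_simps[OF assms et]; assumption)+

text \<open>Associativity in \<open>C\<close>, component by component. This is naturality of the
  Yoneda transformation on 1-cells, before it is phrased with functors.\<close>

lemma cone1_comp: assumes "k \<in> Cell1 C" "Trg C k = L" "h \<in> Cell1 C" "Src C k = Trg C h"
 shows "pre h (cone1 k) = cone1 (Comp1 C k h)"
proof -
 note c = cone1_pseudo_nat[OF assms(1,2), unfolded assms(4)]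
 interpret S: strict_trans D J "Rp (Trg C h)" "Rp (Src C h)" "rep_pnat D C F h"
  by (rule rep_strict_trans[OF assms(3)])
 have kh: "Comp1 C k h \<in> Cell1 C" "Src C (Comp1 C k h) = Src C h" "Trg C (Comp1 C k h) = L"
  using assms by (simp_all add: C.two_simps)
 note s = S.pnat_comp_simps[OF c] cone1_simps[OF assms(1,2)] cone1_simps[OF kh(1,3)] rep_pnat_simps[OF assms(3)]
 show ?thesis by (rule R.pnat_eqI[of "Src C h"])
   (use S.strict_pseudo_nat[OF c] cone1_pseudo_nat[OF kh(1,3)] et_cells assms D.cell1 in
    \<open>simp_all add: s kh C.comp1_assoc C.two_simps C.hcomp2_assoc C.HComp_ide[symmetric]\<close>)
qed

text \<open>Naturality and compatibility both exchange the order in which \<open>si\<close> and a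
  2-cell of \<open>et\<close> are whiskered, hence are instances of
  \<open>whisker_exchange\<close>.\<close>

lemma cone2_modification: assumes "si \<in> Cell2 C" "Trg C (Dom2 C si) = L"
 shows "modification D J (Rp (Src C (Dom2 C si))) (cone2 si)"
proof -
 let ?k = "Dom2 C si" and ?k' = "Cod2 C si"
 have k: "?k \<in> Cell1 C" "?k' \<in> Cell1 C" "Src C ?k' = Src C ?k" "Trg C ?k' = L"
  using assms by (simp_all add: C.two_simps)
 note s = cone1_simps[OF k(1) assms(2)] cone1_simps[OF k(2,4)]
 have "pmod D J (Rp (Src C ?k)) (pob (cone1 ?k)) (par (cone1 ?k)) (ptr (cone1 ?k))
   (pob (cone1 ?k')) (par (cone1 ?k')) (ptr (cone1 ?k')) (\<lambda>x j. HComp C (Ide2 C (pob et x j)) si)"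
 proof
  show "hom0 (Rp (Src C ?k)) x (HComp C (Ide2 C (pob et x j)) si) (pob (cone1 ?k) x j) (pob (cone1 ?k') x j)"
   if "x \<in> Cell0 D" "j \<in> O0 J x" for x j
   using that et_cells(1)[OF that] assms by (simp add: s in_hom_def C.two_simps)
  show "cmp0 (Rp (Src C ?k)) x (HComp C (Ide2 C (pob et x j)) si) (par (cone1 ?k) x u) =
   cmp0 (Rp (Src C ?k)) x (par (cone1 ?k') x u) (HComp C (Ide2 C (pob et x i)) si)"
   if "x \<in> Cell0 D" "hom0 J x u i j" for x u i j
   using that(1) in_homD(1)[OF that(2)] et_cells(2)[OF that(1) in_homD(1)[OF that(2)]]
    par_et_boundary[OF that] assms C.whisker_exchange[OF assms(1), of "par et x u"] by (simp add: s)
  show "cmp0 (Rp (Src C ?k)) (Trg D f) (ptr (cone1 ?k') f j)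
    (A1 (Rp (Src C ?k)) f (HComp C (Ide2 C (pob et (Src D f) j)) si)) = cmp0 (Rp (Src C ?k)) (Trg D f)
    (HComp C (Ide2 C (pob et (Trg D f) (O1 J f j))) si) (ptr (cone1 ?k) f j)"
   if f: "f \<in> Cell1 D" "j \<in> O0 J (Src D f)" for f j
  proof -
   note e = et_cells(1)[OF D.cell1(1)[OF f(1)] f(2)]
   have "Dom2 C (ptr et f j) = Comp1 C (P1 F f) (pob et (Src D f) j)"
    "Cod2 C (ptr et f j) = pob et (Trg D f) (O1 J f j)" using et.tr_hom[OF f] e f by (auto simp: in_hom_def F_simps)
   then show ?thesis using f e et_cells(3)[OF f] assms C.whisker_exchange[OF assms(1), of "ptr et f j"]
    by (simp add: s F_simps C.two_simps C.hcomp2_assoc C.HComp_ide)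
  qed
 qed
 then show ?thesis unfolding cone2_def
  using R.mk_modif_modification cone1_pseudo_nat[OF k(1) assms(2)] cone1_pseudo_nat[OF k(2,4)] k(3) by auto
qed

lemma mk_modif_cong: assumes "\<And>x j. x \<in> Cell0 D ==> j \<in> O0 J x ==> m x j = m' x j"
 shows "mk_modif D J al be m = mk_modif D J al be m'" using assms by (auto simp: mk_modif_def intro!: restrict_ext)

lemma Theta_functor: assumes X: "X \<in> Cell0 C" shows "is_functor (hom_cat C X L) (Hom_cat D J (Rp X)) (Theta X)"
proof (rule is_functorI)
 show "in_hom (Hom_cat D J (Rp X)) (FA (Theta X) si) (FO (Theta X) k) (FO (Theta X) k')"
  if "in_hom (hom_cat C X L) si k k'" for si k k' using that cone2_modification[of si] C.cell2(1,2)[of si]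
  by (auto simp: in_hom_def Theta_def R.Hom_cat_simps) (auto simp: cone2_def)
 show "FA (Theta X) (Ide (hom_cat C X L) k) = Ide (Hom_cat D J (Rp X)) (FO (Theta X) k)"
  if "k \<in> Obj (hom_cat C X L)" for k using that R.modif_id_eq[OF cone1_pseudo_nat[of k]] et_cells
  by (auto simp: Theta_def R.Hom_cat_simps cone2_def C.two_simps cone1_simps C.HComp_ide intro!: mk_modif_cong)
 show "FA (Theta X) (Comp (hom_cat C X L) ta si) = Comp (Hom_cat D J (Rp X)) (FA (Theta X) ta) (FA (Theta X) si)"
  if h: "in_hom (hom_cat C X L) si k k'" "in_hom (hom_cat C X L) ta k' k''" for si ta k k' k''
 proof -
  have c: "si \<in> Cell2 C" "ta \<in> Cell2 C" "Dom2 C ta = Cod2 C si" "Src C (Dom2 C si) = X"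
   "Trg C (Dom2 C si) = L" "Trg C (Dom2 C ta) = L" "Src C (Dom2 C ta) = X" using h by (auto simp: in_hom_def)
  have "modif_vcomp D (cone2 ta) (cone2 si) = mk_modif D J (cone1 (Dom2 C si)) (cone1 (Cod2 C ta))
    (\<lambda>x j. VComp C (mcomp (cone2 ta) x j) (mcomp (cone2 si) x j))"
   using R.modif_vcomp_eq[of X "cone2 si" "cone2 ta"] cone2_modification[of si]
    cone2_modification[of ta] c by (simp add: C.hom_cat_simps) (simp add: cone2_def)
  also have "\<dots> = cone2 (VComp C ta si)"
   using c et_cells(1) by (auto simp: cone2_def C.two_simps C.whisker_left intro!: mk_modif_cong)
  finally show ?thesis using c by (simp add: Theta_def R.Hom_cat_simps C.two_simps)
 qed
 show "FO (Theta X) k \<in> Obj (Hom_cat D J (Rp X))" if "k \<in> Obj (hom_cat C X L)" for k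
  using that cone1_pseudo_nat[of k] by (auto simp: Theta_def R.Hom_cat_simps)
qed (auto simp: Theta_def C.hom_category R.Hom_category)

text \<open>Bijectivity on objects is \<open>one_inj\<close> and \<open>one_surj\<close>. For arrows
  the boundary is treated first: the end points of a modification come from unique 1-cells, and
  between those the clauses on 2-cells apply.\<close>

lemma Theta_cat_iso: assumes X: "X \<in> Cell0 C" shows "cat_iso (hom_cat C X L) (Hom_cat D J (Rp X)) (Theta X)"
proof (rule cat_isoI[OF Theta_functor[OF X]])
 have inj: "k = k'" if "k \<in> Obj (hom_cat C X L)" "k' \<in> Obj (hom_cat C X L)" "cone1 k = cone1 k'" for k k'
 proof -
  have k: "k \<in> Cell1 C" "Trg C k = L" "k' \<in> Cell1 C" "Trg C k' = L" "Src C k = Src C k'" using that by auto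
  note s = cone1_simps[OF k(1,2)] cone1_simps[OF k(3,4)]
  show ?thesis by (rule one_inj) (use k in \<open>simp_all add: s[symmetric] that(3)\<close>)
 qed
 have surj: "\<exists>k\<in>Obj (hom_cat C X L). cone1 k = al" if al: "pseudo_nat D J (Rp X) al" for al
 proof -
  obtain k where k: "k \<in> Cell1 C" "Src C k = X" "Trg C k = L"
   and e: "\<forall>x\<in>Cell0 D. \<forall>j\<in>O0 J x. Comp1 C (pob et x j) k = pob al x j"
   "\<forall>x\<in>Cell0 D. \<forall>u\<in>A0 J x. HComp C (par et x u) (Ide2 C k) = par al x u"
   "\<forall>f\<in>Cell1 D. \<forall>j\<in>O0 J (Src D f). HComp C (ptr et f j) (Ide2 C k) = ptr al f j"
   using one_surj[OF X al] by blast
  have "cone1 k = al" by (rule R.pnat_eqI[OF cone1_pseudo_nat[OF k(1,3), unfolded k(2)] al])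
    (use e in \<open>simp_all add: cone1_simps[OF k(1,3)]\<close>)
  then show ?thesis using k by auto
 qed
 show "bij_betw (FO (Theta X)) (Obj (hom_cat C X L)) (Obj (Hom_cat D J (Rp X)))" unfolding bij_betw_def
 proof
  show "inj_on (FO (Theta X)) (Obj (hom_cat C X L))" using inj by (intro inj_onI) (simp add: Theta_def)
  show "FO (Theta X) ` Obj (hom_cat C X L) = Obj (Hom_cat D J (Rp X))"
  proof (intro equalityI subsetI)
   fix al assume "al \<in> FO (Theta X) ` Obj (hom_cat C X L)"
   then show "al \<in> Obj (Hom_cat D J (Rp X))" using fun_obj[OF Theta_functor[OF X]] by blast
  next
   fix al assume "al \<in> Obj (Hom_cat D J (Rp X))"
   then obtain k where "k \<in> Obj (hom_cat C X L)" "cone1 k = al" using surj R.Hom_cat_simps by blast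
   then show "al \<in> FO (Theta X) ` Obj (hom_cat C X L)" by (intro image_eqI[of _ _ k]) (simp_all add: Theta_def)
  qed
 qed
 have s: "FA (Theta X) si = cone2 si" if "si \<in> Arr (hom_cat C X L)" for si using that by (simp add: Theta_def)
 show "bij_betw (FA (Theta X)) (Arr (hom_cat C X L)) (Arr (Hom_cat D J (Rp X)))" unfolding bij_betw_def
 proof
  show "inj_on (FA (Theta X)) (Arr (hom_cat C X L))"
  proof (rule inj_onI)
   fix si ta assume st: "si \<in> Arr (hom_cat C X L)" "ta \<in> Arr (hom_cat C X L)"
    and "FA (Theta X) si = FA (Theta X) ta"
   then have e: "cone2 si = cone2 ta" by (simp add: s)
   have "cone1 (Dom2 C si) = cone1 (Dom2 C ta)" "cone1 (Cod2 C si) = cone1 (Cod2 C ta)"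
    using arg_cong[OF e, of MDom] arg_cong[OF e, of MCod] by (simp_all add: cone2_def)
   then have d: "Dom2 C si = Dom2 C ta" "Cod2 C si = Cod2 C ta" using st C.cell2(1,2) by (auto intro!: inj)
   have "HComp C (Ide2 C (pob et x j)) si = HComp C (Ide2 C (pob et x j)) ta"
    if "x \<in> Cell0 D" "j \<in> O0 J x" for x j
    using arg_cong[OF e, of "\<lambda>Ga. mcomp Ga x j"] that by (simp add: cone2_def)
   then show "si = ta" using two_inj d st by auto
  qed
  show "FA (Theta X) ` Arr (hom_cat C X L) = Arr (Hom_cat D J (Rp X))"
  proof (intro equalityI subsetI)
   fix Ga assume "Ga \<in> FA (Theta X) ` Arr (hom_cat C X L)"
   then show "Ga \<in> Arr (Hom_cat D J (Rp X))" using is_functor.FA_arr[OF Theta_functor[OF X]] by blast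
  next
   fix Ga assume "Ga \<in> Arr (Hom_cat D J (Rp X))"
   then have G: "modification D J (Rp X) Ga" by (simp add: R.Hom_cat_simps)
   obtain k where k: "k \<in> Obj (hom_cat C X L)" "cone1 k = MDom Ga" using surj modification.MDom[OF G] by blast
   obtain k' where k': "k' \<in> Obj (hom_cat C X L)" "cone1 k' = MCod Ga" using surj modification.MCod[OF G] by blast
   have m: "pmod D J (Rp (Src C k)) (pob (pre k et)) (par (pre k et)) (ptr (pre k et))
     (pob (pre k' et)) (par (pre k' et)) (ptr (pre k' et)) (mcomp Ga)"
    using R.modif_pmod[OF G] k k' by (simp add: cone1_def)
   have kk: "k \<in> Cell1 C" "k' \<in> Cell1 C" "Src C k = Src C k'" "Trg C k = L" "Trg C k' = L" using k k' by auto
   obtain si where si: "si \<in> Cell2 C" "Dom2 C si = k" "Cod2 C si = k'"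
    "\<forall>x\<in>Cell0 D. \<forall>j\<in>O0 J x. HComp C (Ide2 C (pob et x j)) si = mcomp Ga x j"
    using two_surj[OF kk m] by blast
   have "cone2 si = Ga"
   proof (rule R.modif_eqI[OF _ G])
    show "modification D J (Rp X) (cone2 si)" using cone2_modification[OF si(1)] si k by auto
    show "mcomp (cone2 si) x j = mcomp Ga x j" if "x \<in> Cell0 D" "j \<in> O0 J x" for x j
     using that si by (simp add: cone2_def)
   qed (use si k k' in \<open>simp_all add: cone2_def\<close>)
   then show "Ga \<in> FA (Theta X) ` Arr (hom_cat C X L)" using si k by (intro image_eqI[of _ _ si]) (auto simp: s)
  qed
 qed
qed

lemma Theta_natural1: assumes h: "h \<in> Cell1 C"
 shows "comp_func (Hom_func D J (Rp (Trg C h)) (Rp (Src C h)) (rep_pnat D C F h))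
  (Theta (Trg C h)) = comp_func (Theta (Src C h)) (pre_func C h L)"
proof -
 interpret S: strict_trans D J "Rp (Trg C h)" "Rp (Src C h)" "rep_pnat D C F h" by (rule rep_strict_trans[OF h])
 have 1: "FO (Hom_func D J (Rp (Trg C h)) (Rp (Src C h)) (rep_pnat D C F h))
   (FO (Theta (Trg C h)) k) = FO (Theta (Src C h)) (FO (pre_func C h L) k)"
  if "k \<in> Obj (hom_cat C (Trg C h) L)" for k using that h cone1_comp[of k h] cone1_pseudo_nat[of k]
  by (auto simp: Hom_func_def Theta_def R.Hom_cat_simps C.two_simps)
 have 2: "FA (Hom_func D J (Rp (Trg C h)) (Rp (Src C h)) (rep_pnat D C F h))
   (FA (Theta (Trg C h)) si) = FA (Theta (Src C h)) (FA (pre_func C h L) si)"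
  if "si \<in> Arr (hom_cat C (Trg C h) L)" for si
 proof -
  have c: "si \<in> Cell2 C" "Src C (Dom2 C si) = Trg C h" "Trg C (Dom2 C si) = L" using that by auto
  note G = cone2_modification[OF c(1,3), unfolded c(2)]
  have "modif_hcomp D (modif_id D (rep_pnat D C F h)) (cone2 si) = mk_modif D J (pre h (cone1 (Dom2 C si)))
     (pre h (cone1 (Cod2 C si))) (\<lambda>x j. par (rep_pnat D C F h) x (mcomp (cone2 si) x j))"
   using S.modif_hcomp_eq[OF G] by (simp add: cone2_def)
  also have "\<dots> = cone2 (HComp C si (Ide2 C h))"
   using c h et_cells(1) cone1_comp[of "Dom2 C si" h] cone1_comp[of "Cod2 C si" h]
   by (auto simp: cone2_def C.two_simps rep_pnat_simps C.hcomp2_assoc intro!: mk_modif_cong)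
  finally show ?thesis using c h G by (simp add: Theta_def Hom_func_def R.Hom_cat_simps C.two_simps)
 qed
 show ?thesis
  by (rule comp_func_eqI) (use 1 2 in \<open>simp_all add: Theta_def Hom_func_def del: C.hom_cat_simps\<close>)
qed

text \<open>\<open>cone2\<close> is given by components, whereas the 2-functor of cones whiskers
  with \<open>rep_modif\<close>; the two agree by associativity of horizontal composition.\<close>

lemma modif_hcomp_rep: assumes "si \<in> Cell2 C" "k \<in> Cell1 C" "Src C k = Trg C (Dom2 C si)" "Trg C k = L"
 shows "modif_hcomp D (rep_modif D C F si) (modif_id D (cone1 k)) = cone2 (HComp C (Ide2 C k) si)"
proof -
 have c: "Dom2 C si \<in> Cell1 C" "Cod2 C si \<in> Cell1 C" using assms by (simp_all add: C.two_simps)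
 note c1 = cone1_comp[OF assms(2,4) c(1) assms(3)]
 have c2: "pnat_comp D (rep_pnat D C F (Cod2 C si)) (cone1 k) = cone1 (Comp1 C k (Cod2 C si))"
  using cone1_comp[OF assms(2,4) c(2)] assms by simp
 have "hcomp_nat (pre_nat C si (P0 F x)) (id_nat (PN (cone1 k) x)) =
   \<lparr>NDom = PN (cone1 (Comp1 C k (Dom2 C si))) x, NCod = PN (cone1 (Comp1 C k (Cod2 C si))) x,
   NC = (\<lambda>j\<in>O0 J x. HComp C (Ide2 C (pob et x j)) (HComp C (Ide2 C k) si))\<rparr>"
  if x: "x \<in> Cell0 D" for x
 proof (rule ntrans.equality)
  have N: "is_functor (P0 J x) (hom_cat C (Trg C (Dom2 C si)) (P0 F x)) (PN (cone1 k) x)"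
   using pseudo_nat.PN_functor[OF cone1_pseudo_nat[OF assms(2,4)] x] assms by simp
  have "NC (hcomp_nat (pre_nat C si (P0 F x)) (id_nat (PN (cone1 k) x))) j =
    HComp C (Ide2 C (pob et x j)) (HComp C (Ide2 C k) si)" if j: "j \<in> O0 J x" for j
   using hcomp_id_right[OF C.pre_nat_trans[OF assms(1)] N j] assms et_cells(1)[OF x j] x j
   by (simp add: cone1_simps C.two_simps C.hcomp2_assoc C.HComp_ide)
  then show "NC (hcomp_nat (pre_nat C si (P0 F x)) (id_nat (PN (cone1 k) x))) =
    NC \<lparr>NDom = PN (cone1 (Comp1 C k (Dom2 C si))) x, NCod = PN (cone1 (Comp1 C k (Cod2 C si))) x,
     NC = (\<lambda>j\<in>O0 J x. HComp C (Ide2 C (pob et x j)) (HComp C (Ide2 C k) si))\<rparr>" using fun_dom[OF N]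
   by (intro extensionalityI[of _ "O0 J x"]) (auto simp: hcomp_nat_def)
 qed (use x in \<open>simp_all add: c1[symmetric] c2[symmetric] pnat_comp_def rep_pnat_def\<close>)
 then show ?thesis using assms c1 c2
  by (auto simp: modif_hcomp_def cone2_def mk_modif_def rep_modif_def modif_id_def C.two_simps intro!: restrict_ext)
qed

text \<open>At \<open>k\<close> both sides are \<open>cone2\<close> of the whiskering of
  \<open>si\<close> by \<open>k\<close>, composed with an identity modification on the right or on
  the left; these identities stem from the identity factor of each horizontal composite.\<close>

lemma Theta_natural2: assumes si: "si \<in> Cell2 C"
 defines "X \<equiv> Trg C (Dom2 C si)" and "X' \<equiv> Src C (Dom2 C si)"
 shows "hcomp_nat (Hom_nat D J (Rp X) (Rp X') (rep_modif D C F si))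
   (id_nat (Theta X)) = hcomp_nat (id_nat (Theta X')) (pre_nat C si L)"
proof (rule ntrans.equality)
 let ?l = "hcomp_nat (Hom_nat D J (Rp X) (Rp X') (rep_modif D C F si)) (id_nat (Theta X))"
 let ?r = "hcomp_nat (id_nat (Theta X')) (pre_nat C si L)"
 have c: "Dom2 C si \<in> Cell1 C" "Cod2 C si \<in> Cell1 C" using si by (simp_all add: C.two_simps)
 have X: "X' \<in> Cell0 C" "X \<in> Cell0 C" using c by (simp_all add: X_def X'_def C.two_simps)
 show "NDom ?l = NDom ?r" using Theta_natural1[OF c(1)] by (simp add: Hom_nat_def rep_modif_def X_def X'_def)
 show "NCod ?l = NCod ?r" using Theta_natural1[OF c(2)] si by (simp add: Hom_nat_def rep_modif_def X_def X'_def)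
 have "NC ?l k = NC ?r k" if k: "k \<in> Obj (hom_cat C X L)" for k
 proof -
  have k': "k \<in> Cell1 C" "Src C k = Trg C (Dom2 C si)" "Trg C k = L" using k by (auto simp: X_def)
  note ck = cone1_pseudo_nat[OF k'(1,3), unfolded k'(2), folded X_def]
  let ?s = "HComp C (Ide2 C k) si"
  have s: "?s \<in> Cell2 C" "Dom2 C ?s = Comp1 C k (Dom2 C si)" "Cod2 C ?s = Comp1 C k (Cod2 C si)"
   "Src C (Dom2 C ?s) = X'" "Trg C (Dom2 C ?s) = L" using si k' by (simp_all add: C.two_simps X'_def)
  interpret H: category "Hom_cat D J (Rp X')" by (rule R.Hom_category)
  have h: "in_hom (Hom_cat D J (Rp X')) (cone2 ?s) (cone1 (Comp1 C k (Dom2 C si))) (cone1 (Comp1 C k (Cod2 C si)))"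
   using cone2_modification[OF s(1,5)] s by (simp add: in_hom_def R.Hom_cat_simps) (simp add: cone2_def s)
  interpret S: strict_trans D J "Rp X" "Rp X'" "rep_pnat D C F (Dom2 C si)"
   using rep_strict_trans[OF c(1)] by (simp add: X_def X'_def)
  have "NC ?l k = modif_vcomp D (cone2 ?s) (modif_id D (cone1 (Comp1 C k (Dom2 C si))))"
   using k k' ck S.Hom_func_id[OF ck] modif_hcomp_rep[OF si k'] cone1_comp[OF k'(1,3) c(1) k'(2)]
   by (simp add: hcomp_nat_NC Hom_nat_def Theta_def Hom_func_def R.Hom_cat_simps rep_modif_def)
  also have "\<dots> = cone2 ?s" using H.in_hom_ide_right[OF h] by (simp add: R.Hom_cat_simps)
  also have "\<dots> = modif_vcomp D (modif_id D (cone1 (Comp1 C k (Cod2 C si)))) (cone2 ?s)"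
   using H.in_hom_ide_left[OF h] by (simp add: R.Hom_cat_simps)
  also have "\<dots> = NC ?r k"
   using k k' si s c by (simp add: hcomp_nat_NC Theta_def R.Hom_cat_simps X_def X'_def C.two_simps)
  finally show ?thesis .
 qed
 then show "NC ?l = NC ?r"
  by (intro extensionalityI[of _ "Obj (hom_cat C X L)"]) (auto simp: hcomp_nat_def Theta_def X_def)
qed simp

text \<open>Sources and targets of 1-cells are exchanged in \<open>op_two_cat\<close>, so the two
  naturality lemmas, stated with \<open>Trg\<close> on the domain side, are exactly the required
  clauses.\<close>

theorem weighted_pseudo_limit: "weighted_pseudo_limit D C J F L"
 unfolding weighted_pseudo_limit_def two_natural_iso_def using L Theta_cat_iso Theta_natural1 Theta_natural2
 by (auto intro!: exI[of _ Theta] simp: op_two_cat_def rep_two_functor_def cone_two_functor_def)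

end

section \<open>Words of a theory\<close>

lemma length_block_incl [simp]: "length (block_incl ns i) = ns ! i" by (simp add: block_incl_def)

lemma nth_block_incl [simp]: "q < ns ! i ==> block_incl ns i ! q = offset ns i + q" by (simp add: block_incl_def)

lemma set_block_incl: "i < length ns ==> set (block_incl ns i) \<subseteq> {..<sum_list ns}"
 using offset_add_le[of i ns] by (auto simp: block_incl_def)

lemma take_concat: "i < length xss ==> q \<le> length (xss ! i) ==>
  take (offset (map length xss) i + q) (concat xss) = concat (take i xss) @ take q (xss ! i)"
proof (induction xss arbitrary: i)
 case (Cons xs xss)
 then show ?case by (cases i) (auto simp: offset_Suc offset_def add.assoc)
qed simp

lemma nth_concat:
 "i < length xss ==> q < length (xss ! i) ==> concat xss ! (offset (map length xss) i + q) = xss ! i ! q"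
proof (induction xss arbitrary: i)
 case (Cons xs xss)
 then show ?case by (cases i) (auto simp: offset_Suc offset_def nth_append add.assoc)
qed simp

lemma nth_concat_block: "i < length xss ==> map ((!) (concat xss)) (block_incl (map length xss) i) = xss ! i"
 by (rule nth_equalityI) (auto simp: nth_concat)

text \<open>The items before the given position of the flattened list are all blocks before
  \<open>i\<close> and the first \<open>q\<close> items of block \<open>i\<close>; summing
  \<open>f\<close> over the two parts gives the two offsets.\<close>

lemma offset_concat: assumes "i < length xss" "q < length (xss ! i)"
 shows "offset (map f (concat xss)) (offset (map length xss) i + q) =
  offset (map (\<lambda>xs. sum_list (map f xs)) xss) i + offset (map f (xss ! i)) q"
proof -
 have "sum_list (map f (concat (take i xss))) = sum_list (map (\<lambda>xs. sum_list (map f xs)) (take i xss))"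
  for i by (induction xss arbitrary: i; case_tac i) auto
 then show ?thesis
  using arg_cong[OF take_concat[OF assms(1) less_imp_le[OF assms(2)]], of "\<lambda>xs. sum_list (map f xs)"]
  by (simp add: offset_def take_map)
qed

lemma sum_list_map_concat: "sum_list (map f (concat xss)) = sum_list (map (\<lambda>xs. sum_list (map f xs)) xss)"
 by (induction xss) auto

context is_theory
begin

sublocale T: category "TCat T" by (rule T_category)

abbreviation tcomp (infixl "\<bullet>" 70) where "g \<bullet> f \<equiv> Comp (TCat T) g f"
text \<open>The morphism \<open>f' : l -> k\<close> dual to a function \<open>f\<close>. Duality
  reverses composition: in \<open>ren_comp\<close> the composite of the duals of \<open>f\<close>
  and \<open>g\<close> is the dual of \<open>g\<close> after \<open>f\<close>.\<close>

abbreviation "ren l fs \<equiv> tuple T l (map (Prj T l) fs)"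

lemma words_iff: "w \<in> words T n \<longleftrightarrow> in_hom (TCat T) w n 1" by (simp add: words_def in_hom_def)

lemma arity_words: "w \<in> words T n ==> arity T w = n" by (simp add: words_def)

lemma all_words_iff: "w \<in> all_words T \<longleftrightarrow> w \<in> words T (arity T w)"
 using arity_words by (auto simp: all_words_def)

lemma words_all: "w \<in> words T n ==> w \<in> all_words T" by (auto simp: all_words_def)

lemma tuple_is: "set ws \<subseteq> words T m ==> is_tuple T m ws (tuple T m ws)"
 unfolding tuple_def by (rule theI') (rule T_product)

lemma tuple_hom: "set ws \<subseteq> words T m ==> in_hom (TCat T) (tuple T m ws) m (length ws)"
 using tuple_is[of ws m] by (simp add: is_tuple_def in_hom_def)

lemma Prj_tuple: "set ws \<subseteq> words T m ==> i < length ws ==> Prj T (length ws) i \<bullet> tuple T m ws = ws ! i"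
 using tuple_is[of ws m] by (simp add: is_tuple_def)

lemma Prj_hom: "i < n ==> in_hom (TCat T) (Prj T n i) n 1" using Prj_words words_iff by blast

lemma tuple_eqI: assumes "set ws \<subseteq> words T m" "in_hom (TCat T) h m (length ws)"
  "\<And>i. i < length ws ==> Prj T (length ws) i \<bullet> h = ws ! i" shows "h = tuple T m ws"
 using T_product[OF assms(1)] tuple_is[OF assms(1)] assms(2,3) by (auto simp: is_tuple_def in_hom_def)

lemma tuple_comp: assumes ws: "set ws \<subseteq> words T m" and h: "in_hom (TCat T) h l m"
 shows "tuple T m ws \<bullet> h = tuple T l (map (\<lambda>w. w \<bullet> h) ws)"
proof (rule tuple_eqI)
 show "set (map (\<lambda>w. w \<bullet> h) ws) \<subseteq> words T l"
  using ws T.in_hom_comp[OF h] by (auto simp: words_iff)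
 show "in_hom (TCat T) (tuple T m ws \<bullet> h) l (length (map (\<lambda>w. w \<bullet> h) ws))"
  using T.in_hom_comp[OF h tuple_hom[OF ws]] by simp
 show "Prj T (length (map (\<lambda>w. w \<bullet> h) ws)) i \<bullet> (tuple T m ws \<bullet> h) = map (\<lambda>w. w \<bullet> h) ws ! i"
  if "i < length (map (\<lambda>w. w \<bullet> h) ws)" for i
  using that T.in_hom_assoc[OF h tuple_hom[OF ws] Prj_hom] Prj_tuple[OF ws] by simp
qed

lemma set_Prj: "set fs \<subseteq> {..<l} ==> set (map (Prj T l) fs) \<subseteq> words T l" using Prj_words by auto

lemma ren_hom: "set fs \<subseteq> {..<l} ==> in_hom (TCat T) (ren l fs) l (length fs)"
 using tuple_hom[OF set_Prj] by simp

lemma ren_ide: "ren n [0..<n] = Ide (TCat T) n"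
proof (rule tuple_eqI[symmetric])
 show "set (map (Prj T n) [0..<n]) \<subseteq> words T n" by (rule set_Prj) auto
 show "in_hom (TCat T) (Ide (TCat T) n) n (length (map (Prj T n) [0..<n]))"
  using T.in_hom_ide[of n] by (simp add: T_Obj)
 show "Prj T (length (map (Prj T n) [0..<n])) i \<bullet> Ide (TCat T) n = map (Prj T n) [0..<n] ! i"
  if "i < length (map (Prj T n) [0..<n])" for i using that T.in_hom_ide_right[OF Prj_hom] by simp
qed

lemma ren_tuple: assumes "set fs \<subseteq> {..<length ws}" "set ws \<subseteq> words T m" "n = length ws"
 shows "ren n fs \<bullet> tuple T m ws = tuple T m (map ((!) ws) fs)"
proof -
 have "map (\<lambda>w. w \<bullet> tuple T m ws) (map (Prj T (length ws)) fs) = map ((!) ws) fs"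
  using assms Prj_tuple[OF assms(2)] by (auto simp: subset_eq)
 then show ?thesis using tuple_comp[OF set_Prj[OF assms(1)] tuple_hom[OF assms(2)]] assms(3) by (simp del: map_map)
qed

lemma ren_comp: assumes "set fs \<subseteq> {..<length gs}" "set gs \<subseteq> {..<m}" "n = length gs"
 shows "ren n fs \<bullet> ren m gs = ren m (map ((!) gs) fs)"
proof -
 have "map ((!) (map (Prj T m) gs)) fs = map (Prj T m) (map ((!) gs) fs)" using assms(1) by (auto simp: subset_eq)
 then show ?thesis using ren_tuple[of fs "map (Prj T m) gs" m n] set_Prj[OF assms(2)] assms by (simp del: map_map)
qed

lemma subst_words: assumes "w \<in> words T (length fs)" "set fs \<subseteq> {..<l}"
 shows "subst_word T l fs w \<in> words T l"
 using T.in_hom_comp[OF ren_hom[OF assms(2)]] assms(1) by (simp add: words_iff subst_word_def)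

text \<open>The morphism \<open>(w_1, ..., w_k)\<close> from \<open>n_1 + ... + n_k\<close> to
  \<open>k\<close>, isolated from \<open>gam\<close> so that iterated substitutions become
  composites in \<open>T\<close>.\<close>

definition gtup :: "'t list \<Rightarrow> 't" where "gtup ws = (let ns = ars T ws in
  tuple T (sum_list ns) (map (\<lambda>i. ws ! i \<bullet> ren (sum_list ns) (block_incl ns i)) [0..<length ws]))"

lemma gam_gtup: "gam T w ws = w \<bullet> gtup ws" by (simp add: gam_def gtup_def subst_word_def Let_def)

lemma nth_words: "set ws \<subseteq> all_words T ==> i < length ws ==> in_hom (TCat T) (ws ! i) (arity T (ws ! i)) 1"
 using all_words_iff words_iff nth_mem by blast

lemma block_ren_hom: "i < length ws ==> in_hom (TCat T) (ren (sum_list (ars T ws)) (block_incl (ars T ws) i))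
  (sum_list (ars T ws)) (arity T (ws ! i))" using ren_hom[OF set_block_incl, of i "ars T ws"] by simp

lemma gtup_components: assumes "set ws \<subseteq> all_words T"
 shows "set (map (\<lambda>i. ws ! i \<bullet> ren (sum_list (ars T ws)) (block_incl (ars T ws) i))
  [0..<length ws]) \<subseteq> words T (sum_list (ars T ws))"
 using T.in_hom_comp[OF block_ren_hom nth_words[OF assms]] by (auto simp: words_iff)

lemma gtup_hom: assumes "set ws \<subseteq> all_words T"
 shows "in_hom (TCat T) (gtup ws) (sum_list (ars T ws)) (length ws)"
 using tuple_hom[OF gtup_components[OF assms]] by (simp add: gtup_def Let_def)

lemma gam_words: assumes "w \<in> words T (length ws)" "set ws \<subseteq> all_words T"
 shows "gam T w ws \<in> words T (sum_list (ars T ws))"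
 using T.in_hom_comp[OF gtup_hom[OF assms(2)]] assms(1) by (simp add: words_iff gam_gtup)

lemma unit_words: "unit_word T \<in> words T 1" by (simp add: unit_word_def Prj_words)

lemma gtup_ren:
 assumes ws: "set ws \<subseteq> all_words T" and fs: "set fs \<subseteq> {..<m}" "length fs = sum_list (ars T ws)"
 shows "gtup ws \<bullet> ren m fs =
  tuple T m (map (\<lambda>i. ws ! i \<bullet> ren m (map ((!) fs) (block_incl (ars T ws) i))) [0..<length ws])"
proof -
 let ?ns = "ars T ws"
 have "(ws ! i \<bullet> ren (sum_list ?ns) (block_incl ?ns i)) \<bullet> ren m fs =
   ws ! i \<bullet> ren m (map ((!) fs) (block_incl ?ns i))" if "i < length ws" for i
 proof -
  have "set (block_incl ?ns i) \<subseteq> {..<length fs}" using set_block_incl[of i ?ns] that fs(2) by simp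
  note r = ren_comp[OF this fs(1) fs(2)[symmetric]]
  show ?thesis unfolding r[symmetric]
   by (rule T.in_hom_assoc[OF ren_hom[OF fs(1), unfolded fs(2)] block_ren_hom[OF that]
    nth_words[OF ws that], symmetric])
 qed
 then have "map (\<lambda>w. w \<bullet> ren m fs)
   (map (\<lambda>i. ws ! i \<bullet> ren (sum_list ?ns) (block_incl ?ns i)) [0..<length ws]) =
  map (\<lambda>i. ws ! i \<bullet> ren m (map ((!) fs) (block_incl ?ns i))) [0..<length ws]"
  by (intro nth_equalityI) (simp_all del: map_map)
 then show ?thesis using tuple_comp[OF gtup_components[OF ws] ren_hom[OF fs(1), unfolded fs(2)]]
  by (simp only: gtup_def Let_def)
qed

lemma subst_gam: assumes w: "w \<in> words T (length ws)" and ws: "set ws \<subseteq> all_words T"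
  and fs: "set fs \<subseteq> {..<m}" "length fs = sum_list (ars T ws)" shows "subst_word T m fs (gam T w ws) =
  w \<bullet> tuple T m (map (\<lambda>i. ws ! i \<bullet> ren m (map ((!) fs) (block_incl (ars T ws) i))) [0..<length ws])"
 using T.in_hom_assoc[OF ren_hom[OF fs(1), unfolded fs(2)] gtup_hom[OF ws], of w 1] w gtup_ren[OF ws fs]
 by (simp add: subst_word_def gam_gtup words_iff)

text \<open>By associativity in \<open>T\<close> both sides are \<open>w\<close> composed with a
  morphism into the object \<open>length ws\<close>, so the components of these two morphisms are
  compared. Component \<open>i\<close> of \<open>gtup ws\<close> sees only block \<open>i\<close> of
  the flattened list.\<close>

theorem gam_assoc: assumes w: "w \<in> words T (length ws)" and ws: "set ws \<subseteq> all_words T"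
  and len: "map length wss = ars T ws" and us: "\<forall>us\<in>set wss. set us \<subseteq> all_words T"
 shows "gam T (gam T w ws) (concat wss) = gam T w (map2 (gam T) ws wss)"
proof -
 let ?ns = "ars T ws" and ?vs = "concat wss"
 let ?ms = "ars T ?vs" and ?ms' = "ars T (map2 (gam T) ws wss)"
 let ?N = "sum_list ?ns" and ?M = "sum_list ?ms"
 have k: "length wss = length ws" using arg_cong[OF len, of length] by simp
 have li: "length (wss ! i) = arity T (ws ! i)" if "i < length ws" for i
  using arg_cong[OF len, of "\<lambda>xs. xs ! i"] that k by simp
 have us': "set (wss ! i) \<subseteq> all_words T" if "i < length ws" for i using us that k by auto
 have vs: "set ?vs \<subseteq> all_words T" using us by auto
 have N: "?N = length ?vs" by (simp add: length_concat len)
 have g: "gam T (ws ! i) (wss ! i) \<in> words T (sum_list (ars T (wss ! i)))" if "i < length ws" for i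
  by (rule gam_words[OF _ us'[OF that]]) (use nth_words[OF ws that] in \<open>simp add: words_iff li[OF that]\<close>)
 have ms': "?ms' = map (\<lambda>us. sum_list (ars T us)) wss"
  using k arity_words[OF g] by (intro nth_equalityI) simp_all
 have M: "sum_list ?ms' = ?M" unfolding ms' by (simp only: sum_list_map_concat)
 \<comment> \<open>The inclusion of block \<open>i\<close> selects the words of
   \<open>wss ! i\<close>, but with variables in the full sum \<open>?M\<close>; factoring this
   renaming out leaves \<open>gtup (wss ! i)\<close> composed with the inclusion of the
   \<open>i\<close>-th large block.\<close>
 have comp: "(ws ! i \<bullet> ren ?N (block_incl ?ns i)) \<bullet> gtup ?vs =
   gam T (ws ! i) (wss ! i) \<bullet> ren ?M (block_incl ?ms' i)" if i: "i < length ws" for i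
 proof -
  have b: "set (block_incl ?ns i) \<subseteq> {..<?N}" "set (block_incl ?ms' i) \<subseteq> {..<?M}"
   using set_block_incl[of i ?ns] set_block_incl[of i ?ms'] i k by (auto simp only: M length_map) auto
  let ?Ni = "sum_list (ars T (wss ! i))"
  have lb: "length (block_incl ?ms' i) = ?Ni" unfolding length_block_incl ms' using i k by simp
  \<comment> \<open>The \<open>q\<close>-th word of block \<open>i\<close> owns a stretch of
    variables inside the \<open>i\<close>-th large block; its position in the full sum and its
    position relative to that block agree by \<open>offset_concat\<close>.\<close>
  have el: "?vs ! (offset ?ns i + q) \<bullet> ren ?M (block_incl ?ms (offset ?ns i + q)) =
    wss ! i ! q \<bullet> ren ?M (map ((!) (block_incl ?ms' i)) (block_incl (ars T (wss ! i)) q))"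
   if q: "q < arity T (ws ! i)" for q
  proof -
   have q': "q < length (wss ! i)" using q li[OF i] by simp
   have v: "?vs ! (offset ?ns i + q) = wss ! i ! q" using nth_concat[of i wss q] q' i k len by simp
   have o: "offset ?ms (offset ?ns i + q) = offset ?ms' i + offset (ars T (wss ! i)) q"
    using offset_concat[of i wss q "arity T"] q' i k unfolding len ms' by simp
   have p: "offset ?ns i + q < length ?vs" using offset_less[of i ?ns q] i q N by simp
   have "block_incl ?ms (offset ?ns i + q) = map ((!) (block_incl ?ms' i)) (block_incl (ars T (wss ! i)) q)"
   proof (rule nth_equalityI)
    show "length (block_incl ?ms (offset ?ns i + q)) =
      length (map ((!) (block_incl ?ms' i)) (block_incl (ars T (wss ! i)) q))" using p q' v by simp
    fix r assume "r < length (block_incl ?ms (offset ?ns i + q))"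
    then have r: "r < arity T (wss ! i ! q)" using p v by simp
    have "offset (ars T (wss ! i)) q + r < ?Ni" using offset_less[of q "ars T (wss ! i)" r] q' r by simp
    then have "offset (ars T (wss ! i)) q + r < ?ms' ! i" using lb by simp
    then show "block_incl ?ms (offset ?ns i + q) ! r =
      map ((!) (block_incl ?ms' i)) (block_incl (ars T (wss ! i)) q) ! r"
     using p q' r v o by (simp del: nth_map add: nth_map[of _ "block_incl _ _"] nth_map[of q] nth_map[of "offset _ _ + q"])
   qed
   then show ?thesis using v by simp
  qed
  have "ren ?N (block_incl ?ns i) \<bullet> gtup ?vs = tuple T ?M (map ((!) (map (\<lambda>i. ?vs ! i \<bullet> ren ?M (block_incl ?ms i))
    [0..<length ?vs])) (block_incl ?ns i))"
   unfolding gtup_def Let_def by (rule ren_tuple[OF _ gtup_components[OF vs]]) (use b N in auto)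
  also have "map ((!) (map (\<lambda>i. ?vs ! i \<bullet> ren ?M (block_incl ?ms i)) [0..<length ?vs])) (block_incl ?ns i) =
    map (\<lambda>q. wss ! i ! q \<bullet> ren ?M (map ((!) (block_incl ?ms' i)) (block_incl (ars T (wss ! i)) q)))
     [0..<length (wss ! i)]"
  proof (rule nth_equalityI)
   fix q assume "q < length (map ((!) (map (\<lambda>i. ?vs ! i \<bullet> ren ?M (block_incl ?ms i)) [0..<length ?vs])) (block_incl ?ns i))"
   then have q: "q < arity T (ws ! i)" using i by simp
   have p: "offset ?ns i + q < length ?vs" using offset_less[of i ?ns q] i q N by simp
   show "map ((!) (map (\<lambda>i. ?vs ! i \<bullet> ren ?M (block_incl ?ms i)) [0..<length ?vs])) (block_incl ?ns i) ! q =
    map (\<lambda>q. wss ! i ! q \<bullet> ren ?M (map ((!) (block_incl ?ms' i)) (block_incl (ars T (wss ! i)) q)))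
     [0..<length (wss ! i)] ! q" using el[OF q] q p i li[OF i] by simp
  qed (use i li in simp)
  also have "tuple T ?M \<dots> = gtup (wss ! i) \<bullet> ren ?M (block_incl ?ms' i)"
   by (rule gtup_ren[OF us'[OF i] b(2) lb, symmetric])
  finally have e: "ren ?N (block_incl ?ns i) \<bullet> gtup ?vs = gtup (wss ! i) \<bullet> ren ?M (block_incl ?ms' i)" .
  show ?thesis using T.in_hom_assoc[OF gtup_hom[OF vs, folded N] block_ren_hom[OF i] nth_words[OF ws i]] e
    T.in_hom_assoc[OF ren_hom[OF b(2), unfolded lb] gtup_hom[OF us'[OF i], unfolded li[OF i]] nth_words[OF ws i]]
   by (simp add: gam_gtup)
 qed
 have "gtup ws \<bullet> gtup ?vs = tuple T ?M (map (\<lambda>i. gam T (ws ! i) (wss ! i) \<bullet> ren ?M (block_incl ?ms' i)) [0..<length ws])"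
 proof -
  have "map (\<lambda>w. w \<bullet> gtup ?vs) (map (\<lambda>i. ws ! i \<bullet> ren ?N (block_incl ?ns i)) [0..<length ws]) =
   map (\<lambda>i. gam T (ws ! i) (wss ! i) \<bullet> ren ?M (block_incl ?ms' i)) [0..<length ws]"
   using comp by (intro nth_equalityI) (simp_all del: map_map)
  then show ?thesis using tuple_comp[OF gtup_components[OF ws] gtup_hom[OF vs, folded N]]
   by (simp only: gtup_def[of ws] Let_def)
 qed
 also have "\<dots> = gtup (map2 (gam T) ws wss)" unfolding gtup_def Let_def M using k
  by (intro arg_cong[of _ _ "tuple T ?M"] nth_equalityI) (simp_all del: map_map)
 finally show ?thesis using T.in_hom_assoc[OF gtup_hom[OF vs, folded N] gtup_hom[OF ws]] w
  by (simp add: gam_gtup words_iff)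
qed

text \<open>All blocks have length one, so the block inclusions are single indices and the tuple of
  units is the identity renaming.\<close>

lemma gam_unit_right: assumes "w \<in> words T k" shows "gam T w (replicate k (unit_word T)) = w"
proof -
 have o: "offset (replicate k 1) i = i" if "i < k" for i using that by (simp add: offset_def sum_list_replicate)
 have "Prj T 1 0 \<bullet> ren k [i] = Prj T k i" if "i < k" for i
  using Prj_tuple[of "[Prj T k i]" k 0] Prj_words[OF that] by simp
 then have "gtup (replicate k (unit_word T)) = ren k [0..<k]"
  using arity_words[OF unit_words] o by (auto simp: gtup_def Let_def sum_list_replicate block_incl_def unit_word_def
    upt_rec[of _ "Suc _"] intro!: arg_cong[of _ _ "tuple T k"])
 then show ?thesis using assms by (simp add: gam_gtup ren_ide words_iff T.in_hom_ide_right)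
qed

lemma gam_unit_left: assumes "w \<in> words T k" shows "gam T (unit_word T) [w] = w"
proof -
 have "block_incl [k] 0 = [0..<k]" by (simp add: block_incl_def offset_def)
 then have "gtup [w] = tuple T k [w]"
  using assms by (simp add: gtup_def ren_ide words_iff T.in_hom_ide_right[of w k] arity_words[OF assms])
 then show ?thesis using Prj_tuple[of "[w]" k 0] assms by (simp add: gam_gtup unit_word_def)
qed

text \<open>The dual of \<open>f\<close> composed with \<open>gtup vs\<close> selects the components
  of \<open>gtup vs\<close> at the values of \<open>f\<close>. On the other side
  \<open>block_map\<close>, restricted to block \<open>i\<close>, is the inclusion of block
  \<open>fs ! i\<close>, which yields the same components.\<close>

lemma gam_subst_outer: assumes w: "w \<in> words T (length fs)" and fs: "set fs \<subseteq> {..<length vs}"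
  and vs: "set vs \<subseteq> all_words T" and ns: "ns = ars T vs"
 shows "subst_word T (sum_list ns) (block_map ns fs) (gam T w (map ((!) vs) fs)) =
  gam T (subst_word T (length vs) fs w) vs"
proof -
 let ?us = "map ((!) vs) fs" and ?M = "sum_list ns" and ?bm = "block_map ns fs"
 have l: "fs ! i < length vs" if "i < length fs" for i using fs that nth_mem by blast
 have us: "set ?us \<subseteq> all_words T" using vs l by (auto simp: in_set_conv_nth) (metis nth_mem subsetD)
 have ar: "ars T ?us = map length (map (block_incl ns) fs)" using l by (auto simp: ns in_set_conv_nth)
 have bm: "set ?bm \<subseteq> {..<?M}" "length ?bm = sum_list (ars T ?us)"
  using set_block_incl[of _ ns] fs unfolding ar by (auto simp: block_map_def ns length_concat)
 have "subst_word T ?M ?bm (gam T w ?us) = w \<bullet> tuple T ?M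
   (map (\<lambda>i. ?us ! i \<bullet> ren ?M (map ((!) ?bm) (block_incl (ars T ?us) i))) [0..<length ?us])"
  by (rule subst_gam[OF _ us bm]) (use w in simp)
 also have "map (\<lambda>i. ?us ! i \<bullet> ren ?M (map ((!) ?bm) (block_incl (ars T ?us) i))) [0..<length ?us] =
   map ((!) (map (\<lambda>i. vs ! i \<bullet> ren ?M (block_incl ns i)) [0..<length vs])) fs"
 proof (rule nth_equalityI)
  fix i assume "i < length (map (\<lambda>i. ?us ! i \<bullet>
   ren ?M (map ((!) ?bm) (block_incl (ars T ?us) i))) [0..<length ?us])"
  then have i: "i < length fs" by simp
  have "map ((!) ?bm) (block_incl (ars T ?us) i) = block_incl ns (fs ! i)"
   unfolding ar block_map_def using i by (subst nth_concat_block) simp_all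
  then show "map (\<lambda>i. ?us ! i \<bullet> ren ?M (map ((!) ?bm) (block_incl (ars T ?us) i)))
    [0..<length ?us] ! i = map ((!) (map (\<lambda>i. vs ! i \<bullet> ren ?M (block_incl ns i)) [0..<length vs])) fs ! i"
   using i l[OF i] by (simp del: map_map)
 qed simp
 also have "tuple T ?M \<dots> = ren (length vs) fs \<bullet> gtup vs" unfolding gtup_def Let_def ns
  by (rule ren_tuple[symmetric, OF _ gtup_components[OF vs]]) (use fs in auto)
 also have "w \<bullet> \<dots> = gam T (subst_word T (length vs) fs w) vs"
  using T.in_hom_assoc[OF gtup_hom[OF vs] ren_hom[OF fs]] w by (simp add: gam_gtup subst_word_def words_iff)
 finally show ?thesis .
qed

text \<open>On block \<open>i\<close> the block sum is \<open>gss ! i\<close> followed by the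
  inclusion of the \<open>i\<close>-th target block, so by duality the renaming can be absorbed into
  the word \<open>ws ! i\<close>. The remaining clauses are the side conditions under which
  coherence cells are formed for these words.\<close>

lemma gam_subst_inner: assumes w: "w \<in> words T (length ws)" and ws: "set ws \<subseteq> all_words T"
  and len: "length gss = length ws" "length ms = length ws"
  and gss: "\<forall>i<length ws. length (gss ! i) = arity T (ws ! i) \<and> set (gss ! i) \<subseteq> {..<ms ! i}"
 shows "subst_word T (sum_list ms) (block_sum ms gss) (gam T w ws) =
  gam T w (map (\<lambda>i. subst_word T (ms ! i) (gss ! i) (ws ! i)) [0..<length ws])"
  and "ars T (map (\<lambda>i. subst_word T (ms ! i) (gss ! i) (ws ! i)) [0..<length ws]) = ms"
  and "set (map (\<lambda>i. subst_word T (ms ! i) (gss ! i) (ws ! i)) [0..<length ws]) \<subseteq> all_words T"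
  and "set (block_sum ms gss) \<subseteq> {..<sum_list ms}" and "length (block_sum ms gss) = sum_list (ars T ws)"
proof -
 let ?us = "map (\<lambda>i. subst_word T (ms ! i) (gss ! i) (ws ! i)) [0..<length ws]"
 let ?bs = "block_sum ms gss" and ?M = "sum_list ms"
 have u: "subst_word T (ms ! i) (gss ! i) (ws ! i) \<in> words T (ms ! i)" if "i < length ws" for i
  using subst_words[of "ws ! i" "gss ! i" "ms ! i"] nth_words[OF ws that] gss that by (simp add: words_iff)
 show ar: "ars T ?us = ms" using arity_words[OF u] len by (intro nth_equalityI) auto
 show us: "set ?us \<subseteq> all_words T" proof (rule subsetI)
  fix v assume "v \<in> set ?us"
  then obtain i where "i < length ws" "v = subst_word T (ms ! i) (gss ! i) (ws ! i)" by auto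
  then show "v \<in> all_words T" using words_all[OF u] by simp
 qed
 \<comment> \<open>The block sum is the concatenation of these shifted lists, so
   \<open>nth_concat_block\<close> reads off its block \<open>i\<close>.\<close>
 let ?xss = "map (\<lambda>i. map (\<lambda>j. offset ms i + j) (gss ! i)) [0..<length gss]"
 have arw: "ars T ws = map length ?xss" using gss len by (intro nth_equalityI) auto
 show bs: "set ?bs \<subseteq> {..<?M}" using gss len offset_less[of _ ms] by (fastforce simp: block_sum_def)
 show lb: "length ?bs = sum_list (ars T ws)" unfolding arw by (simp add: block_sum_def length_concat)
 have "subst_word T ?M ?bs (gam T w ws) = w \<bullet> tuple T ?M
   (map (\<lambda>i. ws ! i \<bullet> ren ?M (map ((!) ?bs) (block_incl (ars T ws) i))) [0..<length ws])"
  by (rule subst_gam[OF w ws bs lb])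
 also have "map (\<lambda>i. ws ! i \<bullet> ren ?M (map ((!) ?bs) (block_incl (ars T ws) i))) [0..<length ws] =
   map (\<lambda>i. ?us ! i \<bullet> ren ?M (block_incl ms i)) [0..<length ?us]"
 proof (rule map_cong)
  fix i assume "i \<in> set [0..<length ?us]"
  then have i: "i < length ws" by simp
  have b: "set (block_incl ms i) \<subseteq> {..<?M}" using set_block_incl[of i ms] i len by simp
  have g: "set (gss ! i) \<subseteq> {..<ms ! i}" "length (gss ! i) = arity T (ws ! i)" using gss i by auto
  have "map ((!) ?bs) (block_incl (ars T ws) i) = map (\<lambda>j. offset ms i + j) (gss ! i)"
   unfolding arw block_sum_def using i len by (subst nth_concat_block) auto
  also have "\<dots> = map ((!) (block_incl ms i)) (gss ! i)" using g(1) by (auto simp: subset_eq)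
  finally have e: "map ((!) ?bs) (block_incl (ars T ws) i) = map ((!) (block_incl ms i)) (gss ! i)" .
  have g1: "set (gss ! i) \<subseteq> {..<length (block_incl ms i)}" using g by simp
  have r: "ren ?M (map ((!) (block_incl ms i)) (gss ! i)) = ren (ms ! i) (gss ! i) \<bullet> ren ?M (block_incl ms i)"
   by (rule ren_comp[OF g1 b, symmetric]) simp
  have u: "?us ! i = ws ! i \<bullet> ren (ms ! i) (gss ! i)" using i by (simp add: subst_word_def)
  show "ws ! i \<bullet> ren ?M (map ((!) ?bs) (block_incl (ars T ws) i)) =
    ?us ! i \<bullet> ren ?M (block_incl ms i)" unfolding e r u
   by (rule T.in_hom_assoc[OF ren_hom[OF b, unfolded length_block_incl] ren_hom[OF g(1)]
     nth_words[OF ws i, folded g(2)]])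
 qed simp
 also have "w \<bullet> tuple T ?M \<dots> = gam T w ?us" unfolding gam_gtup gtup_def Let_def ar ..
 finally show "subst_word T ?M ?bs (gam T w ws) = gam T w ?us" .
qed

lemma subst_comp:
 assumes "w \<in> words T (length fs)" "set fs \<subseteq> {..<length gs}" "set gs \<subseteq> {..<m}"
 shows "subst_word T m gs (subst_word T (length gs) fs w) = subst_word T m (map ((!) gs) fs) w"
 using T.in_hom_assoc[OF ren_hom[OF assms(3)] ren_hom[OF assms(2)]] assms ren_comp[OF assms(2,3)]
 by (simp add: subst_word_def words_iff)

lemma subst_id: "w \<in> words T k ==> subst_word T k [0..<k] w = w"
 by (simp add: subst_word_def ren_ide words_iff T.in_hom_ide_right)

end

section \<open>Pointwise form of morphisms and cells of pseudo algebras\<close>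

lemma map2_map1: "map2 f (map g xs) ys = map2 (\<lambda>x y. f (g x) y) xs ys"
 by (simp add: zip_map1 comp_def split_def)

lemma pow_func_Obj: "is_functor A B H ==> xs \<in> powO A n ==> map (FO H) xs \<in> powO B n"
 by (auto simp: powO_iff fun_obj)

lemma pow_func_in_hom: "is_functor A B H ==> powH A n fs xs ys ==>
  powH B n (map (FA H) fs) (map (FO H) xs) (map (FO H) ys)" by (auto simp: powH_iff fun_hom)

lemma pow_func_comp: assumes G: "is_functor A B G" and H: "is_functor B C H"
 shows "pow_func n (comp_func H G) = comp_func (pow_func n H) (pow_func n G)"
 by (rule func_eqI[OF pow_functor[OF comp_functor[OF G H]] comp_functor[OF pow_functor[OF G] pow_functor[OF H]]])
  (use pow_func_Obj[OF G] in_homI[THEN pow_func_in_hom[OF G], THEN in_homD(1)] in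
   \<open>auto simp: fun_dom[OF G] fun_dom[OF H] powO_iff powA_iff in_set_conv_nth
    fun_obj[OF G] is_functor.FA_arr[OF G] simp del: pow_cat_simps\<close>)

lemma pow_func_id: "category A ==> pow_func n (id_func A) = id_func (pow_cat A n)"
 by (rule func_eqI[OF pow_functor[OF id_functor] id_functor[OF pow_category]])
  (auto simp: powO_iff powA_iff in_set_conv_nth intro!: map_idI)

text \<open>Together with the similar identities below, this matches the boundaries of the two sides
  of the morphism axioms; only after that can the axioms be compared by components.\<close>

lemma pow_prod: assumes X: "category X" and len: "length Fs = length ns"
  and F: "\<And>i. i < length ns ==> is_functor (pow_cat X (ns ! i)) Y (Fs ! i)" and H: "is_functor Y Z H"
 shows "comp_func (pow_func (length ns) H) (prod_func X Y ns Fs) = prod_func X Z ns (map (comp_func H) Fs)"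
proof (rule func_eqI)
 note P = prod_functor[OF X is_functor.dom_cat[OF H] len F]
 interpret P: is_functor "pow_cat X (sum_list ns)" "pow_cat Y (length ns)" "prod_func X Y ns Fs" by (rule P)
 show "is_functor (pow_cat X (sum_list ns)) (pow_cat Z (length ns))
   (comp_func (pow_func (length ns) H) (prod_func X Y ns Fs))" by (rule comp_functor[OF P pow_functor[OF H]])
 show "is_functor (pow_cat X (sum_list ns)) (pow_cat Z (length ns)) (prod_func X Z ns (map (comp_func H) Fs))"
  by (rule prod_functor[OF X is_functor.cod_cat[OF H]]) (use len comp_functor[OF F H] in auto)
 show "FO (comp_func (pow_func (length ns) H) (prod_func X Y ns Fs)) x =
   FO (prod_func X Z ns (map (comp_func H) Fs)) x" if x: "x \<in> powO X (sum_list ns)" for x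
  using P.FO_obj[OF x] x len blocks_Obj[OF x] fun_dom[OF F] by (auto simp: fun_dom[OF H] intro!: nth_equalityI)
 show "FA (comp_func (pow_func (length ns) H) (prod_func X Y ns Fs)) x =
   FA (prod_func X Z ns (map (comp_func H) Fs)) x" if x: "x \<in> powA X (sum_list ns)" for x
  using P.FA_arr[OF x] x len blocks_Arr[OF x] fun_dom[OF F] by (auto simp: fun_dom[OF H] intro!: nth_equalityI)
qed

lemma prod_pow: assumes H: "is_functor X Y H" and Z: "category Z" and len: "length Gs = length ns"
  and G: "\<And>i. i < length ns ==> is_functor (pow_cat Y (ns ! i)) Z (Gs ! i)"
 shows "comp_func (prod_func Y Z ns Gs) (pow_func (sum_list ns) H) =
  prod_func X Z ns (map2 (\<lambda>G n. comp_func G (pow_func n H)) Gs ns)"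
proof (rule func_eqI)
 note P = prod_functor[OF is_functor.cod_cat[OF H] Z len G]
 show "is_functor (pow_cat X (sum_list ns)) (pow_cat Z (length ns))
   (comp_func (prod_func Y Z ns Gs) (pow_func (sum_list ns) H))" by (rule comp_functor[OF pow_functor[OF H] P])
 show "is_functor (pow_cat X (sum_list ns)) (pow_cat Z (length ns))
   (prod_func X Z ns (map2 (\<lambda>G n. comp_func G (pow_func n H)) Gs ns))"
  by (rule prod_functor[OF is_functor.dom_cat[OF H] Z]) (use len comp_functor[OF pow_functor[OF H] G] in auto)
 show "FO (comp_func (prod_func Y Z ns Gs) (pow_func (sum_list ns) H)) x =
   FO (prod_func X Z ns (map2 (\<lambda>G n. comp_func G (pow_func n H)) Gs ns)) x"
  if x: "x \<in> powO X (sum_list ns)" for x using pow_func_Obj[OF H x] x len blocks_Obj[OF x]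
  by (auto simp: fun_dom[OF H] blocks_map intro!: nth_equalityI)
 show "FA (comp_func (prod_func Y Z ns Gs) (pow_func (sum_list ns) H)) x =
   FA (prod_func X Z ns (map2 (\<lambda>G n. comp_func G (pow_func n H)) Gs ns)) x"
  if x: "x \<in> powA X (sum_list ns)" for x
  using in_homD(1)[OF pow_func_in_hom[OF H in_homI[OF x]]] x len blocks_Arr[OF x]
  by (auto simp: fun_dom[OF H] blocks_map intro!: nth_equalityI)
qed

lemma reindex_pow: assumes H: "is_functor X Y H" and fs: "set fs \<subseteq> {..<l}"
 shows "comp_func (pow_func (length fs) H) (reindex X l fs) = comp_func (reindex Y l fs) (pow_func l H)"
proof (rule func_eqI)
 note R = reindex_functor[OF is_functor.dom_cat[OF H] fs] reindex_functor[OF is_functor.cod_cat[OF H] fs]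
 have l: "i < l" if "i \<in> set fs" for i using that fs by auto
 show "is_functor (pow_cat X l) (pow_cat Y (length fs)) (comp_func (pow_func (length fs) H) (reindex X l fs))"
  by (rule comp_functor[OF R(1) pow_functor[OF H]])
 show "is_functor (pow_cat X l) (pow_cat Y (length fs)) (comp_func (reindex Y l fs) (pow_func l H))"
  by (rule comp_functor[OF pow_functor[OF H] R(2)])
 show "FO (comp_func (pow_func (length fs) H) (reindex X l fs)) x =
   FO (comp_func (reindex Y l fs) (pow_func l H)) x" if x: "x \<in> powO X l" for x
  using pow_func_Obj[OF H x] fun_obj[OF R(1) x] x l
  by (auto simp: fun_dom[OF H] dest!: l) (auto simp: powO_iff dest!: l)
 show "FA (comp_func (pow_func (length fs) H) (reindex X l fs)) x =
   FA (comp_func (reindex Y l fs) (pow_func l H)) x" if x: "x \<in> powA X l" for x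
  using in_homD(1)[OF pow_func_in_hom[OF H in_homI[OF x]]] is_functor.FA_arr[OF R(1) x] x l
  by (auto simp: fun_dom[OF H] dest!: l) (auto simp: powA_iff dest!: l)
qed

lemma end_unit_pow: assumes H: "is_functor X Y H"
 shows "comp_func (end_unit Y) (pow_func 1 H) = comp_func H (end_unit X)"
proof (rule func_eqI)
 have hd: "hd (map f xs) = f (hd xs)" if "length xs = 1" for f :: "'z \<Rightarrow> 'y" and xs
  using that by (cases xs) auto
 note E = end_unit_functor[OF is_functor.dom_cat[OF H]] end_unit_functor[OF is_functor.cod_cat[OF H]]
 show "is_functor (pow_cat X 1) Y (comp_func (end_unit Y) (pow_func 1 H))"
  by (rule comp_functor[OF pow_functor[OF H] E(2)])
 show "is_functor (pow_cat X 1) Y (comp_func H (end_unit X))" by (rule comp_functor[OF E(1) H])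
 show "FO (comp_func (end_unit Y) (pow_func 1 H)) x = FO (comp_func H (end_unit X)) x" if x: "x \<in> powO X 1" for x
  using pow_func_Obj[OF H x] x x[unfolded powO_iff] by (simp add: fun_dom[OF H]) (cases x; simp)
 show "FA (comp_func (end_unit Y) (pow_func 1 H)) x = FA (comp_func H (end_unit X)) x" if x: "x \<in> powA X 1" for x
  using in_homD(1)[OF pow_func_in_hom[OF H in_homI[OF x]]] x x[unfolded powA_iff]
  by (simp add: fun_dom[OF H]) (cases x; simp)
qed

locale alg_over = is_theory T + pseudo_algebra T A for T :: "'t alg_theory" and A :: "('o, 'a, 't) psalg"
begin

sublocale Car: category "Car A" by (rule Car_category)

lemma Phi_word: "w \<in> all_words T ==> is_functor (pow_cat (Car A) (arity T w)) (Car A) (Phi A w)"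
 using Phi_functor all_words_iff by blast

lemma Phi_words: "set ws \<subseteq> all_words T ==> i < length ws ==>
  is_functor (pow_cat (Car A) (ars T ws ! i)) (Car A) (map (Phi A) ws ! i)"
 using Phi_word[OF subsetD[OF _ nth_mem]] by simp

lemma prod_Phi: "set ws \<subseteq> all_words T ==> is_functor (pow_cat (Car A) (sum_list (ars T ws)))
  (pow_cat (Car A) (length ws)) (prod_func (Car A) (Car A) (ars T ws) (map (Phi A) ws))"
 using prod_functor[OF Car_category Car_category, of "map (Phi A) ws" "ars T ws"] Phi_words[of ws] by simp

lemma prod_Phi_Obj: assumes "set ws \<subseteq> all_words T" "xs \<in> powO (Car A) (sum_list (ars T ws))"
 shows "map2 (PhiO A) ws (blocks (ars T ws) xs) \<in> powO (Car A) (length ws)"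
 using fun_obj[OF prod_Phi[OF assms(1)] assms(2)] assms(2) by (simp add: map2_map1)

lemma CohC_hom: assumes "w \<in> words T (length ws)" "set ws \<subseteq> all_words T"
  "xs \<in> powO (Car A) (sum_list (ars T ws))" shows "chom A (NC (CohC A w ws) xs) (PhiO A (gam T w ws) xs)
  (PhiO A w (map2 (PhiO A) ws (blocks (ars T ws) xs)))"
 using nat_hom[OF iso_nat[OF CohC_iso[OF assms(1,2)]] assms(3)] assms(3) by (simp add: end_gam_def map2_map1)

lemma CohI_hom: "xs \<in> powO (Car A) 1 ==> chom A (NC (CohI A) xs) (PhiO A (unit_word T) xs) (hd xs)"
 using nat_hom[OF iso_nat[OF CohI_iso], of xs] by simp

lemma CohS_hom: assumes "w \<in> words T (length fs)" "set fs \<subseteq> {..<l}" "xs \<in> powO (Car A) l"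
 shows "chom A (NC (CohS A w l fs) xs) (PhiO A (subst_word T l fs w) xs) (PhiO A w (map ((!) xs) fs))"
 using nat_hom[OF iso_nat[OF CohS_iso[OF assms(1,2)]] assms(3)] assms(3) by (simp add: end_subst_def)

end

text \<open>A morphism before its three coherence equations. Their equivalence with componentwise
  equations is proved at this level, so that it serves both to use the coherence equations and to
  establish them.\<close>

locale algmor_typed = A: alg_over T A + B: alg_over T B for T :: "'t alg_theory" and A B :: "('o, 'a, 't) psalg" +
 fixes H :: "('o, 'a, 't) algmor" assumes AFun: "is_functor (Car A) (Car B) (AFun H)"
  and ARho_iso: "w \<in> words T n ==> nat_iso (pow_cat (Car A) n) (Car B)
   (comp_func (AFun H) (Phi A w)) (comp_func (Phi B w) (pow_func n (AFun H))) (ARho H w)"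
begin

sublocale AFun: is_functor "Car A" "Car B" "AFun H" by (rule AFun)

lemma ARho_word: "w \<in> all_words T ==> nat_iso (pow_cat (Car A) (arity T w)) (Car B)
   (comp_func (AFun H) (Phi A w)) (comp_func (Phi B w) (pow_func (arity T w) (AFun H))) (ARho H w)"
 using ARho_iso A.all_words_iff by blast

lemma ARho_boundary: assumes "w \<in> all_words T" shows "NDom (ARho H w) = comp_func (AFun H) (Phi A w)"
  "NCod (ARho H w) = comp_func (Phi B w) (pow_func (arity T w) (AFun H))"
 using iso_nat[OF ARho_word[OF assms]] nat_trans.NDom nat_trans.NCod by blast+

lemma rho_hom: assumes "w \<in> words T n" "xs \<in> powO (Car A) n" shows "chom B (rho H w xs) (AO H (PhiO A w xs))
  (PhiO B w (map (AO H) xs))" using nat_hom[OF iso_nat[OF ARho_iso[OF assms(1)]] assms(2)] assms(2)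
  fun_dom[OF A.Phi_functor[OF assms(1)]] by (simp add: AFun.FDom)

lemma rho_iso: assumes "w \<in> words T n" "xs \<in> powO (Car A) n" shows "iso_arr (Car B) (rho H w xs)"
 using nat_iso.NC_iso[OF ARho_iso[OF assms(1)] assms(2)] .

lemma rho_nat: assumes "w \<in> words T n" "powH (Car A) n fs xs ys" shows "cmp B (rho H w ys) (AA H (PhiF A w fs)) =
  cmp B (PhiF B w (map (AA H) fs)) (rho H w xs)"
 using nat_trans.naturality_hom[OF iso_nat[OF ARho_iso[OF assms(1)]] assms(2)]
  in_homD(1)[OF assms(2)] fun_dom[OF A.Phi_functor[OF assms(1)]] by (simp add: AFun.FDom)

text \<open>Both sides run from \<open>H\<close> after the action of \<open>gam T w ws\<close> to
  the substituted actions after a power of \<open>H\<close>; \<open>pow_prod\<close> and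
  \<open>prod_pow\<close> are what makes the factors compose. Whiskering with identities then leaves
  the stated components.\<close>

lemma gam_iff: assumes w: "w \<in> words T (length ws)" and ws: "set ws \<subseteq> all_words T"
 defines "ns \<equiv> ars T ws" shows "vcomp_nat (hcomp_nat (CohC B w ws) (id_nat (pow_func (sum_list ns) (AFun H))))
    (ARho H (gam T w ws)) = vcomp_nat (hcomp_nat (id_nat (Phi B w)) (prod_nat (Car A) (Car B) ns (map (ARho H) ws)))
    (vcomp_nat (hcomp_nat (ARho H w) (id_nat (prod_func (Car A) (Car A) ns (map (Phi A) ws))))
     (hcomp_nat (id_nat (AFun H)) (CohC A w ws))) \<longleftrightarrow> (\<forall>xs\<in>powO (Car A) (sum_list ns).
   cmp B (NC (CohC B w ws) (map (AO H) xs)) (rho H (gam T w ws) xs) =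
   cmp B (PhiF B w (map2 (rho H) ws (blocks ns xs))) (cmp B (rho H w (map2 (PhiO A) ws (blocks ns xs)))
     (AA H (NC (CohC A w ws) xs))))" (is "?l = ?r \<longleftrightarrow> (\<forall>xs\<in>?O. ?lx xs = ?rx xs)")
proof -
 let ?h = "AFun H" and ?N = "sum_list ns" and ?k = "length ws"
 let ?PA = "prod_func (Car A) (Car A) ns (map (Phi A) ws)"
 let ?PB = "prod_func (Car B) (Car B) ns (map (Phi B) ws)"
 let ?R = "prod_nat (Car A) (Car B) ns (map (ARho H) ws)"
 have len: "length ns = ?k" by (simp add: ns_def)
 note g = A.gam_words[OF w ws, folded ns_def]
 note cA = iso_nat[OF A.CohC_iso[OF w ws, folded ns_def], unfolded end_gam_def]
 note cB = iso_nat[OF B.CohC_iso[OF w ws, folded ns_def], unfolded end_gam_def]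
 note rg = iso_nat[OF ARho_iso[OF g]] and rw = iso_nat[OF ARho_iso[OF w]]
 note PhA = A.Phi_functor[OF w] and PhB = B.Phi_functor[OF w]
 note PA = A.prod_Phi[OF ws, folded ns_def] and PB = B.prod_Phi[OF ws, folded ns_def]
 note pow = pow_functor[OF AFun, of ?N] and powk = pow_functor[OF AFun, of ?k]
 have ri: "i < ?k ==> ws ! i \<in> all_words T" for i using ws by auto
 have R: "nat_trans (pow_cat (Car A) ?N) (pow_cat (Car B) ?k)
  (prod_func (Car A) (Car B) ns (map NDom (map (ARho H) ws)))
  (prod_func (Car A) (Car B) ns (map NCod (map (ARho H) ws))) ?R"
  using prod_nat_trans[OF A.Car_category B.Car_category, of "map (ARho H) ws" ns] iso_nat[OF ARho_word[OF ri]]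
  by (simp add: ns_def ARho_boundary[OF ri])
 \<comment> \<open>The domains of the coherences are the composites of \<open>H\<close> with the
   actions of the \<open>ws\<close>; \<open>pow_prod\<close> rewrites their product as a power of
   \<open>H\<close> after the product of the actions, where the coherence of \<open>w\<close>
   ends.\<close>
 have dom: "prod_func (Car A) (Car B) ns (map NDom (map (ARho H) ws)) = comp_func (pow_func ?k ?h) ?PA"
 proof -
  have e: "map NDom (map (ARho H) ws) = map (comp_func ?h) (map (Phi A) ws)" using ARho_boundary(1) ws by auto
  show ?thesis unfolding e
   using pow_prod[OF A.Car_category, where Fs = "map (Phi A) ws" and ns = ns and Y = "Car A" and
     H = ?h and Z = "Car B"] A.Phi_words[OF ws] AFun by (simp add: ns_def del: map_map)
 qed
 have cod: "prod_func (Car A) (Car B) ns (map NCod (map (ARho H) ws)) = comp_func ?PB (pow_func ?N ?h)"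
 proof -
  have e: "map NCod (map (ARho H) ws) = map2 (\<lambda>G n. comp_func G (pow_func n ?h)) (map (Phi B) ws) ns"
   using ARho_boundary(2)[OF ri] by (intro nth_equalityI) (auto simp: ns_def)
  show ?thesis unfolding e using prod_pow[OF AFun B.Car_category, of "map (Phi B) ws" ns] B.Phi_words[OF ws]
   by (simp add: ns_def del: map_map)
 qed
 have L: "nat_trans (pow_cat (Car A) ?N) (Car B) (comp_func ?h (Phi A (gam T w ws)))
   (comp_func (Phi B w) (comp_func ?PB (pow_func ?N ?h))) ?l" unfolding comp_func_assoc[OF pow PB]
  by (rule vcomp_nat_trans[OF rg hcomp_id_right_trans[OF cB pow]])
 have R1: "nat_trans (pow_cat (Car A) ?N) (Car B) (comp_func ?h (Phi A (gam T w ws)))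
   (comp_func (Phi B w) (comp_func (pow_func ?k ?h) ?PA))
   (vcomp_nat (hcomp_nat (ARho H w) (id_nat ?PA)) (hcomp_nat (id_nat ?h) (CohC A w ws)))"
  unfolding comp_func_assoc[OF PA powk] using vcomp_nat_trans[OF hcomp_id_left_trans[OF cA AFun]
    hcomp_id_right_trans[OF rw PA, folded comp_func_assoc[OF PA PhA]]] .
 have R': "nat_trans (pow_cat (Car A) ?N) (Car B) (comp_func ?h (Phi A (gam T w ws)))
   (comp_func (Phi B w) (comp_func ?PB (pow_func ?N ?h))) ?r"
  by (rule vcomp_nat_trans[OF R1 hcomp_id_left_trans[OF R[unfolded dom cod] PhB]])
 have "NC ?l xs = ?lx xs" if xs: "xs \<in> ?O" for xs
  using xs hcomp_id_right[OF cB pow xs] fun_dom[OF A.Phi_functor[OF g]]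
  by (simp add: nat_trans.NDom[OF rg] AFun.FDom AFun.FCod)
 moreover have "NC ?r xs = ?rx xs" if xs: "xs \<in> ?O" for xs
  using xs hcomp_id_left[OF cA AFun xs] hcomp_id_right[OF rw PA xs] hcomp_id_left[OF R PhB xs]
   fun_dom[OF A.Phi_functor[OF g]] by (simp add: nat_trans.NDom[OF cA] AFun.FDom AFun.FCod map2_map1)
 ultimately show ?thesis using nat_eqI[OF L R'] by metis
qed

lemma unit_iff: "vcomp_nat (hcomp_nat (CohI B) (id_nat (pow_func 1 (AFun H)))) (ARho H (unit_word T)) =
    hcomp_nat (id_nat (AFun H)) (CohI A) \<longleftrightarrow> (\<forall>xs\<in>powO (Car A) 1.
   cmp B (NC (CohI B) (map (AO H) xs)) (rho H (unit_word T) xs) =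
   AA H (NC (CohI A) xs))" (is "?l = ?r \<longleftrightarrow> (\<forall>xs\<in>?O. ?lx xs = ?rx xs)")
proof -
 note cA = iso_nat[OF A.CohI_iso] and cB = iso_nat[OF B.CohI_iso]
 note ru = iso_nat[OF ARho_iso[OF A.unit_words]]
 note pow = pow_functor[OF AFun, of 1]
 have L: "nat_trans (pow_cat (Car A) 1) (Car B) (comp_func (AFun H) (Phi A (unit_word T)))
   (comp_func (AFun H) (end_unit (Car A))) ?l"
  using vcomp_nat_trans[OF ru hcomp_id_right_trans[OF cB pow, unfolded end_unit_pow[OF AFun]]] .
 have "NC ?l xs = ?lx xs" if xs: "xs \<in> ?O" for xs
  using xs hcomp_id_right[OF cB pow xs] fun_dom[OF A.Phi_functor[OF A.unit_words]]
  by (simp add: nat_trans.NDom[OF ru] AFun.FDom AFun.FCod)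
 moreover have "NC ?r xs = ?rx xs" if xs: "xs \<in> ?O" for xs using hcomp_id_left[OF cA AFun xs] .
 ultimately show ?thesis using nat_eqI[OF L hcomp_id_left_trans[OF cA AFun]] by metis
qed

lemma subst_iff: assumes w: "w \<in> words T (length fs)" and fs: "set fs \<subseteq> {..<l}" shows "vcomp_nat
    (hcomp_nat (CohS B w l fs) (id_nat (pow_func l (AFun H)))) (ARho H (subst_word T l fs w)) = vcomp_nat
    (hcomp_nat (ARho H w) (id_nat (reindex (Car A) l fs)))
    (hcomp_nat (id_nat (AFun H)) (CohS A w l fs)) \<longleftrightarrow> (\<forall>xs\<in>powO (Car A) l.
   cmp B (NC (CohS B w l fs) (map (AO H) xs)) (rho H (subst_word T l fs w) xs) =
   cmp B (rho H w (map ((!) xs) fs)) (AA H (NC (CohS A w l fs) xs)))"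
  (is "?l = ?r \<longleftrightarrow> (\<forall>xs\<in>?O. ?lx xs = ?rx xs)")
proof -
 note s = A.subst_words[OF w fs]
 note cA = iso_nat[OF A.CohS_iso[OF w fs], unfolded end_subst_def]
 note cB = iso_nat[OF B.CohS_iso[OF w fs], unfolded end_subst_def]
 note rs = iso_nat[OF ARho_iso[OF s]] and rw = iso_nat[OF ARho_iso[OF w]]
 note pow = pow_functor[OF AFun, of l] and powk = pow_functor[OF AFun, of "length fs"]
 note RA = reindex_functor[OF A.Car_category fs] and RB = reindex_functor[OF B.Car_category fs]
 have L: "nat_trans (pow_cat (Car A) l) (Car B) (comp_func (AFun H) (Phi A (subst_word T l fs w)))
   (comp_func (Phi B w) (comp_func (reindex (Car B) l fs) (pow_func l (AFun H)))) ?l"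
  unfolding comp_func_assoc[OF pow RB] by (rule vcomp_nat_trans[OF rs hcomp_id_right_trans[OF cB pow]])
 have R: "nat_trans (pow_cat (Car A) l) (Car B) (comp_func (AFun H) (Phi A (subst_word T l fs w)))
   (comp_func (Phi B w) (comp_func (reindex (Car B) l fs) (pow_func l (AFun H)))) ?r"
  unfolding reindex_pow[OF AFun fs, symmetric] comp_func_assoc[OF RA powk]
  by (rule vcomp_nat_trans[OF hcomp_id_left_trans[OF cA AFun]
     hcomp_id_right_trans[OF rw RA, folded comp_func_assoc[OF RA A.Phi_functor[OF w]]]])
 have "NC ?l xs = ?lx xs" if xs: "xs \<in> ?O" for xs
  using xs hcomp_id_right[OF cB pow xs] fun_dom[OF A.Phi_functor[OF s]]
  by (simp add: nat_trans.NDom[OF rs] AFun.FDom AFun.FCod)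
 moreover have "NC ?r xs = ?rx xs" if xs: "xs \<in> ?O" for xs
  using xs hcomp_id_left[OF cA AFun xs] hcomp_id_right[OF rw RA xs] fun_dom[OF A.Phi_functor[OF s]]
  by (simp add: nat_trans.NDom[OF cA] AFun.FDom AFun.FCod)
 ultimately show ?thesis using nat_eqI[OF L R] by metis
qed

end

locale algmor = is_theory T + algebra_morphism T A B H
 for T :: "'t alg_theory" and A B :: "('o, 'a, 't) psalg" and H :: "('o, 'a, 't) algmor"
begin

sublocale algmor_typed T A B H using A_alg B_alg AFun ARho_iso
 by (intro algmor_typed.intro alg_over.intro algmor_typed_axioms.intro is_theory_axioms)

lemma rho_gam: "[|w \<in> words T (length ws); set ws \<subseteq> all_words T;
  xs \<in> powO (Car A) (sum_list (ars T ws))|] ==> cmp B (NC (CohC B w ws) (map (AO H) xs)) (rho H (gam T w ws) xs) =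
   cmp B (PhiF B w (map2 (rho H) ws (blocks (ars T ws) xs)))
    (cmp B (rho H w (map2 (PhiO A) ws (blocks (ars T ws) xs))) (AA H (NC (CohC A w ws) xs)))"
 using gam_iff[of w ws] ARho_gam[OF _ _ refl, of w ws] by blast

lemma rho_unit: "xs \<in> powO (Car A) 1 ==> cmp B (NC (CohI B) (map (AO H) xs)) (rho H (unit_word T) xs) =
   AA H (NC (CohI A) xs)" using unit_iff ARho_unit by blast

lemma rho_subst: "[|w \<in> words T (length fs); set fs \<subseteq> {..<l}; xs \<in> powO (Car A) l|] ==>
   cmp B (NC (CohS B w l fs) (map (AO H) xs)) (rho H (subst_word T l fs w) xs) =
   cmp B (rho H w (map ((!) xs) fs)) (AA H (NC (CohS A w l fs) xs))"
 using subst_iff[of w fs l] ARho_subst[of w fs l] by blast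

end

lemma (in algmor_typed) algebra_morphismI: assumes "ADom H = A" "ACod H = B" "ARho H \<in> extensional (all_words T)"
  and "\<And>w ws xs. [|w \<in> words T (length ws); set ws \<subseteq> all_words T;
   xs \<in> powO (Car A) (sum_list (ars T ws))|] ==>
   cmp B (NC (CohC B w ws) (map (AO H) xs)) (rho H (gam T w ws) xs) =
   cmp B (PhiF B w (map2 (rho H) ws (blocks (ars T ws) xs)))
    (cmp B (rho H w (map2 (PhiO A) ws (blocks (ars T ws) xs))) (AA H (NC (CohC A w ws) xs)))"
  and "\<And>xs. xs \<in> powO (Car A) 1 ==> cmp B (NC (CohI B) (map (AO H) xs)) (rho H (unit_word T) xs) =
   AA H (NC (CohI A) xs)"
  and "\<And>w (l :: nat) fs xs. [|w \<in> words T (length fs); set fs \<subseteq> {..<l}; xs \<in> powO (Car A) l|] ==>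
   cmp B (NC (CohS B w l fs) (map (AO H) xs)) (rho H (subst_word T l fs w) xs) =
   cmp B (rho H w (map ((!) xs) fs)) (AA H (NC (CohS A w l fs) xs))" shows "algmor T A B H"
proof (intro algmor.intro algebra_morphism.intro)
 show "is_theory T" "pseudo_algebra T A" "pseudo_algebra T B" by unfold_locales
 fix w ws ns assume "w \<in> words T (length ws)" "set ws \<subseteq> all_words T" "ns = ars T ws"
 then show "vcomp_nat (hcomp_nat (CohC B w ws) (id_nat (pow_func (sum_list ns) (AFun H)))) (ARho H (gam T w ws)) =
   vcomp_nat (hcomp_nat (id_nat (Phi B w)) (prod_nat (Car A) (Car B) ns (map (ARho H) ws))) (vcomp_nat
     (hcomp_nat (ARho H w) (id_nat (prod_func (Car A) (Car A) ns (map (Phi A) ws))))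
     (hcomp_nat (id_nat (AFun H)) (CohC A w ws)))" using assms(4) by (simp add: gam_iff)
next
 fix w fs and l :: nat assume "w \<in> words T (length fs)" "set fs \<subseteq> {..<l}"
 then show "vcomp_nat (hcomp_nat (CohS B w l fs) (id_nat (pow_func l (AFun H)))) (ARho H (subst_word T l fs w)) =
   vcomp_nat (hcomp_nat (ARho H w) (id_nat (reindex (Car A) l fs))) (hcomp_nat (id_nat (AFun H)) (CohS A w l fs))"
  using assms(6) by (simp add: subst_iff)
qed (use assms unit_iff AFun ARho_iso in auto)

lemma algmor_eqI: assumes H: "algmor T A B H" and K: "algmor T A B K"
  and "\<And>x. x \<in> Obj (Car A) ==> AO H x = AO K x" and "\<And>f. f \<in> Arr (Car A) ==> AA H f = AA K f"
  and r: "\<And>w n xs. w \<in> words T n ==> xs \<in> powO (Car A) n ==> rho H w xs = rho K w xs" shows "H = K"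
proof -
 interpret H: algmor T A B H by fact
 interpret K: algmor T A B K by fact
 have f: "AFun H = AFun K" by (rule func_eqI[OF H.AFun K.AFun]) (use assms in auto)
 have "ARho H w = ARho K w" if w: "w \<in> all_words T" for w by (rule nat_eqI[OF iso_nat[OF H.ARho_word[OF w]]
     iso_nat[OF K.ARho_word[OF w], folded f]]) (use r w H.all_words_iff in blast)
 then have "ARho H = ARho K" by (rule extensionalityI[OF H.ARho_ext K.ARho_ext])
 then show ?thesis using f H.ADom H.ACod K.ADom K.ACod by (auto intro: algmor.equality)
qed

locale algcell = is_theory T + algebra_cell T A B G H al
 for T :: "'t alg_theory" and A B :: "('o, 'a, 't) psalg" and G H :: "('o, 'a, 't) algmor"
  and al :: "('o, 'a, 't) algcell"
begin

sublocale G: algmor T A B G by (intro algmor.intro is_theory_axioms G_mor)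
sublocale H: algmor T A B H by (intro algmor.intro is_theory_axioms H_mor)
sublocale CNat: nat_trans "Car A" "Car B" "AFun G" "AFun H" "CNat al" by (rule CNat)

end

lemma algcell_iff: assumes G: "algmor T A B G" and H: "algmor T A B H"
  and a: "nat_trans (Car A) (Car B) (AFun G) (AFun H) a" and w: "w \<in> words T n"
 shows "vcomp_nat (ARho H w) (hcomp_nat a (id_nat (Phi A w))) =
   vcomp_nat (hcomp_nat (id_nat (Phi B w)) (pow_nat n a)) (ARho G w) \<longleftrightarrow>
  (\<forall>xs\<in>powO (Car A) n. cmp B (rho H w xs) (NC a (PhiO A w xs)) =
   cmp B (PhiF B w (map (NC a) xs)) (rho G w xs))"
  (is "?l = ?r \<longleftrightarrow> (\<forall>xs\<in>?O. ?lx xs = ?rx xs)")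
proof -
 interpret G: algmor T A B G by fact
 interpret H: algmor T A B H by fact
 interpret a: nat_trans "Car A" "Car B" "AFun G" "AFun H" a by fact
 note rG = iso_nat[OF G.ARho_iso[OF w]] and rH = iso_nat[OF H.ARho_iso[OF w]]
 note PA = G.A.Phi_functor[OF w] and PB = G.B.Phi_functor[OF w]
 note p = pow_nat_trans[OF a, of n]
 have L: "nat_trans (pow_cat (Car A) n) (Car B) (comp_func (AFun G) (Phi A w))
   (comp_func (Phi B w) (pow_func n (AFun H))) ?l" by (rule vcomp_nat_trans[OF hcomp_id_right_trans[OF a PA] rH])
 have R: "nat_trans (pow_cat (Car A) n) (Car B) (comp_func (AFun G) (Phi A w))
   (comp_func (Phi B w) (pow_func n (AFun H))) ?r" by (rule vcomp_nat_trans[OF rG hcomp_id_left_trans[OF p PB]])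
 have "NC ?l xs = ?lx xs" if xs: "xs \<in> ?O" for xs
  using xs hcomp_id_right[OF a PA xs] by (simp add: fun_dom[OF PA] a.boundary)
 moreover have "NC ?r xs = ?rx xs" if xs: "xs \<in> ?O" for xs using xs hcomp_id_left[OF p PB xs]
  by (simp add: fun_dom[OF PA] nat_trans.NDom[OF rG] a.boundary)
 ultimately show ?thesis using nat_eqI[OF L R] by metis
qed

lemma algcellI: assumes G: "algmor T A B G" and H: "algmor T A B H" and "CDom al = G" "CCod al = H"
  and a: "nat_trans (Car A) (Car B) (AFun G) (AFun H) (CNat al)"
  and "\<And>w n xs. w \<in> words T n ==> xs \<in> powO (Car A) n ==> cmp B (rho H w xs) (cN al (PhiO A w xs)) =
   cmp B (PhiF B w (map (cN al) xs)) (rho G w xs)" shows "algcell T A B G H al"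
 using assms algmor.axioms[OF G] algmor.axioms[OF H] algcell_iff[OF G H a]
 by (intro algcell.intro algebra_cell.intro) auto

lemma (in algcell) cell_rho: "w \<in> words T n ==> xs \<in> powO (Car A) n ==>
  cmp B (rho H w xs) (cN al (PhiO A w xs)) = cmp B (PhiF B w (map (cN al) xs)) (rho G w xs)"
 using algcell_iff[OF G.algmor_axioms H.algmor_axioms CNat, of w n] CNat_rho[of w n] by blast

lemma algcell_eqI: assumes a: "algcell T A B G H al" and b: "algcell T A B G H be"
  and "\<And>x. x \<in> Obj (Car A) ==> cN al x = cN be x" shows "al = be"
proof -
 interpret a: algcell T A B G H al by fact
 interpret b: algcell T A B G H be by fact
 show ?thesis using nat_eqI[OF a.CNat b.CNat assms(3)] a.CDom a.CCod b.CDom b.CCod by (auto intro: algcell.equality)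
qed

section \<open>The 2-category of pseudo algebras\<close>

context algmor_typed
begin

text \<open>Collects the coherences of the words \<open>ws\<close> on their blocks into one arrow of
  a power category, the form in which the functor \<open>Phi B w\<close> acts on them.\<close>

lemma rho_block_hom:
 assumes ws: "set ws \<subseteq> all_words T" and xs: "xs \<in> powO (Car A) (sum_list (ars T ws))"
 shows "powH (Car B) (length ws) (map2 (rho H) ws (blocks (ars T ws) xs))
  (map (AO H) (map2 (PhiO A) ws (blocks (ars T ws) xs))) (map2 (PhiO B) ws (blocks (ars T ws) (map (AO H) xs)))"
proof -
 have "chom B (rho H (ws ! i) (blocks (ars T ws) xs ! i)) (AO H (PhiO A (ws ! i) (blocks (ars T ws) xs ! i)))
  (PhiO B (ws ! i) (map (AO H) (blocks (ars T ws) xs ! i)))" if "i < length ws" for i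
  using rho_hom[OF _ blocks_Obj[OF xs, of i, simplified, OF that], of "ws ! i"]
   A.nth_words[OF ws that] that by (simp add: A.words_iff)
 then show ?thesis by (auto simp: powH_iff blocks_map)
qed

end

lemma algmor_comp_simps [simp]: "ADom (algmor_comp T H G) = ADom G" "ACod (algmor_comp T H G) = ACod H"
 "AFun (algmor_comp T H G) = comp_func (AFun H) (AFun G)" "ARho (algmor_comp T H G) \<in> extensional (all_words T)"
 by (simp_all add: algmor_comp_def)

lemma algmor_id_simps [simp]:
 "ADom (algmor_id T A) = A" "ACod (algmor_id T A) = A" "AFun (algmor_id T A) = id_func (Car A)"
 "w \<in> all_words T ==> ARho (algmor_id T A) w = id_nat (Phi A w)"
 "ARho (algmor_id T A) \<in> extensional (all_words T)" by (simp_all add: algmor_id_def)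

locale algmor_pair = G: algmor T A B G + H: algmor T B C H
 for T :: "'t alg_theory" and A B C :: "('o, 'a, 't) psalg" and G H :: "('o, 'a, 't) algmor"
begin

lemma comp_rho: assumes w: "w \<in> words T n" and xs: "xs \<in> powO (Car A) n" shows "rho (algmor_comp T H G) w xs =
  cmp C (rho H w (map (AO G) xs)) (AA H (rho G w xs))"
proof -
 note rG = iso_nat[OF G.ARho_iso[OF w]] and rH = iso_nat[OF H.ARho_iso[OF w]]
 show ?thesis using xs hcomp_id_left[OF rG H.AFun xs] hcomp_id_right[OF rH pow_functor[OF G.AFun] xs]
   G.words_all[OF w] G.arity_words[OF w] fun_dom[OF G.A.Phi_functor[OF w]]
  by (simp add: algmor_comp_def nat_trans.NDom[OF rG] G.AFun.FDom H.AFun.FCod)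
qed

sublocale comp_typed: algmor_typed T A C "algmor_comp T H G"
proof (intro algmor_typed.intro algmor_typed_axioms.intro)
 show "alg_over T A" "alg_over T C" by unfold_locales
 show "is_functor (Car A) (Car C) (AFun (algmor_comp T H G))" using comp_functor[OF G.AFun H.AFun] by simp
 fix w n assume w: "w \<in> words T n"
 note rG = G.ARho_iso[OF w] and rH = H.ARho_iso[OF w]
 have "nat_iso (pow_cat (Car A) n) (Car C) (comp_func (AFun H) (comp_func (AFun G) (Phi A w)))
   (comp_func (comp_func (Phi C w) (pow_func n (AFun H))) (pow_func n (AFun G)))
   (vcomp_nat (hcomp_nat (ARho H w) (id_nat (pow_func n (AFun G)))) (hcomp_nat (id_nat (AFun H)) (ARho G w)))"
  by (rule vcomp_nat_iso[OF hcomp_nat_iso[OF rG id_nat_iso[OF H.AFun],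
     unfolded comp_func_assoc[OF pow_functor[OF G.AFun] G.B.Phi_functor[OF w]]]
    hcomp_nat_iso[OF id_nat_iso[OF pow_functor[OF G.AFun]] rH]])
 then show "nat_iso (pow_cat (Car A) n) (Car C) (comp_func (AFun (algmor_comp T H G)) (Phi A w))
   (comp_func (Phi C w) (pow_func n (AFun (algmor_comp T H G)))) (ARho (algmor_comp T H G) w)"
  using G.words_all[OF w] G.arity_words[OF w] by (simp add: pow_func_comp[OF G.AFun H.AFun]
    comp_func_assoc[OF G.A.Phi_functor[OF w] G.AFun]
    comp_func_assoc[OF pow_functor[OF G.AFun] pow_functor[OF H.AFun]]) (simp add: algmor_comp_def)
qed

text \<open>The coherence square of a composite for \<open>gam\<close> and for
  \<open>subst_word\<close> is pasted from that of \<open>H\<close> at the image under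
  \<open>G\<close> and the image under \<open>H\<close> of that of \<open>G\<close>. For
  \<open>gam\<close>, naturality of the coherence of \<open>H\<close> is needed in between.\<close>

lemma comp_algmor: "algmor T A C (algmor_comp T H G)"
proof (rule comp_typed.algebra_morphismI)
 let ?h = "AO H" and ?H = "AA H" and ?g = "AO G" and ?G = "AA G"
 have Gx: "map ?g xs \<in> powO (Car B) n" if "xs \<in> powO (Car A) n" for xs n using pow_func_Obj[OF G.AFun that] .
 have FO: "map (AO (algmor_comp T H G)) xs = map ?h (map ?g xs)" if "xs \<in> powO (Car A) n" for xs n
  using that by (auto simp: powO_iff G.AFun.FDom in_set_conv_nth)
 have FA: "AA (algmor_comp T H G) f = ?H (?G f)" if "f \<in> Arr (Car A)" for f using that by (simp add: G.AFun.FDom)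
 {
  fix w ws xs
  assume w: "w \<in> words T (length ws)" and ws: "set ws \<subseteq> all_words T"
   and xs: "xs \<in> powO (Car A) (sum_list (ars T ws))"
  let ?ns = "ars T ws"
  let ?b = "blocks ?ns xs" and ?b' = "blocks ?ns (map ?g xs)"
  let ?p = "map2 (PhiO A) ws ?b" and ?q = "map2 (PhiO B) ws ?b'"
  let ?S1 = "map2 (rho H) ws ?b'" and ?S3 = "map2 (rho G) ws ?b"
  note g = G.gam_words[OF w ws]
  note gx = Gx[OF xs]
  note p = G.A.prod_Phi_Obj[OF ws xs] and q = G.B.prod_Phi_Obj[OF ws gx]
  note S1 = H.rho_block_hom[OF ws gx] and S3 = G.rho_block_hom[OF ws xs]
  note HS3 = pow_func_in_hom[OF H.AFun S3]
  interpret Pw: is_functor "pow_cat (Car C) (length ws)" "Car C" "Phi C w" by (rule H.B.Phi_functor[OF w])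
  \<comment> \<open>The list of composite coherences is a composite in the power category, so the
    functor \<open>Phi C w\<close> splits it.\<close>
  have S: "map2 (rho (algmor_comp T H G)) ws ?b = Comp (pow_cat (Car C) (length ws)) ?S1 (map ?H ?S3)"
  proof (rule nth_equalityI)
   fix i assume "i < length (map2 (rho (algmor_comp T H G)) ws ?b)"
   then have i: "i < length ws" by simp
   then show "map2 (rho (algmor_comp T H G)) ws ?b ! i = Comp (pow_cat (Car C) (length ws)) ?S1 (map ?H ?S3) ! i"
    using comp_rho[of "ws ! i" "arity T (ws ! i)" "?b ! i"] blocks_Obj[OF xs, of i] G.nth_words[OF ws i]
    by (simp add: G.words_iff blocks_map)
  qed simp
  note h1 = H.rho_hom[OF g gx] and h2 = H.AFun.FA_in_hom[OF G.rho_hom[OF g xs]]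
  note h3 = H.B.CohC_hom[OF w ws pow_func_Obj[OF H.AFun gx]]
  note h4 = Pw.FA_in_hom[OF S1] and h5 = Pw.FA_in_hom[OF HS3]
  note h6 = H.rho_hom[OF w q] and h7 = H.AFun.FA_in_hom[OF G.B.CohC_hom[OF w ws gx]]
  note h8 = H.rho_hom[OF w Gx[OF p]] and h9 = H.AFun.FA_in_hom[OF G.rho_hom[OF w p]]
  note h10 = H.AFun.FA_in_hom[OF G.AFun.FA_in_hom[OF G.A.CohC_hom[OF w ws xs]]]
  note h11 = H.AFun.FA_in_hom[OF fun_hom[OF G.B.Phi_functor[OF w] S3]]
  note hs = h1 h2 h3 h4 h5 h6 h7 h8 h9 h10 h11
  \<comment> \<open>The coherence square of \<open>G\<close>, transported by the functor
    \<open>H\<close>.\<close>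
  have eB: "cmp C (?H (NC (CohC B w ws) (map ?g xs))) (?H (rho G (gam T w ws) xs)) =
    cmp C (?H (PhiF B w ?S3)) (cmp C (?H (rho G w ?p)) (?H (?G (NC (CohC A w ws) xs))))"
   using arg_cong[OF G.rho_gam[OF w ws xs], of ?H] H.AFun.FA_comp_hom[OF G.rho_hom[OF g xs] G.B.CohC_hom[OF w ws gx]]
    H.AFun.FA_comp_hom[OF G.AFun.FA_in_hom[OF G.A.CohC_hom[OF w ws xs]] G.rho_hom[OF w p]]
    H.AFun.FA_comp_hom[OF G.B.Car.in_hom_comp[OF G.AFun.FA_in_hom[OF G.A.CohC_hom[OF w ws xs]] G.rho_hom[OF w p]]
     fun_hom[OF G.B.Phi_functor[OF w] S3]] by simp
  have "cmp C (NC (CohC C w ws) (map ?h (map ?g xs)))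
    (cmp C (rho H (gam T w ws) (map ?g xs)) (?H (rho G (gam T w ws) xs))) =
   cmp C (cmp C (NC (CohC C w ws) (map ?h (map ?g xs))) (rho H (gam T w ws) (map ?g xs)))
    (?H (rho G (gam T w ws) xs))" using hs by (simp add: H.B.Car.comp_simps)
  also have "\<dots> = cmp C (PhiF C w ?S1) (cmp C (rho H w ?q)
    (cmp C (?H (NC (CohC B w ws) (map ?g xs))) (?H (rho G (gam T w ws) xs))))"
   unfolding H.rho_gam[OF w ws gx] using hs by (simp add: H.B.Car.comp_simps)
  also have "\<dots> = cmp C (PhiF C w ?S1) (cmp C (cmp C (rho H w ?q) (?H (PhiF B w ?S3)))
    (cmp C (?H (rho G w ?p)) (?H (?G (NC (CohC A w ws) xs)))))"
   unfolding eB using hs by (simp add: H.B.Car.comp_simps)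
  \<comment> \<open>Naturality of the coherence of \<open>H\<close> at the list \<open>?S3\<close>
    turns the image under \<open>H\<close> of an action of \<open>w\<close> into an action of
    \<open>w\<close> on the image of the list.\<close>
  also have "\<dots> = cmp C (cmp C (PhiF C w ?S1) (PhiF C w (map ?H ?S3)))
    (cmp C (cmp C (rho H w (map ?g ?p)) (?H (rho G w ?p))) (?H (?G (NC (CohC A w ws) xs))))"
   unfolding H.rho_nat[OF w S3] using hs by (simp add: H.B.Car.comp_simps)
  finally show "cmp C (NC (CohC C w ws) (map (AO (algmor_comp T H G)) xs)) (rho (algmor_comp T H G) (gam T w ws) xs) =
   cmp C (PhiF C w (map2 (rho (algmor_comp T H G)) ws ?b)) (cmp C (rho (algmor_comp T H G) w ?p)
     (AA (algmor_comp T H G) (NC (CohC A w ws) xs)))"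
   unfolding FO[OF xs] S Pw.FA_comp_hom[OF HS3 S1] comp_rho[OF g xs] comp_rho[OF w p]
    FA[OF in_homD(1)[OF G.A.CohC_hom[OF w ws xs]]] .
 next
  fix xs assume xs: "xs \<in> powO (Car A) 1"
  note u = G.unit_words and gx = Gx[OF xs]
  note hs = H.rho_hom[OF u gx] H.AFun.FA_in_hom[OF G.rho_hom[OF u xs]] H.B.CohI_hom[OF pow_func_Obj[OF H.AFun gx]]
  show "cmp C (NC (CohI C) (map (AO (algmor_comp T H G)) xs)) (rho (algmor_comp T H G) (unit_word T) xs) =
   AA (algmor_comp T H G) (NC (CohI A) xs)"
   unfolding FO[OF xs] comp_rho[OF u xs] FA[OF in_homD(1)[OF G.A.CohI_hom[OF xs]]]
    H.B.Car.in_hom_assoc[OF hs(2,1,3)] H.rho_unit[OF gx]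
    H.AFun.FA_comp_hom[OF G.rho_hom[OF u xs] G.B.CohI_hom[OF gx], symmetric] G.rho_unit[OF xs] ..
 next
  fix w fs xs and l :: nat
  assume w: "w \<in> words T (length fs)" and fs: "set fs \<subseteq> {..<l}" and xs: "xs \<in> powO (Car A) l"
  note s = G.subst_words[OF w fs] and gx = Gx[OF xs]
  have r: "map ((!) xs) fs \<in> powO (Car A) (length fs)"
   using fun_obj[OF reindex_functor[OF G.A.Car_category fs] xs] xs by simp
  have r': "map ((!) (map ?g xs)) fs = map ?g (map ((!) xs) fs)" using xs fs by (auto simp: powO_iff)
  note hs = H.rho_hom[OF s gx] H.AFun.FA_in_hom[OF G.rho_hom[OF s xs]]
   H.B.CohS_hom[OF w fs pow_func_Obj[OF H.AFun gx]]
  note ht = H.AFun.FA_in_hom[OF G.B.CohS_hom[OF w fs gx]]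
  note hu = H.rho_hom[OF w Gx[OF r], folded r'] H.AFun.FA_in_hom[OF G.rho_hom[OF w r]]
   H.AFun.FA_in_hom[OF G.AFun.FA_in_hom[OF G.A.CohS_hom[OF w fs xs]]]
  have "cmp C (NC (CohS C w l fs) (map ?h (map ?g xs))) (cmp C
    (rho H (subst_word T l fs w) (map ?g xs)) (?H (rho G (subst_word T l fs w) xs))) =
   cmp C (cmp C (rho H w (map ((!) (map ?g xs)) fs)) (?H (NC (CohS B w l fs) (map ?g xs))))
    (?H (rho G (subst_word T l fs w) xs))"
   unfolding H.rho_subst[OF w fs gx, symmetric] using hs by (simp add: H.B.Car.comp_simps)
  also have "\<dots> = cmp C (rho H w (map ((!) (map ?g xs)) fs))
    (cmp C (?H (NC (CohS B w l fs) (map ?g xs))) (?H (rho G (subst_word T l fs w) xs)))"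
   using hs ht hu by (simp add: H.B.Car.comp_simps del: map_map)
  also have "\<dots> = cmp C (rho H w (map ((!) (map ?g xs)) fs))
    (cmp C (?H (rho G w (map ((!) xs) fs))) (?H (?G (NC (CohS A w l fs) xs))))"
   unfolding H.AFun.FA_comp_hom[OF G.rho_hom[OF s xs] G.B.CohS_hom[OF w fs gx], symmetric] G.rho_subst[OF w fs xs]
    H.AFun.FA_comp_hom[OF G.AFun.FA_in_hom[OF G.A.CohS_hom[OF w fs xs]] G.rho_hom[OF w r]] ..
  also have "\<dots> = cmp C (cmp C (rho H w (map ?g (map ((!) xs) fs)))
    (?H (rho G w (map ((!) xs) fs)))) (?H (?G (NC (CohS A w l fs) xs)))"
   unfolding r' using hu[unfolded r'] by (simp add: H.B.Car.comp_simps del: map_map)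
  finally show "cmp C (NC (CohS C w l fs) (map (AO (algmor_comp T H G)) xs))
    (rho (algmor_comp T H G) (subst_word T l fs w) xs) = cmp C (rho (algmor_comp T H G) w (map ((!) xs) fs))
    (AA (algmor_comp T H G) (NC (CohS A w l fs) xs))" unfolding FO[OF xs] comp_rho[OF s xs] comp_rho[OF w r]
    FA[OF in_homD(1)[OF G.A.CohS_hom[OF w fs xs]]] .
 }
qed (simp_all add: H.ACod G.ADom)

end

context alg_over
begin

lemma id_algmor: "algmor T A A (algmor_id T A)"
proof -
 interpret t: algmor_typed T A A "algmor_id T A"
 proof (intro algmor_typed.intro algmor_typed_axioms.intro alg_over_axioms)
  show "is_functor (Car A) (Car A) (AFun (algmor_id T A))" using id_functor[OF Car_category] by simp
  show "nat_iso (pow_cat (Car A) n) (Car A) (comp_func (AFun (algmor_id T A)) (Phi A w))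
    (comp_func (Phi A w) (pow_func n (AFun (algmor_id T A)))) (ARho (algmor_id T A) w)"
   if w: "w \<in> words T n" for w n
   using id_nat_iso[OF Phi_functor[OF w]] words_all[OF w] comp_func_id[OF Phi_functor[OF w]]
   by (simp add: pow_func_id[OF Car_category])
 qed
 have m: "map (FO (id_func (Car A))) xs = xs" if "xs \<in> powO (Car A) n" for xs n
  using that by (auto simp: powO_iff in_set_conv_nth intro!: map_idI)
 have r: "rho (algmor_id T A) w xs = Ide (Car A) (PhiO A w xs)"
  if "w \<in> words T n" "xs \<in> powO (Car A) n" for w n xs
  using that words_all[OF that(1)] fun_dom[OF Phi_functor[OF that(1)]] fun_cod[OF Phi_functor[OF that(1)]] by simp
 show ?thesis
 proof (rule t.algebra_morphismI)
  fix w ws xs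
  assume w: "w \<in> words T (length ws)" and ws: "set ws \<subseteq> all_words T"
   and xs: "xs \<in> powO (Car A) (sum_list (ars T ws))"
  note p = prod_Phi_Obj[OF ws xs] and c = CohC_hom[OF w ws xs]
  have S: "map2 (rho (algmor_id T A)) ws (blocks (ars T ws) xs) =
    Ide (pow_cat (Car A) (length ws)) (map2 (PhiO A) ws (blocks (ars T ws) xs))"
  proof (rule nth_equalityI)
   fix i assume "i < length (map2 (rho (algmor_id T A)) ws (blocks (ars T ws) xs))"
   then have i: "i < length ws" by simp
   then show "map2 (rho (algmor_id T A)) ws (blocks (ars T ws) xs) ! i =
    Ide (pow_cat (Car A) (length ws)) (map2 (PhiO A) ws (blocks (ars T ws) xs)) ! i"
    using r[of "ws ! i" "arity T (ws ! i)" "blocks (ars T ws) xs ! i"] blocks_Obj[OF xs, of i] nth_words[OF ws i]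
    by (simp add: words_iff)
  qed simp
  show "cmp A (NC (CohC A w ws) (map (AO (algmor_id T A)) xs)) (rho (algmor_id T A) (gam T w ws) xs) =
   cmp A (PhiF A w (map2 (rho (algmor_id T A)) ws (blocks (ars T ws) xs)))
    (cmp A (rho (algmor_id T A) w (map2 (PhiO A) ws (blocks (ars T ws) xs)))
     (AA (algmor_id T A) (NC (CohC A w ws) xs)))" unfolding S is_functor.FA_ide[OF Phi_functor[OF w] p]
   using c r[OF gam_words[OF w ws] xs] r[OF w p] m[OF xs] by (simp add: Car.comp_simps)
 next
  fix xs assume xs: "xs \<in> powO (Car A) 1"
  show "cmp A (NC (CohI A) (map (AO (algmor_id T A)) xs)) (rho (algmor_id T A) (unit_word T) xs) =
   AA (algmor_id T A) (NC (CohI A) xs)"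
   using CohI_hom[OF xs] r[OF unit_words xs] m[OF xs] by (simp add: Car.comp_simps)
 next
  fix w fs xs and l :: nat
  assume w: "w \<in> words T (length fs)" and fs: "set fs \<subseteq> {..<l}" and xs: "xs \<in> powO (Car A) l"
  have x: "map ((!) xs) fs \<in> powO (Car A) (length fs)"
   using fun_obj[OF reindex_functor[OF Car_category fs] xs] xs by simp
  show "cmp A (NC (CohS A w l fs) (map (AO (algmor_id T A)) xs)) (rho (algmor_id T A) (subst_word T l fs w) xs) =
   cmp A (rho (algmor_id T A) w (map ((!) xs) fs)) (AA (algmor_id T A) (NC (CohS A w l fs) xs))"
   using CohS_hom[OF w fs xs] r[OF subst_words[OF w fs] xs] r[OF w x] m[OF xs] by (simp add: Car.comp_simps)
 qed simp_all
qed

end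

definition cell_id :: "('o, 'a, 't) algmor \<Rightarrow> ('o, 'a, 't) algcell" where
 "cell_id H = \<lparr>CDom = H, CCod = H, CNat = id_nat (AFun H)\<rparr>"

definition cell_vcomp :: "('o, 'a, 't) algcell \<Rightarrow> ('o, 'a, 't) algcell \<Rightarrow> ('o, 'a, 't) algcell" where
 "cell_vcomp be al = \<lparr>CDom = CDom al, CCod = CCod be, CNat = vcomp_nat (CNat be) (CNat al)\<rparr>"

definition cell_hcomp :: "'t alg_theory \<Rightarrow> ('o, 'a, 't) algcell \<Rightarrow> ('o, 'a, 't) algcell \<Rightarrow> ('o, 'a, 't) algcell" where
 "cell_hcomp T be al = \<lparr>CDom = algmor_comp T (CDom be) (CDom al), CCod = algmor_comp T (CCod be) (CCod al),
  CNat = hcomp_nat (CNat be) (CNat al)\<rparr>"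

lemma cell_simps [simp]: "CDom (cell_id H) = H" "CCod (cell_id H) = H" "CNat (cell_id H) = id_nat (AFun H)"
 "CDom (cell_vcomp be al) = CDom al" "CCod (cell_vcomp be al) = CCod be"
 "CNat (cell_vcomp be al) = vcomp_nat (CNat be) (CNat al)"
 "CDom (cell_hcomp T be al) = algmor_comp T (CDom be) (CDom al)"
 "CCod (cell_hcomp T be al) = algmor_comp T (CCod be) (CCod al)"
 "CNat (cell_hcomp T be al) = hcomp_nat (CNat be) (CNat al)"
 by (simp_all add: cell_id_def cell_vcomp_def cell_hcomp_def)

lemma (in algmor) cell_id_cell: "algcell T A B H H (cell_id H)"
proof (rule algcellI[OF algmor_axioms algmor_axioms])
 show "nat_trans (Car A) (Car B) (AFun H) (AFun H) (CNat (cell_id H))" using iso_nat[OF id_nat_iso[OF AFun]] by simp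
 fix w n xs assume w: "w \<in> words T n" and xs: "xs \<in> powO (Car A) n"
 have e: "map (cN (cell_id H)) xs = Ide (pow_cat (Car B) n) (map (AO H) xs)"
  using xs by (auto simp: powO_iff in_set_conv_nth AFun.FDom AFun.FCod)
 show "cmp B (rho H w xs) (cN (cell_id H) (PhiO A w xs)) = cmp B (PhiF B w (map (cN (cell_id H)) xs)) (rho H w xs)"
  unfolding e is_functor.FA_ide[OF B.Phi_functor[OF w] pow_func_Obj[OF AFun xs]]
  using rho_hom[OF w xs] fun_obj[OF A.Phi_functor[OF w] xs] by (simp add: AFun.FDom AFun.FCod B.Car.comp_simps)
qed simp_all

lemma cell_vcomp_cell: assumes a: "algcell T A B G H al" and b: "algcell T A B H K be"
 shows "algcell T A B G K (cell_vcomp be al)"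
proof -
 interpret a: algcell T A B G H al by fact
 interpret b: algcell T A B H K be by fact
 show ?thesis
 proof (rule algcellI[OF a.G.algmor_axioms b.H.algmor_axioms])
  show "nat_trans (Car A) (Car B) (AFun G) (AFun K) (CNat (cell_vcomp be al))"
   using vcomp_nat_trans[OF a.CNat b.CNat] by simp
  fix w n xs assume w: "w \<in> words T n" and xs: "xs \<in> powO (Car A) n"
  note x = fun_obj[OF a.G.A.Phi_functor[OF w] xs]
  interpret P: is_functor "pow_cat (Car B) n" "Car B" "Phi B w" by (rule a.G.B.Phi_functor[OF w])
  have ma: "powH (Car B) n (map (cN al) xs) (map (AO G) xs) (map (AO H) xs)"
   and mb: "powH (Car B) n (map (cN be) xs) (map (AO H) xs) (map (AO K) xs)"
   using xs by (auto simp: powH_iff powO_iff a.CNat.NC_in_hom b.CNat.NC_in_hom)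
  have m: "map (NC (vcomp_nat (CNat be) (CNat al))) xs = Comp (pow_cat (Car B) n) (map (cN be) xs) (map (cN al) xs)"
   using xs by (auto simp: powO_iff a.CNat.boundary intro!: nth_equalityI)
  note hs = a.CNat.NC_in_hom[OF x] b.CNat.NC_in_hom[OF x] b.H.rho_hom[OF w xs]
   a.H.rho_hom[OF w xs] a.G.rho_hom[OF w xs] P.FA_in_hom[OF ma] P.FA_in_hom[OF mb]
  have "cmp B (rho K w xs) (cmp B (cN be (PhiO A w xs)) (cN al (PhiO A w xs))) =
    cmp B (cmp B (rho K w xs) (cN be (PhiO A w xs))) (cN al (PhiO A w xs))"
   using hs by (simp add: a.G.B.Car.comp_simps)
  also have "\<dots> = cmp B (PhiF B w (map (cN be) xs)) (cmp B (rho H w xs) (cN al (PhiO A w xs)))"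
   unfolding b.cell_rho[OF w xs] using hs by (simp add: a.G.B.Car.comp_simps)
  also have "\<dots> = cmp B (cmp B (PhiF B w (map (cN be) xs)) (PhiF B w (map (cN al) xs))) (rho G w xs)"
   unfolding a.cell_rho[OF w xs] using hs by (simp add: a.G.B.Car.comp_simps)
  finally show "cmp B (rho K w xs) (cN (cell_vcomp be al) (PhiO A w xs)) =
    cmp B (PhiF B w (map (cN (cell_vcomp be al)) xs)) (rho G w xs)"
   using x m P.FA_comp_hom[OF ma mb] by (simp add: a.CNat.boundary)
 qed (simp_all add: a.CDom b.CCod)
qed

text \<open>The condition is pasted from naturality of \<open>be\<close> at the coherence of
  \<open>G'\<close>, the condition on \<open>be\<close> at the image under \<open>G'\<close>, the
  image under \<open>H\<close> of the condition on \<open>al\<close>, and naturality of the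
  coherence of \<open>H\<close>.\<close>

lemma cell_hcomp_cell: assumes a: "algcell T A B G G' al" and b: "algcell T B C H H' be"
 shows "algcell T A C (algmor_comp T H G) (algmor_comp T H' G') (cell_hcomp T be al)"
proof -
 interpret a: algcell T A B G G' al by fact
 interpret b: algcell T B C H H' be by fact
 interpret p: algmor_pair T A B C G H by unfold_locales
 interpret p': algmor_pair T A B C G' H' by unfold_locales
 let ?H = "AA H" and ?H' = "AA H'" and ?a = "cN al" and ?b = "cN be"
 have nc: "cN (cell_hcomp T be al) x = cmp C (?b (AO G' x)) (?H (?a x))" if "x \<in> Obj (Car A)" for x
  using that by (simp add: hcomp_nat_NC a.CNat.boundary b.CNat.boundary)
 show ?thesis
 proof (rule algcellI[OF p.comp_algmor p'.comp_algmor])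
  show "nat_trans (Car A) (Car C) (AFun (algmor_comp T H G)) (AFun (algmor_comp T H' G')) (CNat (cell_hcomp T be al))"
   using hcomp_nat_trans[OF a.CNat b.CNat] by simp
  fix w n xs assume w: "w \<in> words T n" and xs: "xs \<in> powO (Car A) n"
  let ?x = "PhiO A w xs" and ?gx = "map (AO G) xs" and ?g'x = "map (AO G') xs"
  note x = fun_obj[OF a.G.A.Phi_functor[OF w] xs]
  note gx = pow_func_Obj[OF a.G.AFun xs] and g'x = pow_func_Obj[OF a.H.AFun xs]
  interpret P: is_functor "pow_cat (Car C) n" "Car C" "Phi C w" by (rule b.G.B.Phi_functor[OF w])
  have ma: "powH (Car B) n (map ?a xs) ?gx ?g'x" using xs by (auto simp: powH_iff powO_iff a.CNat.NC_in_hom)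
  note mHa = pow_func_in_hom[OF b.G.AFun ma]
  have mb: "powH (Car C) n (map ?b ?g'x) (map (AO H) ?g'x) (map (AO H') ?g'x)"
   using xs by (auto simp: powH_iff powO_iff b.CNat.NC_in_hom a.H.AFun.FO_obj)
  have m: "map (cN (cell_hcomp T be al)) xs = Comp (pow_cat (Car C) n) (map ?b ?g'x) (map ?H (map ?a xs))"
   using xs by (auto simp: powO_iff nc[unfolded cell_simps] intro!: nth_equalityI)
  note x' = a.H.AFun.FO_obj[OF x]
  note hs = b.CNat.NC_in_hom[OF x'] b.G.AFun.FA_in_hom[OF a.CNat.NC_in_hom[OF x]]
   b.H.rho_hom[OF w g'x] b.H.AFun.FA_in_hom[OF a.H.rho_hom[OF w xs]]
   b.G.AFun.FA_in_hom[OF a.H.rho_hom[OF w xs]] b.G.AFun.FA_in_hom[OF a.G.rho_hom[OF w xs]]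
   b.G.rho_hom[OF w gx] b.G.rho_hom[OF w g'x] P.FA_in_hom[OF mHa] P.FA_in_hom[OF mb]
   b.CNat.NC_in_hom[OF fun_obj[OF a.G.B.Phi_functor[OF w] g'x]]
   b.G.AFun.FA_in_hom[OF fun_hom[OF a.G.B.Phi_functor[OF w] ma]]
  have "cmp C (cmp C (rho H' w ?g'x) (?H' (rho G' w xs))) (cmp C (?b (AO G' ?x)) (?H (?a ?x))) =
   cmp C (rho H' w ?g'x) (cmp C (cmp C (?H' (rho G' w xs)) (?b (AO G' ?x))) (?H (?a ?x)))"
   using hs by (simp add: b.G.B.Car.comp_simps)
  also have "\<dots> = cmp C (cmp C (rho H' w ?g'x) (?b (PhiO B w ?g'x))) (cmp C (?H (rho G' w xs)) (?H (?a ?x)))"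
   unfolding b.CNat.naturality_hom[OF a.H.rho_hom[OF w xs], symmetric] using hs by (simp add: b.G.B.Car.comp_simps)
  also have "\<dots> = cmp C (PhiF C w (map ?b ?g'x)) (cmp C (rho H w ?g'x) (?H (cmp B (rho G' w xs) (?a ?x))))"
   unfolding b.cell_rho[OF w g'x] b.G.AFun.FA_comp_hom[OF a.CNat.NC_in_hom[OF x] a.H.rho_hom[OF w xs]]
   using hs by (simp add: b.G.B.Car.comp_simps)
  also have "\<dots> = cmp C (PhiF C w (map ?b ?g'x)) (cmp C
    (cmp C (rho H w ?g'x) (?H (PhiF B w (map ?a xs)))) (?H (rho G w xs)))" unfolding a.cell_rho[OF w xs]
    b.G.AFun.FA_comp_hom[OF a.G.rho_hom[OF w xs] fun_hom[OF a.G.B.Phi_functor[OF w] ma]]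
   using hs by (simp add: b.G.B.Car.comp_simps)
  also have "\<dots> = cmp C (cmp C (PhiF C w (map ?b ?g'x)) (PhiF C w (map ?H (map ?a xs))))
    (cmp C (rho H w ?gx) (?H (rho G w xs)))"
   unfolding b.G.rho_nat[OF w ma] using hs by (simp add: b.G.B.Car.comp_simps)
  finally show "cmp C (rho (algmor_comp T H' G') w xs) (cN (cell_hcomp T be al) ?x) =
    cmp C (PhiF C w (map (cN (cell_hcomp T be al)) xs)) (rho (algmor_comp T H G) w xs)"
   unfolding nc[OF x] m P.FA_comp_hom[OF mHa mb] p.comp_rho[OF w xs] p'.comp_rho[OF w xs] .
 qed (simp_all add: a.CDom b.CCod a.CCod b.CDom)
qed

context is_theory
begin

abbreviation "PA \<equiv> PsAlg T"

lemma PsAlg_simps [simp]: "A \<in> Cell0 PA \<longleftrightarrow> small_algebra T A"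
 "H \<in> Cell1 PA \<longleftrightarrow> small_algebra T (ADom H) \<and> small_algebra T (ACod H) \<and> algmor T (ADom H) (ACod H) H"
 "al \<in> Cell2 PA \<longleftrightarrow> small_algebra T (ADom (CDom al)) \<and> small_algebra T (ACod (CDom al)) \<and>
  algcell T (ADom (CDom al)) (ACod (CDom al)) (CDom al) (CCod al) al"
 "Src PA = ADom" "Trg PA = ACod" "Dom2 PA = CDom" "Cod2 PA = CCod"
 "Ide1 PA = algmor_id T" "Comp1 PA = algmor_comp T" "Ide2 PA = cell_id"
 "VComp PA = cell_vcomp" "HComp PA = cell_hcomp T" using is_theory_axioms
 by (auto simp: PsAlg_def algmor_def algcell_def cell_id_def cell_vcomp_def cell_hcomp_def fun_eq_iff)

lemma small_algebra_over: "small_algebra T A ==> alg_over T A"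
 by (simp add: small_algebra_def alg_over_def is_theory_axioms)

lemma algcell_boundary: assumes "algcell T A B G H al"
 shows "CDom al = G" "CCod al = H" "ADom G = A" "ACod G = B" "ADom H = A" "ACod H = B"
  "algmor T A B G" "algmor T A B H"
proof -
 interpret algcell T A B G H al by fact
 show "CDom al = G" "CCod al = H" "ADom G = A" "ACod G = B" "ADom H = A" "ACod H = B"
  "algmor T A B G" "algmor T A B H"
  using CDom CCod G.ADom G.ACod H.ADom H.ACod G.algmor_axioms H.algmor_axioms by auto
qed

lemma algmor_compI: "algmor T A B G ==> algmor T B C H ==> algmor T A C (algmor_comp T H G)"
 by (rule algmor_pair.comp_algmor[OF algmor_pair.intro])

lemma algmor_comp_assoc: assumes "algmor T A B F" "algmor T B C G" "algmor T C E H"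
 shows "algmor_comp T H (algmor_comp T G F) = algmor_comp T (algmor_comp T H G) F"
proof -
 interpret F: algmor T A B F by fact
 interpret G: algmor T B C G by fact
 interpret H: algmor T C E H by fact
 interpret GF: algmor_pair T A B C F G by unfold_locales
 interpret HG: algmor_pair T B C E G H by unfold_locales
 interpret H_GF: algmor_pair T A C E "algmor_comp T G F" H by (intro algmor_pair.intro GF.comp_algmor H.algmor_axioms)
 interpret HG_F: algmor_pair T A B E F "algmor_comp T H G" by (intro algmor_pair.intro HG.comp_algmor F.algmor_axioms)
 show ?thesis
 proof (rule algmor_eqI[OF H_GF.comp_algmor HG_F.comp_algmor])
  fix w n xs assume w: "w \<in> words T n" and xs: "xs \<in> powO (Car A) n"
  note fx = pow_func_Obj[OF F.AFun xs]
  have m: "map (AO (algmor_comp T G F)) xs = map (AO G) (map (AO F) xs)"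
   using xs by (auto simp: powO_iff F.AFun.FDom in_set_conv_nth)
  have e: "AA (algmor_comp T H G) (rho F w xs) = AA H (AA G (rho F w xs))"
   using in_homD(1)[OF F.rho_hom[OF w xs]] by (simp add: G.AFun.FDom)
  note hs = H.rho_hom[OF w pow_func_Obj[OF G.AFun fx]] H.AFun.FA_in_hom[OF G.rho_hom[OF w fx]]
   H.AFun.FA_in_hom[OF G.AFun.FA_in_hom[OF F.rho_hom[OF w xs]]]
  show "rho (algmor_comp T H (algmor_comp T G F)) w xs = rho (algmor_comp T (algmor_comp T H G) F) w xs"
   unfolding H_GF.comp_rho[OF w xs] HG_F.comp_rho[OF w xs] GF.comp_rho[OF w xs] HG.comp_rho[OF w fx] m e
    H.AFun.FA_comp_hom[OF G.AFun.FA_in_hom[OF F.rho_hom[OF w xs]] G.rho_hom[OF w fx]]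
   by (rule H.B.Car.in_hom_assoc[OF hs(3,2,1)])
 qed (simp_all add: comp_func_assoc[OF F.AFun G.AFun])
qed

lemma algmor_comp_id: assumes "algmor T A B H"
 shows "algmor_comp T H (algmor_id T A) = H" "algmor_comp T (algmor_id T B) H = H"
proof -
 interpret H: algmor T A B H by fact
 interpret r: algmor_pair T A A B "algmor_id T A" H by (intro algmor_pair.intro H.A.id_algmor assms)
 interpret l: algmor_pair T A B B H "algmor_id T B" by (intro algmor_pair.intro H.B.id_algmor assms)
 show "algmor_comp T H (algmor_id T A) = H"
 proof (rule algmor_eqI[OF r.comp_algmor assms])
  fix w n xs assume w: "w \<in> words T n" and xs: "xs \<in> powO (Car A) n"
  have m: "map (AO (algmor_id T A)) xs = xs" using xs by (auto simp: powO_iff in_set_conv_nth intro!: map_idI)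
  show "rho (algmor_comp T H (algmor_id T A)) w xs = rho H w xs" unfolding r.comp_rho[OF w xs] m
   using words_all[OF w] xs fun_dom[OF H.A.Phi_functor[OF w]] fun_cod[OF H.A.Phi_functor[OF w]]
    fun_obj[OF H.A.Phi_functor[OF w] xs] H.rho_hom[OF w xs] by (simp add: H.AFun.FA_ide H.B.Car.comp_simps)
 qed (simp_all add: comp_func_id[OF H.AFun])
 show "algmor_comp T (algmor_id T B) H = H"
 proof (rule algmor_eqI[OF l.comp_algmor assms])
  fix w n xs assume w: "w \<in> words T n" and xs: "xs \<in> powO (Car A) n"
  show "rho (algmor_comp T (algmor_id T B) H) w xs = rho H w xs" unfolding l.comp_rho[OF w xs]
   using words_all[OF w] pow_func_Obj[OF H.AFun xs] fun_dom[OF H.B.Phi_functor[OF w]]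
    fun_cod[OF H.B.Phi_functor[OF w]] H.rho_hom[OF w xs] by (simp add: H.B.Car.comp_simps)
 qed (simp_all add: comp_func_id[OF H.AFun])
qed

lemma algcell_record_eqI: fixes al be :: "('o, 'a, 't) algcell"
 shows "CDom al = CDom be ==> CCod al = CCod be ==> CNat al = CNat be ==> al = be" by (cases al; cases be) auto

lemma algcell_nat: "algcell T A B G H al ==> nat_trans (Car A) (Car B) (AFun G) (AFun H) (CNat al)"
 by (rule algebra_cell.CNat[OF algcell.axioms(2)])

lemma Cell2E: assumes "al \<in> Cell2 PA"
 obtains A B G H where "algcell T A B G H al" "small_algebra T A" "small_algebra T B" "CDom al = G"
  "CCod al = H" "ADom G = A" "ACod G = B" "ADom H = A" "ACod H = B" "algmor T A B G" "algmor T A B H"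
 using assms algcell_boundary[of "ADom (CDom al)" "ACod (CDom al)" "CDom al" "CCod al" al] that by auto

lemma Cell2I: "algcell T A B G H al ==> small_algebra T A ==> small_algebra T B ==> al \<in> Cell2 PA"
 using algcell_boundary[of A B G H al] by auto

lemma Cell1E: assumes "H \<in> Cell1 PA"
 obtains A B where "algmor T A B H" "small_algebra T A" "small_algebra T B" "ADom H = A" "ACod H = B"
 using assms that by auto

lemma PsAlg_under: "category (under_cat PA)"
proof (rule category.intro)
 fix x assume x: "x \<in> Obj (under_cat PA)"
 then interpret alg_over T x by (simp add: under_cat_def small_algebra_over)
 show "Ide (under_cat PA) x \<in> Arr (under_cat PA)" "Dom (under_cat PA) (Ide (under_cat PA) x) = x"
  "Cod (under_cat PA) (Ide (under_cat PA) x) = x" using x id_algmor by (simp_all add: under_cat_def)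
next
 fix f g assume fg: "f \<in> Arr (under_cat PA)" "g \<in> Arr (under_cat PA)"
  "Dom (under_cat PA) g = Cod (under_cat PA) f"
 show "Comp (under_cat PA) g f \<in> Arr (under_cat PA)"
  using fg algmor_compI[of "ADom f" "ACod f" f "ACod g" g] by (simp add: under_cat_def)
 fix h assume "h \<in> Arr (under_cat PA)" "Dom (under_cat PA) h = Cod (under_cat PA) g"
 then show "Comp (under_cat PA) h (Comp (under_cat PA) g f) = Comp (under_cat PA) (Comp (under_cat PA) h g) f"
  using fg algmor_comp_assoc[of "ADom f" "ACod f" f "ACod g" g "ACod h" h] by (simp add: under_cat_def)
qed (auto simp: under_cat_def algmor_comp_id)

lemma PsAlg_vert: "category (vert_cat PA)"
proof (rule category.intro)
 fix f assume "f \<in> Arr (vert_cat PA)"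
 then have "f \<in> Cell2 PA" by (simp add: vert_cat_def)
 then obtain A B G H where f: "algcell T A B G H f" "small_algebra T A" "small_algebra T B" "CDom f = G"
  "CCod f = H" "ADom G = A" "ACod G = B" "ADom H = A" "ACod H = B" "algmor T A B G" "algmor T A B H" by (rule Cell2E)
 show "Dom (vert_cat PA) f \<in> Obj (vert_cat PA)" "Cod (vert_cat PA) f \<in> Obj (vert_cat PA)"
  using f by (simp_all add: vert_cat_def)
 show "Comp (vert_cat PA) f (Ide (vert_cat PA) (Dom (vert_cat PA) f)) = f"
  "Comp (vert_cat PA) (Ide (vert_cat PA) (Cod (vert_cat PA) f)) f = f"
  using f vcomp_nat_id[OF algcell_nat[OF f(1)]] by (auto simp: vert_cat_def intro!: algcell_record_eqI)
 fix g assume "g \<in> Arr (vert_cat PA)" and gf: "Dom (vert_cat PA) g = Cod (vert_cat PA) f"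
 then have "g \<in> Cell2 PA" by (simp add: vert_cat_def)
 then obtain A' B' G' K where g': "algcell T A' B' G' K g" "CDom g = G'" "CCod g = K" "ADom G' = A'" "ACod G' = B'"
  by (rule Cell2E)
 have g: "algcell T A B H K g" using g' f gf by (simp add: vert_cat_def)
 note gf' = cell_vcomp_cell[OF f(1) g]
 show "Comp (vert_cat PA) g f \<in> Arr (vert_cat PA)"
  using Cell2I[OF gf' f(2,3)] by (simp add: vert_cat_def del: PsAlg_simps(3))
 show "Dom (vert_cat PA) (Comp (vert_cat PA) g f) = Dom (vert_cat PA) f"
  "Cod (vert_cat PA) (Comp (vert_cat PA) g f) = Cod (vert_cat PA) g" by (simp_all add: vert_cat_def)
 fix h assume "h \<in> Arr (vert_cat PA)" and hg: "Dom (vert_cat PA) h = Cod (vert_cat PA) g"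
 then have "h \<in> Cell2 PA" by (simp add: vert_cat_def)
 then obtain A'' B'' G'' M where h': "algcell T A'' B'' G'' M h" "CDom h = G''" "ADom G'' = A''" "ACod G'' = B''"
  by (rule Cell2E)
 have h: "algcell T A B K M h" using h' g' hg algcell_boundary[OF g] by (simp add: vert_cat_def)
 show "Comp (vert_cat PA) h (Comp (vert_cat PA) g f) = Comp (vert_cat PA) (Comp (vert_cat PA) h g) f"
  using vcomp_nat_assoc[OF algcell_nat[OF f(1)] algcell_nat[OF g] algcell_nat[OF h]]
  by (auto simp: vert_cat_def intro!: algcell_record_eqI)
next
 fix H assume "H \<in> Obj (vert_cat PA)"
 then have H: "H \<in> Cell1 PA" by (simp add: vert_cat_def)
 then obtain A B where AB: "algmor T A B H" "small_algebra T A" "small_algebra T B" by (rule Cell1E)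
 show "Ide (vert_cat PA) H \<in> Arr (vert_cat PA)"
  using Cell2I[OF algmor.cell_id_cell[OF AB(1)] AB(2,3)] by (simp add: vert_cat_def del: PsAlg_simps(3))
qed (simp_all add: vert_cat_def)

lemma PsAlg_horiz: "category (horiz_cat PA)"
proof (rule category.intro)
 fix f assume "f \<in> Arr (horiz_cat PA)"
 then have "f \<in> Cell2 PA" by (simp add: horiz_cat_def)
 then obtain A B G H where f: "algcell T A B G H f" "small_algebra T A" "small_algebra T B" "CDom f = G"
  "CCod f = H" "ADom G = A" "ACod G = B" "ADom H = A" "ACod H = B" "algmor T A B G" "algmor T A B H" by (rule Cell2E)
 show "Dom (horiz_cat PA) f \<in> Obj (horiz_cat PA)" "Cod (horiz_cat PA) f \<in> Obj (horiz_cat PA)"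
  using f by (simp_all add: horiz_cat_def)
 show "Comp (horiz_cat PA) f (Ide (horiz_cat PA) (Dom (horiz_cat PA) f)) = f"
  "Comp (horiz_cat PA) (Ide (horiz_cat PA) (Cod (horiz_cat PA) f)) f = f"
  using f hcomp_nat_id[OF algcell_nat[OF f(1)]]
  by (auto simp: horiz_cat_def algmor_comp_id intro!: algcell_record_eqI)
 fix g assume "g \<in> Arr (horiz_cat PA)" and gf: "Dom (horiz_cat PA) g = Cod (horiz_cat PA) f"
 then have "g \<in> Cell2 PA" by (simp add: horiz_cat_def)
 then obtain B' C K M where g': "algcell T B' C K M g" "small_algebra T C" "CDom g = K" "CCod g = M"
  "ADom K = B'" "ACod K = C" "algmor T B' C K" "algmor T B' C M" by (rule Cell2E)
 have g: "algcell T B C K M g" and B': "B' = B" using g' f gf by (simp_all add: horiz_cat_def)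
 note gf' = cell_hcomp_cell[OF f(1) g]
 show "Comp (horiz_cat PA) g f \<in> Arr (horiz_cat PA)"
  using Cell2I[OF gf' f(2) g'(2)] by (simp add: horiz_cat_def del: PsAlg_simps(3))
 show "Dom (horiz_cat PA) (Comp (horiz_cat PA) g f) = Dom (horiz_cat PA) f"
  "Cod (horiz_cat PA) (Comp (horiz_cat PA) g f) = Cod (horiz_cat PA) g" by (simp_all add: horiz_cat_def)
 fix h assume "h \<in> Arr (horiz_cat PA)" and hg: "Dom (horiz_cat PA) h = Cod (horiz_cat PA) g"
 then have "h \<in> Cell2 PA" by (simp add: horiz_cat_def)
 then obtain C' E N P where h': "algcell T C' E N P h" "CDom h = N" "CCod h = P" "ADom N = C'" "ACod N = E"
  "algmor T C' E N" "algmor T C' E P" by (rule Cell2E)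
 have h: "algcell T C E N P h" and C': "C' = C" using h' g' hg by (simp_all add: horiz_cat_def)
 show "Comp (horiz_cat PA) h (Comp (horiz_cat PA) g f) = Comp (horiz_cat PA) (Comp (horiz_cat PA) h g) f"
  using hcomp_nat_assoc[OF algcell_nat[OF f(1)] algcell_nat[OF g] algcell_nat[OF h]]
   algmor_comp_assoc[OF f(10) g'(7)[unfolded B'] h'(6)[unfolded C']]
   algmor_comp_assoc[OF f(11) g'(8)[unfolded B'] h'(7)[unfolded C']] f(4,5) g'(3,4) h'(2,3)
  by (auto simp: horiz_cat_def intro!: algcell_record_eqI)
next
 fix A assume A: "A \<in> Obj (horiz_cat PA)"
 then interpret alg_over T A by (simp add: horiz_cat_def small_algebra_over)
 have "cell_id (algmor_id T A) \<in> Cell2 PA"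
  using Cell2I[OF algmor.cell_id_cell[OF id_algmor]] A by (simp add: horiz_cat_def del: PsAlg_simps(3))
 then show "Ide (horiz_cat PA) A \<in> Arr (horiz_cat PA)" by (simp add: horiz_cat_def del: PsAlg_simps(3))
qed (simp_all add: horiz_cat_def)

text \<open>A 2-cell consists of its boundary and a natural transformation, so each law on 2-cells
  follows from the law for natural transformations once the boundaries are matched.\<close>

theorem PsAlg_two_category: "two_category PA"
proof (rule two_category.intro[OF PsAlg_under PsAlg_vert PsAlg_horiz])
 fix a assume "a \<in> Cell2 PA"
 then obtain A B G H where a: "algcell T A B G H a" "CDom a = G" "CCod a = H" "ADom G = A" "ACod G = B"
  "ADom H = A" "ACod H = B" by (rule Cell2E)
 show "Src PA (Dom2 PA a) = Src PA (Cod2 PA a)" "Trg PA (Dom2 PA a) = Trg PA (Cod2 PA a)" using a by simp_all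
next
 fix f g assume "f \<in> Cell1 PA" "g \<in> Cell1 PA" "Src PA g = Trg PA f"
 then show "HComp PA (Ide2 PA g) (Ide2 PA f) = Ide2 PA (Comp1 PA g f)"
  using hcomp_id_id[OF algebra_morphism.AFun[OF algmor.axioms(2)] algebra_morphism.AFun[OF algmor.axioms(2)],
    of T "ADom f" "ACod f" f T "ACod g" g] by (auto intro!: algcell_record_eqI)
next
 fix a a' b b'
 assume c: "a \<in> Cell2 PA" "a' \<in> Cell2 PA" "b \<in> Cell2 PA" "b' \<in> Cell2 PA"
  and e: "Dom2 PA a' = Cod2 PA a" "Dom2 PA b' = Cod2 PA b" "Src PA (Dom2 PA b) = Trg PA (Dom2 PA a)"
 obtain A B G H where a: "algcell T A B G H a" "CDom a = G" "CCod a = H" "ADom G = A" "ACod G = B"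
  "ADom H = A" "ACod H = B" using c(1) by (rule Cell2E)
 obtain A' B' G' H' where a': "algcell T A' B' G' H' a'" "CDom a' = G'" "CCod a' = H'" "ADom G' = A'" "ACod G' = B'"
  using c(2) by (rule Cell2E)
 obtain B'' C K M where b: "algcell T B'' C K M b" "CDom b = K" "CCod b = M" "ADom K = B''" "ACod K = C"
  "ADom M = B''" "ACod M = C" using c(3) by (rule Cell2E)
 obtain C' E K' M' where b': "algcell T C' E K' M' b'" "CDom b' = K'" "CCod b' = M'" "ADom K' = C'" "ACod K' = E"
  using c(4) by (rule Cell2E)
 have "algcell T A B H H' a'" "algcell T B C K M b" "algcell T B C M M' b'" using a a' b b' e by simp_all
 from interchange_nat[OF algcell_nat[OF a(1)] algcell_nat[OF this(1)] algcell_nat[OF this(2)] algcell_nat[OF this(3)]]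
 show "HComp PA (VComp PA b' b) (VComp PA a' a) = VComp PA (HComp PA b' a') (HComp PA b a)"
  by (auto intro!: algcell_record_eqI)
qed simp_all

end

section \<open>The category of cones\<close>

definition forget_psfun :: "('d0, 'd1, 'd2, ('o, 'a, 't) psalg, ('o, 'a, 't) algmor, ('o, 'a, 't) algcell) psfun \<Rightarrow>
  ('d0, 'd1, 'd2, 'o, 'a) cat_psfun" where
 "forget_psfun F = \<lparr>P0 = (\<lambda>x. Car (P0 F x)), P1 = (\<lambda>f. AFun (P1 F f)), P2 = (\<lambda>si. CNat (P2 F si)),
  PComp = (\<lambda>g f. CNat (PComp F g f)), PUnit = (\<lambda>x. CNat (PUnit F x))\<rparr>"

lemma forget_simps [simp]: "P0 (forget_psfun F) x = Car (P0 F x)" "P1 (forget_psfun F) f = AFun (P1 F f)"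
 "P2 (forget_psfun F) si = CNat (P2 F si)" "PComp (forget_psfun F) g f = CNat (PComp F g f)"
 "PUnit (forget_psfun F) x = CNat (PUnit F x)" by (simp_all add: forget_psfun_def)

text \<open>Transport of structure along injective codes. Cones are records of functions, whereas
  the carrier of a small algebra must have its objects and arrows in \<open>'u\<close>.\<close>

definition enc_cat :: "('o \<Rightarrow> 'p) \<Rightarrow> ('a \<Rightarrow> 'b) \<Rightarrow> ('o, 'a) cat \<Rightarrow> ('p, 'b) cat" where
 "enc_cat eo ea C = (let dO = inv_into (Obj C) eo; dA = inv_into (Arr C) ea in
  \<lparr>Obj = eo ` Obj C, Arr = ea ` Arr C, Dom = (\<lambda>f. eo (Dom C (dA f))), Cod = (\<lambda>f. eo (Cod C (dA f))),
  Ide = (\<lambda>x. ea (Ide C (dO x))), Comp = (\<lambda>g f. ea (Comp C (dA g) (dA f)))\<rparr>)"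

lemma enc_category: assumes "category C" "inj_on eo (Obj C)" "inj_on ea (Arr C)" shows "category (enc_cat eo ea C)"
proof -
 interpret category C by fact
 have o: "eo x = eo y \<longleftrightarrow> x = y" if "x \<in> Obj C" "y \<in> Obj C" for x y
  using inj_onD[OF assms(2)] that by blast
 show ?thesis by (rule category.intro)
   (auto simp: enc_cat_def Let_def assms(2,3) dom_obj cod_obj ide_arr ide_dom ide_cod comp_arr comp_dom
    comp_cod comp_ide_left comp_ide_right comp_assoc o)
qed

lemma small_category_obj: fixes X :: "('u::universe, 'u) cat"
 shows "small_category X ==> Obj X \<prec> (UNIV :: 'u set)" by (simp add: small_category_def small_def)

lemma small_category_arr: fixes X :: "('u::universe, 'u) cat"
 shows "small_category X ==> Arr X \<prec> (UNIV :: 'u set)" by (simp add: small_category_def small_def)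

locale limit_setting = is_theory T for T :: "'t alg_theory" + fixes D :: "('u::universe, 'u, 'u) two_cat"
  and J :: "('u, 'u, 'u, ('u, 'u) cat, ('u, 'u, 'u, 'u) func, ('u, 'u, 'u, 'u) ntrans) psfun"
  and F :: "('u, 'u, 'u, ('u, 'u, 't) psalg, ('u, 'u, 't) algmor, ('u, 'u, 't) algcell) psfun"
 assumes D_small: "small_two_category D" and J_psfun: "pseudo_functor D Cat J" and F_psfun: "pseudo_functor D PA F"
begin

sublocale D: two_category D using D_small by (simp add: small_two_category_def)
sublocale Jp: pseudo_functor D Cat J by (rule J_psfun)
sublocale Fp: pseudo_functor D PA F by (rule F_psfun)

lemma J_small: "x \<in> Cell0 D ==> small_category (P0 J x)" using Jp.P0_cell[of x] by (simp add: Cat_def)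

lemma J_cat_valued: "cat_valued D J"
proof (rule cat_valued.intro)
 show "category (P0 J x)" if "x \<in> Cell0 D" for x using J_small[OF that] by (simp add: small_category_def)
 show "is_functor (P0 J (Src D f)) (P0 J (Trg D f)) (P1 J f)" if "f \<in> Cell1 D" for f
  using Jp.P1_cell[OF that] Jp.P1_src[OF that] Jp.P1_trg[OF that] by (simp add: Cat_def)
 show "nat_trans (P0 J (Src D (Dom2 D si))) (P0 J (Trg D (Dom2 D si))) (P1 J (Dom2 D si)) (P1 J (Cod2 D si)) (P2 J si)"
  if "si \<in> Cell2 D" for si
  using Jp.P2_cell[OF that] Jp.P2_dom[OF that] Jp.P2_cod[OF that] Jp.P1_src[of "Dom2 D si"]
   Jp.P1_trg[of "Dom2 D si"] D.cell2(1)[OF that] by (simp add: Cat_def)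
 show "nat_trans (P0 J (Src D f)) (P0 J (Trg D g)) (comp_func (P1 J g) (P1 J f)) (P1 J (Comp1 D g f)) (PComp J g f)"
  if "f \<in> Cell1 D" "g \<in> Cell1 D" "Src D g = Trg D f" for f g
  using psfun_cells(1)[OF J_psfun that] Jp.PComp_dom[OF that] Jp.PComp_cod[OF that] Jp.P1_src[OF that(1)]
   Jp.P1_trg[OF that(2)] by (simp add: Cat_def)
 show "nat_trans (P0 J x) (P0 J x) (id_func (P0 J x)) (P1 J (Ide1 D x)) (PUnit J x)" if "x \<in> Cell0 D" for x
  using psfun_cells(2)[OF J_psfun that] Jp.PUnit_dom[OF that] Jp.PUnit_cod[OF that] by (simp add: Cat_def)
qed

lemma F_small: "x \<in> Cell0 D ==> small_algebra T (P0 F x)" using Fp.P0_cell[of x] by simp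

lemma F_alg: "x \<in> Cell0 D ==> alg_over T (P0 F x)" using F_small small_algebra_over by blast

lemma F_cat: "x \<in> Cell0 D ==> category (Car (P0 F x))"
 using F_alg alg_over.axioms(2) pseudo_algebra.Car_category by blast

lemma F_mor: "f \<in> Cell1 D ==> algmor T (P0 F (Src D f)) (P0 F (Trg D f)) (P1 F f)"
 using Fp.P1_cell[of f] Fp.P1_src[of f] Fp.P1_trg[of f] by simp

lemma F_cell: "si \<in> Cell2 D ==> algcell T (P0 F (Src D (Dom2 D si))) (P0 F (Trg D (Dom2 D si)))
  (P1 F (Dom2 D si)) (P1 F (Cod2 D si)) (P2 F si)"
 using Fp.P2_cell[of si] Fp.P2_dom[of si] Fp.P2_cod[of si] Fp.P1_src[of "Dom2 D si"] Fp.P1_trg[of "Dom2 D si"]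
  D.cell2(1)[of si] by simp

lemma F_comp_cell: "f \<in> Cell1 D ==> g \<in> Cell1 D ==> Src D g = Trg D f ==>
  algcell T (P0 F (Src D f)) (P0 F (Trg D g)) (algmor_comp T (P1 F g) (P1 F f)) (P1 F (Comp1 D g f)) (PComp F g f)"
 using psfun_cells(1)[OF F_psfun, of f g] Fp.PComp_dom[of f g] Fp.PComp_cod[of f g] Fp.P1_src[of f]
  Fp.P1_trg[of g] by simp

lemma F_unit_cell: "x \<in> Cell0 D ==>
  algcell T (P0 F x) (P0 F x) (algmor_id T (P0 F x)) (P1 F (Ide1 D x)) (PUnit F x)"
 using psfun_cells(2)[OF F_psfun, of x] Fp.PUnit_dom[of x] Fp.PUnit_cod[of x] by simp

abbreviation "U \<equiv> forget_psfun F"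

lemma U_cat_valued: "cat_valued D U"
proof (rule cat_valued.intro)
 show "category (P0 U x)" if "x \<in> Cell0 D" for x using F_cat[OF that] by simp
 show "is_functor (P0 U (Src D f)) (P0 U (Trg D f)) (P1 U f)" if "f \<in> Cell1 D" for f
  using algebra_morphism.AFun[OF algmor.axioms(2)[OF F_mor[OF that]]] by simp
 show "nat_trans (P0 U (Src D (Dom2 D si))) (P0 U (Trg D (Dom2 D si))) (P1 U (Dom2 D si)) (P1 U (Cod2 D si)) (P2 U si)"
  if "si \<in> Cell2 D" for si using algcell_nat[OF F_cell[OF that]] by simp
 show "nat_trans (P0 U (Src D f)) (P0 U (Trg D g)) (comp_func (P1 U g) (P1 U f)) (P1 U (Comp1 D g f)) (PComp U g f)"
  if "f \<in> Cell1 D" "g \<in> Cell1 D" "Src D g = Trg D f" for f g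
  using algcell_nat[OF F_comp_cell[OF that]] by simp
 show "nat_trans (P0 U x) (P0 U x) (id_func (P0 U x)) (P1 U (Ide1 D x)) (PUnit U x)" if "x \<in> Cell0 D" for x
  using algcell_nat[OF F_unit_cell[OF that]] by simp
qed

sublocale J: cat_valued D J by (rule J_cat_valued)
sublocale U: hom_setting D J U by (intro hom_setting.intro U_cat_valued) unfold_locales

abbreviation "H \<equiv> Hom_cat D J U"

text \<open>A cone is determined by \<open>pob\<close>, \<open>par\<close> and \<open>ptr\<close>,
  three families on small index sets with values in small sets; so the cones embed into a product of
  three small function sets.\<close>

lemma Obj_H_small: "Obj H \<prec> (UNIV :: 'u set)"
proof -
 let ?I1 = "Sigma (Cell0 D) (\<lambda>x. O0 J x)" and ?I2 = "Sigma (Cell0 D) (\<lambda>x. A0 J x)"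
  and ?I3 = "Sigma (Cell1 D) (\<lambda>f. O0 J (Src D f))"
 let ?P1 = "PiE ?I1 (\<lambda>(x, j). Obj (Car (P0 F x)))" and ?P2 = "PiE ?I2 (\<lambda>(x, u). Arr (Car (P0 F x)))"
  and ?P3 = "PiE ?I3 (\<lambda>(f, j). Arr (Car (P0 F (Trg D f))))"
 have D: "Cell0 D \<prec> (UNIV :: 'u set)" "Cell1 D \<prec> (UNIV :: 'u set)"
  using D_small by (simp_all add: small_two_category_def small_def)
 have FX: "small_category (Car (P0 F x))" if "x \<in> Cell0 D" for x
  using F_small[OF that] by (simp add: small_algebra_def)
 have "?P1 \<times> ?P2 \<times> ?P3 \<prec> (UNIV :: 'u set)" by (intro small_Times small_PiE small_Sigma D)
   (auto intro!: small_category_obj small_category_arr J_small FX D.cell1)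
 moreover have "Obj H \<lesssim> ?P1 \<times> ?P2 \<times> ?P3" unfolding lepoll_def
 proof (intro exI conjI)
  let ?g = "\<lambda>al. (restrict (\<lambda>(x, j). pob al x j) ?I1, restrict (\<lambda>(x, u). par al x u) ?I2,
   restrict (\<lambda>(f, j). ptr al f j) ?I3)"
  show "inj_on ?g (Obj H)"
  proof (rule inj_onI)
   fix al be assume "al \<in> Obj H" "be \<in> Obj H" and e: "?g al = ?g be"
   then have ab: "pseudo_nat D J U al" "pseudo_nat D J U be" by simp_all
   show "al = be"
   proof (rule U.pnat_eqI[OF ab])
    show "pob al x j = pob be x j" if "x \<in> Cell0 D" "j \<in> O0 J x" for x j
     using fun_cong[OF arg_cong[OF e, of fst], of "(x, j)"] that by simp
    show "par al x j = par be x j" if "x \<in> Cell0 D" "j \<in> A0 J x" for x j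
     using fun_cong[OF arg_cong[OF e, of "\<lambda>p. fst (snd p)"], of "(x, j)"] that by simp
    show "ptr al x j = ptr be x j" if "x \<in> Cell1 D" "j \<in> O0 J (Src D x)" for x j
     using fun_cong[OF arg_cong[OF e, of "\<lambda>p. snd (snd p)"], of "(x, j)"] that by simp
   qed
  qed
  show "?g ` Obj H \<subseteq> ?P1 \<times> ?P2 \<times> ?P3"
  proof (rule image_subsetI)
   fix al assume "al \<in> Obj H"
   then interpret c: pcone D J U "pob al" "par al" "ptr al" using U.pnat_pcone by simp
   show "?g al \<in> ?P1 \<times> ?P2 \<times> ?P3"
    using c.ob_obj c.ar_hom[OF _ in_homI] c.tr_hom by (auto simp: in_hom_def)
  qed
 qed
 ultimately show ?thesis using lesspoll_trans1 by blast
qed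

text \<open>A modification is determined by its two boundary cones and its components, and the set
  of cones is already known to be small.\<close>

lemma Arr_H_small: "Arr H \<prec> (UNIV :: 'u set)"
proof -
 let ?I1 = "Sigma (Cell0 D) (\<lambda>x. O0 J x)"
 let ?P1 = "PiE ?I1 (\<lambda>(x, j). Arr (Car (P0 F x)))"
 have D: "Cell0 D \<prec> (UNIV :: 'u set)" using D_small by (simp_all add: small_two_category_def small_def)
 have FX: "small_category (Car (P0 F x))" if "x \<in> Cell0 D" for x
  using F_small[OF that] by (simp add: small_algebra_def)
 have "Obj H \<times> Obj H \<times> ?P1 \<prec> (UNIV :: 'u set)"
  by (intro small_Times small_PiE small_Sigma D Obj_H_small)
   (auto intro!: small_category_obj small_category_arr J_small FX)
 moreover have "Arr H \<lesssim> Obj H \<times> Obj H \<times> ?P1" unfolding lepoll_def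
 proof (intro exI conjI)
  let ?g = "\<lambda>Ga. (MDom Ga, MCod Ga, restrict (\<lambda>(x, j). mcomp Ga x j) ?I1)"
  show "inj_on ?g (Arr H)"
  proof (rule inj_onI)
   fix Ga De assume "Ga \<in> Arr H" "De \<in> Arr H" and e: "?g Ga = ?g De"
   then have ab: "modification D J U Ga" "modification D J U De" by simp_all
   show "Ga = De"
   proof (rule U.modif_eqI[OF ab])
    show "mcomp Ga x j = mcomp De x j" if "x \<in> Cell0 D" "j \<in> O0 J x" for x j
     using fun_cong[OF arg_cong[OF e, of "\<lambda>p. snd (snd p)"], of "(x, j)"] that by simp
   qed (use e in simp_all)
  qed
  show "?g ` Arr H \<subseteq> Obj H \<times> Obj H \<times> ?P1"
  proof (rule image_subsetI)
   fix Ga assume "Ga \<in> Arr H"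
   then have G: "modification D J U Ga" by simp
   show "?g Ga \<in> Obj H \<times> Obj H \<times> ?P1"
    using modification.MDom[OF G] modification.MCod[OF G] U.modif_in_hom[OF G] by (auto simp: in_hom_def)
  qed
 qed
 ultimately show ?thesis using lesspoll_trans1 by blast
qed

definition eo :: "('u, 'u, 'u, 'u, 'u, 'u) pnat \<Rightarrow> 'u" where
 "eo = (SOME f. inj_on f (Obj H) \<and> small (f ` Obj H))"

definition ea :: "('u, 'u, 'u, 'u, 'u, 'u) modif \<Rightarrow> 'u" where
 "ea = (SOME f. inj_on f (Arr H) \<and> small (f ` Arr H))"

lemma eo: "inj_on eo (Obj H)" "small (eo ` Obj H)"
proof -
 have "\<exists>f :: _ \<Rightarrow> 'u. inj_on f (Obj H) \<and> small (f ` Obj H)"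
  using small_encode[OF Obj_H_small] by metis
 from someI_ex[OF this] show "inj_on eo (Obj H)" "small (eo ` Obj H)" by (auto simp: eo_def)
qed

lemma ea: "inj_on ea (Arr H)" "small (ea ` Arr H)"
proof -
 have "\<exists>f :: _ \<Rightarrow> 'u. inj_on f (Arr H) \<and> small (f ` Arr H)"
  using small_encode[OF Arr_H_small] by metis
 from someI_ex[OF this] show "inj_on ea (Arr H)" "small (ea ` Arr H)" by (auto simp: ea_def)
qed

definition LC :: "('u, 'u) cat" where "LC = enc_cat eo ea H"
definition dO :: "'u \<Rightarrow> ('u, 'u, 'u, 'u, 'u, 'u) pnat" where "dO = inv_into (Obj H) eo"
definition dA :: "'u \<Rightarrow> ('u, 'u, 'u, 'u, 'u, 'u) modif" where "dA = inv_into (Arr H) ea"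

abbreviation "ob z \<equiv> pob (dO z)"
abbreviation "ar z \<equiv> par (dO z)"
abbreviation "tr z \<equiv> ptr (dO z)"
abbreviation "mc m \<equiv> mcomp (dA m)"

definition mkO where "mkO o' a t = eo (mk_pnat D J U o' a t)"
definition mkA where "mkA z z' m = ea (mk_modif D J (dO z) (dO z') m)"

lemma LC_small: "small_category LC" using enc_category[OF U.Hom_category eo(1) ea(1)] eo(2) ea(2)
 by (simp add: small_category_def LC_def) (simp add: enc_cat_def Let_def)

sublocale LC: category LC using LC_small by (simp add: small_category_def)

lemma dO: "z \<in> Obj LC ==> pseudo_nat D J U (dO z)" "z \<in> Obj LC ==> eo (dO z) = z"
 "pseudo_nat D J U al ==> eo al \<in> Obj LC" "pseudo_nat D J U al ==> dO (eo al) = al"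
 using inv_into_into[of z eo "Obj H"] f_inv_into_f[of z eo "Obj H"] inv_into_f_f[OF eo(1), of al]
 by (auto simp: LC_def dO_def enc_cat_def Let_def)

lemma dA: "m \<in> Arr LC ==> modification D J U (dA m)" "m \<in> Arr LC ==> ea (dA m) = m"
 "modification D J U Ga ==> ea Ga \<in> Arr LC" "modification D J U Ga ==> dA (ea Ga) = Ga"
 using inv_into_into[of m ea "Arr H"] f_inv_into_f[of m ea "Arr H"] inv_into_f_f[OF ea(1), of Ga]
 by (auto simp: LC_def dA_def enc_cat_def Let_def)

lemma LC_Dom: "m \<in> Arr LC ==> dO (Dom LC m) = MDom (dA m)" "m \<in> Arr LC ==> dO (Cod LC m) = MCod (dA m)"
proof -
 assume m: "m \<in> Arr LC"
 have "Dom LC m = eo (MDom (dA m))" "Cod LC m = eo (MCod (dA m))" by (simp_all add: LC_def enc_cat_def Let_def dA_def)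
 then show "dO (Dom LC m) = MDom (dA m)" "dO (Cod LC m) = MCod (dA m)"
  using dO(4) modification.MDom[OF dA(1)[OF m]] modification.MCod[OF dA(1)[OF m]] by simp_all
qed

lemma LC_pcone: "z \<in> Obj LC ==> pcone D J U (ob z) (ar z) (tr z)" by (rule U.pnat_pcone[OF dO(1)])

lemma LC_obj_eqI: assumes "z \<in> Obj LC" "z' \<in> Obj LC"
  "\<And>x j. x \<in> Cell0 D ==> j \<in> O0 J x ==> ob z x j = ob z' x j"
  "\<And>x u. x \<in> Cell0 D ==> u \<in> A0 J x ==> ar z x u = ar z' x u"
  "\<And>f j. f \<in> Cell1 D ==> j \<in> O0 J (Src D f) ==> tr z f j = tr z' f j" shows "z = z'"
 using U.pnat_eqI[OF dO(1)[OF assms(1)] dO(1)[OF assms(2)] assms(3-5)] dO(2) assms(1,2) by metis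

lemma mkO: assumes "pcone D J U o' a t" shows "mkO o' a t \<in> Obj LC"
  "x \<in> Cell0 D ==> j \<in> O0 J x ==> ob (mkO o' a t) x j = o' x j"
  "x \<in> Cell0 D ==> u \<in> A0 J x ==> ar (mkO o' a t) x u = a x u"
  "f \<in> Cell1 D ==> j \<in> O0 J (Src D f) ==> tr (mkO o' a t) f j = t f j"
 using dO(3,4)[OF U.mk_pnat_pseudo_nat[OF assms]] by (simp_all add: mkO_def U.mk_pnat_simps)

lemma LC_pmod: assumes "in_hom LC m z z'" shows "pmod D J U (ob z) (ar z) (tr z) (ob z') (ar z') (tr z') (mc m)"
 using U.modif_pmod[OF dA(1)] LC_Dom assms by (auto simp: in_hom_def)

lemma mc_hom: "in_hom LC m z z' ==> x \<in> Cell0 D ==> j \<in> O0 J x ==>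
  chom (P0 F x) (mc m x j) (ob z x j) (ob z' x j)" using pmod.m_hom[OF LC_pmod] by fastforce

lemma LC_arr_eqI: assumes "in_hom LC m z z'" "in_hom LC n z z'"
  "\<And>x j. x \<in> Cell0 D ==> j \<in> O0 J x ==> mc m x j = mc n x j" shows "m = n"
proof -
 have m: "m \<in> Arr LC" and n: "n \<in> Arr LC" using assms by (auto simp: in_hom_def)
 have "MDom (dA m) = MDom (dA n)" "MCod (dA m) = MCod (dA n)"
  using assms(1,2) LC_Dom[OF m] LC_Dom[OF n] by (auto simp: in_hom_def)
 from U.modif_eqI[OF dA(1)[OF m] dA(1)[OF n] this assms(3)]
 show ?thesis using dA(2) m n by metis
qed

lemma mkA: assumes "z \<in> Obj LC" "z' \<in> Obj LC" "pmod D J U (ob z) (ar z) (tr z) (ob z') (ar z') (tr z') m"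
 shows "in_hom LC (mkA z z' m) z z'" "x \<in> Cell0 D ==> j \<in> O0 J x ==> mc (mkA z z' m) x j = m x j"
proof -
 note G = U.mk_modif_modification[OF dO(1)[OF assms(1)] dO(1)[OF assms(2)] assms(3)]
 have a: "mkA z z' m \<in> Arr LC" "dA (mkA z z' m) = mk_modif D J (dO z) (dO z') m"
  using dA(3,4)[OF G] by (simp_all add: mkA_def)
 have "dO (Dom LC (mkA z z' m)) = dO z" "dO (Cod LC (mkA z z' m)) = dO z'" using LC_Dom[OF a(1)] by (simp_all add: a)
 then show "in_hom LC (mkA z z' m) z z'"
  using a(1) dO(2) assms(1,2) LC.dom_obj[OF a(1)] LC.cod_obj[OF a(1)] unfolding in_hom_def by metis
 show "mc (mkA z z' m) x j = m x j" if "x \<in> Cell0 D" "j \<in> O0 J x" using that by (simp add: a)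
qed

lemma mc_comp: assumes "in_hom LC m z z'" "in_hom LC n z' z''" "x \<in> Cell0 D" "j \<in> O0 J x"
 shows "mc (Comp LC n m) x j = cmp (P0 F x) (mc n x j) (mc m x j)"
proof -
 have a: "m \<in> Arr LC" "n \<in> Arr LC" "Dom LC n = Cod LC m" using assms by (auto simp: in_hom_def)
 then have "MDom (dA n) = MCod (dA m)" using LC_Dom by metis
 from U.modif_vcomp_modification[OF dA(1)[OF a(1)] dA(1)[OF a(2)] this]
 have "dA (Comp LC n m) = modif_vcomp D (dA n) (dA m)" using dA(4) by (simp add: LC_def enc_cat_def Let_def dA_def)
 then show ?thesis using U.modif_vcomp_mcomp[OF dA(1)[OF a(1)] dA(1)[OF a(2)] assms(3,4)] by simp
qed

lemma mc_ide: assumes "z \<in> Obj LC" "x \<in> Cell0 D" "j \<in> O0 J x"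
 shows "mc (Ide LC z) x j = Ide (Car (P0 F x)) (ob z x j)"
proof -
 have "dA (Ide LC z) = modif_id D (dO z)" using dA(4)[OF U.modif_id_modification[OF dO(1)[OF assms(1)]]]
  by (simp add: LC_def enc_cat_def Let_def dO_def)
 then show ?thesis using U.modif_id_mcomp[OF dO(1)[OF assms(1)] assms(2,3)] by simp
qed

text \<open>Pointwise inverses form a modification by \<open>pmod_inverse\<close>, and composites in
  \<open>LC\<close> are computed on components.\<close>

lemma LC_isoI: assumes m: "in_hom LC m z z'"
  and iso: "\<And>x j. x \<in> Cell0 D ==> j \<in> O0 J x ==> iso_arr (Car (P0 F x)) (mc m x j)" shows "iso_arr LC m"
proof -
 note z = LC.in_hom_obj[OF m]
 have "\<forall>x j. \<exists>g. x \<in> Cell0 D \<longrightarrow> j \<in> O0 J x \<longrightarrow>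
   chom (P0 F x) g (ob z' x j) (ob z x j) \<and> cmp (P0 F x) g (mc m x j) = Ide (Car (P0 F x)) (ob z x j) \<and>
   cmp (P0 F x) (mc m x j) g = Ide (Car (P0 F x)) (ob z' x j)"
  using category.iso_arrE[OF F_cat iso mc_hom[OF m]] by metis
 then obtain n where n: "\<And>x j. x \<in> Cell0 D ==> j \<in> O0 J x ==>
   chom (P0 F x) (n x j) (ob z' x j) (ob z x j) \<and>
   cmp (P0 F x) (n x j) (mc m x j) = Ide (Car (P0 F x)) (ob z x j) \<and>
   cmp (P0 F x) (mc m x j) (n x j) = Ide (Car (P0 F x)) (ob z' x j)" by metis
 have "pmod D J U (ob z') (ar z') (tr z') (ob z) (ar z) (tr z) n"
  by (rule U.pmod_inverse[OF LC_pcone[OF z(1)] LC_pcone[OF z(2)] LC_pmod[OF m]]) (use n in auto)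
 note k = mkA[OF z(2,1) this]
 show ?thesis
 proof (rule LC.iso_arrI[OF m k(1)])
  show "Comp LC (mkA z' z n) m = Ide LC z" by (rule LC_arr_eqI[OF LC.in_hom_comp[OF m k(1)] LC.in_hom_ide[OF z(1)]])
    (use n in \<open>simp add: mc_comp[OF m k(1)] mc_ide[OF z(1)] k(2)\<close>)
  show "Comp LC m (mkA z' z n) = Ide LC z'" by (rule LC_arr_eqI[OF LC.in_hom_comp[OF k(1) m] LC.in_hom_ide[OF z(2)]])
    (use n in \<open>simp add: mc_comp[OF k(1) m] mc_ide[OF z(2)] k(2)\<close>)
 qed
qed

lemma mc_iso: assumes "iso_arr LC m" "x \<in> Cell0 D" "j \<in> O0 J x" shows "iso_arr (Car (P0 F x)) (mc m x j)"
proof -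
 have m: "in_hom LC m (Dom LC m) (Cod LC m)" using assms(1) by (simp add: iso_arr_def in_hom_def)
 obtain n where n: "in_hom LC n (Cod LC m) (Dom LC m)" "Comp LC n m = Ide LC (Dom LC m)"
  "Comp LC m n = Ide LC (Cod LC m)" using LC.iso_arrE[OF assms(1) m] .
 show ?thesis by (rule category.iso_arrI[OF F_cat[OF assms(2)] mc_hom[OF m assms(2,3)] mc_hom[OF n(1) assms(2,3)]])
   (simp_all add: mc_comp[OF m n(1) assms(2,3), symmetric] mc_comp[OF n(1) m assms(2,3), symmetric] n
    mc_ide[OF _ assms(2,3)] LC.in_hom_obj[OF m])
qed

text \<open>The codomain is recovered from the domain and the components. Its arrow values follow
  from naturality by cancelling the component at the domain of the arrow; its 2-cells follow from
  compatibility by cancelling the image of the component under the functor of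
  \<open>P1 F f\<close>.\<close>

lemma LC_iso_eqI: assumes m: "in_hom LC m z z'" "iso_arr LC m" and n: "in_hom LC n z z''"
  and e: "\<And>x j. x \<in> Cell0 D ==> j \<in> O0 J x ==> mc m x j = mc n x j" shows "m = n"
proof -
 interpret m: pmod D J U "ob z" "ar z" "tr z" "ob z'" "ar z'" "tr z'" "mc m" by (rule LC_pmod[OF m(1)])
 interpret n: pmod D J U "ob z" "ar z" "tr z" "ob z''" "ar z''" "tr z''" "mc n" by (rule LC_pmod[OF n])
 note zm = LC.in_hom_obj[OF m(1)] and zn = LC.in_hom_obj[OF n]
 interpret c': pcone D J U "ob z'" "ar z'" "tr z'" by (rule LC_pcone[OF zm(2)])
 interpret c'': pcone D J U "ob z''" "ar z''" "tr z''" by (rule LC_pcone[OF zn(2)])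
 have o': "ob z' x j = ob z'' x j" if "x \<in> Cell0 D" "j \<in> O0 J x" for x j
  using m.m_hom[OF that] n.m_hom[OF that] e[OF that] by (simp add: in_hom_def)
 have "z' = z''"
 proof (rule LC_obj_eqI[OF zm(2) zn(2) o'])
  fix x u assume x: "x \<in> Cell0 D" and "u \<in> A0 J x"
  then have u: "hom0 J x u (Dom (P0 J x) u) (Cod (P0 J x) u)" by (simp add: in_homI)
  note ij = hom_obj[OF J.P0_cat[OF x] u]
  show "ar z' x u = ar z'' x u" by (rule category.iso_cancel_right[OF F_cat[OF x] _ mc_iso[OF m(2) x ij(1)],
      of _ _ _ "ob z' x (Cod (P0 J x) u)" _ "ob z'' x (Cod (P0 J x) u)"])
    (use m.m_hom[OF x ij(1)] c'.ar_hom[OF x u] c''.ar_hom[OF x u] o'[OF x ij(1)] m.m_nat[OF x u]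
     n.m_nat[OF x u] e[OF x] ij in auto)
 next
  fix f j assume f: "f \<in> Cell1 D" and j: "j \<in> O0 J (Src D f)"
  note xy = D.cell1(1,2)[OF f]
  interpret Uf: is_functor "Car (P0 F (Src D f))" "Car (P0 F (Trg D f))" "AFun (P1 F f)"
   using U.K.P1_func[OF f] by simp
  have m': "chom (P0 F (Src D f)) (mc m (Src D f) j) (ob z (Src D f) j) (ob z' (Src D f) j)"
   using m.m_hom[OF xy(1) j] by simp
  show "tr z' f j = tr z'' f j"
   by (rule category.iso_cancel_right[OF F_cat[OF xy(2)] Uf.FA_in_hom[OF m'] Uf.FA_iso[OF mc_iso[OF m(2) xy(1) j]],
      of _ "ob z' (Trg D f) (O1 J f j)" _ "ob z'' (Trg D f) (O1 J f j)"])
    (use c'.tr_hom[OF f j] c''.tr_hom[OF f j] o'[OF xy(1) j] m.m_compat[OF f j] n.m_compat[OF f j]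
     e[OF xy(1) j] e[OF xy(2) fun_obj[OF J.P1_func[OF f] j]] in auto)
 qed
 then show ?thesis using LC_arr_eqI[OF m(1)] n e by simp
qed

end

section \<open>The pseudo algebra of cones\<close>

lemma map2_maps: "map2 h (map f zs) (map g zs) = map (\<lambda>z. h (f z) (g z)) zs" by (induction zs) auto

context limit_setting
begin

abbreviation "Obs zs x j \<equiv> map (\<lambda>z. ob z x j) zs"
abbreviation "Ars zs x u \<equiv> map (\<lambda>z. ar z x u) zs"
abbreviation "Trs zs f j \<equiv> map (\<lambda>z. tr z f j) zs"
abbreviation "Mcs ms x j \<equiv> map (\<lambda>m. mc m x j) ms"
abbreviation "X x \<equiv> Car (P0 F x)"

lemma pow_LC_nth: "zs \<in> powO LC n ==> z \<in> set zs ==> z \<in> Obj LC" by (auto simp: powO_iff in_set_conv_nth)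

lemma Obs: "zs \<in> powO LC n ==> x \<in> Cell0 D ==> j \<in> O0 J x ==> Obs zs x j \<in> powO (X x) n"
 using pcone.ob_obj[OF LC_pcone] by (auto simp: powO_iff)

lemma Ars: "zs \<in> powO LC n ==> x \<in> Cell0 D ==> hom0 J x u i j ==>
  powH (X x) n (Ars zs x u) (Obs zs x i) (Obs zs x j)"
 using pcone.ar_hom[OF LC_pcone] by (auto simp: powO_iff powH_iff)

lemma Trs: "zs \<in> powO LC n ==> f \<in> Cell1 D ==> j \<in> O0 J (Src D f) ==>
  powH (X (Trg D f)) n (Trs zs f j) (map (AO (P1 F f)) (Obs zs (Src D f) j)) (Obs zs (Trg D f) (O1 J f j))"
 using pcone.tr_hom[OF LC_pcone] by (auto simp: powO_iff powH_iff)

lemma Trs_iso: "zs \<in> powO LC n ==> f \<in> Cell1 D ==> j \<in> O0 J (Src D f) ==>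
  iso_arr (pow_cat (X (Trg D f)) n) (Trs zs f j)"
 using pcone.tr_iso[OF LC_pcone] by (intro iso_arr_pow) (auto simp: powO_iff)

lemma Mcs: "powH LC n ms zs zs' ==> x \<in> Cell0 D ==> j \<in> O0 J x ==>
  powH (X x) n (Mcs ms x j) (Obs zs x j) (Obs zs' x j)" using mc_hom by (auto simp: powH_iff)

section \<open>The action of a word on tuples of cones and on tuples of modifications\<close>

definition "phi_ob w zs x j = PhiO (P0 F x) w (Obs zs x j)"
definition "phi_ar w zs x u = PhiF (P0 F x) w (Ars zs x u)"
text \<open>The coherence of \<open>P1 F f\<close> leads from the image of a value of
  \<open>w\<close> to the value of \<open>w\<close> at the images; there the 2-cells of the single
  cones can be applied in each argument.\<close>

definition "phi_tr w zs f j = Comp (X (Trg D f)) (PhiF (P0 F (Trg D f)) w (Trs zs f j))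
 (rho (P1 F f) w (Obs zs (Src D f) j))"

text \<open>Each condition holds in every coordinate of the tuple, hence as one equation in a power
  category, to which the functor of the word is applied. It remains to move the coherences of the
  morphisms \<open>P1 F f\<close> across: past arrow values by their naturality, past the structure
  cells of \<open>F\<close> because these are algebra 2-cells.\<close>

lemma phi_pcone: assumes w: "w \<in> words T n" and zs: "zs \<in> powO LC n"
 shows "pcone D J U (phi_ob w zs) (phi_ar w zs) (phi_tr w zs)"
proof
 have c: "pcone D J U (ob z) (ar z) (tr z)" if "z \<in> set zs" for z using LC_pcone pow_LC_nth[OF zs that] .
 have l: "length zs = n" using zs by (simp add: powO_iff)
 fix x assume x: "x \<in> Cell0 D"
 interpret A: alg_over T "P0 F x" by (rule F_alg[OF x])
 interpret P: is_functor "pow_cat (X x) n" "X x" "Phi (P0 F x) w" by (rule A.Phi_functor[OF w])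
 show "phi_ob w zs x j \<in> O0 U x" if "j \<in> O0 J x" for j
  using P.FO_obj[OF Obs[OF zs x that]] by (simp add: phi_ob_def)
 show "hom0 U x (phi_ar w zs x u) (phi_ob w zs x i) (phi_ob w zs x j)" if "hom0 J x u i j" for u i j
  using P.FA_in_hom[OF Ars[OF zs x that]] by (simp add: phi_ob_def phi_ar_def)
 show "phi_ar w zs x (Ide (P0 J x) j) = Ide (P0 U x) (phi_ob w zs x j)" if j: "j \<in> O0 J x" for j
 proof -
  have "Ars zs x (Ide (P0 J x) j) = Ide (pow_cat (X x) n) (Obs zs x j)" using pcone.ar_ide[OF c x j] by simp
  then show ?thesis using P.FA_ide[OF Obs[OF zs x j]] by (simp only: phi_ob_def phi_ar_def forget_simps)
 qed
 show "phi_ar w zs x (cmp0 J x v u) = cmp0 U x (phi_ar w zs x v) (phi_ar w zs x u)"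
  if u: "hom0 J x u i j" and v: "hom0 J x v j k" for u v i j k
 proof -
  have "Ars zs x (cmp0 J x v u) = Comp (pow_cat (X x) n) (Ars zs x v) (Ars zs x u)"
   using pcone.ar_comp[OF c x u v] by (simp add: map2_maps)
  then show ?thesis using P.FA_comp_hom[OF Ars[OF zs x u] Ars[OF zs x v]] by (simp only: phi_ar_def forget_simps)
 qed
 fix j assume j: "j \<in> O0 J x"
 note e = D.cell1(3,4,5)[OF x]
 interpret a: algcell T "P0 F x" "P0 F x" "algmor_id T (P0 F x)" "P1 F (Ide1 D x)" "PUnit F x"
  by (rule F_unit_cell[OF x])
 interpret UJ: nat_trans "P0 J x" "P0 J x" "id_func (P0 J x)" "P1 J (Ide1 D x)" "PUnit J x"
  by (rule J.PUnit_nat[OF x])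
 let ?a = "cN (PUnit F x)"
 note o1 = Obs[OF zs x j] and t = Trs[OF zs e(1), unfolded e(2,3), OF j]
 have ma: "powH (X x) n (map ?a (Obs zs x j)) (Obs zs x j) (map (AO (P1 F (Ide1 D x))) (Obs zs x j))"
  using o1 a.CNat.NC_in_hom by (auto simp: powO_iff powH_iff)
 \<comment> \<open>The coherence of the identity morphism is an identity, so it disappears from the
   unit condition.\<close>
 have rid: "rho (algmor_id T (P0 F x)) w (Obs zs x j) = Ide (X x) (phi_ob w zs x j)"
  using words_all[OF w] o1 by (simp add: P.FDom P.FCod phi_ob_def)
 have ec: "Comp (pow_cat (X x) n) (Trs zs (Ide1 D x) j) (map ?a (Obs zs x j)) = Ars zs x (NC (PUnit J x) j)"
  using pcone.tr_unit[OF c x j] by (simp add: map2_maps)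
 note hs = P.FA_in_hom[OF t] a.H.rho_hom[OF w o1] a.CNat.NC_in_hom[OF P.FO_obj[OF o1]] P.FA_in_hom[OF ma]
  P.FO_obj[OF o1]
 have "Comp (X x) (phi_tr w zs (Ide1 D x) j) (?a (phi_ob w zs x j)) =
  Comp (X x) (PhiF (P0 F x) w (Trs zs (Ide1 D x) j))
   (Comp (X x) (rho (P1 F (Ide1 D x)) w (Obs zs x j)) (?a (PhiO (P0 F x) w (Obs zs x j))))"
  using hs by (simp add: phi_tr_def e phi_ob_def A.Car.comp_simps)
 also have "\<dots> = PhiF (P0 F x) w (Ars zs x (NC (PUnit J x) j))"
  unfolding a.cell_rho[OF w o1] rid ec[symmetric] P.FA_comp_hom[OF ma t]
  using hs by (simp add: phi_ob_def A.Car.comp_simps del: map_map)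
 finally show "cmp0 U x (phi_tr w zs (Ide1 D x) j) (NC (PUnit U x) (phi_ob w zs x j)) =
   phi_ar w zs x (NC (PUnit J x) j)" by (simp add: phi_ar_def)
next
 have c: "pcone D J U (ob z) (ar z) (tr z)" if "z \<in> set zs" for z using LC_pcone pow_LC_nth[OF zs that] .
 fix f assume f: "f \<in> Cell1 D"
 note xy = D.cell1(1,2)[OF f]
 let ?x = "Src D f" and ?y = "Trg D f"
 interpret m: algmor T "P0 F ?x" "P0 F ?y" "P1 F f" by (rule F_mor[OF f])
 interpret P: is_functor "pow_cat (X ?y) n" "X ?y" "Phi (P0 F ?y) w" by (rule m.B.Phi_functor[OF w])
 interpret Px: is_functor "pow_cat (X ?x) n" "X ?x" "Phi (P0 F ?x) w" by (rule m.A.Phi_functor[OF w])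
 interpret Jf: is_functor "P0 J ?x" "P0 J ?y" "P1 J f" by (rule J.P1_func[OF f])
 have th: "in_hom (X ?y) (phi_tr w zs f j) (AO (P1 F f) (phi_ob w zs ?x j))
   (phi_ob w zs ?y (O1 J f j))" if j: "j \<in> O0 J ?x" for j
  using m.B.Car.in_hom_comp[OF m.rho_hom[OF w Obs[OF zs xy(1) j]] P.FA_in_hom[OF Trs[OF zs f j]]]
  by (simp add: phi_ob_def phi_tr_def)
 show "hom0 U ?y (phi_tr w zs f j) (O1 U f (phi_ob w zs ?x j)) (phi_ob w zs ?y (O1 J f j))"
  if "j \<in> O0 J ?x" for j using th[OF that] by simp
 show "iso_arr (P0 U ?y) (phi_tr w zs f j)" if j: "j \<in> O0 J ?x" for j
  using m.B.Car.iso_comp[OF m.rho_hom[OF w Obs[OF zs xy(1) j]] m.rho_iso[OF w Obs[OF zs xy(1) j]]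
    P.FA_in_hom[OF Trs[OF zs f j]] P.FA_iso[OF Trs_iso[OF zs f j]]] by (simp add: phi_tr_def)
 show "cmp0 U ?y (phi_tr w zs f j) (A1 U f (phi_ar w zs ?x u)) =
   cmp0 U ?y (phi_ar w zs ?y (A1 J f u)) (phi_tr w zs f i)" if u: "hom0 J ?x u i j" for u i j
 proof -
  note ij = hom_obj[OF J.P0_cat[OF xy(1)] u]
  note a = Ars[OF zs xy(1) u] and a' = Ars[OF zs xy(2) Jf.FA_in_hom[OF u]]
  note ha = pow_func_in_hom[OF m.AFun a]
  note ti = Trs[OF zs f ij(1)] and tj = Trs[OF zs f ij(2)]
  note oi = Obs[OF zs xy(1) ij(1)] and oj = Obs[OF zs xy(1) ij(2)]
  note hs = P.FA_in_hom[OF ti] P.FA_in_hom[OF tj] P.FA_in_hom[OF ha] P.FA_in_hom[OF a']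
   m.rho_hom[OF w oi] m.rho_hom[OF w oj] m.AFun.FA_in_hom[OF Px.FA_in_hom[OF a]]
  have ec: "Comp (pow_cat (X ?y) n) (Trs zs f j) (map (AA (P1 F f)) (Ars zs ?x u)) =
    Comp (pow_cat (X ?y) n) (Ars zs ?y (A1 J f u)) (Trs zs f i)" using pcone.tr_nat[OF c f u] by (simp add: map2_maps)
  show ?thesis unfolding phi_tr_def phi_ar_def forget_simps
   by (rule m.B.Car.square_paste[OF hs(7,3,4,5,6,1,2) m.rho_nat[OF w a] P.FA_square[OF ha tj ti a' ec]])
 qed
 fix g j assume g: "g \<in> Cell1 D" "Src D g = Trg D f" and j: "j \<in> O0 J ?x"
 let ?z = "Trg D g"
 note z = D.cell1(2)[OF g(1)] and gf = D.cell1(6,7,8)[OF f g]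
 interpret k: algmor T "P0 F ?y" "P0 F ?z" "P1 F g" using F_mor[OF g(1)] by (simp add: g(2))
 interpret kf: algmor_pair T "P0 F ?x" "P0 F ?y" "P0 F ?z" "P1 F f" "P1 F g" by unfold_locales
 interpret a: algcell T "P0 F ?x" "P0 F ?z" "algmor_comp T (P1 F g) (P1 F f)" "P1 F (Comp1 D g f)" "PComp F g f"
  by (rule F_comp_cell[OF f g])
 interpret Pz: is_functor "pow_cat (X ?z) n" "X ?z" "Phi (P0 F ?z) w" by (rule k.B.Phi_functor[OF w])
 interpret CJ: nat_trans "P0 J ?x" "P0 J ?z" "comp_func (P1 J g) (P1 J f)"
   "P1 J (Comp1 D g f)" "PComp J g f" by (rule J.PComp_nat[OF f g])
 let ?a = "cN (PComp F g f)" and ?O = "Obs zs ?x j"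
 let ?j = "O1 J f j" and ?G = "AA (P1 F g)" and ?Pz = "PhiF (P0 F ?z) w"
 note j' = Jf.FO_obj[OF j]
 note o1 = Obs[OF zs xy(1) j] and o2 = Obs[OF zs xy(2) j']
 note fo = pow_func_Obj[OF m.AFun o1]
 note t1 = Trs[OF zs f j] and t2 = Trs[OF zs g(1), unfolded g(2), OF j']
 note t3 = Trs[OF zs gf(1), unfolded gf(2,3), OF j]
 note gt = pow_func_in_hom[OF k.AFun t1]
 note aj = Ars[OF zs z CJ.NC_in_hom[OF j]]
 have ma: "powH (X ?z) n (map ?a ?O) (map (AO (P1 F g)) (map (AO (P1 F f)) ?O)) (map (AO (P1 F (Comp1 D g f))) ?O)"
  using o1 a.CNat.NC_in_hom by (auto simp: powO_iff powH_iff m.AFun.FDom)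
 \<comment> \<open>The composition conditions of the single cones, collected into one equation in
   the power category.\<close>
 have ec: "Comp (pow_cat (X ?z) n) (Trs zs (Comp1 D g f) j) (map ?a ?O) =
   Comp (pow_cat (X ?z) n) (Ars zs ?z (NC (PComp J g f) j))
    (Comp (pow_cat (X ?z) n) (Trs zs g ?j) (map ?G (Trs zs f j)))"
  using pcone.tr_comp[OF c f g j] by (simp add: map2_maps)
 have fj: "FO (comp_func (P1 J g) (P1 J f)) j = O1 J g ?j" using j by (simp add: Jf.FDom)
 note aj = aj[unfolded fj]
 interpret PZ: category "pow_cat (X ?z) n" by (rule pow_category[OF k.B.Car_category])
 note hs = Pz.FA_in_hom[OF t2] Pz.FA_in_hom[OF t3] Pz.FA_in_hom[OF gt] Pz.FA_in_hom[OF aj] Pz.FA_in_hom[OF ma]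
  a.H.rho_hom[OF w o1] k.rho_hom[OF w fo] k.AFun.FA_in_hom[OF m.rho_hom[OF w o1]]
  k.AFun.FA_in_hom[OF P.FA_in_hom[OF t1]] k.rho_hom[OF w o2]
 have h0: "in_hom (X ?z) (?a (PhiO (P0 F ?x) w ?O)) (AO (P1 F g) (AO (P1 F f) (PhiO (P0 F ?x) w ?O)))
   (AO (P1 F (Comp1 D g f)) (PhiO (P0 F ?x) w ?O))"
  using a.CNat.NC_in_hom[OF Px.FO_obj[OF o1]] Px.FO_obj[OF o1] by (simp add: m.AFun.FDom)
 have "Comp (X ?z) (phi_tr w zs (Comp1 D g f) j) (?a (phi_ob w zs ?x j)) = Comp (X ?z) (?Pz (Trs zs (Comp1 D g f) j))
    (Comp (X ?z) (rho (P1 F (Comp1 D g f)) w ?O) (?a (PhiO (P0 F ?x) w ?O)))"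
  using hs h0 by (simp add: phi_tr_def phi_ob_def gf k.B.Car.comp_simps)
 \<comment> \<open>The 2-cell condition of \<open>PComp F g f\<close> replaces the coherence of the
   image of the composite by that of the composite of the images, which \<open>comp_rho\<close>
   splits into the coherences for \<open>g\<close> and for \<open>f\<close>.\<close>
 also have "\<dots> = Comp (X ?z) (Comp (X ?z) (?Pz (Trs zs (Comp1 D g f) j)) (?Pz (map ?a ?O)))
   (Comp (X ?z) (rho (P1 F g) w (map (AO (P1 F f)) ?O)) (?G (rho (P1 F f) w ?O)))"
  unfolding a.cell_rho[OF w o1] kf.comp_rho[OF w o1] using hs by (simp add: k.B.Car.comp_simps del: map_map)
 also have "\<dots> = Comp (X ?z) (?Pz (Ars zs ?z (NC (PComp J g f) j))) (Comp (X ?z) (?Pz (Trs zs g ?j))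
   (Comp (X ?z) (Comp (X ?z) (?Pz (map ?G (Trs zs f j))) (rho (P1 F g) w (map (AO (P1 F f)) ?O)))
    (?G (rho (P1 F f) w ?O))))"
  unfolding Pz.FA_comp_hom[OF ma t3, symmetric] ec Pz.FA_comp_hom[OF PZ.in_hom_comp[OF gt t2] aj]
   Pz.FA_comp_hom[OF gt t2] using hs by (simp add: k.B.Car.comp_simps del: map_map)
 \<comment> \<open>Naturality of the coherence of \<open>P1 F g\<close> at the 2-cells for
   \<open>f\<close> regroups the factors into the corrected 2-cells for \<open>g\<close> and for
   \<open>f\<close>.\<close>
 also have "\<dots> = Comp (X ?z) (phi_ar w zs ?z (NC (PComp J g f) j))
   (Comp (X ?z) (phi_tr w zs g ?j) (?G (phi_tr w zs f j)))"
  unfolding k.rho_nat[OF w t1, symmetric] phi_tr_def phi_ar_def g(2)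
   k.AFun.FA_comp_hom[OF m.rho_hom[OF w o1] P.FA_in_hom[OF t1]]
  using hs by (simp add: k.B.Car.comp_simps del: map_map)
 finally show "cmp0 U ?z (phi_tr w zs (Comp1 D g f) j) (NC (PComp U g f) (phi_ob w zs ?x j)) =
   cmp0 U ?z (phi_ar w zs ?z (NC (PComp J g f) j)) (cmp0 U ?z (phi_tr w zs g ?j) (A1 U g (phi_tr w zs f j)))" by simp
next
 have c: "pcone D J U (ob z) (ar z) (tr z)" if "z \<in> set zs" for z using LC_pcone pow_LC_nth[OF zs that] .
 fix si j assume si: "si \<in> Cell2 D" and j: "j \<in> O0 J (Src D (Dom2 D si))"
 note f = D.cell2(1,2)[OF si]
 note xy = D.cell1(1,2)[OF f(1)]
 note gl = D.Src_globular[OF si, symmetric] D.Trg_globular[OF si, symmetric]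
 let ?x = "Src D (Dom2 D si)" and ?y = "Trg D (Dom2 D si)"
 interpret a: algcell T "P0 F ?x" "P0 F ?y" "P1 F (Dom2 D si)" "P1 F (Cod2 D si)" "P2 F si" by (rule F_cell[OF si])
 interpret P: is_functor "pow_cat (X ?y) n" "X ?y" "Phi (P0 F ?y) w" by (rule a.G.B.Phi_functor[OF w])
 interpret Px: is_functor "pow_cat (X ?x) n" "X ?x" "Phi (P0 F ?x) w" by (rule a.G.A.Phi_functor[OF w])
 interpret SJ: nat_trans "P0 J ?x" "P0 J ?y" "P1 J (Dom2 D si)" "P1 J (Cod2 D si)" "P2 J si" by (rule J.P2_nat[OF si])
 let ?a = "cN (P2 F si)" and ?O = "Obs zs ?x j"
 note o1 = Obs[OF zs xy(1) j]
 note t1 = Trs[OF zs f(1) j] and t2 = Trs[OF zs f(2), unfolded gl, OF j]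
 note aj = Ars[OF zs xy(2) SJ.NC_in_hom[OF j]]
 have ma: "powH (X ?y) n (map ?a ?O) (map (AO (P1 F (Dom2 D si))) ?O) (map (AO (P1 F (Cod2 D si))) ?O)"
  using o1 a.CNat.NC_in_hom by (auto simp: powO_iff powH_iff)
 have ec: "Comp (pow_cat (X ?y) n) (Trs zs (Cod2 D si) j) (map ?a ?O) =
   Comp (pow_cat (X ?y) n) (Ars zs ?y (NC (P2 J si) j)) (Trs zs (Dom2 D si) j)"
  using pcone.tr_cell[OF c si j] by (simp add: map2_maps)
 note hs = P.FA_in_hom[OF t1] P.FA_in_hom[OF t2] P.FA_in_hom[OF aj] P.FA_in_hom[OF ma]
  a.H.rho_hom[OF w o1] a.G.rho_hom[OF w o1] a.CNat.NC_in_hom[OF Px.FO_obj[OF o1]]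
 show "cmp0 U ?y (phi_tr w zs (Cod2 D si) j) (NC (P2 U si) (phi_ob w zs ?x j)) =
   cmp0 U ?y (phi_ar w zs ?y (NC (P2 J si) j)) (phi_tr w zs (Dom2 D si) j)"
  unfolding phi_tr_def phi_ar_def phi_ob_def forget_simps gl
  by (rule a.G.B.Car.square_paste[OF hs(7,4,3,6,5,1,2) a.cell_rho[OF w o1] P.FA_square[OF ma t2 t1 aj ec]])
qed

definition "phiO w zs = mkO (phi_ob w zs) (phi_ar w zs) (phi_tr w zs)"
definition "phiA w ms = mkA (phiO w (map (Dom LC) ms)) (phiO w (map (Cod LC) ms))
 (\<lambda>x j. PhiF (P0 F x) w (Mcs ms x j))"
definition "PhiL w = \<lparr>FDom = pow_cat LC (arity T w), FCod = LC,
 FO = (\<lambda>zs\<in>powO LC (arity T w). phiO w zs), FA = (\<lambda>ms\<in>powA LC (arity T w). phiA w ms)\<rparr>"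

lemma phiO: assumes "w \<in> words T n" "zs \<in> powO LC n" shows "phiO w zs \<in> Obj LC"
  "x \<in> Cell0 D ==> j \<in> O0 J x ==> ob (phiO w zs) x j = PhiO (P0 F x) w (Obs zs x j)"
  "x \<in> Cell0 D ==> u \<in> A0 J x ==> ar (phiO w zs) x u = PhiF (P0 F x) w (Ars zs x u)"
  "f \<in> Cell1 D ==> j \<in> O0 J (Src D f) ==> tr (phiO w zs) f j =
   Comp (X (Trg D f)) (PhiF (P0 F (Trg D f)) w (Trs zs f j)) (rho (P1 F f) w (Obs zs (Src D f) j))"
 using mkO[OF phi_pcone[OF assms]] by (simp_all add: phiO_def phi_ob_def phi_ar_def phi_tr_def)

text \<open>Naturality is functoriality of the word in each \<open>F x\<close>; compatibility with
  the corrected 2-cells uses in addition naturality of the coherence of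
  \<open>P1 F f\<close>.\<close>

lemma phi_pmod: assumes w: "w \<in> words T n" and ms: "powH LC n ms zs zs'"
 shows "pmod D J U (ob (phiO w zs)) (ar (phiO w zs)) (tr (phiO w zs))
  (ob (phiO w zs')) (ar (phiO w zs')) (tr (phiO w zs')) (\<lambda>x j. PhiF (P0 F x) w (Mcs ms x j))"
proof
 interpret PL: category "pow_cat LC n" by (rule pow_category[OF LC.category_axioms])
 note zs = PL.in_hom_obj[OF ms]
 note p = phiO[OF w zs(1)] and p' = phiO[OF w zs(2)]
 have len: "length ms = n" "length zs = n" "length zs' = n" using ms by (auto simp: powH_iff)
 have c: "pmod D J U (ob (zs ! i)) (ar (zs ! i)) (tr (zs ! i)) (ob (zs' ! i)) (ar (zs' ! i)) (tr (zs' ! i)) (mc (ms ! i))"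
  if "i < n" for i using LC_pmod ms that by (auto simp: powH_iff)
 {
  fix x assume x: "x \<in> Cell0 D"
  interpret A: alg_over T "P0 F x" by (rule F_alg[OF x])
  interpret P: is_functor "pow_cat (X x) n" "X x" "Phi (P0 F x) w" by (rule A.Phi_functor[OF w])
  show "hom0 U x (PhiF (P0 F x) w (Mcs ms x j)) (ob (phiO w zs) x j) (ob (phiO w zs') x j)"
   if j: "j \<in> O0 J x" for j using P.FA_in_hom[OF Mcs[OF ms x j]] p(2)[OF x j] p'(2)[OF x j] by simp
  show "cmp0 U x (PhiF (P0 F x) w (Mcs ms x j)) (ar (phiO w zs) x u) =
   cmp0 U x (ar (phiO w zs') x u) (PhiF (P0 F x) w (Mcs ms x i))" if u: "hom0 J x u i j" for u i j
  proof -
   note ij = hom_obj[OF J.P0_cat[OF x] u]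
   have "Comp (pow_cat (X x) n) (Mcs ms x j) (Ars zs x u) = Comp (pow_cat (X x) n) (Ars zs' x u) (Mcs ms x i)"
    using pmod.m_nat[OF c x u] len by (auto intro!: nth_equalityI)
   then show ?thesis using P.FA_comp_hom[OF Ars[OF zs(1) x u] Mcs[OF ms x ij(2)]]
     P.FA_comp_hom[OF Mcs[OF ms x ij(1)] Ars[OF zs(2) x u]] p(3)[OF x in_homD(1)[OF u]]
     p'(3)[OF x in_homD(1)[OF u]] by (simp del: pow_cat_simps)
  qed
 next
  fix f j assume f: "f \<in> Cell1 D" and j: "j \<in> O0 J (Src D f)"
  let ?x = "Src D f" and ?y = "Trg D f" and ?j = "O1 J f j"
  note xy = D.cell1(1,2)[OF f]
  interpret m: algmor T "P0 F ?x" "P0 F ?y" "P1 F f" by (rule F_mor[OF f])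
  interpret P: is_functor "pow_cat (X ?y) n" "X ?y" "Phi (P0 F ?y) w" by (rule m.B.Phi_functor[OF w])
  interpret Px: is_functor "pow_cat (X ?x) n" "X ?x" "Phi (P0 F ?x) w" by (rule m.A.Phi_functor[OF w])
  note j' = fun_obj[OF J.P1_func[OF f] j]
  note M1 = Mcs[OF ms xy(1) j] and M2 = Mcs[OF ms xy(2) j']
  note hM = pow_func_in_hom[OF m.AFun M1]
  note t1 = Trs[OF zs(1) f j] and t2 = Trs[OF zs(2) f j]
  note o1 = Obs[OF zs(1) xy(1) j] and o2 = Obs[OF zs(2) xy(1) j]
  have ec: "Comp (pow_cat (X ?y) n) (Trs zs' f j) (map (AA (P1 F f)) (Mcs ms ?x j)) =
    Comp (pow_cat (X ?y) n) (Mcs ms ?y ?j) (Trs zs f j)"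
   using pmod.m_compat[OF c f j] len by (auto intro!: nth_equalityI)
  note hs = P.FA_in_hom[OF t1] P.FA_in_hom[OF t2] P.FA_in_hom[OF hM] P.FA_in_hom[OF M2]
   m.rho_hom[OF w o1] m.rho_hom[OF w o2] m.AFun.FA_in_hom[OF Px.FA_in_hom[OF M1]]
  show "cmp0 U ?y (tr (phiO w zs') f j) (A1 U f (PhiF (P0 F ?x) w (Mcs ms ?x j))) =
    cmp0 U ?y (PhiF (P0 F ?y) w (Mcs ms ?y ?j)) (tr (phiO w zs) f j)"
   unfolding p(4)[OF f j] p'(4)[OF f j] forget_simps
   by (rule m.B.Car.square_paste[OF hs(7,3,4,5,6,1,2) m.rho_nat[OF w M1] P.FA_square[OF hM t2 t1 M2 ec]])
 }
qed

lemma phiA: assumes w: "w \<in> words T n" and ms: "powH LC n ms zs zs'"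
 shows "in_hom LC (phiA w ms) (phiO w zs) (phiO w zs')"
  "x \<in> Cell0 D ==> j \<in> O0 J x ==> mc (phiA w ms) x j = PhiF (P0 F x) w (Mcs ms x j)"
proof -
 have e: "map (Dom LC) ms = zs" "map (Cod LC) ms = zs'" using ms by (auto simp: in_hom_def)
 interpret PL: category "pow_cat LC n" by (rule pow_category[OF LC.category_axioms])
 note zs = PL.in_hom_obj[OF ms]
 show "in_hom LC (phiA w ms) (phiO w zs) (phiO w zs')"
  "x \<in> Cell0 D ==> j \<in> O0 J x ==> mc (phiA w ms) x j = PhiF (P0 F x) w (Mcs ms x j)"
  unfolding phiA_def e using mkA[OF phiO(1)[OF w zs(1)] phiO(1)[OF w zs(2)] phi_pmod[OF w ms]] by auto
qed

text \<open>Equations in \<open>LC\<close> are tested on components. Evaluating a tuple of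
  modifications respects identities and composites in each coordinate, so functoriality is inherited
  from the action of the word in each \<open>F x\<close>.\<close>

lemma PhiL_functor: assumes w: "w \<in> words T n" shows "is_functor (pow_cat LC n) LC (PhiL w)"
proof (rule is_functorI)
 interpret PL: category "pow_cat LC n" by (rule pow_category[OF LC.category_axioms])
 note ar = arity_words[OF w]
 have FO: "FO (PhiL w) zs = phiO w zs" if "zs \<in> powO LC n" for zs using that by (simp add: PhiL_def ar)
 have FA: "FA (PhiL w) ms = phiA w ms" if "ms \<in> powA LC n" for ms using that by (simp add: PhiL_def ar)
 show "FO (PhiL w) zs \<in> Obj LC" if "zs \<in> powO LC n" for zs using FO[OF that] phiO(1)[OF w that] by simp
 show "in_hom LC (FA (PhiL w) ms) (FO (PhiL w) zs) (FO (PhiL w) zs')" if "powH LC n ms zs zs'" for ms zs zs'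
  using FO[OF PL.in_hom_obj(1)[OF that]] FO[OF PL.in_hom_obj(2)[OF that]] FA[OF in_homD(1)[OF that]] phiA(1)[OF w that]
  by simp
 show "FA (PhiL w) (Ide (pow_cat LC n) zs) = Ide LC (FO (PhiL w) zs)" if zs: "zs \<in> powO LC n" for zs
  unfolding FO[OF zs] FA[OF PL.ide_arr[OF zs]]
 proof (rule LC_arr_eqI[OF phiA(1)[OF w PL.in_hom_ide[OF zs]] LC.in_hom_ide[OF phiO(1)[OF w zs]]])
  fix x j assume xj: "x \<in> Cell0 D" "j \<in> O0 J x"
  have "Mcs (Ide (pow_cat LC n) zs) x j = Ide (pow_cat (X x) n) (Obs zs x j)"
   using mc_ide[OF _ xj] pow_LC_nth[OF zs] by simp
  then show "mc (phiA w (Ide (pow_cat LC n) zs)) x j = mc (Ide LC (phiO w zs)) x j"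
   unfolding phiA(2)[OF w PL.in_hom_ide[OF zs] xj] mc_ide[OF phiO(1)[OF w zs] xj] phiO(2)[OF w zs xj]
   using is_functor.FA_ide[OF pseudo_algebra.Phi_functor[OF alg_over.axioms(2)[OF F_alg[OF xj(1)]] w]
     Obs[OF zs xj]] by (simp only:)
 qed
 show "FA (PhiL w) (Comp (pow_cat LC n) ns ms) = Comp LC (FA (PhiL w) ns) (FA (PhiL w) ms)"
  if m: "powH LC n ms zs zs'" and n: "powH LC n ns zs' zs''" for ms ns zs zs' zs''
  unfolding FA[OF in_homD(1)[OF m]] FA[OF in_homD(1)[OF n]] FA[OF in_homD(1)[OF PL.in_hom_comp[OF m n]]]
 proof (rule LC_arr_eqI[OF phiA(1)[OF w PL.in_hom_comp[OF m n]] LC.in_hom_comp[OF phiA(1)[OF w m] phiA(1)[OF w n]]])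
  fix x j assume xj: "x \<in> Cell0 D" "j \<in> O0 J x"
  have "Mcs (Comp (pow_cat LC n) ns ms) x j = Comp (pow_cat (X x) n) (Mcs ns x j) (Mcs ms x j)"
  proof (rule nth_equalityI)
   fix i assume "i < length (Mcs (Comp (pow_cat LC n) ns ms) x j)"
   then show "Mcs (Comp (pow_cat LC n) ns ms) x j ! i = Comp (pow_cat (X x) n) (Mcs ns x j) (Mcs ms x j) ! i"
    using mc_comp[OF _ _ xj, of "ms ! i" "zs ! i" "zs' ! i" "ns ! i" "zs'' ! i"] m n by (simp add: powH_iff)
  qed simp
  then show "mc (phiA w (Comp (pow_cat LC n) ns ms)) x j = mc (Comp LC (phiA w ns) (phiA w ms)) x j"
   unfolding phiA(2)[OF w PL.in_hom_comp[OF m n] xj] mc_comp[OF phiA(1)[OF w m] phiA(1)[OF w n] xj]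
    phiA(2)[OF w m xj] phiA(2)[OF w n xj]
   using is_functor.FA_comp_hom[OF pseudo_algebra.Phi_functor[OF alg_over.axioms(2)[OF F_alg[OF xj(1)]] w]
     Mcs[OF m xj] Mcs[OF n xj]] by (simp only:)
 qed
qed (auto simp: PhiL_def arity_words[OF w] pow_category LC.category_axioms)

end

context alg_over
begin

lemma CohC_boundary: assumes "w \<in> words T (length ws)" "set ws \<subseteq> all_words T"
 shows "NDom (CohC A w ws) = Phi A (gam T w ws)"
  "NCod (CohC A w ws) = end_gam (Car A) (ars T ws) (Phi A w) (map (Phi A) ws)"
 using CohC_iso[OF assms] iso_nat nat_trans.NDom nat_trans.NCod by blast+

lemma CohI_boundary: "NDom (CohI A) = Phi A (unit_word T)" "NCod (CohI A) = end_unit (Car A)"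
 using CohI_iso iso_nat nat_trans.NDom nat_trans.NCod by blast+

lemma CohS_boundary: assumes "w \<in> words T (length fs)" "set fs \<subseteq> {..<l}"
 shows "NDom (CohS A w l fs) = Phi A (subst_word T l fs w)" "NCod (CohS A w l fs) = end_subst (Car A) l fs (Phi A w)"
 using CohS_iso[OF assms] iso_nat nat_trans.NDom nat_trans.NCod by blast+

end

lemma end_gam2_boundary [simp]: "NDom (end_gam2 X ns be als) = end_gam X ns (NDom be) (map NDom als)"
 "NCod (end_gam2 X ns be als) = end_gam X ns (NCod be) (map NCod als)" by (simp_all add: end_gam2_def end_gam_def)

lemma end_subst2_boundary [simp]: "NDom (end_subst2 X l fs be) = end_subst X l fs (NDom be)"
 "NCod (end_subst2 X l fs be) = end_subst X l fs (NCod be)" by (simp_all add: end_subst2_def end_subst_def)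

lemma end_gam_functor:
 assumes "category X" "length Fs = length ns" "\<And>i. i < length ns ==> is_functor (pow_cat X (ns ! i)) X (Fs ! i)"
  "is_functor (pow_cat X (length ns)) X F" shows "is_functor (pow_cat X (sum_list ns)) X (end_gam X ns F Fs)"
 unfolding end_gam_def by (rule comp_functor[OF prod_functor[OF assms(1,1,2,3)] assms(4)])

lemma end_subst_functor: assumes "category X" "set fs \<subseteq> {..<l}" "is_functor (pow_cat X (length fs)) X F"
 shows "is_functor (pow_cat X l) X (end_subst X l fs F)"
 unfolding end_subst_def by (rule comp_functor[OF reindex_functor[OF assms(1,2)] assms(3)])

section \<open>Functors and natural isomorphisms on powers of \<open>LC\<close> that lie over
  families on the algebras \<open>F x\<close>\<close>

context limit_setting
begin

text \<open>This is commutation on the nose with the functor that evaluates cones at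
  \<open>x\<close> and \<open>j\<close>.\<close>

definition relF where
 "relF x j n P P' \<longleftrightarrow> (\<forall>zs\<in>powO LC n. ob (FO P zs) x j = FO P' (Obs zs x j)) \<and>
  (\<forall>ms\<in>powA LC n. mc (FA P ms) x j = FA P' (Mcs ms x j))"

definition relN where
 "relN x j n al al' \<longleftrightarrow> (\<forall>zs\<in>powO LC n. mc (NC al zs) x j = NC al' (Obs zs x j))"

text \<open>\<open>strict_over n al A\<close>: the natural isomorphism \<open>al\<close> of functors \<open>LC^n \<rightarrow> LC\<close> lies over the family \<open>A\<close>,
 along all evaluations of cones.\<close>

definition strict_over where
 "strict_over n al A \<longleftrightarrow> nat_iso (pow_cat LC n) LC (NDom al) (NCod al) al \<and>
  (\<forall>x\<in>Cell0 D. FDom (NDom (A x)) = pow_cat (X x) n \<and> FCod (NDom (A x)) = X x) \<and>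
  (\<forall>x\<in>Cell0 D. \<forall>j\<in>O0 J x. relF x j n (NDom al) (NDom (A x)) \<and> relF x j n (NCod al) (NCod (A x)) \<and>
   relN x j n al (A x))"

text \<open>At each tuple the two components are isomorphisms of cones with equal domain and equal
  evaluations, so they coincide by \<open>LC_iso_eqI\<close>; \<open>nat_iso_cod_unique\<close> then
  identifies the codomain functors. Every axiom of the algebra of cones is thereby reduced to an
  equality of domains and the same axiom in each \<open>F x\<close>.\<close>

lemma strict_over_eq: assumes a: "strict_over n al A" and b: "strict_over n be B" and d: "NDom al = NDom be"
  and AB: "\<And>x. x \<in> Cell0 D ==> A x = B x" shows "al = be"
proof (rule nat_iso_cod_unique)
 show na: "nat_iso (pow_cat LC n) LC (NDom al) (NCod al) al" using a by (simp add: strict_over_def)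
 show nb: "nat_iso (pow_cat LC n) LC (NDom al) (NCod be) be" using b d by (simp add: strict_over_def)
 show "NC al zs = NC be zs" if zs: "zs \<in> powO LC n" for zs
 proof (rule LC_iso_eqI)
  show "in_hom LC (NC al zs) (FO (NDom al) zs) (FO (NCod al) zs)" using nat_hom[OF iso_nat[OF na] zs] .
  show "in_hom LC (NC be zs) (FO (NDom al) zs) (FO (NCod be) zs)" using nat_hom[OF iso_nat[OF nb] zs] .
  show "iso_arr LC (NC al zs)" using nat_iso.NC_iso[OF na zs] .
  show "mc (NC al zs) x j = mc (NC be zs) x j" if "x \<in> Cell0 D" "j \<in> O0 J x" for x j
   using a b AB zs that by (simp add: strict_over_def relN_def)
 qed
qed

lemma strict_over_vcomp: assumes a: "strict_over n al A" and b: "strict_over n be B" and d: "NDom be = NCod al"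
 shows "strict_over n (vcomp_nat be al) (\<lambda>x. vcomp_nat (B x) (A x))"
proof -
 have na: "nat_iso (pow_cat LC n) LC (NDom al) (NCod al) al" and nb: "nat_iso (pow_cat LC n) LC (NCod al) (NCod be) be"
  using a b d by (simp_all add: strict_over_def)
 have "relN x j n (vcomp_nat be al) (vcomp_nat (B x) (A x))" if x: "x \<in> Cell0 D" "j \<in> O0 J x" for x j
  unfolding relN_def
 proof
  fix zs assume zs: "zs \<in> powO LC n"
  interpret al: nat_trans "pow_cat LC n" LC "NDom al" "NCod al" al by (rule iso_nat[OF na])
  interpret be: nat_trans "pow_cat LC n" LC "NCod al" "NCod be" be by (rule iso_nat[OF nb])
  show "mc (NC (vcomp_nat be al) zs) x j = NC (vcomp_nat (B x) (A x)) (Obs zs x j)"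
   using a b x zs Obs[OF zs x] mc_comp[OF al.NC_in_hom[OF zs] be.NC_in_hom[OF zs] x]
   by (simp add: al.DF.FDom al.DF.FCod strict_over_def relN_def)
 qed
 then show ?thesis using a b vcomp_nat_iso[OF na nb] by (simp add: strict_over_def)
qed

lemma strict_over_id:
 assumes P: "is_functor (pow_cat LC n) LC P" and Q: "\<And>x. x \<in> Cell0 D ==> is_functor (pow_cat (X x) n) (X x) (Q x)"
  and r: "\<And>x j. x \<in> Cell0 D ==> j \<in> O0 J x ==> relF x j n P (Q x)"
 shows "strict_over n (id_nat P) (\<lambda>x. id_nat (Q x))"
proof -
 have "relN x j n (id_nat P) (id_nat (Q x))" if x: "x \<in> Cell0 D" "j \<in> O0 J x" for x j
  using r[OF x] Obs[OF _ x, of _ n] mc_ide[OF fun_obj[OF P] x]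
  by (simp add: relN_def relF_def fun_dom[OF P] fun_cod[OF P] fun_dom[OF Q[OF x(1)]] fun_cod[OF Q[OF x(1)]])
 then show ?thesis using r id_nat_iso[OF P] fun_dom[OF Q] fun_cod[OF Q] by (simp add: strict_over_def)
qed

lemma map2_FO_Obs: assumes "length Ps = length ns" "length Ps' = length ns"
  and "\<And>i. i < length ns ==> relF x j (ns ! i) (Ps ! i) (Ps' ! i)" and zs: "zs \<in> powO LC (sum_list ns)"
 shows "map (\<lambda>z. ob z x j) (map2 FO Ps (blocks ns zs)) = map2 FO Ps' (blocks ns (Obs zs x j))"
 using assms blocks_Obj[OF zs] by (auto simp: blocks_map relF_def intro!: nth_equalityI)

lemma map2_FA_Mcs: assumes "length Ps = length ns" "length Ps' = length ns"
  and "\<And>i. i < length ns ==> relF x j (ns ! i) (Ps ! i) (Ps' ! i)" and ms: "ms \<in> powA LC (sum_list ns)"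
 shows "map (\<lambda>m. mc m x j) (map2 FA Ps (blocks ns ms)) = map2 FA Ps' (blocks ns (Mcs ms x j))"
 using assms blocks_Arr[OF ms] by (auto simp: blocks_map relF_def intro!: nth_equalityI)

lemma Mcs_Arr: "ms \<in> powA LC n ==> x \<in> Cell0 D ==> j \<in> O0 J x ==> Mcs ms x j \<in> powA (X x) n"
 using in_homD(1)[OF Mcs[OF in_homI]] .

lemma relF_end_gam:
 assumes x: "x \<in> Cell0 D" "j \<in> O0 J x" and len: "length Ps = length ns" "length Ps' = length ns"
  and r: "\<And>i. i < length ns ==> relF x j (ns ! i) (Ps ! i) (Ps' ! i)" and rP: "relF x j (length ns) P P'"
  and f: "\<And>i. i < length ns ==> is_functor (pow_cat LC (ns ! i)) LC (Ps ! i)"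
 shows "relF x j (sum_list ns) (end_gam LC ns P Ps) (end_gam (X x) ns P' Ps')"
proof -
 note PL = prod_functor[OF LC.category_axioms LC.category_axioms len(1) f]
 show ?thesis unfolding relF_def
 proof (intro conjI ballI)
  fix zs assume zs: "zs \<in> powO LC (sum_list ns)"
  show "ob (FO (end_gam LC ns P Ps) zs) x j = FO (end_gam (X x) ns P' Ps') (Obs zs x j)"
   using zs Obs[OF zs x] fun_obj[OF PL zs] rP map2_FO_Obs[OF len r zs]
   by (simp add: end_gam_def relF_def del: map_map)
 next
  fix ms assume ms: "ms \<in> powA LC (sum_list ns)"
  show "mc (FA (end_gam LC ns P Ps) ms) x j = FA (end_gam (X x) ns P' Ps') (Mcs ms x j)"
   using ms Mcs_Arr[OF ms x] is_functor.FA_arr[OF PL ms] rP map2_FA_Mcs[OF len r ms]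
   by (simp add: end_gam_def relF_def del: map_map)
 qed
qed

lemma nth_Obs: "set fs \<subseteq> {..<length zs} ==> map (\<lambda>z. g z) (map ((!) zs) fs) = map ((!) (map g zs)) fs"
 by (auto simp: subset_eq)

lemma reindex_Obj: "zs \<in> powO Y l ==> set fs \<subseteq> {..<l} ==> map ((!) zs) fs \<in> powO Y (length fs)"
 by (simp add: powO_iff subset_eq)

lemma reindex_Arr: "zs \<in> powA Y l ==> set fs \<subseteq> {..<l} ==> map ((!) zs) fs \<in> powA Y (length fs)"
 by (simp add: powA_iff subset_eq)

lemma relF_end_subst:
 assumes x: "x \<in> Cell0 D" "j \<in> O0 J x" and fs: "set fs \<subseteq> {..<l}" and rP: "relF x j (length fs) P P'"
 shows "relF x j l (end_subst LC l fs P) (end_subst (X x) l fs P')" unfolding relF_def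
proof (intro conjI ballI)
 fix zs assume zs: "zs \<in> powO LC l"
 then have l: "length zs = l" by (simp add: powO_iff)
 show "ob (FO (end_subst LC l fs P) zs) x j = FO (end_subst (X x) l fs P') (Obs zs x j)"
  using zs Obs[OF zs x] reindex_Obj[OF zs fs] rP nth_Obs[of fs zs "\<lambda>z. ob z x j"] fs l
  by (simp add: end_subst_def relF_def del: map_map)
next
 fix ms assume ms: "ms \<in> powA LC l"
 then have l: "length ms = l" by (simp add: powA_iff)
 show "mc (FA (end_subst LC l fs P) ms) x j = FA (end_subst (X x) l fs P') (Mcs ms x j)"
  using ms Mcs_Arr[OF ms x] reindex_Arr[OF ms fs] rP nth_Obs[of fs ms "\<lambda>z. mc z x j"] fs l
  by (simp add: end_subst_def relF_def del: map_map)
qed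

lemma relF_end_unit: assumes x: "x \<in> Cell0 D" "j \<in> O0 J x" shows "relF x j 1 (end_unit LC) (end_unit (X x))"
 unfolding relF_def
proof (intro conjI ballI)
 have hd: "hd (map g zs) = g (hd zs)" if "length zs = 1" for g :: "'u \<Rightarrow> 'u" and zs
  using that by (cases zs) auto
 fix zs assume zs: "zs \<in> powO LC 1"
 then have "length zs = 1" by (simp add: powO_iff)
 from hd[OF this, of "\<lambda>z. ob z x j"] show "ob (FO (end_unit LC) zs) x j = FO (end_unit (X x)) (Obs zs x j)"
  using zs Obs[OF zs x] by simp
next
 have hd: "hd (map g zs) = g (hd zs)" if "length zs = 1" for g :: "'u \<Rightarrow> 'u" and zs
  using that by (cases zs) auto
 fix ms assume ms: "ms \<in> powA LC 1"
 then have "length ms = 1" by (simp add: powA_iff)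
 from hd[OF this, of "\<lambda>z. mc z x j"] show "mc (FA (end_unit LC) ms) x j = FA (end_unit (X x)) (Mcs ms x j)"
  using ms Mcs_Arr[OF ms x] by simp
qed

lemma relF_PhiL: assumes x: "x \<in> Cell0 D" "j \<in> O0 J x" and w: "w \<in> words T n"
 shows "relF x j n (PhiL w) (Phi (P0 F x) w)"
 using phiO(2)[OF w _ x] phiA(2)[OF w in_homI x] by (simp add: relF_def PhiL_def arity_words[OF w])

text \<open>Evaluation preserves composites in \<open>LC\<close>, so the two factors of a horizontal
  composite can be evaluated separately, and each of them lies over the corresponding factor in
  \<open>F x\<close>.\<close>

lemma strict_over_end_gam2:
 assumes len: "length als = length ns" "\<And>x. x \<in> Cell0 D ==> length (As x) = length ns"
  and a: "\<And>i. i < length ns ==> strict_over (ns ! i) (als ! i) (\<lambda>x. As x ! i)"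
  and b: "strict_over (length ns) be B"
 shows "strict_over (sum_list ns) (end_gam2 LC ns be als) (\<lambda>x. end_gam2 (X x) ns (B x) (As x))"
proof -
 have na: "nat_iso (pow_cat LC (ns ! i)) LC (NDom (als ! i)) (NCod (als ! i)) (als ! i)" if "i < length ns" for i
  using a[OF that] by (simp add: strict_over_def)
 have nb: "nat_iso (pow_cat LC (length ns)) LC (NDom be) (NCod be) be" using b by (simp add: strict_over_def)
 have L: "nat_iso (pow_cat LC (sum_list ns)) LC (NDom (end_gam2 LC ns be als)) (NCod (end_gam2 LC ns be als)) (end_gam2 LC ns be als)"
  using end_gam2_iso[OF LC.category_axioms len(1) na nb] by simp
 have R: "FDom (NDom (end_gam2 (X x) ns (B x) (As x))) = pow_cat (X x) (sum_list ns) \<and>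
   FCod (NDom (end_gam2 (X x) ns (B x) (As x))) = X x" if "x \<in> Cell0 D" for x
  using b that by (simp add: end_gam_def strict_over_def)
 {
  fix x j assume x: "x \<in> Cell0 D" "j \<in> O0 J x"
  have rd: "relF x j (ns ! i) (map NDom als ! i) (map NDom (As x) ! i)"
   and rc: "relF x j (ns ! i) (map NCod als ! i) (map NCod (As x) ! i)" if "i < length ns" for i
   using a[OF that] that x len by (simp_all add: strict_over_def)
  have fd: "is_functor (pow_cat LC (ns ! i)) LC (map NDom als ! i)" and fc: "is_functor (pow_cat LC (ns ! i)) LC (map NCod als ! i)"
   if "i < length ns" for i using nat_trans.dom_functor[OF iso_nat[OF na[OF that]]]
    nat_trans.cod_functor[OF iso_nat[OF na[OF that]]] that len by simp_all
  have bd: "relF x j (length ns) (NDom be) (NDom (B x))" and bc: "relF x j (length ns) (NCod be) (NCod (B x))"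
   using b x by (simp_all add: strict_over_def)
  have l: "length (map NDom als) = length ns" "length (map NDom (As x)) = length ns"
   "length (map NCod als) = length ns" "length (map NCod (As x)) = length ns" using len x by simp_all
  have 1: "relF x j (sum_list ns) (NDom (end_gam2 LC ns be als)) (NDom (end_gam2 (X x) ns (B x) (As x)))"
   using relF_end_gam[OF x l(1,2) rd bd fd] by simp
  have 2: "relF x j (sum_list ns) (NCod (end_gam2 LC ns be als)) (NCod (end_gam2 (X x) ns (B x) (As x)))"
   using relF_end_gam[OF x l(3,4) rc bc fc] by simp
  have "relN x j (sum_list ns) (end_gam2 LC ns be als) (end_gam2 (X x) ns (B x) (As x))" unfolding relN_def
  proof
   fix zs assume zs: "zs \<in> powO LC (sum_list ns)"
   interpret be: nat_trans "pow_cat LC (length ns)" LC "NDom be" "NCod be" be by (rule iso_nat[OF nb])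
   interpret p: nat_trans "pow_cat LC (sum_list ns)" "pow_cat LC (length ns)"
    "prod_func LC LC ns (map NDom als)" "prod_func LC LC ns (map NCod als)" "prod_nat LC LC ns als"
    by (rule prod_nat_trans[OF LC.category_axioms LC.category_axioms len(1) iso_nat[OF na]])
   have pz: "powH LC (length ns) (map2 NC als (blocks ns zs)) (map2 FO (map NDom als) (blocks ns zs))
     (map2 FO (map NCod als) (blocks ns zs))" using p.NC_in_hom[OF zs] zs by simp
   note cz = hom_obj(2)[OF pow_category[OF LC.category_axioms] pz]
   have m: "map (\<lambda>m. mc m x j) (map2 NC als (blocks ns zs)) = map2 NC (As x) (blocks ns (Obs zs x j))"
    using a x len blocks_Obj[OF zs] by (auto simp: blocks_map strict_over_def relN_def intro!: nth_equalityI)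
   have "mc (NC (end_gam2 LC ns be als) zs) x j =
     mc (Comp LC (NC be (map2 FO (map NCod als) (blocks ns zs))) (FA (NDom be) (map2 NC als (blocks ns zs)))) x j"
    using zs by (simp add: end_gam2_def hcomp_nat_NC be.DF.FCod)
   also have "\<dots> = Comp (X x) (mc (NC be (map2 FO (map NCod als) (blocks ns zs))) x j)
     (mc (FA (NDom be) (map2 NC als (blocks ns zs))) x j)"
    by (rule mc_comp[OF be.DF.FA_in_hom[OF pz] be.NC_in_hom[OF cz] x])
   also have "mc (NC be (map2 FO (map NCod als) (blocks ns zs))) x j =
     NC (B x) (map2 FO (map NCod (As x)) (blocks ns (Obs zs x j)))"
    using b x cz map2_FO_Obs[OF l(3,4) rc zs] by (simp add: strict_over_def relN_def del: map_map)
   also have "mc (FA (NDom be) (map2 NC als (blocks ns zs))) x j = FA (NDom (B x)) (map2 NC (As x) (blocks ns (Obs zs x j)))"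
    using bd in_homD(1)[OF pz] m by (simp add: relF_def del: map_map)
   finally show "mc (NC (end_gam2 LC ns be als) zs) x j = NC (end_gam2 (X x) ns (B x) (As x)) (Obs zs x j)"
    using Obs[OF zs x] b x by (simp add: end_gam2_def hcomp_nat_NC strict_over_def)
  qed
  note 1 2 this
 }
 then show ?thesis using L R by (simp add: strict_over_def del: end_gam2_boundary)
qed

lemma strict_over_end_subst2: assumes fs: "set fs \<subseteq> {..<l}" and b: "strict_over (length fs) be B"
 shows "strict_over l (end_subst2 LC l fs be) (\<lambda>x. end_subst2 (X x) l fs (B x))"
proof -
 have nb: "nat_iso (pow_cat LC (length fs)) LC (NDom be) (NCod be) be" using b by (simp add: strict_over_def)
 interpret be: nat_trans "pow_cat LC (length fs)" LC "NDom be" "NCod be" be by (rule iso_nat[OF nb])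
 have "relN x j l (end_subst2 LC l fs be) (end_subst2 (X x) l fs (B x))"
  if x: "x \<in> Cell0 D" "j \<in> O0 J x" for x j unfolding relN_def
 proof
  fix zs assume zs: "zs \<in> powO LC l"
  then have l: "length zs = l" by (simp add: powO_iff)
  note r = reindex_Obj[OF zs fs]
  note i = category.in_hom_ide[OF be.DF.dom_cat r]
  \<comment> \<open>The second factor of the whiskering is the image of an identity tuple, and
    evaluation sends an identity tuple to an identity tuple.\<close>
  have "map (\<lambda>m. mc m x j) (Ide (pow_cat LC (length fs)) (map ((!) zs) fs)) =
    Ide (pow_cat (X x) (length fs)) (Obs (map ((!) zs) fs) x j)"
   using r Obs[OF r x] mc_ide[OF _ x] by (auto simp: powO_iff in_set_conv_nth)
  then show "mc (NC (end_subst2 LC l fs be) zs) x j = NC (end_subst2 (X x) l fs (B x)) (Obs zs x j)"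
   using b x r zs Obs[OF zs x] in_homD(1)[OF i] mc_comp[OF be.DF.FA_in_hom[OF i] be.NC_in_hom[OF r] x]
    nth_Obs[of fs zs "\<lambda>z. ob z x j"] fs l
   by (simp add: end_subst2_def hcomp_nat_NC strict_over_def relN_def relF_def be.DF.FCod del: map_map)
 qed
 moreover have "FDom (end_subst (X x) l fs P) = pow_cat (X x) l" "FCod (end_subst (X x) l fs P) = FCod P" for x P
  by (simp_all add: end_subst_def)
 ultimately show ?thesis
  using b end_subst2_iso[OF LC.category_axioms fs nb] by (simp add: strict_over_def relF_end_subst[OF _ _ fs])
qed

text \<open>The candidate over the family \<open>th\<close>: its component at a tuple of cones has
  the components of \<open>th\<close> at the evaluated tuple. That these form a modification has to
  be shown separately.\<close>

definition lift_nat where "lift_nat n P Q th = \<lparr>NDom = P, NCod = Q,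
  NC = (\<lambda>zs\<in>powO LC n. mkA (FO P zs) (FO Q zs) (\<lambda>x j. NC (th x) (Obs zs x j)))\<rparr>"

lemma lift_nat_boundary [simp]: "NDom (lift_nat n P Q th) = P" "NCod (lift_nat n P Q th) = Q"
 by (simp_all add: lift_nat_def)

text \<open>Naturality and invertibility are tested on components, where they hold because each
  \<open>th x\<close> is a natural isomorphism between the functors over which \<open>P\<close> and
  \<open>Q\<close> lie. The hypothesis \<open>pm\<close> is where the arrow values and 2-cells of
  the cones enter.\<close>

lemma strict_over_lift: assumes P: "is_functor (pow_cat LC n) LC P" and Q: "is_functor (pow_cat LC n) LC Q"
  and th: "\<And>x. x \<in> Cell0 D ==> nat_iso (pow_cat (X x) n) (X x) (NDom (th x)) (NCod (th x)) (th x)"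
  and rP: "\<And>x j. x \<in> Cell0 D ==> j \<in> O0 J x ==> relF x j n P (NDom (th x))"
  and rQ: "\<And>x j. x \<in> Cell0 D ==> j \<in> O0 J x ==> relF x j n Q (NCod (th x))"
  and pm: "\<And>zs. zs \<in> powO LC n ==> pmod D J U (ob (FO P zs)) (ar (FO P zs)) (tr (FO P zs))
   (ob (FO Q zs)) (ar (FO Q zs)) (tr (FO Q zs)) (\<lambda>x j. NC (th x) (Obs zs x j))"
 shows "strict_over n (lift_nat n P Q th) th"
proof -
 interpret P: is_functor "pow_cat LC n" LC P by (rule P)
 interpret Q: is_functor "pow_cat LC n" LC Q by (rule Q)
 interpret PL: category "pow_cat LC n" by (rule P.dom_cat)
 have m: "in_hom LC (NC (lift_nat n P Q th) zs) (FO P zs) (FO Q zs)"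
  "\<And>x j. x \<in> Cell0 D ==> j \<in> O0 J x ==> mc (NC (lift_nat n P Q th) zs) x j = NC (th x) (Obs zs x j)"
  if zs: "zs \<in> powO LC n" for zs
  using mkA[OF P.FO_obj[OF zs] Q.FO_obj[OF zs] pm[OF zs]] zs by (simp_all add: lift_nat_def)
 have "nat_iso (pow_cat LC n) LC P Q (lift_nat n P Q th)"
 proof (intro nat_isoI nat_transI[OF P Q])
  fix ms zs zs' assume ms: "powH LC n ms zs zs'"
  note zs = PL.in_hom_obj[OF ms]
  show "Comp LC (NC (lift_nat n P Q th) zs') (FA P ms) = Comp LC (FA Q ms) (NC (lift_nat n P Q th) zs)"
  proof (rule LC_arr_eqI[OF LC.in_hom_comp[OF P.FA_in_hom[OF ms] m(1)[OF zs(2)]]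
     LC.in_hom_comp[OF m(1)[OF zs(1)] Q.FA_in_hom[OF ms]]])
   fix x j assume x: "x \<in> Cell0 D" "j \<in> O0 J x"
   show "mc (Comp LC (NC (lift_nat n P Q th) zs') (FA P ms)) x j = mc (Comp LC (FA Q ms) (NC (lift_nat n P Q th) zs)) x j"
    unfolding mc_comp[OF P.FA_in_hom[OF ms] m(1)[OF zs(2)] x] mc_comp[OF m(1)[OF zs(1)] Q.FA_in_hom[OF ms] x]
     m(2)[OF zs(1) x] m(2)[OF zs(2) x]
    using nat_trans.naturality_hom[OF iso_nat[OF th[OF x(1)]] Mcs[OF ms x]] rP[OF x] rQ[OF x]
     in_homD(1)[OF ms] by (simp add: relF_def)
  qed
 next
  fix zs assume zs: "zs \<in> powO LC n"
  show "iso_arr LC (NC (lift_nat n P Q th) zs)"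
   using LC_isoI[OF m(1)[OF zs]] m(2)[OF zs] nat_iso.NC_iso[OF th Obs[OF zs]] by simp
 qed (use m(1) in \<open>simp_all add: lift_nat_def\<close>)
 then show ?thesis using fun_dom[OF nat_trans.dom_functor[OF iso_nat[OF th]]]
   fun_cod[OF nat_trans.dom_functor[OF iso_nat[OF th]]] rP rQ m(2) by (simp add: strict_over_def relN_def)
qed

text \<open>A modification between cones whose data are obtained by applying functors to a tuple of cones.\<close>

lemma struct_mod: assumes zs: "zs \<in> powO LC n"
  and th: "\<And>x. x \<in> Cell0 D ==> nat_trans (pow_cat (X x) n) (X x) (P x) (Q x) (th x)"
  and oP: "\<And>x j. x \<in> Cell0 D ==> j \<in> O0 J x ==> ob z x j = FO (P x) (Obs zs x j)"
  and aP: "\<And>x u. x \<in> Cell0 D ==> u \<in> A0 J x ==> ar z x u = FA (P x) (Ars zs x u)"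
  and tP: "\<And>f j. f \<in> Cell1 D ==> j \<in> O0 J (Src D f) ==>
   tr z f j = Comp (X (Trg D f)) (FA (P (Trg D f)) (Trs zs f j)) (pr f j)"
  and oQ: "\<And>x j. x \<in> Cell0 D ==> j \<in> O0 J x ==> ob z' x j = FO (Q x) (Obs zs x j)"
  and aQ: "\<And>x u. x \<in> Cell0 D ==> u \<in> A0 J x ==> ar z' x u = FA (Q x) (Ars zs x u)"
  and tQ: "\<And>f j. f \<in> Cell1 D ==> j \<in> O0 J (Src D f) ==>
   tr z' f j = Comp (X (Trg D f)) (FA (Q (Trg D f)) (Trs zs f j)) (ka f j)"
  and pr: "\<And>f j. f \<in> Cell1 D ==> j \<in> O0 J (Src D f) ==>
   in_hom (X (Trg D f)) (pr f j) (AO (P1 F f) (FO (P (Src D f)) (Obs zs (Src D f) j)))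
    (FO (P (Trg D f)) (map (AO (P1 F f)) (Obs zs (Src D f) j)))"
  and ka: "\<And>f j. f \<in> Cell1 D ==> j \<in> O0 J (Src D f) ==>
   in_hom (X (Trg D f)) (ka f j) (AO (P1 F f) (FO (Q (Src D f)) (Obs zs (Src D f) j)))
    (FO (Q (Trg D f)) (map (AO (P1 F f)) (Obs zs (Src D f) j)))"
  and compat: "\<And>f j. f \<in> Cell1 D ==> j \<in> O0 J (Src D f) ==>
   Comp (X (Trg D f)) (NC (th (Trg D f)) (map (AO (P1 F f)) (Obs zs (Src D f) j))) (pr f j) =
   Comp (X (Trg D f)) (ka f j) (AA (P1 F f) (NC (th (Src D f)) (Obs zs (Src D f) j)))"
 shows "pmod D J U (ob z) (ar z) (tr z) (ob z') (ar z') (tr z') (\<lambda>x j. NC (th x) (Obs zs x j))"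
proof
 fix x assume x: "x \<in> Cell0 D"
 interpret th: nat_trans "pow_cat (X x) n" "X x" "P x" "Q x" "th x" by (rule th[OF x])
 show "hom0 U x (NC (th x) (Obs zs x j)) (ob z x j) (ob z' x j)" if "j \<in> O0 J x" for j
  using th.NC_in_hom[OF Obs[OF zs x that]] oP[OF x that] oQ[OF x that] by simp
 show "cmp0 U x (NC (th x) (Obs zs x j)) (ar z x u) = cmp0 U x (ar z' x u) (NC (th x) (Obs zs x i))"
  if "hom0 J x u i j" for u i j
  using th.naturality_hom[OF Ars[OF zs x that]] aP[OF x in_homD(1)[OF that]] aQ[OF x in_homD(1)[OF that]] by simp
next
 fix f j assume f: "f \<in> Cell1 D" and j: "j \<in> O0 J (Src D f)"
 let ?x = "Src D f" and ?y = "Trg D f" and ?j = "O1 J f j"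
 note xy = D.cell1(1,2)[OF f]
 interpret m: algmor T "P0 F ?x" "P0 F ?y" "P1 F f" by (rule F_mor[OF f])
 interpret thx: nat_trans "pow_cat (X ?x) n" "X ?x" "P ?x" "Q ?x" "th ?x" by (rule th[OF xy(1)])
 interpret thy: nat_trans "pow_cat (X ?y) n" "X ?y" "P ?y" "Q ?y" "th ?y" by (rule th[OF xy(2)])
 note o1 = Obs[OF zs xy(1) j] and t = Trs[OF zs f j]
 note fo = pow_func_Obj[OF m.AFun o1] and oy = Obs[OF zs xy(2) fun_obj[OF J.P1_func[OF f] j]]
 note hs = pr[OF f j] ka[OF f j] thy.DF.FA_in_hom[OF t] thy.CF.FA_in_hom[OF t]
  m.AFun.FA_in_hom[OF thx.NC_in_hom[OF o1]] thy.NC_in_hom[OF fo] thy.NC_in_hom[OF oy]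
 have "Comp (X ?y) (tr z' f j) (AA (P1 F f) (NC (th ?x) (Obs zs ?x j))) =
   Comp (X ?y) (FA (Q ?y) (Trs zs f j)) (Comp (X ?y) (ka f j) (AA (P1 F f) (NC (th ?x) (Obs zs ?x j))))"
  unfolding tQ[OF f j] using hs by (simp add: m.B.Car.comp_simps del: map_map)
 \<comment> \<open>Here \<open>pr\<close> and \<open>ka\<close> are the comparison cells of
   \<open>P1 F f\<close> for the operations \<open>P\<close> and \<open>Q\<close>, and
   \<open>compat\<close> says that \<open>th\<close> respects them. The next equation is naturality
   of \<open>th\<close> at the 2-cells of the tuple.\<close>
 also have "\<dots> = Comp (X ?y) (Comp (X ?y) (FA (Q ?y) (Trs zs f j))
   (NC (th ?y) (map (AO (P1 F f)) (Obs zs ?x j)))) (pr f j)"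
  unfolding compat[OF f j, symmetric] using hs by (simp add: m.B.Car.comp_simps del: map_map)
 also have "\<dots> = Comp (X ?y) (NC (th ?y) (Obs zs ?y ?j)) (tr z f j)"
  unfolding tP[OF f j] thy.naturality_hom[OF t, symmetric] using hs by (simp add: m.B.Car.comp_simps del: map_map)
 finally show "cmp0 U ?y (tr z' f j) (A1 U f (NC (th ?x) (Obs zs ?x j))) =
   cmp0 U ?y (NC (th ?y) (Obs zs ?y ?j)) (tr z f j)" by simp
qed

end

context alg_over
begin

lemma end_gam_FO: "xs \<in> powO (Car A) (sum_list ns) ==>
  FO (end_gam (Car A) ns (Phi A w) (map (Phi A) ws)) xs = PhiO A w (map2 (PhiO A) ws (blocks ns xs))"
 by (simp add: end_gam_def map2_map1)

lemma end_gam_FA: "xs \<in> powA (Car A) (sum_list ns) ==>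
  FA (end_gam (Car A) ns (Phi A w) (map (Phi A) ws)) xs = PhiF A w (map2 (PhiF A) ws (blocks ns xs))"
 by (simp add: end_gam_def map2_map1)

lemma end_subst_FO: "xs \<in> powO (Car A) l ==> FO (end_subst (Car A) l fs G) xs = FO G (map ((!) xs) fs)"
 by (simp add: end_subst_def)

lemma end_subst_FA: "xs \<in> powA (Car A) l ==> FA (end_subst (Car A) l fs G) xs = FA G (map ((!) xs) fs)"
 by (simp add: end_subst_def)

end

section \<open>The coherence isomorphisms and the axioms of the algebra of cones\<close>

context limit_setting
begin

lemma PhiL_FO: "w \<in> words T n ==> zs \<in> powO LC n ==> FO (PhiL w) zs = phiO w zs"
 by (simp add: PhiL_def arity_words)

lemma PhiL_words: assumes "set ws \<subseteq> all_words T" "i < length (ars T ws)"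
 shows "is_functor (pow_cat LC (ars T ws ! i)) LC (map PhiL ws ! i)"
 using assms PhiL_functor[of "ws ! i" "arity T (ws ! i)"] nth_words[OF assms(1), of i] by (simp add: words_iff)

lemma relF_PhiL_words:
 assumes "x \<in> Cell0 D" "j \<in> O0 J x" "set ws \<subseteq> all_words T" "i < length (ars T ws)"
 shows "relF x j (ars T ws ! i) (map PhiL ws ! i) (map (Phi (P0 F x)) ws ! i)"
 using assms relF_PhiL[OF assms(1,2), of "ws ! i" "arity T (ws ! i)"] nth_words[OF assms(3), of i]
 by (simp add: words_iff)

definition "CohCL w ws = lift_nat (sum_list (ars T ws)) (PhiL (gam T w ws))
 (end_gam LC (ars T ws) (PhiL w) (map PhiL ws)) (\<lambda>x. CohC (P0 F x) w ws)"
definition "CohIL = lift_nat 1 (PhiL (unit_word T)) (end_unit LC) (\<lambda>x. CohI (P0 F x))"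
definition "CohSL w l fs = lift_nat l (PhiL (subst_word T l fs w)) (end_subst LC l fs (PhiL w))
 (\<lambda>x. CohS (P0 F x) w l fs)"

text \<open>The comparison cell of a substituted operation is the coherence of \<open>w\<close>
  followed by \<open>w\<close> applied to the coherences of the \<open>ws\<close>. With this choice
  of \<open>ka\<close> the compatibility required by \<open>struct_mod\<close> is
  \<open>rho_gam\<close> for \<open>P1 F f\<close>.\<close>

lemma strict_over_CohC: assumes w: "w \<in> words T (length ws)" and ws: "set ws \<subseteq> all_words T"
 shows "strict_over (sum_list (ars T ws)) (CohCL w ws) (\<lambda>x. CohC (P0 F x) w ws)" unfolding CohCL_def
proof (rule strict_over_lift)
 let ?ns = "ars T ws"
 let ?N = "sum_list ?ns" and ?k = "length ws"
 let ?Q = "end_gam LC ?ns (PhiL w) (map PhiL ws)"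
 note g = gam_words[OF w ws]
 show P: "is_functor (pow_cat LC ?N) LC (PhiL (gam T w ws))" by (rule PhiL_functor[OF g])
 show Q: "is_functor (pow_cat LC ?N) LC ?Q"
  by (rule end_gam_functor[OF LC.category_axioms _ PhiL_words[OF ws]]) (use PhiL_functor[OF w] in simp_all)
 have rQ: "relF x j ?N ?Q (end_gam (X x) ?ns (Phi (P0 F x) w) (map (Phi (P0 F x)) ws))"
  if x: "x \<in> Cell0 D" and j: "j \<in> O0 J x" for x j
  by (rule relF_end_gam[OF x j _ _ relF_PhiL_words[OF x j ws] _ PhiL_words[OF ws]])
   (use relF_PhiL[OF x j w] in simp_all)
 {
  fix x assume x: "x \<in> Cell0 D"
  interpret A: alg_over T "P0 F x" by (rule F_alg[OF x])
  show "nat_iso (pow_cat (X x) ?N) (X x) (NDom (CohC (P0 F x) w ws)) (NCod (CohC (P0 F x) w ws)) (CohC (P0 F x) w ws)"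
   using A.CohC_iso[OF w ws] by (simp add: A.CohC_boundary[OF w ws])
  fix j assume j: "j \<in> O0 J x"
  show "relF x j ?N (PhiL (gam T w ws)) (NDom (CohC (P0 F x) w ws))"
   unfolding A.CohC_boundary[OF w ws] by (rule relF_PhiL[OF x j g])
  show "relF x j ?N ?Q (NCod (CohC (P0 F x) w ws))" unfolding A.CohC_boundary[OF w ws] by (rule rQ[OF x j])
 }
 fix zs assume zs: "zs \<in> powO LC ?N"
 \<comment> \<open>The intermediate tuple of cones, one for each word of \<open>ws\<close>, so that
   the codomain at \<open>zs\<close> is the cone \<open>phiO w ps\<close>.\<close>
 define ps where "ps = map2 phiO ws (blocks ?ns zs)"
 have b: "blocks ?ns zs ! i \<in> powO LC (arity T (ws ! i))" if "i < ?k" for i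
  using blocks_Obj[OF zs, of i] that by simp
 have wi: "ws ! i \<in> words T (arity T (ws ! i))" if "i < ?k" for i
  using nth_words[OF ws that] by (simp add: words_iff)
 have "map2 (\<lambda>w. FO (PhiL w)) ws (blocks ?ns zs) = ps"
  unfolding ps_def by (intro nth_equalityI) (simp_all add: PhiL_FO[OF wi b])
 moreover have ps: "ps \<in> powO LC ?k" using phiO(1)[OF wi b] by (auto simp: ps_def powO_iff)
 ultimately have FQ: "FO ?Q zs = phiO w ps" using zs PhiL_FO[OF w ps] by (simp add: end_gam_def map2_map1)
 show "pmod D J U (ob (FO (PhiL (gam T w ws)) zs)) (ar (FO (PhiL (gam T w ws)) zs)) (tr (FO (PhiL (gam T w ws)) zs))
   (ob (FO ?Q zs)) (ar (FO ?Q zs)) (tr (FO ?Q zs)) (\<lambda>x j. NC (CohC (P0 F x) w ws) (Obs zs x j))"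
 proof (rule struct_mod[OF zs, where P = "\<lambda>x. Phi (P0 F x) (gam T w ws)"
    and Q = "\<lambda>x. end_gam (X x) ?ns (Phi (P0 F x) w) (map (Phi (P0 F x)) ws)"
    and pr = "\<lambda>f j. rho (P1 F f) (gam T w ws) (Obs zs (Src D f) j)"
    and ka = "\<lambda>f j. Comp (X (Trg D f)) (PhiF (P0 F (Trg D f)) w
      (map2 (rho (P1 F f)) ws (blocks ?ns (Obs zs (Src D f) j))))
     (rho (P1 F f) w (map2 (\<lambda>w. PhiO (P0 F (Src D f)) w) ws (blocks ?ns (Obs zs (Src D f) j))))"])
  fix x assume x: "x \<in> Cell0 D"
  interpret A: alg_over T "P0 F x" by (rule F_alg[OF x])
  show "nat_trans (pow_cat (X x) ?N) (X x) (Phi (P0 F x) (gam T w ws))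
    (end_gam (X x) ?ns (Phi (P0 F x) w) (map (Phi (P0 F x)) ws)) (CohC (P0 F x) w ws)"
   by (rule iso_nat[OF A.CohC_iso[OF w ws]])
  show "ob (FO (PhiL (gam T w ws)) zs) x j = PhiO (P0 F x) (gam T w ws) (Obs zs x j)" if "j \<in> O0 J x" for j
   using phiO(2)[OF g zs x that] by (simp add: PhiL_FO[OF g zs])
  show "ar (FO (PhiL (gam T w ws)) zs) x u = PhiF (P0 F x) (gam T w ws) (Ars zs x u)" if "u \<in> A0 J x" for u
   using phiO(3)[OF g zs x that] by (simp add: PhiL_FO[OF g zs])
  show "ob (FO ?Q zs) x j = FO (end_gam (X x) ?ns (Phi (P0 F x) w) (map (Phi (P0 F x)) ws)) (Obs zs x j)"
   if "j \<in> O0 J x" for j using rQ[OF x that] zs by (simp add: relF_def A.CohC_boundary[OF w ws])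
  show "ar (FO ?Q zs) x u = FA (end_gam (X x) ?ns (Phi (P0 F x) w) (map (Phi (P0 F x)) ws)) (Ars zs x u)"
   if u: "u \<in> A0 J x" for u
  proof -
   have e: "Ars ps x u = map2 (PhiF (P0 F x)) ws (blocks ?ns (Ars zs x u))"
    using phiO(3)[OF wi b x u] by (auto simp: ps_def blocks_map intro!: nth_equalityI)
   show ?thesis unfolding FQ phiO(3)[OF w ps x u] e
    using A.end_gam_FA[of "Ars zs x u" ?ns w ws] in_homD(1)[OF Ars[OF zs x in_homI[OF u]]] by simp
  qed
 next
  fix f j assume f: "f \<in> Cell1 D" and j: "j \<in> O0 J (Src D f)"
  let ?x = "Src D f" and ?y = "Trg D f"
  note xy = D.cell1(1,2)[OF f]
  interpret m: algmor T "P0 F ?x" "P0 F ?y" "P1 F f" by (rule F_mor[OF f])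
  interpret P: is_functor "pow_cat (X ?y) ?k" "X ?y" "Phi (P0 F ?y) w" by (rule m.B.Phi_functor[OF w])
  note o1 = Obs[OF zs xy(1) j] and t = Trs[OF zs f j]
  note fo = pow_func_Obj[OF m.AFun o1]
  note p1 = m.A.prod_Phi_Obj[OF ws o1]
  note S = m.rho_block_hom[OF ws o1]
  show "tr (FO (PhiL (gam T w ws)) zs) f j = Comp (X ?y) (PhiF (P0 F ?y) (gam T w ws) (Trs zs f j))
    (rho (P1 F f) (gam T w ws) (Obs zs ?x j))" using phiO(4)[OF g zs f j] by (simp add: PhiL_FO[OF g zs])
  show "in_hom (X ?y) (rho (P1 F f) (gam T w ws) (Obs zs ?x j))
    (AO (P1 F f) (PhiO (P0 F ?x) (gam T w ws) (Obs zs ?x j)))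
    (PhiO (P0 F ?y) (gam T w ws) (map (AO (P1 F f)) (Obs zs ?x j)))" by (rule m.rho_hom[OF g o1])
  show "in_hom (X ?y) (Comp (X ?y) (PhiF (P0 F ?y) w (map2 (rho (P1 F f)) ws (blocks ?ns (Obs zs ?x j))))
     (rho (P1 F f) w (map2 (PhiO (P0 F ?x)) ws (blocks ?ns (Obs zs ?x j)))))
    (AO (P1 F f) (FO (end_gam (X ?x) ?ns (Phi (P0 F ?x) w) (map (Phi (P0 F ?x)) ws)) (Obs zs ?x j)))
    (FO (end_gam (X ?y) ?ns (Phi (P0 F ?y) w) (map (Phi (P0 F ?y)) ws)) (map (AO (P1 F f)) (Obs zs ?x j)))"
   unfolding m.A.end_gam_FO[OF o1] m.B.end_gam_FO[OF fo]
   by (rule m.B.Car.in_hom_comp[OF m.rho_hom[OF w p1] P.FA_in_hom[OF S]])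
  show "Comp (X ?y) (NC (CohC (P0 F ?y) w ws) (map (AO (P1 F f)) (Obs zs ?x j)))
    (rho (P1 F f) (gam T w ws) (Obs zs ?x j)) =
   Comp (X ?y) (Comp (X ?y) (PhiF (P0 F ?y) w (map2 (rho (P1 F f)) ws (blocks ?ns (Obs zs ?x j))))
     (rho (P1 F f) w (map2 (PhiO (P0 F ?x)) ws (blocks ?ns (Obs zs ?x j)))))
    (AA (P1 F f) (NC (CohC (P0 F ?x) w ws) (Obs zs ?x j)))" unfolding m.rho_gam[OF w ws o1]
   by (rule m.B.Car.in_hom_assoc[OF m.AFun.FA_in_hom[OF m.A.CohC_hom[OF w ws o1]] m.rho_hom[OF w p1] P.FA_in_hom[OF S]])
  have eo': "Obs ps ?x j = map2 (PhiO (P0 F ?x)) ws (blocks ?ns (Obs zs ?x j))"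
   using phiO(2)[OF wi b xy(1) j] by (auto simp: ps_def blocks_map intro!: nth_equalityI)
  \<comment> \<open>The 2-cells of the intermediate cones already contain coherences of the
    \<open>ws\<close>; as a composite in the power category they split under the action of
    \<open>w\<close>, which produces the comparison cell chosen for \<open>ka\<close>.\<close>
  have et: "Trs ps f j = Comp (pow_cat (X ?y) ?k) (map2 (PhiF (P0 F ?y)) ws (blocks ?ns (Trs zs f j)))
    (map2 (rho (P1 F f)) ws (blocks ?ns (Obs zs ?x j)))"
   using phiO(4)[OF wi b f j] by (auto simp: ps_def blocks_map intro!: nth_equalityI)
  have tb: "powH (X ?y) ?k (map2 (PhiF (P0 F ?y)) ws (blocks ?ns (Trs zs f j)))
    (map2 (PhiO (P0 F ?y)) ws (blocks ?ns (map (AO (P1 F f)) (Obs zs ?x j))))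
    (map2 (PhiO (P0 F ?y)) ws (blocks ?ns (Obs zs ?y (O1 J f j))))"
   using fun_hom[OF m.B.prod_Phi[OF ws] t] in_homD(1)[OF t] fo Obs[OF zs xy(2) fun_obj[OF J.P1_func[OF f] j]]
   by (simp add: map2_map1 del: map_map)
  show "tr (FO ?Q zs) f j = Comp (X ?y)
    (FA (end_gam (X ?y) ?ns (Phi (P0 F ?y) w) (map (Phi (P0 F ?y)) ws)) (Trs zs f j))
    (Comp (X ?y) (PhiF (P0 F ?y) w (map2 (rho (P1 F f)) ws (blocks ?ns (Obs zs ?x j))))
     (rho (P1 F f) w (map2 (PhiO (P0 F ?x)) ws (blocks ?ns (Obs zs ?x j)))))"
   unfolding FQ phiO(4)[OF w ps f j] et eo' P.FA_comp_hom[OF S tb] m.B.end_gam_FA[OF in_homD(1)[OF t]]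
   by (rule m.B.Car.in_hom_assoc[OF m.rho_hom[OF w p1] P.FA_in_hom[OF S] P.FA_in_hom[OF tb], symmetric])
 qed
qed

text \<open>Functors commute strictly with \<open>end_unit\<close>, so its comparison cell is an
  identity and compatibility is \<open>rho_unit\<close>.\<close>

lemma strict_over_CohI: "strict_over 1 CohIL (\<lambda>x. CohI (P0 F x))" unfolding CohIL_def
proof (rule strict_over_lift)
 note u = unit_words
 show P: "is_functor (pow_cat LC 1) LC (PhiL (unit_word T))" by (rule PhiL_functor[OF u])
 show Q: "is_functor (pow_cat LC 1) LC (end_unit LC)" by (rule end_unit_functor[OF LC.category_axioms])
 {
  fix x assume x: "x \<in> Cell0 D"
  interpret A: alg_over T "P0 F x" by (rule F_alg[OF x])
  show "nat_iso (pow_cat (X x) 1) (X x) (NDom (CohI (P0 F x))) (NCod (CohI (P0 F x))) (CohI (P0 F x))"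
   using A.CohI_iso by (simp only: A.CohI_boundary)
  fix j assume j: "j \<in> O0 J x"
  show "relF x j 1 (PhiL (unit_word T)) (NDom (CohI (P0 F x)))"
   unfolding A.CohI_boundary by (rule relF_PhiL[OF x j u])
  show "relF x j 1 (end_unit LC) (NCod (CohI (P0 F x)))" unfolding A.CohI_boundary by (rule relF_end_unit[OF x j])
 }
 fix zs assume zs: "zs \<in> powO LC 1"
 then obtain z where z: "zs = [z]" "z \<in> Obj LC" by (cases zs) (auto simp: powO_iff)
 have FQ: "FO (end_unit LC) zs = z" using zs by (simp add: z)
 interpret c: pcone D J U "ob z" "ar z" "tr z" by (rule LC_pcone[OF z(2)])
 show "pmod D J U (ob (FO (PhiL (unit_word T)) zs)) (ar (FO (PhiL (unit_word T)) zs)) (tr (FO (PhiL (unit_word T)) zs))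
   (ob (FO (end_unit LC) zs)) (ar (FO (end_unit LC) zs)) (tr (FO (end_unit LC) zs)) (\<lambda>x j. NC (CohI (P0 F x)) (Obs zs x j))"
 proof (rule struct_mod[OF zs, where P = "\<lambda>x. Phi (P0 F x) (unit_word T)" and Q = "\<lambda>x. end_unit (X x)"
    and pr = "\<lambda>f j. rho (P1 F f) (unit_word T) (Obs zs (Src D f) j)"
    and ka = "\<lambda>f j. Ide (X (Trg D f)) (AO (P1 F f) (ob z (Src D f) j))"])
  fix x assume x: "x \<in> Cell0 D"
  interpret A: alg_over T "P0 F x" by (rule F_alg[OF x])
  show "nat_trans (pow_cat (X x) 1) (X x) (Phi (P0 F x) (unit_word T)) (end_unit (X x)) (CohI (P0 F x))"
   by (rule iso_nat[OF A.CohI_iso])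
  show "ob (FO (PhiL (unit_word T)) zs) x j = PhiO (P0 F x) (unit_word T) (Obs zs x j)" if "j \<in> O0 J x" for j
   using phiO(2)[OF u zs x that] by (simp add: PhiL_FO[OF u zs])
  show "ar (FO (PhiL (unit_word T)) zs) x v = PhiF (P0 F x) (unit_word T) (Ars zs x v)" if "v \<in> A0 J x" for v
   using phiO(3)[OF u zs x that] by (simp add: PhiL_FO[OF u zs])
  show "ob (FO (end_unit LC) zs) x j = FO (end_unit (X x)) (Obs zs x j)" if "j \<in> O0 J x" for j
   using Obs[OF zs x that] by (simp add: FQ) (simp add: z)
  show "ar (FO (end_unit LC) zs) x v = FA (end_unit (X x)) (Ars zs x v)" if "v \<in> A0 J x" for v
   using in_homD(1)[OF Ars[OF zs x in_homI[OF that]]] by (simp add: FQ) (simp add: z)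
 next
  fix f j assume f: "f \<in> Cell1 D" and j: "j \<in> O0 J (Src D f)"
  let ?x = "Src D f" and ?y = "Trg D f"
  note xy = D.cell1(1,2)[OF f]
  interpret m: algmor T "P0 F ?x" "P0 F ?y" "P1 F f" by (rule F_mor[OF f])
  note o1 = Obs[OF zs xy(1) j] and t = Trs[OF zs f j]
  note fo = pow_func_Obj[OF m.AFun o1]
  have th: "in_hom (X ?y) (tr z f j) (AO (P1 F f) (ob z ?x j)) (ob z ?y (O1 J f j))" using c.tr_hom[OF f j] by simp
  note i = m.B.Car.in_hom_ide[OF m.B.Car.in_hom_obj(1)[OF th]]
  show "tr (FO (PhiL (unit_word T)) zs) f j = Comp (X ?y) (PhiF (P0 F ?y) (unit_word T) (Trs zs f j))
    (rho (P1 F f) (unit_word T) (Obs zs ?x j))" using phiO(4)[OF u zs f j] by (simp add: PhiL_FO[OF u zs])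
  show "in_hom (X ?y) (rho (P1 F f) (unit_word T) (Obs zs ?x j))
    (AO (P1 F f) (PhiO (P0 F ?x) (unit_word T) (Obs zs ?x j)))
    (PhiO (P0 F ?y) (unit_word T) (map (AO (P1 F f)) (Obs zs ?x j)))" by (rule m.rho_hom[OF u o1])
  show "in_hom (X ?y) (Ide (X ?y) (AO (P1 F f) (ob z ?x j))) (AO (P1 F f) (FO (end_unit (X ?x)) (Obs zs ?x j)))
    (FO (end_unit (X ?y)) (map (AO (P1 F f)) (Obs zs ?x j)))" using i o1 fo by (simp add: z)
  show "Comp (X ?y) (NC (CohI (P0 F ?y)) (map (AO (P1 F f)) (Obs zs ?x j)))
    (rho (P1 F f) (unit_word T) (Obs zs ?x j)) =
   Comp (X ?y) (Ide (X ?y) (AO (P1 F f) (ob z ?x j))) (AA (P1 F f) (NC (CohI (P0 F ?x)) (Obs zs ?x j)))"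
   unfolding m.rho_unit[OF o1]
   using m.B.Car.in_hom_ide_left[OF m.AFun.FA_in_hom[OF m.A.CohI_hom[OF o1]]] by (simp add: z)
  show "tr (FO (end_unit LC) zs) f j = Comp (X ?y) (FA (end_unit (X ?y)) (Trs zs f j))
    (Ide (X ?y) (AO (P1 F f) (ob z ?x j)))"
   using in_homD(1)[OF t] m.B.Car.in_hom_ide_right[OF th] by (simp add: FQ) (simp add: z)
 qed
qed

text \<open>Functors commute strictly with reindexing, so the comparison cell of the reindexed
  operation is the coherence of \<open>w\<close> at the reindexed tuple, and compatibility is
  \<open>rho_subst\<close>.\<close>

lemma strict_over_CohS: assumes w: "w \<in> words T (length fs)" and fs: "set fs \<subseteq> {..<l}"
 shows "strict_over l (CohSL w l fs) (\<lambda>x. CohS (P0 F x) w l fs)" unfolding CohSL_def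
proof (rule strict_over_lift)
 let ?Q = "end_subst LC l fs (PhiL w)" and ?s = "subst_word T l fs w"
 note g = subst_words[OF w fs]
 show P: "is_functor (pow_cat LC l) LC (PhiL ?s)" by (rule PhiL_functor[OF g])
 show Q: "is_functor (pow_cat LC l) LC ?Q" by (rule end_subst_functor[OF LC.category_axioms fs PhiL_functor[OF w]])
 {
  fix x assume x: "x \<in> Cell0 D"
  interpret A: alg_over T "P0 F x" by (rule F_alg[OF x])
  show "nat_iso (pow_cat (X x) l) (X x) (NDom (CohS (P0 F x) w l fs)) (NCod (CohS (P0 F x) w l fs)) (CohS (P0 F x) w l fs)"
   using A.CohS_iso[OF w fs] by (simp add: A.CohS_boundary[OF w fs])
  fix j assume j: "j \<in> O0 J x"
  show "relF x j l (PhiL ?s) (NDom (CohS (P0 F x) w l fs))"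
   unfolding A.CohS_boundary[OF w fs] by (rule relF_PhiL[OF x j g])
  show "relF x j l ?Q (NCod (CohS (P0 F x) w l fs))"
   unfolding A.CohS_boundary[OF w fs] by (rule relF_end_subst[OF x j fs relF_PhiL[OF x j w]])
 }
 note rQ = relF_end_subst[OF _ _ fs relF_PhiL[OF _ _ w]]
 fix zs assume zs: "zs \<in> powO LC l"
 then have len: "length zs = l" by (simp add: powO_iff)
 define ps where "ps = map ((!) zs) fs"
 have ps: "ps \<in> powO LC (length fs)" unfolding ps_def by (rule reindex_Obj[OF zs fs])
 have FQ: "FO ?Q zs = phiO w ps" using zs PhiL_FO[OF w ps] by (simp add: end_subst_def ps_def)
 have mp: "map h ps = map ((!) (map h zs)) fs" for h :: "'u \<Rightarrow> 'u"
  unfolding ps_def by (rule nth_Obs) (use fs len in simp)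
 show "pmod D J U (ob (FO (PhiL ?s) zs)) (ar (FO (PhiL ?s) zs)) (tr (FO (PhiL ?s) zs))
   (ob (FO ?Q zs)) (ar (FO ?Q zs)) (tr (FO ?Q zs)) (\<lambda>x j. NC (CohS (P0 F x) w l fs) (Obs zs x j))"
 proof (rule struct_mod[OF zs, where P = "\<lambda>x. Phi (P0 F x) ?s"
    and Q = "\<lambda>x. end_subst (X x) l fs (Phi (P0 F x) w)"
    and pr = "\<lambda>f j. rho (P1 F f) ?s (Obs zs (Src D f) j)"
    and ka = "\<lambda>f j. rho (P1 F f) w (map ((!) (Obs zs (Src D f) j)) fs)"])
  fix x assume x: "x \<in> Cell0 D"
  interpret A: alg_over T "P0 F x" by (rule F_alg[OF x])
  show "nat_trans (pow_cat (X x) l) (X x) (Phi (P0 F x) ?s) (end_subst (X x) l fs (Phi (P0 F x) w)) (CohS (P0 F x) w l fs)"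
   by (rule iso_nat[OF A.CohS_iso[OF w fs]])
  show "ob (FO (PhiL ?s) zs) x j = PhiO (P0 F x) ?s (Obs zs x j)" if "j \<in> O0 J x" for j
   using phiO(2)[OF g zs x that] by (simp add: PhiL_FO[OF g zs])
  show "ar (FO (PhiL ?s) zs) x u = PhiF (P0 F x) ?s (Ars zs x u)" if "u \<in> A0 J x" for u
   using phiO(3)[OF g zs x that] by (simp add: PhiL_FO[OF g zs])
  show "ob (FO ?Q zs) x j = FO (end_subst (X x) l fs (Phi (P0 F x) w)) (Obs zs x j)" if "j \<in> O0 J x" for j
   using rQ[OF x that x that] zs by (simp add: relF_def A.CohS_boundary[OF w fs])
  show "ar (FO ?Q zs) x u = FA (end_subst (X x) l fs (Phi (P0 F x) w)) (Ars zs x u)" if u: "u \<in> A0 J x" for u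
   unfolding FQ phiO(3)[OF w ps x u] mp A.end_subst_FA[OF in_homD(1)[OF Ars[OF zs x in_homI[OF u]]]] ..
 next
  fix f j assume f: "f \<in> Cell1 D" and j: "j \<in> O0 J (Src D f)"
  let ?x = "Src D f" and ?y = "Trg D f"
  note xy = D.cell1(1,2)[OF f]
  interpret m: algmor T "P0 F ?x" "P0 F ?y" "P1 F f" by (rule F_mor[OF f])
  note o1 = Obs[OF zs xy(1) j] and t = Trs[OF zs f j]
  note fo = pow_func_Obj[OF m.AFun o1]
  have r: "map ((!) (map (AO (P1 F f)) (Obs zs ?x j))) fs = map (AO (P1 F f)) (map ((!) (Obs zs ?x j)) fs)"
   by (rule nth_Obs[symmetric]) (use fs len in simp)
  show "tr (FO (PhiL ?s) zs) f j = Comp (X ?y) (PhiF (P0 F ?y) ?s (Trs zs f j)) (rho (P1 F f) ?s (Obs zs ?x j))"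
   using phiO(4)[OF g zs f j] by (simp add: PhiL_FO[OF g zs])
  show "in_hom (X ?y) (rho (P1 F f) ?s (Obs zs ?x j)) (AO (P1 F f) (PhiO (P0 F ?x) ?s (Obs zs ?x j)))
    (PhiO (P0 F ?y) ?s (map (AO (P1 F f)) (Obs zs ?x j)))" by (rule m.rho_hom[OF g o1])
  show "in_hom (X ?y) (rho (P1 F f) w (map ((!) (Obs zs ?x j)) fs))
    (AO (P1 F f) (FO (end_subst (X ?x) l fs (Phi (P0 F ?x) w)) (Obs zs ?x j)))
    (FO (end_subst (X ?y) l fs (Phi (P0 F ?y) w)) (map (AO (P1 F f)) (Obs zs ?x j)))"
   unfolding m.A.end_subst_FO[OF o1] m.B.end_subst_FO[OF fo] r by (rule m.rho_hom[OF w reindex_Obj[OF o1 fs]])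
  show "Comp (X ?y) (NC (CohS (P0 F ?y) w l fs) (map (AO (P1 F f)) (Obs zs ?x j))) (rho (P1 F f) ?s (Obs zs ?x j)) =
   Comp (X ?y) (rho (P1 F f) w (map ((!) (Obs zs ?x j)) fs)) (AA (P1 F f) (NC (CohS (P0 F ?x) w l fs) (Obs zs ?x j)))"
   by (rule m.rho_subst[OF w fs o1])
  show "tr (FO ?Q zs) f j = Comp (X ?y) (FA (end_subst (X ?y) l fs (Phi (P0 F ?y) w)) (Trs zs f j))
    (rho (P1 F f) w (map ((!) (Obs zs ?x j)) fs))"
   unfolding FQ phiO(4)[OF w ps f j] mp m.B.end_subst_FA[OF in_homD(1)[OF t]] ..
 qed
qed

lemma strict_over_idL: assumes w: "w \<in> words T n"
 shows "strict_over n (id_nat (PhiL w)) (\<lambda>x. id_nat (Phi (P0 F x) w))"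
 by (rule strict_over_id[OF PhiL_functor[OF w] _ relF_PhiL[OF _ _ w]])
  (use F_alg pseudo_algebra.Phi_functor[OF alg_over.axioms(2) w] in blast)

lemma CohL_boundary [simp]: "NDom (CohCL w ws) = PhiL (gam T w ws)"
 "NCod (CohCL w ws) = end_gam LC (ars T ws) (PhiL w) (map PhiL ws)"
 "NDom CohIL = PhiL (unit_word T)" "NCod CohIL = end_unit LC"
 "NDom (CohSL w l fs) = PhiL (subst_word T l fs w)" "NCod (CohSL w l fs) = end_subst LC l fs (PhiL w)"
 by (simp_all add: CohCL_def CohIL_def CohSL_def)

definition AlgL :: "('u, 'u, 't) psalg" where
 "AlgL = \<lparr>Car = LC, Phi = PhiL, CohC = CohCL, CohI = CohIL, CohS = CohSL\<rparr>"

lemma AlgL_simps [simp]: "Car AlgL = LC" "Phi AlgL = PhiL" "CohC AlgL = CohCL" "CohI AlgL = CohIL" "CohS AlgL = CohSL"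
 by (simp_all add: AlgL_def)

lemma strict_over_nat_iso: "strict_over n al A ==> nat_iso (pow_cat LC n) LC (NDom al) (NCod al) al"
 by (simp add: strict_over_def)

text \<open>The two sides lie over the two sides of the same axiom in each \<open>F x\<close>, where
  they are equal, and their domains agree by \<open>gam_assoc\<close>; \<open>strict_over_eq\<close>
  concludes. The other axioms follow this pattern with the corresponding identity of words.\<close>

lemma AlgL_assoc: assumes w: "w \<in> words T (length ws)" and ws: "set ws \<subseteq> all_words T"
  and len: "map length wss = ars T ws" and us: "\<forall>us\<in>set wss. set us \<subseteq> all_words T"
 shows "vcomp_nat (end_gam2 LC (ars T (concat wss)) (CohCL w ws) (map (\<lambda>u. id_nat (PhiL u)) (concat wss)))
    (CohCL (gam T w ws) (concat wss)) = vcomp_nat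
    (end_gam2 LC (map (\<lambda>us. sum_list (ars T us)) wss) (id_nat (PhiL w)) (map2 CohCL ws wss))
    (CohCL w (map2 (gam T) ws wss))" (is "?l = ?r")
proof -
 let ?vs = "concat wss" and ?ms' = "map (\<lambda>us. sum_list (ars T us)) wss" and ?gs = "map2 (gam T) ws wss"
 let ?M = "sum_list (ars T ?vs)"
 have k: "length wss = length ws" using arg_cong[OF len, of length] by simp
 have vs: "set ?vs \<subseteq> all_words T" using us by auto
 have N: "sum_list (ars T ws) = length ?vs" by (simp add: length_concat len)
 have M: "sum_list ?ms' = ?M" by (simp only: sum_list_map_concat)
 have g: "gam T w ws \<in> words T (length ?vs)" using gam_words[OF w ws] N by simp
 have wi: "ws ! i \<in> words T (length (wss ! i))" and ui: "set (wss ! i) \<subseteq> all_words T" if "i < length ws" for i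
  using nth_words[OF ws that] arg_cong[OF len, of "\<lambda>xs. xs ! i"] that k us by (simp_all add: words_iff)
 have gi: "gam T (ws ! i) (wss ! i) \<in> words T (sum_list (ars T (wss ! i)))" if "i < length ws" for i
  by (rule gam_words[OF wi[OF that] ui[OF that]])
 have gs: "set ?gs \<subseteq> all_words T"
 proof (rule subsetI)
  fix v assume "v \<in> set ?gs"
  then obtain i where "i < length ws" "v = gam T (ws ! i) (wss ! i)" by (auto simp: in_set_conv_nth k)
  then show "v \<in> all_words T" using words_all[OF gi] by simp
 qed
 have ags: "ars T ?gs = ?ms'" using arity_words[OF gi] k by (intro nth_equalityI) (simp_all)
 have wg: "w \<in> words T (length ?gs)" using w k by simp
 have vi: "?vs ! i \<in> words T (arity T (?vs ! i))" if "i < length ?vs" for i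
  using nth_words[OF vs that] by (simp add: words_iff)
 have L: "strict_over ?M ?l (\<lambda>x. vcomp_nat
   (end_gam2 (X x) (ars T ?vs) (CohC (P0 F x) w ws) (map (\<lambda>u. id_nat (Phi (P0 F x) u)) ?vs))
   (CohC (P0 F x) (gam T w ws) ?vs))" by (rule strict_over_vcomp[OF strict_over_CohC[OF g vs] strict_over_end_gam2])
   (use strict_over_CohC[OF w ws] N strict_over_idL[OF vi] in \<open>simp_all add: comp_def\<close>)
 have 4: "strict_over (sum_list ?ms') (end_gam2 LC ?ms' (id_nat (PhiL w)) (map2 CohCL ws wss))
   (\<lambda>x. end_gam2 (X x) ?ms' (id_nat (Phi (P0 F x) w)) (map2 (CohC (P0 F x)) ws wss))"
  by (rule strict_over_end_gam2) (use strict_over_idL[OF w] strict_over_CohC[OF wi ui] k in simp_all)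
 have R: "strict_over ?M ?r (\<lambda>x. vcomp_nat
   (end_gam2 (X x) ?ms' (id_nat (Phi (P0 F x) w)) (map2 (CohC (P0 F x)) ws wss)) (CohC (P0 F x) w ?gs))"
 proof (rule strict_over_vcomp[OF strict_over_CohC[OF wg gs, unfolded ags M] 4[unfolded M]])
  \<comment> \<open>Composability of the two factors: each inner \<open>CohCL\<close> starts at the
    action of a substituted word, which is where the first factor ends.\<close>
  have "map NDom (map2 CohCL ws wss) = map PhiL ?gs" using k by (intro nth_equalityI) simp_all
  then show "NDom (end_gam2 LC ?ms' (id_nat (PhiL w)) (map2 CohCL ws wss)) = NCod (CohCL w ?gs)"
   by (simp add: ags del: map_map)
 qed
 show ?thesis
 proof (rule strict_over_eq[OF L R])
  show "NDom ?l = NDom ?r" using gam_assoc[OF w ws len us] by simp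
  show "vcomp_nat (end_gam2 (X x) (ars T ?vs) (CohC (P0 F x) w ws) (map (\<lambda>u. id_nat (Phi (P0 F x) u)) ?vs))
    (CohC (P0 F x) (gam T w ws) ?vs) =
   vcomp_nat (end_gam2 (X x) ?ms' (id_nat (Phi (P0 F x) w)) (map2 (CohC (P0 F x)) ws wss)) (CohC (P0 F x) w ?gs)"
   if "x \<in> Cell0 D" for x by (rule pseudo_algebra.coh_assoc[OF alg_over.axioms(2)[OF F_alg[OF that]] w ws len us])
 qed
qed

lemma AlgL_unit_right: assumes w: "w \<in> words T k"
 shows "vcomp_nat (end_gam2 LC (replicate k 1) (id_nat (PhiL w)) (replicate k CohIL))
  (CohCL w (replicate k (unit_word T))) = id_nat (PhiL w)" (is "?l = _")
proof -
 let ?us = "replicate k (unit_word T)"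
 have us: "set ?us \<subseteq> all_words T" using words_all[OF unit_words] by auto
 have wu: "w \<in> words T (length ?us)" using w by simp
 have a: "ars T ?us = replicate k 1" using arity_words[OF unit_words] by simp
 have s: "sum_list (replicate k (1::nat)) = k" by (simp add: sum_list_replicate)
 have 1: "strict_over (sum_list (replicate k 1)) (end_gam2 LC (replicate k 1) (id_nat (PhiL w)) (replicate k CohIL))
   (\<lambda>x. end_gam2 (X x) (replicate k 1) (id_nat (Phi (P0 F x) w)) (replicate k (CohI (P0 F x))))"
  by (rule strict_over_end_gam2) (use strict_over_CohI strict_over_idL[OF w] in simp_all)
 show ?thesis
 proof (rule strict_over_eq[OF strict_over_vcomp[OF strict_over_CohC[OF wu us, unfolded a s] 1[unfolded s]] strict_over_idL[OF w]])
  show "NDom ?l = NDom (id_nat (PhiL w))" using gam_unit_right[OF w] by simp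
 qed (simp add: arity_words[OF unit_words], rule pseudo_algebra.coh_unit_right[OF alg_over.axioms(2)[OF F_alg] w])
qed

lemma AlgL_unit_left: assumes w: "w \<in> words T k"
 shows "vcomp_nat (end_gam2 LC [k] CohIL [id_nat (PhiL w)]) (CohCL (unit_word T) [w]) = id_nat (PhiL w)" (is "?l = _")
proof -
 have ws: "set [w] \<subseteq> all_words T" using words_all[OF w] by simp
 have u: "unit_word T \<in> words T (length [w])" using unit_words by simp
 have a: "map (arity T) [w] = [k]" using arity_words[OF w] by simp
 have 1: "strict_over (sum_list [k]) (end_gam2 LC [k] CohIL [id_nat (PhiL w)])
   (\<lambda>x. end_gam2 (X x) [k] (CohI (P0 F x)) [id_nat (Phi (P0 F x) w)])"
  by (rule strict_over_end_gam2) (use strict_over_CohI strict_over_idL[OF w] in simp_all)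
 have s: "sum_list [k] = k" by simp
 show ?thesis
 proof (rule strict_over_eq[OF strict_over_vcomp[OF strict_over_CohC[OF u ws, unfolded a s] 1[unfolded s]] strict_over_idL[OF w]])
  show "NDom ?l = NDom (id_nat (PhiL w))" using gam_unit_left[OF w] by simp
 qed (simp add: arity_words[OF w], rule pseudo_algebra.coh_unit_left[OF alg_over.axioms(2)[OF F_alg] w])
qed

lemma AlgL_subst_outer: assumes w: "w \<in> words T (length fs)" and fs: "set fs \<subseteq> {..<length vs}"
  and vs: "set vs \<subseteq> all_words T" and ns: "ns = ars T vs" shows "vcomp_nat
    (end_subst2 LC (sum_list ns) (block_map ns fs) (CohCL w (map ((!) vs) fs)))
    (CohSL (gam T w (map ((!) vs) fs)) (sum_list ns) (block_map ns fs)) = vcomp_nat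
    (end_gam2 LC ns (CohSL w (length vs) fs) (map (\<lambda>v. id_nat (PhiL v)) vs))
    (CohCL (subst_word T (length vs) fs w) vs)" (is "?l = ?r")
proof -
 let ?us = "map ((!) vs) fs" and ?bm = "block_map ns fs" and ?s = "subst_word T (length vs) fs w"
 have l: "fs ! i < length vs" if "i < length fs" for i using fs that nth_mem by blast
 have us: "set ?us \<subseteq> all_words T" using vs fs by (auto simp: subset_eq)
 have wu: "w \<in> words T (length ?us)" using w by simp
 have lb: "length ?bm = sum_list (ars T ?us)" unfolding block_map_def length_concat map_map
  by (rule arg_cong[of _ _ sum_list]) (use l in \<open>auto simp: ns in_set_conv_nth\<close>)
 have bm: "set ?bm \<subseteq> {..<sum_list ns}" using set_block_incl[of _ ns] fs by (auto simp: block_map_def ns)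
 have g: "gam T w ?us \<in> words T (length ?bm)" using gam_words[OF wu us] lb by simp
 have s: "?s \<in> words T (length vs)" by (rule subst_words[OF w fs])
 have vi: "vs ! i \<in> words T (ns ! i)" if "i < length vs" for i
  using nth_words[OF vs that] that by (simp add: words_iff ns)
 have 1: "strict_over (length ?bm) (CohCL w ?us) (\<lambda>x. CohC (P0 F x) w ?us)"
  using strict_over_CohC[OF wu us] lb by simp
 have 2: "strict_over (sum_list ns) (end_gam2 LC ns (CohSL w (length vs) fs) (map (\<lambda>v. id_nat (PhiL v)) vs))
   (\<lambda>x. end_gam2 (X x) ns (CohS (P0 F x) w (length vs) fs) (map (\<lambda>v. id_nat (Phi (P0 F x) v)) vs))"
  by (rule strict_over_end_gam2) (use strict_over_CohS[OF w fs] strict_over_idL[OF vi] in \<open>simp_all add: ns\<close>)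
 show ?thesis
 proof (rule strict_over_eq[OF strict_over_vcomp[OF strict_over_CohS[OF g bm] strict_over_end_subst2[OF bm 1]]
    strict_over_vcomp[OF strict_over_CohC[OF s vs, folded ns] 2]])
  show "NDom ?l = NDom ?r" using gam_subst_outer[OF w fs vs ns] by simp
 qed (simp, simp add: ns comp_def, rule pseudo_algebra.coh_subst_outer[OF alg_over.axioms(2)[OF F_alg] w fs vs ns])
qed

lemma AlgL_subst_inner: assumes w: "w \<in> words T (length ws)" and ws: "set ws \<subseteq> all_words T"
  and len: "length gss = length ws" "length ms = length ws"
  and gss: "\<forall>i<length ws. length (gss ! i) = arity T (ws ! i) \<and> set (gss ! i) \<subseteq> {..<ms ! i}"
 shows "vcomp_nat (end_subst2 LC (sum_list ms) (block_sum ms gss) (CohCL w ws))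
    (CohSL (gam T w ws) (sum_list ms) (block_sum ms gss)) = vcomp_nat
    (end_gam2 LC ms (id_nat (PhiL w)) (map (\<lambda>i. CohSL (ws ! i) (ms ! i) (gss ! i)) [0..<length ws]))
    (CohCL w (map (\<lambda>i. subst_word T (ms ! i) (gss ! i) (ws ! i)) [0..<length ws]))" (is "?l = ?r")
proof -
 let ?us = "map (\<lambda>i. subst_word T (ms ! i) (gss ! i) (ws ! i)) [0..<length ws]" and ?bs = "block_sum ms gss"
 note i = gam_subst_inner[OF w ws len gss]
 have wu: "w \<in> words T (length ?us)" using w by simp
 have g: "gam T w ws \<in> words T (length ?bs)" using gam_words[OF w ws] i(5) by simp
 have wi: "ws ! i \<in> words T (length (gss ! i))" and gi: "set (gss ! i) \<subseteq> {..<ms ! i}" if "i < length ws" for i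
  using nth_words[OF ws that] gss that by (simp_all add: words_iff)
 have 1: "strict_over (length ?bs) (CohCL w ws) (\<lambda>x. CohC (P0 F x) w ws)"
  using strict_over_CohC[OF w ws] i(5) by simp
 have 2: "strict_over (sum_list ms) (end_gam2 LC ms (id_nat (PhiL w)) (map (\<lambda>i. CohSL (ws ! i) (ms ! i) (gss ! i)) [0..<length ws]))
   (\<lambda>x. end_gam2 (X x) ms (id_nat (Phi (P0 F x) w)) (map (\<lambda>i. CohS (P0 F x) (ws ! i) (ms ! i) (gss ! i)) [0..<length ws]))"
  by (rule strict_over_end_gam2) (use strict_over_idL[OF w] strict_over_CohS[OF wi gi] len in simp_all)
 have 3: "map NDom (map (\<lambda>i. CohSL (ws ! i) (ms ! i) (gss ! i)) [0..<length ws]) = map PhiL ?us" by simp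
 show ?thesis
 proof (rule strict_over_eq[OF strict_over_vcomp[OF strict_over_CohS[OF g i(4)] strict_over_end_subst2[OF i(4) 1]]
    strict_over_vcomp[OF strict_over_CohC[OF wu i(3), unfolded i(2)] 2]])
  show "NDom ?l = NDom ?r" using i(1) by simp
 qed (simp, use 3 in \<open>simp add: i(2) del: map_map\<close>, rule pseudo_algebra.coh_subst_inner[OF alg_over.axioms(2)[OF F_alg] w ws len gss])
qed

lemma AlgL_subst_comp:
 assumes w: "w \<in> words T (length fs)" and fs: "set fs \<subseteq> {..<length gs}" and gs: "set gs \<subseteq> {..<m}"
 shows "vcomp_nat (end_subst2 LC m gs (CohSL w (length gs) fs)) (CohSL (subst_word T (length gs) fs w) m gs) =
  CohSL w m (map ((!) gs) fs)" (is "?l = ?r")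
proof -
 note s = subst_words[OF w fs]
 have fgs: "set (map ((!) gs) fs) \<subseteq> {..<m}" using fs gs by (auto simp: subset_eq)
 have w': "w \<in> words T (length (map ((!) gs) fs))" using w by simp
 show ?thesis
 proof (rule strict_over_eq[OF strict_over_vcomp[OF strict_over_CohS[OF s gs] strict_over_end_subst2[OF gs strict_over_CohS[OF w fs]]]
    strict_over_CohS[OF w' fgs]])
  show "NDom ?l = NDom ?r" using subst_comp[OF w fs gs] by simp
 qed (simp, rule pseudo_algebra.coh_subst_comp[OF alg_over.axioms(2)[OF F_alg] w fs gs])
qed

lemma AlgL_subst_id: assumes w: "w \<in> words T k" shows "CohSL w k [0..<k] = id_nat (PhiL w)"
proof (rule strict_over_eq[OF strict_over_CohS strict_over_idL[OF w]])
 show "w \<in> words T (length [0..<k])" using w by simp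
 show "NDom (CohSL w k [0..<k]) = NDom (id_nat (PhiL w))" using subst_id[OF w] by simp
qed (auto intro: pseudo_algebra.coh_subst_id[OF alg_over.axioms(2)[OF F_alg] w])

theorem AlgL_pseudo_algebra: "pseudo_algebra T AlgL" by (rule pseudo_algebra.intro; (unfold AlgL_simps)?)
  (use LC.category_axioms PhiL_functor strict_over_nat_iso[OF strict_over_CohC] strict_over_nat_iso[OF strict_over_CohI]
   strict_over_nat_iso[OF strict_over_CohS] AlgL_assoc AlgL_unit_right AlgL_unit_left AlgL_subst_outer AlgL_subst_inner
   AlgL_subst_comp AlgL_subst_id in simp_all)

lemma AlgL_small: "small_algebra T AlgL" using AlgL_pseudo_algebra LC_small by (simp add: small_algebra_def)

end

section \<open>Hom categories of pseudo algebras and their invertible 2-cells\<close>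

context is_theory
begin

lemma hom_PsAlg: assumes "small_algebra T A" "small_algebra T B"
 shows "H \<in> Obj (hom_cat PA A B) \<longleftrightarrow> algmor T A B H"
  "in_hom (hom_cat PA A B) al G H \<longleftrightarrow> algcell T A B G H al"
proof -
 have "algmor T A B H ==> ADom H = A \<and> ACod H = B"
  using algebra_morphism.ADom algebra_morphism.ACod algmor.axioms(2) by blast
 then show "H \<in> Obj (hom_cat PA A B) \<longleftrightarrow> algmor T A B H" using assms by (auto simp: hom_cat_def)
 show "in_hom (hom_cat PA A B) al G H \<longleftrightarrow> algcell T A B G H al"
  using assms algcell_boundary[of A B G H al] by (auto simp: hom_cat_def in_hom_def)
qed

lemma cell_vcomp_NC: assumes "algcell T A B G H al" "p \<in> Obj (Car A)"
 shows "cN (cell_vcomp be al) p = cmp B (cN be p) (cN al p)"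
proof -
 interpret algcell T A B G H al by fact
 show ?thesis using assms(2) by (simp add: CNat.boundary)
qed

lemma cell_hcomp_left_NC: assumes "algcell T A B G G' al" "algmor T B C H" "p \<in> Obj (Car A)"
 shows "cN (cell_hcomp T (cell_id H) al) p = AA H (cN al p)"
 using hcomp_id_left[OF algcell_nat[OF assms(1)] algebra_morphism.AFun[OF algmor.axioms(2)[OF assms(2)]] assms(3)] by simp

lemma cell_hcomp_right_NC: assumes "algmor T A B H" "algcell T B C G G' al" "p \<in> Obj (Car A)"
 shows "cN (cell_hcomp T al (cell_id H)) p = cN al (AO H p)"
 using hcomp_id_right[OF algcell_nat[OF assms(2)] algebra_morphism.AFun[OF algmor.axioms(2)[OF assms(1)]] assms(3)] by simp

lemma algmor_AFun: "algmor T A B H ==> is_functor (Car A) (Car B) (AFun H)"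
 by (rule algebra_morphism.AFun[OF algmor.axioms(2)])

lemma cell_id_NC: "algmor T A B H ==> p \<in> Obj (Car A) ==> cN (cell_id H) p = Ide (Car B) (AO H p)"
 using fun_dom[OF algmor_AFun, of A B H] fun_cod[OF algmor_AFun, of A B H] by simp

lemma algmor_comp_AFun: assumes "algmor T A B G"
 shows "p \<in> Obj (Car A) ==> AO (algmor_comp T H G) p = AO H (AO G p)"
  "q \<in> Arr (Car A) ==> AA (algmor_comp T H G) q = AA H (AA G q)"
 using fun_dom[OF algmor_AFun[OF assms]] by simp_all

lemma algcell_iso_NC: assumes s: "small_algebra T A" "small_algebra T B" and a: "algcell T A B G H al"
  and iso: "iso_arr (hom_cat PA A B) al" and p: "p \<in> Obj (Car A)" shows "iso_arr (Car B) (cN al p)"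
proof -
 interpret PS: two_category PA by (rule PsAlg_two_category)
 interpret a: algcell T A B G H al by fact
 obtain be where b: "algcell T A B H G be" and e: "cell_vcomp be al = cell_id G" "cell_vcomp al be = cell_id H"
  using category.iso_arrE[OF PS.hom_category iso, unfolded hom_PsAlg[OF s], OF a] by (auto simp: hom_cat_def)
 interpret b: algcell T A B H G be by fact
 show ?thesis using arg_cong[OF e(1), of "\<lambda>ga. cN ga p"] arg_cong[OF e(2), of "\<lambda>ga. cN ga p"] p
  by (intro a.G.B.Car.iso_arrI[OF a.CNat.NC_in_hom[OF p] b.CNat.NC_in_hom[OF p]])
   (simp_all only: cell_vcomp_NC[OF a p] cell_vcomp_NC[OF b p] cell_id_NC[OF a.G.algmor_axioms p]
    cell_id_NC[OF a.H.algmor_axioms p])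
qed

text \<open>Chosen pointwise inverses are natural and satisfy the 2-cell condition by
  \<open>inverse_square\<close>; for the latter the functor \<open>Phi B w\<close> carries the list
  of inverses to an inverse.\<close>

lemma algcell_isoI: assumes s: "small_algebra T A" "small_algebra T B" and a: "algcell T A B G H al"
  and iso: "\<And>p. p \<in> Obj (Car A) ==> iso_arr (Car B) (cN al p)" shows "iso_arr (hom_cat PA A B) al"
proof -
 interpret PS: two_category PA by (rule PsAlg_two_category)
 interpret a: algcell T A B G H al by fact
 have "\<forall>p. \<exists>g. p \<in> Obj (Car A) \<longrightarrow> chom B g (AO H p) (AO G p) \<and>
   cmp B g (cN al p) = Ide (Car B) (AO G p) \<and> cmp B (cN al p) g = Ide (Car B) (AO H p)"
  using a.G.B.Car.iso_arrE[OF iso a.CNat.NC_in_hom] by metis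
 then obtain g where g: "chom B (g p) (AO H p) (AO G p)" "cmp B (g p) (cN al p) = Ide (Car B) (AO G p)"
   "cmp B (cN al p) (g p) = Ide (Car B) (AO H p)" if "p \<in> Obj (Car A)" for p by metis
 define be where "be = \<lparr>CDom = H, CCod = G, CNat = \<lparr>NDom = AFun H, NCod = AFun G, NC = (\<lambda>p\<in>Obj (Car A). g p)\<rparr>\<rparr>"
 have [simp]: "cN be p = g p" if "p \<in> Obj (Car A)" for p using that by (simp add: be_def)
 have b: "algcell T A B H G be"
 proof (rule algcellI[OF a.H.algmor_axioms a.G.algmor_axioms])
  show "nat_trans (Car A) (Car B) (AFun H) (AFun G) (CNat be)"
  proof (rule nat_transI[OF a.H.AFun a.G.AFun])
   fix q p p' assume q: "chom A q p p'"
   note p = a.G.A.Car.in_hom_obj[OF q]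
   show "cmp B (cN be p') (AA H q) = cmp B (AA G q) (cN be p)"
    using a.G.B.Car.inverse_square[OF a.CNat.NC_in_hom[OF p(1)] g(1,3)[OF p(1)] a.CNat.NC_in_hom[OF p(2)] g(1,2)[OF p(2)]
      a.G.AFun.FA_in_hom[OF q] a.H.AFun.FA_in_hom[OF q] a.CNat.naturality_hom[OF q]] p by simp
  qed (use g in \<open>simp_all add: be_def\<close>)
  fix w n ps assume w: "w \<in> words T n" and ps: "ps \<in> powO (Car A) n"
  interpret P: is_functor "pow_cat (Car B) n" "Car B" "Phi B w" by (rule a.G.B.Phi_functor[OF w])
  note p = fun_obj[OF a.G.A.Phi_functor[OF w] ps]
  have h: "powH (Car B) n (map (cN al) ps) (map (AO G) ps) (map (AO H) ps)"
   "powH (Car B) n (map (cN be) ps) (map (AO H) ps) (map (AO G) ps)"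
   using ps g(1) by (auto simp: powH_iff powO_iff a.CNat.NC_in_hom)
  have "Comp (pow_cat (Car B) n) (map (cN be) ps) (map (cN al) ps) = Ide (pow_cat (Car B) n) (map (AO G) ps)"
   using ps g(2) by (auto simp: powO_iff intro!: nth_equalityI)
  from arg_cong[OF this, of "PhiF B w"]
  have i: "cmp B (PhiF B w (map (cN be) ps)) (PhiF B w (map (cN al) ps)) = Ide (Car B) (PhiO B w (map (AO G) ps))"
   unfolding P.FA_comp_hom[OF h] P.FA_ide[OF pow_func_Obj[OF a.G.AFun ps]] .
  show "cmp B (rho G w ps) (cN be (PhiO A w ps)) = cmp B (PhiF B w (map (cN be) ps)) (rho H w ps)"
   using a.G.B.Car.inverse_square[OF a.CNat.NC_in_hom[OF p] g(1,3)[OF p] P.FA_in_hom[OF h(1)] P.FA_in_hom[OF h(2)] i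
     a.G.rho_hom[OF w ps] a.H.rho_hom[OF w ps] a.cell_rho[OF w ps, symmetric]] p by simp
 qed (simp_all add: be_def)
 have c: "cell_vcomp be al = cell_id G" "cell_vcomp al be = cell_id H"
  by (rule algcell_eqI[OF cell_vcomp_cell[OF a b] a.G.cell_id_cell],
    simp del: cell_simps add: cell_vcomp_NC[OF a] g cell_id_NC[OF a.G.algmor_axioms])
   (rule algcell_eqI[OF cell_vcomp_cell[OF b a] a.H.cell_id_cell],
    simp del: cell_simps add: cell_vcomp_NC[OF b] g cell_id_NC[OF a.H.algmor_axioms])
 show ?thesis by (rule category.iso_arrI[OF PS.hom_category, where x = G and y = H and g = be])
   (simp_all add: hom_PsAlg[OF s] a b, simp_all add: hom_cat_def c)
qed

end

section \<open>Evaluations of cones as strict morphisms to the algebras \<open>F x\<close>, and the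
  2-cells between them\<close>

context limit_setting
begin

sublocale S: rep_setting D PA J F
 by (intro rep_setting.intro D.two_category_axioms PsAlg_two_category J_cat_valued F_psfun)

interpretation AL: alg_over T AlgL by (rule small_algebra_over[OF AlgL_small])

definition evF where
 "evF x j = \<lparr>FDom = LC, FCod = X x, FO = (\<lambda>z\<in>Obj LC. ob z x j), FA = (\<lambda>m\<in>Arr LC. mc m x j)\<rparr>"

lemma evF_simps [simp]: "z \<in> Obj LC ==> FO (evF x j) z = ob z x j" "m \<in> Arr LC ==> FA (evF x j) m = mc m x j"
 "FDom (evF x j) = LC" "FCod (evF x j) = X x" by (simp_all add: evF_def)

lemma map_evF: "zs \<in> powO LC n ==> map (FO (evF x j)) zs = Obs zs x j"
 "ms \<in> powA LC n ==> map (FA (evF x j)) ms = Mcs ms x j" by (auto simp: powO_iff powA_iff in_set_conv_nth)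

lemma ob_obj: "z \<in> Obj LC ==> x \<in> Cell0 D ==> j \<in> O0 J x ==> ob z x j \<in> Obj (X x)"
 using pcone.ob_obj[OF LC_pcone, of z x j] by simp

lemma evF_functor: assumes x: "x \<in> Cell0 D" and j: "j \<in> O0 J x" shows "is_functor LC (X x) (evF x j)"
proof (rule is_functorI)
 show "FA (evF x j) (Comp LC n m) = Comp (X x) (FA (evF x j) n) (FA (evF x j) m)"
  if "in_hom LC m z z'" "in_hom LC n z' z''" for m n z z' z''
  using mc_comp[OF that x j] in_homD(1)[OF that(1)] in_homD(1)[OF that(2)] in_homD(1)[OF LC.in_hom_comp[OF that]] by simp
 show "in_hom (X x) (FA (evF x j) m) (FO (evF x j) z) (FO (evF x j) z')" if "in_hom LC m z z'" for m z z'
  using mc_hom[OF that x j] in_homD(1)[OF that] LC.in_hom_obj[OF that] by simp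
qed (use x j F_cat LC.category_axioms in \<open>simp_all add: ob_obj mc_ide LC.ide_arr, simp_all add: evF_def\<close>)

text \<open>Words act on cones pointwise, so evaluation commutes with them on the nose; this is what
  allows the coherences of \<open>ev\<close> to be identities.\<close>

lemma evF_square: assumes x: "x \<in> Cell0 D" and j: "j \<in> O0 J x" and w: "w \<in> words T n"
 shows "comp_func (evF x j) (PhiL w) = comp_func (Phi (P0 F x) w) (pow_func n (evF x j))"
proof (rule func_eqI)
 interpret A: alg_over T "P0 F x" by (rule F_alg[OF x])
 interpret P: is_functor "pow_cat LC n" LC "PhiL w" by (rule PhiL_functor[OF w])
 note r = relF_PhiL[OF x j w]
 show "is_functor (pow_cat LC n) (X x) (comp_func (evF x j) (PhiL w))"
  by (rule comp_functor[OF P.is_functor_axioms evF_functor[OF x j]])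
 show "is_functor (pow_cat LC n) (X x) (comp_func (Phi (P0 F x) w) (pow_func n (evF x j)))"
  by (rule comp_functor[OF pow_functor[OF evF_functor[OF x j]] A.Phi_functor[OF w]])
 show "FO (comp_func (evF x j) (PhiL w)) zs = FO (comp_func (Phi (P0 F x) w) (pow_func n (evF x j))) zs"
  if "zs \<in> powO LC n" for zs using r that P.FO_obj[OF that] by (simp add: P.FDom relF_def map_evF)
 show "FA (comp_func (evF x j) (PhiL w)) ms = FA (comp_func (Phi (P0 F x) w) (pow_func n (evF x j))) ms"
  if "ms \<in> powA LC n" for ms using r that P.FA_arr[OF that] by (simp add: P.FDom relF_def map_evF)
qed

definition ev where "ev x j = \<lparr>ADom = AlgL, ACod = P0 F x, AFun = evF x j,
  ARho = (\<lambda>w\<in>all_words T. id_nat (comp_func (evF x j) (PhiL w)))\<rparr>"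

lemma ev_simps [simp]: "ADom (ev x j) = AlgL" "ACod (ev x j) = P0 F x" "AFun (ev x j) = evF x j"
 by (simp_all add: ev_def)

lemma ev_rho:
 assumes x: "x \<in> Cell0 D" and j: "j \<in> O0 J x" and w: "w \<in> words T n" and zs: "zs \<in> powO LC n"
 shows "rho (ev x j) w zs = Ide (X x) (PhiO (P0 F x) w (Obs zs x j))"
 using zs words_all[OF w] fun_cod[OF PhiL_functor[OF w]] fun_dom[OF PhiL_functor[OF w]]
  relF_PhiL[OF x j w] fun_obj[OF PhiL_functor[OF w] zs] by (simp add: ev_def relF_def)

text \<open>With identity coherences each equation says that a coherence isomorphism of
  \<open>AlgL\<close> evaluates to that of \<open>F x\<close>, which is the component part of
  \<open>strict_over\<close>.\<close>

lemma ev_algmor: assumes x: "x \<in> Cell0 D" and j: "j \<in> O0 J x" shows "algmor T AlgL (P0 F x) (ev x j)"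
proof -
 interpret A: alg_over T "P0 F x" by (rule F_alg[OF x])
 interpret t: algmor_typed T AlgL "P0 F x" "ev x j"
 proof (intro algmor_typed.intro algmor_typed_axioms.intro)
  fix w n assume w: "w \<in> words T n"
  show "nat_iso (pow_cat (Car AlgL) n) (X x) (comp_func (AFun (ev x j)) (Phi AlgL w))
    (comp_func (Phi (P0 F x) w) (pow_func n (AFun (ev x j)))) (ARho (ev x j) w)"
   using id_nat_iso[OF comp_functor[OF PhiL_functor[OF w] evF_functor[OF x j]]] words_all[OF w]
    evF_square[OF x j w] by (simp add: ev_def)
 qed (use evF_functor[OF x j] in \<open>simp_all add: AL.alg_over_axioms A.alg_over_axioms\<close>)
 show ?thesis
 proof (rule t.algebra_morphismI)
  fix zs assume zs: "zs \<in> powO (Car AlgL) 1"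
  have z: "zs \<in> powO LC 1" using zs by simp
  show "Comp (X x) (NC (CohI (P0 F x)) (map (AO (ev x j)) zs)) (rho (ev x j) (unit_word T) zs) =
    AA (ev x j) (NC (CohI AlgL) zs)"
   using A.Car.in_hom_ide_right[OF A.CohI_hom[OF Obs[OF z x j]]] strict_over_CohI x j z
    in_homD(1)[OF AL.CohI_hom[OF zs]] by (simp add: ev_rho[OF x j unit_words] map_evF strict_over_def relN_def)
 next
  fix w ws zs assume w: "w \<in> words T (length ws)" and ws: "set ws \<subseteq> all_words T"
   and zs: "zs \<in> powO (Car AlgL) (sum_list (ars T ws))"
  let ?ns = "ars T ws"
  have z: "zs \<in> powO LC (sum_list ?ns)" using zs by simp
  note o1 = Obs[OF z x j] and c = strict_over_CohC[OF w ws]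
  note p = AL.prod_Phi_Obj[OF ws zs] and q = A.prod_Phi_Obj[OF ws o1]
  interpret P: is_functor "pow_cat (X x) (length ws)" "X x" "Phi (P0 F x) w" by (rule A.Phi_functor[OF w])
  have "map2 (rho (ev x j)) ws (blocks ?ns zs) = map (Ide (X x)) (map2 (PhiO (P0 F x)) ws (blocks ?ns (Obs zs x j)))"
   using ev_rho[OF x j _ blocks_Obj[OF z]] nth_words[OF ws]
   by (intro nth_equalityI) (simp_all add: words_iff blocks_map)
  then have e: "PhiF (P0 F x) w (map2 (rho (ev x j)) ws (blocks ?ns zs)) =
    Ide (X x) (PhiO (P0 F x) w (map2 (PhiO (P0 F x)) ws (blocks ?ns (Obs zs x j))))" using P.FA_ide[OF q] by simp
  have o2: "Obs (map2 (\<lambda>w. FO (PhiL w)) ws (blocks ?ns zs)) x j = map2 (PhiO (P0 F x)) ws (blocks ?ns (Obs zs x j))"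
   using blocks_Obj[OF z] relF_PhiL_words[OF x j ws] by (intro nth_equalityI) (simp_all add: relF_def blocks_map)
  show "Comp (X x) (NC (CohC (P0 F x) w ws) (map (AO (ev x j)) zs)) (rho (ev x j) (gam T w ws) zs) =
   Comp (X x) (PhiF (P0 F x) w (map2 (rho (ev x j)) ws (blocks ?ns zs)))
    (Comp (X x) (rho (ev x j) w (map2 (PhiO AlgL) ws (blocks ?ns zs))) (AA (ev x j) (NC (CohC AlgL w ws) zs)))"
   unfolding e using A.CohC_hom[OF w ws o1] p z in_homD(1)[OF AL.CohC_hom[OF w ws zs]] c x j o2
   by (simp add: map_evF ev_rho[OF x j gam_words[OF w ws]] ev_rho[OF x j w] strict_over_def relN_def
    A.Car.in_hom_ide_left A.Car.in_hom_ide_right del: map_map)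
 next
  fix w fs zs and l :: nat assume w: "w \<in> words T (length fs)" and fs: "set fs \<subseteq> {..<l}" and zs: "zs \<in> powO (Car AlgL) l"
  have z: "zs \<in> powO LC l" using zs by simp
  note o1 = Obs[OF z x j] and c = strict_over_CohS[OF w fs] and r = reindex_Obj[OF z fs]
  have "Obs (map ((!) zs) fs) x j = map ((!) (Obs zs x j)) fs"
   by (rule nth_Obs) (use fs z in \<open>simp add: powO_iff\<close>)
  then show "Comp (X x) (NC (CohS (P0 F x) w l fs) (map (AO (ev x j)) zs)) (rho (ev x j) (subst_word T l fs w) zs) =
   Comp (X x) (rho (ev x j) w (map ((!) zs) fs)) (AA (ev x j) (NC (CohS AlgL w l fs) zs))"
   using A.CohS_hom[OF w fs o1] r z in_homD(1)[OF AL.CohS_hom[OF w fs zs]] c x j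
   by (simp add: map_evF ev_rho[OF x j subst_words[OF w fs]] ev_rho[OF x j w] strict_over_def relN_def
    A.Car.in_hom_ide_left A.Car.in_hom_ide_right del: map_map)
 qed (simp_all add: ev_def)
qed

definition ev_ar where "ev_ar x u = \<lparr>CDom = ev x (Dom (P0 J x) u), CCod = ev x (Cod (P0 J x) u),
  CNat = \<lparr>NDom = evF x (Dom (P0 J x) u), NCod = evF x (Cod (P0 J x) u), NC = (\<lambda>z\<in>Obj LC. ar z x u)\<rparr>\<rparr>"

definition ev_tr where
 "ev_tr f j = \<lparr>CDom = algmor_comp T (P1 F f) (ev (Src D f) j), CCod = ev (Trg D f) (O1 J f j),
  CNat = \<lparr>NDom = comp_func (AFun (P1 F f)) (evF (Src D f) j), NCod = evF (Trg D f) (O1 J f j),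
   NC = (\<lambda>z\<in>Obj LC. tr z f j)\<rparr>\<rparr>"

lemma ev_NC [simp]: "z \<in> Obj LC ==> cN (ev_ar x u) z = ar z x u" "z \<in> Obj LC ==> cN (ev_tr f j) z = tr z f j"
 by (simp_all add: ev_ar_def ev_tr_def)

lemma map_ev_NC: "zs \<in> powO LC n ==> map (cN (ev_ar x u)) zs = Ars zs x u"
 "zs \<in> powO LC n ==> map (cN (ev_tr f j)) zs = Trs zs f j" by (auto simp: powO_iff in_set_conv_nth)

text \<open>Naturality in the cone is the naturality condition of modifications, with the roles of
  the variables exchanged; the 2-cell condition is the formula for the arrow values of
  \<open>phiO\<close>.\<close>

lemma ev_ar_cell: assumes x: "x \<in> Cell0 D" and u: "hom0 J x u i j"
 shows "algcell T AlgL (P0 F x) (ev x i) (ev x j) (ev_ar x u)"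
proof -
 note ij = hom_obj[OF J.P0_cat[OF x] u]
 have e: "Dom (P0 J x) u = i" "Cod (P0 J x) u = j" using u by (auto simp: in_hom_def)
 interpret A: alg_over T "P0 F x" by (rule F_alg[OF x])
 show ?thesis
 proof (rule algcellI[OF ev_algmor[OF x ij(1)] ev_algmor[OF x ij(2)]])
  show "nat_trans (Car AlgL) (X x) (AFun (ev x i)) (AFun (ev x j)) (CNat (ev_ar x u))"
  proof (rule nat_transI)
   fix m z z' assume "chom AlgL m z z'"
   then have m: "in_hom LC m z z'" by simp
   show "Comp (X x) (cN (ev_ar x u) z') (AA (ev x i) m) = Comp (X x) (AA (ev x j) m) (cN (ev_ar x u) z)"
    using pmod.m_nat[OF LC_pmod[OF m] x u] LC.in_hom_obj[OF m] in_homD(1)[OF m] by simp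
  next
   fix z assume "z \<in> Obj (Car AlgL)"
   then show "in_hom (X x) (cN (ev_ar x u) z) (AO (ev x i) z) (AO (ev x j) z)"
    using pcone.ar_hom[OF LC_pcone x u, of z] by simp
  qed (use evF_functor[OF x ij(1)] evF_functor[OF x ij(2)] in \<open>simp_all add: e\<close>, simp_all add: ev_ar_def e)
  fix w n zs assume w: "w \<in> words T n" and "zs \<in> powO (Car AlgL) n"
  then have zs: "zs \<in> powO LC n" by simp
  note a = fun_hom[OF A.Phi_functor[OF w] Ars[OF zs x u]]
  show "Comp (X x) (rho (ev x j) w zs) (cN (ev_ar x u) (PhiO AlgL w zs)) =
    Comp (X x) (PhiF (P0 F x) w (map (cN (ev_ar x u)) zs)) (rho (ev x i) w zs)"
   using ev_rho[OF x ij(1) w zs] ev_rho[OF x ij(2) w zs] phiO(1,3)[OF w zs] x in_homD(1)[OF u]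
    A.Car.in_hom_ide_left[OF a] A.Car.in_hom_ide_right[OF a] by (simp add: PhiL_FO[OF w zs] map_ev_NC[OF zs])
 qed (simp_all add: ev_ar_def e)
qed

text \<open>Naturality in the cone is the compatibility condition of modifications. The 2-cell
  condition is the formula for the 2-cells of \<open>phiO\<close>: the coherence of
  \<open>P1 F f\<close> in that formula is the coherence of the composite of \<open>P1 F f\<close>
  with the strict morphism \<open>ev\<close>.\<close>

lemma ev_tr_cell: assumes f: "f \<in> Cell1 D" and j: "j \<in> O0 J (Src D f)"
 shows "algcell T AlgL (P0 F (Trg D f)) (algmor_comp T (P1 F f) (ev (Src D f) j)) (ev (Trg D f) (O1 J f j)) (ev_tr f j)"
proof -
 let ?x = "Src D f" and ?y = "Trg D f" and ?j = "O1 J f j"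
 note xy = D.cell1(1,2)[OF f]
 note j' = fun_obj[OF J.P1_func[OF f] j]
 note E = ev_algmor[OF xy(1) j]
 interpret m: algmor T "P0 F ?x" "P0 F ?y" "P1 F f" by (rule F_mor[OF f])
 interpret p: algmor_pair T AlgL "P0 F ?x" "P0 F ?y" "ev ?x j" "P1 F f" by (intro algmor_pair.intro E m.algmor_axioms)
 show ?thesis
 proof (rule algcellI[OF algmor_compI[OF E m.algmor_axioms] ev_algmor[OF xy(2) j']])
  show "nat_trans (Car AlgL) (X ?y) (AFun (algmor_comp T (P1 F f) (ev ?x j))) (AFun (ev ?y ?j)) (CNat (ev_tr f j))"
  proof (rule nat_transI)
   fix n z z' assume "chom AlgL n z z'"
   then have n: "in_hom LC n z z'" by simp
   show "Comp (X ?y) (cN (ev_tr f j) z') (AA (algmor_comp T (P1 F f) (ev ?x j)) n) =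
     Comp (X ?y) (AA (ev ?y ?j) n) (cN (ev_tr f j) z)"
    using pmod.m_compat[OF LC_pmod[OF n] f j] LC.in_hom_obj[OF n] in_homD(1)[OF n] by simp
  next
   fix z assume "z \<in> Obj (Car AlgL)"
   then show "in_hom (X ?y) (cN (ev_tr f j) z) (AO (algmor_comp T (P1 F f) (ev ?x j)) z) (AO (ev ?y ?j) z)"
    using pcone.tr_hom[OF LC_pcone f j, of z] by simp
  qed (use comp_functor[OF evF_functor[OF xy(1) j] m.AFun] evF_functor[OF xy(2) j'] in simp_all, simp_all add: ev_tr_def)
  fix w n zs assume w: "w \<in> words T n" and zs': "zs \<in> powO (Car AlgL) n"
  then have zs: "zs \<in> powO LC n" by simp
  interpret Px: is_functor "pow_cat (X ?x) n" "X ?x" "Phi (P0 F ?x) w" by (rule m.A.Phi_functor[OF w])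
  note o1 = Obs[OF zs xy(1) j] and t = fun_hom[OF m.B.Phi_functor[OF w] Trs[OF zs f j]]
  note r = m.rho_hom[OF w o1] and tr = m.B.Car.in_hom_comp[OF m.rho_hom[OF w o1] t]
  show "Comp (X ?y) (rho (ev ?y ?j) w zs) (cN (ev_tr f j) (PhiO AlgL w zs)) =
    Comp (X ?y) (PhiF (P0 F ?y) w (map (cN (ev_tr f j)) zs)) (rho (algmor_comp T (P1 F f) (ev ?x j)) w zs)"
   unfolding p.comp_rho[OF w zs']
   using phiO(1,4)[OF w zs] f j m.B.Car.in_hom_ide_left[OF tr] m.B.Car.in_hom_ide_right[OF r]
   by (simp add: PhiL_FO[OF w zs] map_ev_NC[OF zs] map_evF(1)[OF zs] ev_rho[OF xy(1) j w zs] ev_rho[OF xy(2) j' w zs]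
    m.AFun.FA_ide[OF Px.FO_obj[OF o1]] del: map_map)
 qed (simp_all add: ev_tr_def)
qed

end

section \<open>Cones whose vertex is an arbitrary small algebra \<open>A\<close>\<close>

context limit_setting
begin

abbreviation "R A \<equiv> rep_psfun PA A F"

lemma algcell_NC_hom: "algcell T A B G M al ==> p \<in> Obj (Car A) ==> chom B (cN al p) (AO G p) (AO M p)"
 by (rule nat_hom[OF algcell_nat])

lemma F_simps: "f \<in> Cell1 D ==> ADom (P1 F f) = P0 F (Src D f)" "f \<in> Cell1 D ==> ACod (P1 F f) = P0 F (Trg D f)"
 using Fp.P1_src[of f] Fp.P1_trg[of f] by simp_all

context fixes A :: "('u, 'u, 't) psalg" assumes A: "small_algebra T A"
begin

lemma algmor_cells: assumes "algmor T A B M" "small_algebra T B" shows "M \<in> Cell1 PA" "ADom M = A" "ACod M = B"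
 using assms A hom_PsAlg(1)[OF A assms(2), of M] by (simp_all add: hom_cat_def)

lemma rep_in_hom: "x \<in> Cell0 D ==> hom0 (R A) x al G M \<longleftrightarrow> algcell T A (P0 F x) G M al"
 using hom_PsAlg(2)[OF A F_small] by (simp only: S.C.rep_psfun_simps)

lemma rep_Obj: "x \<in> Cell0 D ==> M \<in> O0 (R A) x \<longleftrightarrow> algmor T A (P0 F x) M"
 using hom_PsAlg(1)[OF A F_small] by (simp only: S.C.rep_psfun_simps)

lemma rep_P1: assumes "f \<in> Cell1 D" "algmor T A (P0 F (Src D f)) M"
 shows "O1 (R A) f M = algmor_comp T (P1 F f) M"
 using algmor_cells[OF assms(2) F_small[OF D.cell1(1)[OF assms(1)]]] F_simps[OF assms(1)] assms(2)
 by (simp del: PsAlg_simps(2))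

lemma rep_P1_NC:
 assumes f: "f \<in> Cell1 D" and a: "algcell T A (P0 F (Src D f)) G M al" and p: "p \<in> Obj (Car A)"
 shows "cN (A1 (R A) f al) p = AA (P1 F f) (cN al p)"
proof -
 have "A1 (R A) f al = cell_hcomp T (cell_id (P1 F f)) al"
  using Cell2I[OF a A F_small[OF D.cell1(1)[OF f]]] algcell_boundary[OF a] F_simps[OF f] by (simp del: PsAlg_simps(3))
 then show ?thesis using cell_hcomp_left_NC[OF a F_mor[OF f] p] by simp
qed

lemma post_nat_NC:
 assumes t: "algcell T B C G G' th" and B: "small_algebra T B" and M: "algmor T A B M" and p: "p \<in> Obj (Car A)"
 shows "cN (NC (post_nat PA A th) M) p = cN th (AO M p)"
proof -
 have "NC (post_nat PA A th) M = cell_hcomp T th (cell_id M)"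
  using algmor_cells[OF M B] algcell_boundary[OF t] by (simp del: PsAlg_simps(2))
 then show ?thesis using cell_hcomp_right_NC[OF M t p] by simp
qed

lemma rep_Comp_NC: assumes "algcell T A (P0 F x) G M al" "p \<in> Obj (Car A)"
 shows "cN (cmp0 (R A) x be al) p = Comp (X x) (cN be p) (cN al p)" using cell_vcomp_NC[OF assms] by simp

lemma rep_eq_iff: assumes "x \<in> Cell0 D" "hom0 (R A) x al G M" "hom0 (R A) x be G M"
 shows "al = be \<longleftrightarrow> (\<forall>p\<in>Obj (Car A). cN al p = cN be p)"
 using algcell_eqI assms rep_in_hom by blast

text \<open>Pseudo natural transformations into \<open>C(A, F-)\<close> are families of cones indexed by the objects of \<open>A\<close>.\<close>

lemma pcone_rep_iff: assumes o: "\<And>x j. x \<in> Cell0 D ==> j \<in> O0 J x ==> algmor T A (P0 F x) (o' x j)"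
  and a: "\<And>x u i j. x \<in> Cell0 D ==> hom0 J x u i j ==> algcell T A (P0 F x) (o' x i) (o' x j) (a' x u)"
  and t: "\<And>f j. f \<in> Cell1 D ==> j \<in> O0 J (Src D f) ==> algcell T A (P0 F (Trg D f))
   (algmor_comp T (P1 F f) (o' (Src D f) j)) (o' (Trg D f) (O1 J f j)) (t' f j)"
 shows "pcone D J (R A) o' a' t' \<longleftrightarrow> (\<forall>p\<in>Obj (Car A).
  pcone D J U (\<lambda>x j. AO (o' x j) p) (\<lambda>x u. cN (a' x u) p) (\<lambda>f j. cN (t' f j) p))"
  (is "?L \<longleftrightarrow> (\<forall>p\<in>?A. pcone D J U (?o p) (?a p) (?t p))")
proof -
 have oR: "o' x j \<in> O0 (R A) x" if "x \<in> Cell0 D" "j \<in> O0 J x" for x j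
  using o[OF that] rep_Obj[OF that(1)] by blast
 have aR: "hom0 (R A) x (a' x u) (o' x i) (o' x j)" if "x \<in> Cell0 D" "hom0 J x u i j" for x u i j
  using a[OF that] rep_in_hom[OF that(1)] by blast
 have tR: "hom0 (R A) (Trg D f) (t' f j) (O1 (R A) f (o' (Src D f) j)) (o' (Trg D f) (O1 J f j))"
  if "f \<in> Cell1 D" "j \<in> O0 J (Src D f)" for f j
  using t[OF that] rep_in_hom[OF D.cell1(2)[OF that(1)]] rep_P1[OF that(1) o[OF D.cell1(1)[OF that(1)] that(2)]] by simp
 \<comment> \<open>Both sides of each cone condition are algebra 2-cells with the same boundary, so
   the condition is equivalent to its components at the objects of \<open>A\<close>;
   \<open>E1\<close> to \<open>E6\<close> record this for the six equations.\<close>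
 have E1: "a' x (Ide (P0 J x) j) = Ide (P0 (R A) x) (o' x j) \<longleftrightarrow>
   (\<forall>p\<in>?A. ?a p x (Ide (P0 J x) j) = Ide (X x) (?o p x j))" if x: "x \<in> Cell0 D" and j: "j \<in> O0 J x" for x j
  unfolding rep_eq_iff[OF x aR[OF x category.in_hom_ide[OF J.P0_cat[OF x] j]] category.in_hom_ide[OF S.R.K.P0_cat[OF x] oR[OF x j]]]
  using cell_id_NC[OF o[OF x j]] by (simp del: cell_simps)
 have E2: "a' x (cmp0 J x v u) = cmp0 (R A) x (a' x v) (a' x u) \<longleftrightarrow>
   (\<forall>p\<in>?A. ?a p x (cmp0 J x v u) = Comp (X x) (?a p x v) (?a p x u))"
  if x: "x \<in> Cell0 D" and u: "hom0 J x u i j" and v: "hom0 J x v j k" for x u v i j k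
  unfolding rep_eq_iff[OF x aR[OF x category.in_hom_comp[OF J.P0_cat[OF x] u v]]
    category.in_hom_comp[OF S.R.K.P0_cat[OF x] aR[OF x u] aR[OF x v]]]
  by (simp only: rep_Comp_NC[OF a[OF x u]] cong: ball_cong)
 have E3: "cmp0 (R A) (Trg D f) (t' f j) (A1 (R A) f (a' (Src D f) u)) =
   cmp0 (R A) (Trg D f) (a' (Trg D f) (A1 J f u)) (t' f i) \<longleftrightarrow>
   (\<forall>p\<in>?A. Comp (X (Trg D f)) (?t p f j) (AA (P1 F f) (?a p (Src D f) u)) =
    Comp (X (Trg D f)) (?a p (Trg D f) (A1 J f u)) (?t p f i))"
  if f: "f \<in> Cell1 D" and u: "hom0 J (Src D f) u i j" for f u i j
 proof -
  note xy = D.cell1(1,2)[OF f]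
  note ij = hom_obj[OF J.P0_cat[OF xy(1)] u]
  note h = fun_hom[OF S.R.K.P1_func[OF f] aR[OF xy(1) u]]
  note u' = fun_hom[OF J.P1_func[OF f] u]
  note c = S.R.K.P0_cat[OF xy(2)]
  show ?thesis unfolding rep_eq_iff[OF xy(2) category.in_hom_comp[OF c h tR[OF f ij(2)]]
     category.in_hom_comp[OF c tR[OF f ij(1)] aR[OF xy(2) u']]]
   by (simp only: rep_Comp_NC[OF t[OF f ij(1)]] rep_Comp_NC[OF h[unfolded rep_in_hom[OF xy(2)]]]
    rep_P1_NC[OF f a[OF xy(1) u]] cong: ball_cong)
 qed
 have E4: "cmp0 (R A) (Trg D (Dom2 D si)) (t' (Cod2 D si) j) (NC (P2 (R A) si) (o' (Src D (Dom2 D si)) j)) =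
   cmp0 (R A) (Trg D (Dom2 D si)) (a' (Trg D (Dom2 D si)) (NC (P2 J si) j)) (t' (Dom2 D si) j) \<longleftrightarrow>
   (\<forall>p\<in>?A. Comp (X (Trg D (Dom2 D si))) (?t p (Cod2 D si) j) (cN (P2 F si) (?o p (Src D (Dom2 D si)) j)) =
    Comp (X (Trg D (Dom2 D si))) (?a p (Trg D (Dom2 D si)) (NC (P2 J si) j)) (?t p (Dom2 D si) j))"
  if s: "si \<in> Cell2 D" and j: "j \<in> O0 J (Src D (Dom2 D si))" for si j
 proof -
  note f = D.cell2(1,2)[OF s]
  note xy = D.cell1(1,2)[OF f(1)]
  note h = nat_hom[OF S.R.K.P2_nat[OF s] oR[OF xy(1) j]]
  note v = nat_hom[OF J.P2_nat[OF s] j]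
  note t1 = tR[OF f(2), unfolded D.Src2[OF s] D.Trg_globular[OF s, symmetric], OF j]
  note c = S.R.K.P0_cat[OF xy(2)]
  show ?thesis unfolding rep_eq_iff[OF xy(2) category.in_hom_comp[OF c h t1]
     category.in_hom_comp[OF c tR[OF f(1) j] aR[OF xy(2) v]]]
   by (simp only: rep_Comp_NC[OF t[OF f(1) j]] rep_Comp_NC[OF h[unfolded rep_in_hom[OF xy(2)]]]
    S.C.rep_psfun_simps post_nat_NC[OF F_cell[OF s] F_small[OF xy(1)] o[OF xy(1) j]]
    rep_Comp_NC[unfolded S.C.rep_psfun_simps, OF h[unfolded rep_in_hom[OF xy(2)], unfolded S.C.rep_psfun_simps]]
    rep_Comp_NC[unfolded S.C.rep_psfun_simps, OF t[OF f(1) j]] cong: ball_cong)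
 qed
 have E5: "cmp0 (R A) (Trg D g) (t' (Comp1 D g f) j) (NC (PComp (R A) g f) (o' (Src D f) j)) =
   cmp0 (R A) (Trg D g) (a' (Trg D g) (NC (PComp J g f) j))
    (cmp0 (R A) (Trg D g) (t' g (O1 J f j)) (A1 (R A) g (t' f j))) \<longleftrightarrow>
   (\<forall>p\<in>?A. Comp (X (Trg D g)) (?t p (Comp1 D g f) j) (cN (PComp F g f) (?o p (Src D f) j)) =
    Comp (X (Trg D g)) (?a p (Trg D g) (NC (PComp J g f) j))
     (Comp (X (Trg D g)) (?t p g (O1 J f j)) (AA (P1 F g) (?t p f j))))"
  if f: "f \<in> Cell1 D" and g: "g \<in> Cell1 D" "Src D g = Trg D f" and j: "j \<in> O0 J (Src D f)" for f g j
 proof -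
  note xy = D.cell1(1,2)[OF f] and z = D.cell1(2)[OF g(1)] and gf = D.cell1(6,7,8)[OF f g]
  note j' = fun_obj[OF J.P1_func[OF f] j]
  interpret Kf: is_functor "P0 (R A) (Src D f)" "P0 (R A) (Trg D f)" "P1 (R A) f" by (rule S.R.K.P1_func[OF f])
  interpret Jf: is_functor "P0 J (Src D f)" "P0 J (Trg D f)" "P1 J f" by (rule J.P1_func[OF f])
  have e: "FO (comp_func (P1 (R A) g) (P1 (R A) f)) (o' (Src D f) j) = O1 (R A) g (O1 (R A) f (o' (Src D f) j))"
   "FO (comp_func (P1 J g) (P1 J f)) j = O1 J g (O1 J f j)"
   by (rule comp_func_simps; simp only: Kf.FDom Jf.FDom oR[OF xy(1) j] j)+
  note h = nat_hom[OF S.R.K.PComp_nat[OF f g] oR[OF xy(1) j], unfolded e]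
  note v = nat_hom[OF J.PComp_nat[OF f g] j, unfolded e]
  note t1 = tR[OF gf(1), unfolded gf(2,3), OF j] and t2 = tR[OF g(1), unfolded g(2), OF j']
  note k = fun_hom[OF S.R.K.P1_func[OF g(1), unfolded g(2)] tR[OF f j]]
  note c = S.R.K.P0_cat[OF z]
  note m = category.in_hom_comp[OF c k t2]
  have k1: "cN (A1 (R A) g (t' f j)) p = AA (P1 F g) (?t p f j)" if "p \<in> ?A" for p
   using rep_P1_NC[OF g(1), unfolded g(2), OF t[OF f j] that] .
  have h1: "cN (NC (PComp (R A) g f) (o' (Src D f) j)) p = cN (PComp F g f) (?o p (Src D f) j)" if "p \<in> ?A" for p
   using post_nat_NC[OF F_comp_cell[OF f g] F_small[OF xy(1)] o[OF xy(1) j] that] by (simp only: S.C.rep_psfun_simps)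
  show ?thesis unfolding rep_eq_iff[OF z category.in_hom_comp[OF c h t1] category.in_hom_comp[OF c m aR[OF z v]]]
   by (simp only: rep_Comp_NC[OF h[unfolded rep_in_hom[OF z]]] rep_Comp_NC[OF m[unfolded rep_in_hom[OF z]]]
    rep_Comp_NC[OF k[unfolded rep_in_hom[OF z]]] k1 h1 cong: ball_cong)
 qed
 have E6: "cmp0 (R A) x (t' (Ide1 D x) j) (NC (PUnit (R A) x) (o' x j)) = a' x (NC (PUnit J x) j) \<longleftrightarrow>
   (\<forall>p\<in>?A. Comp (X x) (?t p (Ide1 D x) j) (cN (PUnit F x) (?o p x j)) = ?a p x (NC (PUnit J x) j))"
  if x: "x \<in> Cell0 D" and j: "j \<in> O0 J x" for x j
 proof -
  note e = D.cell1(3,4,5)[OF x] and c = S.R.K.P0_cat[OF x]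
  note h = nat_hom[OF S.R.K.PUnit_nat[OF x] oR[OF x j], unfolded id_func_simps(3)[OF oR[OF x j]]]
  note v = nat_hom[OF J.PUnit_nat[OF x] j, unfolded id_func_simps(3)[OF j]]
  note t1 = tR[OF e(1), unfolded e(2,3), OF j]
  have h1: "cN (NC (PUnit (R A) x) (o' x j)) p = cN (PUnit F x) (?o p x j)" if "p \<in> ?A" for p
   using post_nat_NC[OF F_unit_cell[OF x] F_small[OF x] o[OF x j] that] by (simp only: S.C.rep_psfun_simps)
  show ?thesis unfolding rep_eq_iff[OF x category.in_hom_comp[OF c h t1] aR[OF x v]]
   by (simp only: rep_Comp_NC[OF h[unfolded rep_in_hom[OF x]]] h1 cong: ball_cong)
 qed
 \<comment> \<open>Invertibility of an algebra 2-cell is pointwise too, by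
   \<open>algcell_isoI\<close> and its converse \<open>algcell_iso_NC\<close>.\<close>
 have E7: "iso_arr (P0 (R A) (Trg D f)) (t' f j) \<longleftrightarrow> (\<forall>p\<in>?A. iso_arr (X (Trg D f)) (?t p f j))"
  if f: "f \<in> Cell1 D" and j: "j \<in> O0 J (Src D f)" for f j
  using algcell_isoI[OF A F_small t] algcell_iso_NC[OF A F_small t] D.cell1(2)[OF f] f j
  by (simp only: S.C.rep_psfun_simps) blast
 show ?thesis
 proof
  assume ?L
  then interpret c: pcone D J "R A" o' a' t' .
  show "\<forall>p\<in>?A. pcone D J U (?o p) (?a p) (?t p)"
  proof
   fix p assume p: "p \<in> ?A"
   have th: "in_hom (X (Trg D f)) (?t p f j) (AO (P1 F f) (?o p (Src D f) j)) (?o p (Trg D f) (O1 J f j))"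
    if "f \<in> Cell1 D" "j \<in> O0 J (Src D f)" for f j
    using algcell_NC_hom[OF t[OF that] p] algmor_comp_AFun(1)[OF o[OF D.cell1(1)[OF that(1)] that(2)] p] by simp
   show "pcone D J U (?o p) (?a p) (?t p)"
   proof (rule pcone.intro; unfold forget_simps)
    show "?o p x j \<in> Obj (X x)" if "x \<in> Cell0 D" "j \<in> O0 J x" for x j
     using fun_obj[OF algmor_AFun[OF o[OF that]] p] .
    show "in_hom (X x) (?a p x u) (?o p x i) (?o p x j)" if "x \<in> Cell0 D" "hom0 J x u i j" for x u i j
     using algcell_NC_hom[OF a[OF that] p] .
   qed (rule th bspec[OF E1[THEN iffD1, OF _ _ c.ar_ide] p] bspec[OF E2[THEN iffD1, OF _ _ _ c.ar_comp] p]
     bspec[OF E3[THEN iffD1, OF _ _ c.tr_nat] p] bspec[OF E4[THEN iffD1, OF _ _ c.tr_cell] p]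
     bspec[OF E5[THEN iffD1, OF _ _ _ _ c.tr_comp] p] bspec[OF E6[THEN iffD1, OF _ _ c.tr_unit] p]
     bspec[OF E7[THEN iffD1, OF _ _ c.tr_iso] p]; assumption)+
  qed
 next
  assume R: "\<forall>p\<in>?A. pcone D J U (?o p) (?a p) (?t p)"
  note R' = R[THEN bspec]
  show ?L
  proof
  qed (rule oR aR tR E1[THEN iffD2, OF _ _ ballI[OF pcone.ar_ide[OF R', unfolded forget_simps]]]
    E2[THEN iffD2, OF _ _ _ ballI[OF pcone.ar_comp[OF R', unfolded forget_simps]]]
    E3[THEN iffD2, OF _ _ ballI[OF pcone.tr_nat[OF R', unfolded forget_simps]]]
    E4[THEN iffD2, OF _ _ ballI[OF pcone.tr_cell[OF R', unfolded forget_simps]]]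
    E5[THEN iffD2, OF _ _ _ _ ballI[OF pcone.tr_comp[OF R', unfolded forget_simps]]]
    E6[THEN iffD2, OF _ _ ballI[OF pcone.tr_unit[OF R', unfolded forget_simps]]]
    E7[THEN iffD2, OF _ _ ballI[OF pcone.tr_iso[OF R', unfolded forget_simps]]]; assumption)+
 qed
qed

text \<open>Vertical composition and whiskering in the hom categories are computed pointwise, so
  every condition on a modification can be evaluated at \<open>p\<close>.\<close>

lemma pmod_rep: assumes "pmod D J (R A) o1 a1 t1 o2 a2 t2 m" and p: "p \<in> Obj (Car A)"
  and c1: "pcone D J (R A) o1 a1 t1" and c2: "pcone D J (R A) o2 a2 t2"
 shows "pmod D J U (\<lambda>x j. AO (o1 x j) p) (\<lambda>x u. cN (a1 x u) p) (\<lambda>f j. cN (t1 f j) p)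
  (\<lambda>x j. AO (o2 x j) p) (\<lambda>x u. cN (a2 x u) p) (\<lambda>f j. cN (t2 f j) p) (\<lambda>x j. cN (m x j) p)"
proof -
 interpret m: pmod D J "R A" o1 a1 t1 o2 a2 t2 m by fact
 interpret c1: pcone D J "R A" o1 a1 t1 by fact
 interpret c2: pcone D J "R A" o2 a2 t2 by fact
 show ?thesis
 proof (rule pmod.intro; unfold forget_simps)
  fix x assume x: "x \<in> Cell0 D"
  show "in_hom (X x) (cN (m x j) p) (AO (o1 x j) p) (AO (o2 x j) p)" if "j \<in> O0 J x" for j
   using algcell_NC_hom[OF m.m_hom[OF x that, unfolded rep_in_hom[OF x]] p] .
  show "Comp (X x) (cN (m x j) p) (cN (a1 x u) p) = Comp (X x) (cN (a2 x u) p) (cN (m x i) p)"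
   if u: "hom0 J x u i j" for u i j
   using arg_cong[OF m.m_nat[OF x u], of "\<lambda>al. cN al p"] hom_obj(1)[OF J.P0_cat[OF x] u]
   by (simp only: rep_Comp_NC[OF c1.ar_hom[OF x u, unfolded rep_in_hom[OF x]] p]
    rep_Comp_NC[OF m.m_hom[OF x, unfolded rep_in_hom[OF x]] p])
 next
  fix f j assume f: "f \<in> Cell1 D" and j: "j \<in> O0 J (Src D f)"
  note xy = D.cell1(1,2)[OF f]
  note h = m.m_hom[OF xy(1) j]
  note k = fun_hom[OF S.R.K.P1_func[OF f] h, unfolded rep_in_hom[OF xy(2)]]
  show "Comp (X (Trg D f)) (cN (t2 f j) p) (AA (P1 F f) (cN (m (Src D f) j) p)) =
    Comp (X (Trg D f)) (cN (m (Trg D f) (O1 J f j)) p) (cN (t1 f j) p)"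
   using arg_cong[OF m.m_compat[OF f j], of "\<lambda>al. cN al p"]
   by (simp only: rep_Comp_NC[OF k p] rep_Comp_NC[OF c1.tr_hom[OF f j, unfolded rep_in_hom[OF xy(2)]] p]
    rep_P1_NC[OF f h[unfolded rep_in_hom[OF xy(1)]] p])
 qed
qed

end

text \<open>By \<open>pcone_rep_iff\<close> it suffices to look at one object \<open>z\<close> of
  \<open>LC\<close>, where the evaluations return the values of the cone \<open>z\<close>
  itself.\<close>

lemma ev_pcone: "pcone D J (R AlgL) ev ev_ar ev_tr"
 by (subst pcone_rep_iff[OF AlgL_small ev_algmor ev_ar_cell ev_tr_cell]) (simp_all add: LC_pcone)

definition "et = mk_pnat D J (R AlgL) ev ev_ar ev_tr"

lemma et: "pseudo_nat D J (R AlgL) et" unfolding et_def by (rule S.R.mk_pnat_pseudo_nat[OF ev_pcone])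

lemma et_simps: "x \<in> Cell0 D ==> j \<in> O0 J x ==> pob et x j = ev x j"
 "x \<in> Cell0 D ==> u \<in> A0 J x ==> par et x u = ev_ar x u"
 "f \<in> Cell1 D ==> j \<in> O0 J (Src D f) ==> ptr et f j = ev_tr f j"
 unfolding et_def using S.R.mk_pnat_simps by simp_all

end

lemma algmor_rho_iso: assumes "algmor T A B M" "w \<in> words T n" "xs \<in> powO (Car A) n"
 shows "iso_arr (Car B) (rho M w xs)"
proof -
 interpret algmor T A B M by fact
 show ?thesis by (rule rho_iso[OF assms(2,3)])
qed

section \<open>The morphism into the algebra of cones that is induced by a cone with vertex
  \<open>A\<close>\<close>

context limit_setting
begin

context fixes A :: "('u, 'u, 't) psalg" and o' a' t'
 assumes A: "small_algebra T A" and cone: "pcone D J (R A) o' a' t'"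
begin

lemma cone_typed: shows "x \<in> Cell0 D ==> j \<in> O0 J x ==> algmor T A (P0 F x) (o' x j)"
  "x \<in> Cell0 D ==> hom0 J x u i j ==> algcell T A (P0 F x) (o' x i) (o' x j) (a' x u)"
  "f \<in> Cell1 D ==> j \<in> O0 J (Src D f) ==> algcell T A (P0 F (Trg D f))
   (algmor_comp T (P1 F f) (o' (Src D f) j)) (o' (Trg D f) (O1 J f j)) (t' f j)"
proof -
 interpret c: pcone D J "R A" o' a' t' by (rule cone)
 show o: "algmor T A (P0 F x) (o' x j)" if "x \<in> Cell0 D" "j \<in> O0 J x" for x j
  using c.ob_obj[OF that] rep_Obj[OF A that(1)] by blast
 show "algcell T A (P0 F x) (o' x i) (o' x j) (a' x u)" if "x \<in> Cell0 D" "hom0 J x u i j"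
  using c.ar_hom[OF that] rep_in_hom[OF A that(1)] by blast
 show "algcell T A (P0 F (Trg D f)) (algmor_comp T (P1 F f) (o' (Src D f) j)) (o' (Trg D f) (O1 J f j)) (t' f j)"
  if "f \<in> Cell1 D" "j \<in> O0 J (Src D f)"
  using c.tr_hom[OF that] rep_in_hom[OF A D.cell1(2)[OF that(1)]] rep_P1[OF A that(1) o[OF D.cell1(1)[OF that(1)] that(2)]] by simp
qed

lemmas om = cone_typed(1) and ac = cone_typed(2) and tc = cone_typed(3)

text \<open>The member at \<open>p\<close> of the family of cones that corresponds, by
  \<open>pcone_rep_iff\<close>, to the given cone with vertex \<open>A\<close>.\<close>

definition "fO p = mkO (\<lambda>x j. AO (o' x j) p) (\<lambda>x u. cN (a' x u) p) (\<lambda>f j. cN (t' f j) p)"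

lemma fO: assumes "p \<in> Obj (Car A)"
 shows "fO p \<in> Obj LC" "x \<in> Cell0 D ==> j \<in> O0 J x ==> ob (fO p) x j = AO (o' x j) p"
  "x \<in> Cell0 D ==> u \<in> A0 J x ==> ar (fO p) x u = cN (a' x u) p"
  "f \<in> Cell1 D ==> j \<in> O0 J (Src D f) ==> tr (fO p) f j = cN (t' f j) p" unfolding fO_def
 using mkO[OF pcone_rep_iff[OF A cone_typed, THEN iffD1, OF _ _ _ _ _ _ cone, THEN bspec, OF _ _ _ _ _ _ assms]]
 by simp_all

interpretation A: alg_over T A by (rule small_algebra_over[OF A])

definition "fA q = mkA (fO (Dom (Car A) q)) (fO (Cod (Car A) q)) (\<lambda>x j. AA (o' x j) q)"

text \<open>The conditions on a modification are the naturality squares at \<open>q\<close> of the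
  2-cells \<open>a' x u\<close> and \<open>t' f j\<close>.\<close>

lemma fA: assumes q: "chom A q p p'"
 shows "in_hom LC (fA q) (fO p) (fO p')" "x \<in> Cell0 D ==> j \<in> O0 J x ==> mc (fA q) x j = AA (o' x j) q"
proof -
 note p = A.Car.in_hom_obj[OF q]
 have "pmod D J U (ob (fO p)) (ar (fO p)) (tr (fO p)) (ob (fO p')) (ar (fO p')) (tr (fO p')) (\<lambda>x j. AA (o' x j) q)"
 proof (rule pmod.intro; unfold forget_simps)
  fix x assume x: "x \<in> Cell0 D"
  show "in_hom (X x) (AA (o' x j) q) (ob (fO p) x j) (ob (fO p') x j)" if "j \<in> O0 J x" for j
   unfolding fO(2)[OF p(1) x that] fO(2)[OF p(2) x that] by (rule fun_hom[OF algmor_AFun[OF om[OF x that]] q])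
  show "Comp (X x) (AA (o' x j) q) (ar (fO p) x u) = Comp (X x) (ar (fO p') x u) (AA (o' x i) q)"
   if u: "hom0 J x u i j" for u i j unfolding fO(3)[OF p(1) x in_homD(1)[OF u]] fO(3)[OF p(2) x in_homD(1)[OF u]]
   by (rule nat_trans.naturality_hom[OF algcell_nat[OF ac[OF x u]] q, symmetric])
 next
  fix f j assume f: "f \<in> Cell1 D" and j: "j \<in> O0 J (Src D f)"
  show "Comp (X (Trg D f)) (tr (fO p') f j) (AA (P1 F f) (AA (o' (Src D f) j) q)) =
    Comp (X (Trg D f)) (AA (o' (Trg D f) (O1 J f j)) q) (tr (fO p) f j)"
   unfolding fO(4)[OF p(1) f j] fO(4)[OF p(2) f j] algmor_comp_AFun(2)[OF om[OF D.cell1(1)[OF f] j] in_homD(1)[OF q], symmetric]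
   by (rule nat_trans.naturality_hom[OF algcell_nat[OF tc[OF f j]] q])
 qed
 note k = mkA[OF fO(1)[OF p(1)] fO(1)[OF p(2)] this]
 have "Dom (Car A) q = p" "Cod (Car A) q = p'" using q by (simp_all add: in_hom_def)
 then show "in_hom LC (fA q) (fO p) (fO p')" "x \<in> Cell0 D ==> j \<in> O0 J x ==> mc (fA q) x j = AA (o' x j) q"
  using k by (simp_all add: fA_def)
qed

lemma fO_list: assumes ps: "ps \<in> powO (Car A) n" shows "map fO ps \<in> powO LC n"
  "x \<in> Cell0 D ==> j \<in> O0 J x ==> Obs (map fO ps) x j = map (AO (o' x j)) ps"
  "x \<in> Cell0 D ==> u \<in> A0 J x ==> Ars (map fO ps) x u = map (cN (a' x u)) ps"
  "f \<in> Cell1 D ==> j \<in> O0 J (Src D f) ==> Trs (map fO ps) f j = map (cN (t' f j)) ps"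
 using ps fO by (auto simp: powO_iff in_set_conv_nth)

definition "fr w ps = mkA (fO (PhiO A w ps)) (phiO w (map fO ps)) (\<lambda>x j. rho (o' x j) w ps)"

text \<open>The coherences of all \<open>o' x j\<close> at \<open>ps\<close> form one modification:
  its naturality is the 2-cell condition of \<open>a' x u\<close>, its compatibility is that of
  \<open>t' f j\<close>, where \<open>comp_rho\<close> supplies the coherence of
  \<open>P1 F f\<close> contained in \<open>phiO\<close>.\<close>

lemma fr: assumes w: "w \<in> words T n" and ps: "ps \<in> powO (Car A) n"
 shows "in_hom LC (fr w ps) (fO (PhiO A w ps)) (phiO w (map fO ps))"
  "x \<in> Cell0 D ==> j \<in> O0 J x ==> mc (fr w ps) x j = rho (o' x j) w ps"
proof -
 note p = fun_obj[OF A.Phi_functor[OF w] ps]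
 note l = fO_list[OF ps]
 note h = phiO[OF w l(1)]
 have "pmod D J U (ob (fO (PhiO A w ps))) (ar (fO (PhiO A w ps))) (tr (fO (PhiO A w ps)))
  (ob (phiO w (map fO ps))) (ar (phiO w (map fO ps))) (tr (phiO w (map fO ps))) (\<lambda>x j. rho (o' x j) w ps)"
 proof (rule pmod.intro; unfold forget_simps)
  fix x assume x: "x \<in> Cell0 D"
  show "in_hom (X x) (rho (o' x j) w ps) (ob (fO (PhiO A w ps)) x j) (ob (phiO w (map fO ps)) x j)"
   if j: "j \<in> O0 J x" for j
  proof -
   interpret m: algmor T A "P0 F x" "o' x j" by (rule om[OF x j])
   show ?thesis unfolding fO(2)[OF p x j] h(2)[OF x j] l(2)[OF x j] by (rule m.rho_hom[OF w ps])
  qed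
  show "Comp (X x) (rho (o' x j) w ps) (ar (fO (PhiO A w ps)) x u) =
    Comp (X x) (ar (phiO w (map fO ps)) x u) (rho (o' x i) w ps)" if u: "hom0 J x u i j" for u i j
   unfolding fO(3)[OF p x in_homD(1)[OF u]] h(3)[OF x in_homD(1)[OF u]] l(3)[OF x in_homD(1)[OF u]]
   by (rule algcell.cell_rho[OF ac[OF x u] w ps])
 next
  fix f j assume f: "f \<in> Cell1 D" and j: "j \<in> O0 J (Src D f)"
  let ?x = "Src D f" and ?y = "Trg D f"
  note xy = D.cell1(1,2)[OF f]
  interpret c: algmor_pair T A "P0 F ?x" "P0 F ?y" "o' ?x j" "P1 F f"
   by (intro algmor_pair.intro om[OF xy(1) j] F_mor[OF f])
  interpret a: algcell T A "P0 F ?y" "algmor_comp T (P1 F f) (o' ?x j)" "o' ?y (O1 J f j)" "t' f j" by (rule tc[OF f j])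
  have t: "powH (X ?y) n (map (cN (t' f j)) ps)
    (map (AO (P1 F f)) (map (AO (o' ?x j)) ps)) (map (AO (o' ?y (O1 J f j))) ps)"
   using ps a.CNat.NC_in_hom algmor_comp_AFun(1)[OF om[OF xy(1) j]] by (simp add: powH_iff powO_iff)
  show "Comp (X ?y) (tr (phiO w (map fO ps)) f j) (AA (P1 F f) (rho (o' ?x j) w ps)) =
    Comp (X ?y) (rho (o' ?y (O1 J f j)) w ps) (tr (fO (PhiO A w ps)) f j)"
   unfolding fO(4)[OF p f j] h(4)[OF f j] l(4)[OF f j] l(2)[OF xy(1) j] a.cell_rho[OF w ps] c.comp_rho[OF w ps]
   by (rule c.H.B.Car.in_hom_assoc[OF c.H.AFun.FA_in_hom[OF c.G.rho_hom[OF w ps]] c.H.rho_hom[OF w pow_func_Obj[OF c.G.AFun ps]]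
      fun_hom[OF c.H.B.Phi_functor[OF w] t], symmetric])
 qed
 from mkA[OF fO(1)[OF p] h(1) this]
 show "in_hom LC (fr w ps) (fO (PhiO A w ps)) (phiO w (map fO ps))"
  "x \<in> Cell0 D ==> j \<in> O0 J x ==> mc (fr w ps) x j = rho (o' x j) w ps" by (simp_all add: fr_def)
qed

definition "fF = \<lparr>FDom = Car A, FCod = LC, FO = (\<lambda>p\<in>Obj (Car A). fO p), FA = (\<lambda>q\<in>Arr (Car A). fA q)\<rparr>"

definition "fM = \<lparr>ADom = A, ACod = AlgL, AFun = fF,
 ARho = (\<lambda>w\<in>all_words T. \<lparr>NDom = comp_func fF (Phi A w), NCod = comp_func (PhiL w) (pow_func (arity T w) fF),
  NC = (\<lambda>ps\<in>powO (Car A) (arity T w). fr w ps)\<rparr>)\<rparr>"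

lemma fM_simps [simp]:
 "p \<in> Obj (Car A) ==> FO fF p = fO p" "q \<in> Arr (Car A) ==> FA fF q = fA q" "AFun fM = fF" "ADom fM = A" "ACod fM = AlgL"
 by (simp_all add: fF_def fM_def)

lemma fM_rho: "w \<in> words T n ==> ps \<in> powO (Car A) n ==> rho fM w ps = fr w ps"
 using words_all arity_words by (simp add: fM_def)

lemma map_fF: "ps \<in> powO (Car A) n ==> map (FO fF) ps = map fO ps" by (auto simp: powO_iff in_set_conv_nth)

lemma fF_functor: "is_functor (Car A) LC fF"
proof (rule is_functorI)
 show "in_hom LC (FA fF q) (FO fF p) (FO fF p')" if "chom A q p p'" for q p p'
  using fA(1)[OF that] in_homD(1)[OF that] A.Car.in_hom_obj[OF that] by simp
 show "FA fF (Ide (Car A) p) = Ide LC (FO fF p)" if p: "p \<in> Obj (Car A)" for p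
 proof -
  note i = A.Car.in_hom_ide[OF p]
  have "fA (Ide (Car A) p) = Ide LC (fO p)" by (rule LC_arr_eqI[OF fA(1)[OF i] LC.in_hom_ide[OF fO(1)[OF p]]])
    (use p in \<open>simp add: fA(2)[OF i] mc_ide[OF fO(1)[OF p]] fO(2) is_functor.FA_ide[OF algmor_AFun[OF om]]\<close>)
  then show ?thesis using p A.Car.ide_arr by simp
 qed
 show "FA fF (cmp A r q) = Comp LC (FA fF r) (FA fF q)" if q: "chom A q p p'" and r: "chom A r p' p''"
  for q r p p' p''
 proof -
  note i = A.Car.in_hom_comp[OF q r]
  have "fA (cmp A r q) = Comp LC (fA r) (fA q)"
   by (rule LC_arr_eqI[OF fA(1)[OF i] LC.in_hom_comp[OF fA(1)[OF q] fA(1)[OF r]]])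
    (simp add: fA(2)[OF i] mc_comp[OF fA(1)[OF q] fA(1)[OF r]] fA(2)[OF q] fA(2)[OF r]
     is_functor.FA_comp_hom[OF algmor_AFun[OF om] q r])
  then show ?thesis using in_homD(1)[OF q] in_homD(1)[OF r] in_homD(1)[OF i] by simp
 qed
qed (use fO(1) A.Car.category_axioms LC.category_axioms in \<open>simp_all add: fF_def\<close>)

text \<open>All equations are between arrows of \<open>LC\<close>, hence may be evaluated at every
  \<open>x\<close> and \<open>j\<close>; there they are the naturality and coherence equations of
  the morphism \<open>o' x j\<close>.\<close>

lemma fM_algmor: "algmor T A AlgL fM"
proof -
 interpret t: algmor_typed T A AlgL fM
 proof (intro algmor_typed.intro algmor_typed_axioms.intro)
  show "alg_over T AlgL" by (rule small_algebra_over[OF AlgL_small])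
  show "is_functor (Car A) (Car AlgL) (AFun fM)" using fF_functor by simp
  fix w n assume w: "w \<in> words T n"
  interpret P: is_functor "pow_cat (Car A) n" "Car A" "Phi A w" by (rule A.Phi_functor[OF w])
  interpret PA: category "pow_cat (Car A) n" by (rule P.dom_cat)
  interpret Q: is_functor "pow_cat LC n" LC "PhiL w" by (rule PhiL_functor[OF w])
  note fd = fun_dom[OF fF_functor] and pf = pow_functor[OF fF_functor, of n]
  have h: "in_hom LC (rho fM w ps) (FO fF (PhiO A w ps)) (FO (PhiL w) (FO (pow_func n fF) ps))"
   if ps: "ps \<in> powO (Car A) n" for ps
   using fr(1)[OF w ps] fM_rho[OF w ps] P.FO_obj[OF ps] ps PhiL_FO[OF w fO_list(1)[OF ps]]
   by (simp add: fd map_fF[OF ps])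
  have "nat_iso (pow_cat (Car A) n) LC (comp_func fF (Phi A w)) (comp_func (PhiL w) (pow_func n fF)) (ARho fM w)"
  proof (intro nat_isoI nat_transI comp_functor[OF P.is_functor_axioms fF_functor] comp_functor[OF pf Q.is_functor_axioms])
   fix qs ps ps' assume qs: "powH (Car A) n qs ps ps'"
   note p = PA.in_hom_obj[OF qs]
   note k = fun_hom[OF fF_functor P.FA_in_hom[OF qs]] Q.FA_in_hom[OF fun_hom[OF pf qs]]
   have "Comp LC (rho fM w ps') (FA fF (PhiF A w qs)) = Comp LC (FA (PhiL w) (FA (pow_func n fF) qs)) (rho fM w ps)"
   proof (rule LC_arr_eqI[OF LC.in_hom_comp[OF k(1) h[OF p(2)]] LC.in_hom_comp[OF h[OF p(1)] k(2)]])
    fix x j assume x: "x \<in> Cell0 D" and j: "j \<in> O0 J x"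
    interpret m: algmor T A "P0 F x" "o' x j" by (rule om[OF x j])
    have "Mcs (FA (pow_func n fF) qs) x j = map (AA (o' x j)) qs"
    proof -
     have "FA (pow_func n fF) qs = map (FA fF) qs" using in_homD(1)[OF qs] by (simp add: fd)
     moreover have "mc (FA fF q) x j = AA (o' x j) q" if sq: "q \<in> set qs" for q
     proof -
      obtain r r' where q: "chom A q r r'" using sq qs by (auto simp: powH_iff in_set_conv_nth)
      show ?thesis using fA(2)[OF q x j] in_homD(1)[OF q] by simp
     qed
     ultimately show ?thesis by simp
    qed
    then have "mc (FA (PhiL w) (FA (pow_func n fF) qs)) x j = PhiF (P0 F x) w (map (AA (o' x j)) qs)"
     using relF_PhiL[OF x j w] in_homD(1)[OF fun_hom[OF pf qs]] by (simp add: relF_def)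
    then show "mc (Comp LC (rho fM w ps') (FA fF (PhiF A w qs))) x j =
      mc (Comp LC (FA (PhiL w) (FA (pow_func n fF) qs)) (rho fM w ps)) x j"
     unfolding mc_comp[OF k(1) h[OF p(2)] x j] mc_comp[OF h[OF p(1)] k(2) x j]
     unfolding fM_rho[OF w p(1)] fM_rho[OF w p(2)] fr(2)[OF w p(1) x j] fr(2)[OF w p(2) x j]
     using m.rho_nat[OF w qs] fA(2)[OF P.FA_in_hom[OF qs] x j] in_homD(1)[OF P.FA_in_hom[OF qs]] by simp
   qed
   then show "Comp LC (rho fM w ps') (FA (comp_func fF (Phi A w)) qs) =
     Comp LC (FA (comp_func (PhiL w) (pow_func n fF)) qs) (rho fM w ps)"
    using in_homD(1)[OF qs] by (simp add: P.FDom fd)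
  next
   fix ps assume ps: "ps \<in> powO (Car A) n"
   show "in_hom LC (rho fM w ps) (FO (comp_func fF (Phi A w)) ps) (FO (comp_func (PhiL w) (pow_func n fF)) ps)"
    using h[OF ps] ps by (simp add: P.FDom fd del: pow_func_simps(3,4))
   show "iso_arr LC (rho fM w ps)" unfolding fM_rho[OF w ps]
    by (rule LC_isoI[OF fr(1)[OF w ps]]) (simp add: fr(2)[OF w ps] algmor_rho_iso[OF om w ps])
  qed (use words_all[OF w] arity_words[OF w] in \<open>simp_all add: fM_def\<close>)
  then show "nat_iso (pow_cat (Car A) n) (Car AlgL) (comp_func (AFun fM) (Phi A w))
    (comp_func (Phi AlgL w) (pow_func n (AFun fM))) (ARho fM w)" by simp
 qed (rule A.alg_over_axioms)
 show ?thesis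
 proof (rule t.algebra_morphismI)
  fix ps assume ps: "ps \<in> powO (Car A) 1"
  note fo = pow_func_Obj[OF t.AFun ps] and u = unit_words
  note h = t.rho_hom[OF u ps] t.B.CohI_hom[OF fo] t.AFun.FA_in_hom[OF A.CohI_hom[OF ps]]
  \<comment> \<open>Aligns the codomains of the two sides, since \<open>LC_arr_eqI\<close> compares
    components only across a common boundary.\<close>
  have e: "hd (map (AO fM) ps) = AO fM (hd ps)" using ps by (cases ps) (auto simp: powO_iff)
  have "Comp LC (NC CohIL (map (AO fM) ps)) (rho fM (unit_word T) ps) = AA fM (NC (CohI A) ps)"
  proof (rule LC_arr_eqI)
   show "in_hom LC (Comp LC (NC CohIL (map (AO fM) ps)) (rho fM (unit_word T) ps))
     (AO fM (PhiO A (unit_word T) ps)) (AO fM (hd ps))" using t.B.Car.in_hom_comp[OF h(1,2)] unfolding e by simp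
   show "in_hom LC (AA fM (NC (CohI A) ps)) (AO fM (PhiO A (unit_word T) ps)) (AO fM (hd ps))" using h(3) by simp
   fix x j assume x: "x \<in> Cell0 D" and j: "j \<in> O0 J x"
   interpret m: algmor T A "P0 F x" "o' x j" by (rule om[OF x j])
   show "mc (Comp LC (NC CohIL (map (AO fM) ps)) (rho fM (unit_word T) ps)) x j = mc (AA fM (NC (CohI A) ps)) x j"
    using mc_comp[OF h(1,2)[unfolded AlgL_simps] x j] fr(2)[OF u ps x j] fM_rho[OF u ps] m.rho_unit[OF ps] strict_over_CohI x j
     fo fO_list(2)[OF ps x j] map_fF[OF ps] fA(2)[OF A.CohI_hom[OF ps] x j] in_homD(1)[OF A.CohI_hom[OF ps]]
    by (simp add: strict_over_def relN_def del: map_map map_eq_conv)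
  qed
  then show "cmp AlgL (NC (CohI AlgL) (map (AO fM) ps)) (rho fM (unit_word T) ps) = AA fM (NC (CohI A) ps)" by simp
 next
  fix w ws ps assume w: "w \<in> words T (length ws)" and ws: "set ws \<subseteq> all_words T"
   and ps: "ps \<in> powO (Car A) (sum_list (ars T ws))"
  let ?ns = "ars T ws"
  interpret Q: is_functor "pow_cat LC (length ws)" LC "PhiL w" by (rule PhiL_functor[OF w])
  note fo = pow_func_Obj[OF t.AFun ps] and g = gam_words[OF w ws] and pp = A.prod_Phi_Obj[OF ws ps]
  note h = t.rho_hom[OF g ps] t.B.CohC_hom[OF w ws fo]
  note rb = t.rho_block_hom[OF ws ps]
  note k = t.AFun.FA_in_hom[OF A.CohC_hom[OF w ws ps]] t.rho_hom[OF w pp] Q.FA_in_hom[OF rb[unfolded AlgL_simps]]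
  note k = k[unfolded AlgL_simps] and h = h[unfolded AlgL_simps]
  have "Comp LC (NC (CohCL w ws) (map (AO fM) ps)) (rho fM (gam T w ws) ps) =
   Comp LC (FA (PhiL w) (map2 (rho fM) ws (blocks ?ns ps)))
    (Comp LC (rho fM w (map2 (PhiO A) ws (blocks ?ns ps))) (AA fM (NC (CohC A w ws) ps)))"
  proof (rule LC_arr_eqI[OF LC.in_hom_comp[OF h] LC.in_hom_comp[OF LC.in_hom_comp[OF k(1,2)] k(3)]])
   fix x j assume x: "x \<in> Cell0 D" and j: "j \<in> O0 J x"
   interpret m: algmor T A "P0 F x" "o' x j" by (rule om[OF x j])
   have "Mcs (map2 (rho fM) ws (blocks ?ns ps)) x j = map2 (rho (o' x j)) ws (blocks ?ns ps)"
    using fM_rho[OF _ blocks_Obj[OF ps]] fr(2)[OF _ blocks_Obj[OF ps] x j] nth_words[OF ws]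
    by (intro nth_equalityI) (simp_all add: words_iff)
   then have 1: "mc (FA (PhiL w) (map2 (rho fM) ws (blocks ?ns ps))) x j =
     PhiF (P0 F x) w (map2 (rho (o' x j)) ws (blocks ?ns ps))"
    using relF_PhiL[OF x j w] in_homD(1)[OF rb] by (simp add: relF_def del: map_map map_eq_conv)
   have 2: "mc (NC (CohCL w ws) (map (AO fM) ps)) x j = NC (CohC (P0 F x) w ws) (map (AO (o' x j)) ps)"
    using strict_over_CohC[OF w ws] x j fo fO_list[OF ps] map_fF[OF ps] by (simp add: strict_over_def relN_def del: map_map map_eq_conv)
   show "mc (Comp LC (NC (CohCL w ws) (map (AO fM) ps)) (rho fM (gam T w ws) ps)) x j =
    mc (Comp LC (FA (PhiL w) (map2 (rho fM) ws (blocks ?ns ps)))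
     (Comp LC (rho fM w (map2 (PhiO A) ws (blocks ?ns ps))) (AA fM (NC (CohC A w ws) ps)))) x j"
    unfolding mc_comp[OF h x j] mc_comp[OF LC.in_hom_comp[OF k(1,2)] k(3) x j] mc_comp[OF k(1,2) x j]
    unfolding 1 2 fM_rho[OF g ps] fr(2)[OF g ps x j] fM_rho[OF w pp] fr(2)[OF w pp x j] m.rho_gam[OF w ws ps]
    using fA(2)[OF A.CohC_hom[OF w ws ps] x j] in_homD(1)[OF A.CohC_hom[OF w ws ps]] by simp
  qed
  then show "cmp AlgL (NC (CohC AlgL w ws) (map (AO fM) ps)) (rho fM (gam T w ws) ps) =
   cmp AlgL (PhiF AlgL w (map2 (rho fM) ws (blocks ?ns ps))) (cmp AlgL (rho fM w (map2 (PhiO A) ws (blocks ?ns ps)))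
     (AA fM (NC (CohC A w ws) ps)))" by simp
 next
  fix w fs ps and l :: nat assume w: "w \<in> words T (length fs)" and fs: "set fs \<subseteq> {..<l}" and ps: "ps \<in> powO (Car A) l"
  note fo = pow_func_Obj[OF t.AFun ps] and g = subst_words[OF w fs] and r = reindex_Obj[OF ps fs]
  note h = t.rho_hom[OF g ps] t.B.CohS_hom[OF w fs fo]
  note k = t.AFun.FA_in_hom[OF A.CohS_hom[OF w fs ps]] t.rho_hom[OF w r]
  note k = k[unfolded AlgL_simps] and h = h[unfolded AlgL_simps]
  have e: "map ((!) (map (AO fM) ps)) fs = map (AO fM) (map ((!) ps) fs)"
   by (rule nth_Obs[symmetric]) (use fs ps in \<open>simp add: powO_iff\<close>)
  have "Comp LC (NC (CohSL w l fs) (map (AO fM) ps)) (rho fM (subst_word T l fs w) ps) =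
   Comp LC (rho fM w (map ((!) ps) fs)) (AA fM (NC (CohS A w l fs) ps))"
  proof (rule LC_arr_eqI[OF LC.in_hom_comp[OF h, unfolded e] LC.in_hom_comp[OF k]])
   fix x j assume x: "x \<in> Cell0 D" and j: "j \<in> O0 J x"
   interpret m: algmor T A "P0 F x" "o' x j" by (rule om[OF x j])
   have 2: "mc (NC (CohSL w l fs) (map (AO fM) ps)) x j = NC (CohS (P0 F x) w l fs) (map (AO (o' x j)) ps)"
    using strict_over_CohS[OF w fs] x j fo fO_list[OF ps] map_fF[OF ps] by (simp add: strict_over_def relN_def del: map_map map_eq_conv)
   show "mc (Comp LC (NC (CohSL w l fs) (map (AO fM) ps)) (rho fM (subst_word T l fs w) ps)) x j =
    mc (Comp LC (rho fM w (map ((!) ps) fs)) (AA fM (NC (CohS A w l fs) ps))) x j"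
    unfolding mc_comp[OF h x j] mc_comp[OF k x j]
    unfolding 2 fM_rho[OF g ps] fr(2)[OF g ps x j] fM_rho[OF w r] fr(2)[OF w r x j] m.rho_subst[OF w fs ps]
    using fA(2)[OF A.CohS_hom[OF w fs ps] x j] in_homD(1)[OF A.CohS_hom[OF w fs ps]] by simp
  qed
  then show "cmp AlgL (NC (CohS AlgL w l fs) (map (AO fM) ps)) (rho fM (subst_word T l fs w) ps) =
   cmp AlgL (rho fM w (map ((!) ps) fs)) (AA fM (NC (CohS A w l fs) ps))" by simp
 qed (simp_all add: fM_def)
qed

text \<open>The coherences of \<open>ev x j\<close> are identities, so those of the composite are
  the components of \<open>fr\<close>, which are the coherences of \<open>o' x j\<close>.\<close>

lemma fM_ev: assumes x: "x \<in> Cell0 D" and j: "j \<in> O0 J x" shows "algmor_comp T (ev x j) fM = o' x j"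
proof -
 interpret m: algmor T A "P0 F x" "o' x j" by (rule om[OF x j])
 interpret c: algmor_pair T A AlgL "P0 F x" fM "ev x j" by (intro algmor_pair.intro fM_algmor ev_algmor[OF x j])
 show ?thesis
 proof (rule algmor_eqI[OF c.comp_algmor m.algmor_axioms])
  fix w n ps assume w: "w \<in> words T n" and ps: "ps \<in> powO (Car A) n"
  show "rho (algmor_comp T (ev x j) fM) w ps = rho (o' x j) w ps" unfolding c.comp_rho[OF w ps]
   using in_homD(1)[OF fr(1)[OF w ps]] m.B.Car.in_hom_ide_left[OF m.rho_hom[OF w ps]] fO_list[OF ps]
   by (simp add: map_fF[OF ps] ev_rho[OF x j w] fM_rho[OF w ps] fr(2)[OF w ps x j] x j del: map_map map_eq_conv)
 next
  fix q assume q: "q \<in> Arr (Car A)"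
  then show "AA (algmor_comp T (ev x j) fM) q = AA (o' x j) q"
   using fA(1)[OF in_homI[OF q]] fA(2)[OF in_homI[OF q] x j] algmor_comp_AFun(2)[OF fM_algmor q, where H = "ev x j"] by (simp add: in_hom_def)
 qed (use x j algmor_comp_AFun(1)[OF fM_algmor, where H = "ev x j"] fO in simp)
qed

lemma fM_ev_ar: assumes x: "x \<in> Cell0 D" and u: "hom0 J x u i j"
 shows "cell_hcomp T (ev_ar x u) (cell_id fM) = a' x u"
proof (rule algcell_eqI[OF _ ac[OF x u]])
 note ij = hom_obj[OF J.P0_cat[OF x] u]
 show "algcell T A (P0 F x) (o' x i) (o' x j) (cell_hcomp T (ev_ar x u) (cell_id fM))"
  using cell_hcomp_cell[OF algmor.cell_id_cell[OF fM_algmor] ev_ar_cell[OF x u]] fM_ev[OF x] ij by simp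
 show "cN (cell_hcomp T (ev_ar x u) (cell_id fM)) p = cN (a' x u) p" if "p \<in> Obj (Car A)" for p
  unfolding cell_hcomp_right_NC[OF fM_algmor ev_ar_cell[OF x u] that]
  using fO[OF that] x in_homD(1)[OF u] that by simp
qed

lemma fM_ev_tr: assumes f: "f \<in> Cell1 D" and j: "j \<in> O0 J (Src D f)"
 shows "cell_hcomp T (ev_tr f j) (cell_id fM) = t' f j"
proof (rule algcell_eqI[OF _ tc[OF f j]])
 note xy = D.cell1(1,2)[OF f]
 note j' = fun_obj[OF J.P1_func[OF f] j]
 show "algcell T A (P0 F (Trg D f)) (algmor_comp T (P1 F f) (o' (Src D f) j)) (o' (Trg D f) (O1 J f j))
   (cell_hcomp T (ev_tr f j) (cell_id fM))"
  using cell_hcomp_cell[OF algmor.cell_id_cell[OF fM_algmor] ev_tr_cell[OF f j]]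
  unfolding algmor_comp_assoc[OF fM_algmor ev_algmor[OF xy(1) j] F_mor[OF f], symmetric] fM_ev[OF xy(1) j] fM_ev[OF xy(2) j'] .
 show "cN (cell_hcomp T (ev_tr f j) (cell_id fM)) p = cN (t' f j) p" if "p \<in> Obj (Car A)" for p
  unfolding cell_hcomp_right_NC[OF fM_algmor ev_tr_cell[OF f j] that] using fO[OF that] f j that by simp
qed

end

end

lemma pmod_cong: assumes "pmod D J K o1 a1 t1 o2 a2 t2 m"
  and "\<And>x j. x \<in> Cell0 D ==> j \<in> O0 J x ==> o1 x j = o1' x j" "\<And>x j. x \<in> Cell0 D ==> j \<in> O0 J x ==> o2 x j = o2' x j"
   "\<And>x u. x \<in> Cell0 D ==> u \<in> A0 J x ==> a1 x u = a1' x u" "\<And>x u. x \<in> Cell0 D ==> u \<in> A0 J x ==> a2 x u = a2' x u"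
   "\<And>f j. f \<in> Cell1 D ==> j \<in> O0 J (Src D f) ==> t1 f j = t1' f j"
   "\<And>f j. f \<in> Cell1 D ==> j \<in> O0 J (Src D f) ==> t2 f j = t2' f j"
 shows "pmod D J K o1' a1' t1' o2' a2' t2' m"
proof -
 interpret pmod D J K o1 a1 t1 o2 a2 t2 m by fact
 show ?thesis by (rule pmod.intro) (use m_hom m_nat m_compat in_homD(1) assms(2-) in metis)+
qed

section \<open>Composition with the evaluations is bijective on 1-cells and on 2-cells\<close>

context limit_setting
begin

lemma comp_ev: assumes M: "algmor T A AlgL M" and x: "x \<in> Cell0 D" and j: "j \<in> O0 J x"
 shows "algmor T A (P0 F x) (algmor_comp T (ev x j) M)"
  "p \<in> Obj (Car A) ==> AO (algmor_comp T (ev x j) M) p = ob (AO M p) x j"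
  "q \<in> Arr (Car A) ==> AA (algmor_comp T (ev x j) M) q = mc (AA M q) x j"
  "w \<in> words T n ==> ps \<in> powO (Car A) n ==> rho (algmor_comp T (ev x j) M) w ps = mc (rho M w ps) x j"
proof -
 interpret m: algmor T A AlgL M by fact
 interpret c: algmor_pair T A AlgL "P0 F x" M "ev x j" by (intro algmor_pair.intro M ev_algmor[OF x j])
 show "algmor T A (P0 F x) (algmor_comp T (ev x j) M)" by (rule c.comp_algmor)
 show "AO (algmor_comp T (ev x j) M) p = ob (AO M p) x j" if "p \<in> Obj (Car A)"
  using algmor_comp_AFun(1)[OF M that, where H = "ev x j"] m.AFun.FO_obj[OF that] by simp
 show "AA (algmor_comp T (ev x j) M) q = mc (AA M q) x j" if "q \<in> Arr (Car A)"
  using algmor_comp_AFun(2)[OF M that, where H = "ev x j"] m.AFun.FA_arr[OF that] by simp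
 assume w: "w \<in> words T n" and ps: "ps \<in> powO (Car A) n"
 have z: "map (AO M) ps \<in> powO LC n" using pow_func_Obj[OF m.AFun ps] by simp
 have r: "in_hom LC (rho M w ps) (AO M (PhiO A w ps)) (phiO w (map (AO M) ps))"
  using m.rho_hom[OF w ps] by (simp add: PhiL_FO[OF w z])
 show "rho (algmor_comp T (ev x j) M) w ps = mc (rho M w ps) x j"
  unfolding c.comp_rho[OF w ps] ev_rho[OF x j w z] phiO(2)[OF w z x j, symmetric]
  using category.in_hom_ide_left[OF F_cat[OF x] mc_hom[OF r x j]] in_homD(1)[OF r] by simp
qed

lemma comp_ev_cell: assumes p: "p \<in> Obj (Car A)"
 shows "algmor T A AlgL M ==> x \<in> Cell0 D ==> u \<in> A0 J x ==>
   cN (cell_hcomp T (ev_ar x u) (cell_id M)) p = ar (AO M p) x u"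
  "algmor T A AlgL M ==> f \<in> Cell1 D ==> j \<in> O0 J (Src D f) ==>
   cN (cell_hcomp T (ev_tr f j) (cell_id M)) p = tr (AO M p) f j"
  "algcell T A AlgL M N si ==> x \<in> Cell0 D ==> j \<in> O0 J x ==>
   cN (cell_hcomp T (cell_id (ev x j)) si) p = mc (cN si p) x j"
proof -
 assume M: "algmor T A AlgL M"
 have z: "AO M p \<in> Obj LC" using fun_obj[OF algmor_AFun[OF M] p] by simp
 show "cN (cell_hcomp T (ev_ar x u) (cell_id M)) p = ar (AO M p) x u" if "x \<in> Cell0 D" "u \<in> A0 J x"
  unfolding cell_hcomp_right_NC[OF M ev_ar_cell[OF that(1) in_homI[OF that(2)]] p] ev_NC(1)[OF z] ..
 show "cN (cell_hcomp T (ev_tr f j) (cell_id M)) p = tr (AO M p) f j" if "f \<in> Cell1 D" "j \<in> O0 J (Src D f)"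
  unfolding cell_hcomp_right_NC[OF M ev_tr_cell[OF that] p] ev_NC(2)[OF z] ..
next
 assume s: "algcell T A AlgL M N si" and x: "x \<in> Cell0 D" "j \<in> O0 J x"
 show "cN (cell_hcomp T (cell_id (ev x j)) si) p = mc (cN si p) x j"
  unfolding cell_hcomp_left_NC[OF s ev_algmor[OF x] p] using in_homD(1)[OF algcell_NC_hom[OF s p]] by simp
qed

text \<open>Composites with \<open>ev\<close> determine the object values of the cones
  \<open>AO k p\<close> and all components of the modifications \<open>AA k q\<close> and
  \<open>rho k w ps\<close>. The arrow values and the 2-cells of the cones are seen by whiskering
  with \<open>ev_ar\<close> and \<open>ev_tr\<close>.\<close>

lemma ev_one_inj: assumes k: "algmor T A AlgL k" "algmor T A AlgL k'"
  and o: "\<And>x j. x \<in> Cell0 D ==> j \<in> O0 J x ==> algmor_comp T (ev x j) k = algmor_comp T (ev x j) k'"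
  and a: "\<And>x u. x \<in> Cell0 D ==> u \<in> A0 J x ==>
   cell_hcomp T (ev_ar x u) (cell_id k) = cell_hcomp T (ev_ar x u) (cell_id k')"
  and t: "\<And>f j. f \<in> Cell1 D ==> j \<in> O0 J (Src D f) ==>
   cell_hcomp T (ev_tr f j) (cell_id k) = cell_hcomp T (ev_tr f j) (cell_id k')" shows "k = k'"
proof -
 interpret k: algmor T A AlgL k by fact
 interpret k': algmor T A AlgL k' by fact
 have kO: "AO k p \<in> Obj LC" "AO k' p \<in> Obj LC" if "p \<in> Obj (Car A)" for p
  using k.AFun.FO_obj[OF that] k'.AFun.FO_obj[OF that] by simp_all
 have O: "AO k p = AO k' p" if p: "p \<in> Obj (Car A)" for p
 proof (rule LC_obj_eqI[OF kO[OF p]])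
  show "ob (AO k p) x j = ob (AO k' p) x j" if "x \<in> Cell0 D" "j \<in> O0 J x" for x j
   using comp_ev(2)[OF k(1) that p] comp_ev(2)[OF k(2) that p] o[OF that] by metis
  show "ar (AO k p) x u = ar (AO k' p) x u" if "x \<in> Cell0 D" "u \<in> A0 J x" for x u
   using comp_ev_cell(1)[OF p k(1) that] comp_ev_cell(1)[OF p k(2) that] a[OF that] by metis
  show "tr (AO k p) f j = tr (AO k' p) f j" if "f \<in> Cell1 D" "j \<in> O0 J (Src D f)" for f j
   using comp_ev_cell(2)[OF p k(1) that] comp_ev_cell(2)[OF p k(2) that] t[OF that] by metis
 qed
 show ?thesis
 proof (rule algmor_eqI[OF k O])
  fix q assume q: "q \<in> Arr (Car A)"
  note h = k.AFun.FA_in_hom[OF in_homI[OF q]] k'.AFun.FA_in_hom[OF in_homI[OF q]]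
  show "AA k q = AA k' q"
  proof (rule LC_arr_eqI)
   show "in_hom LC (AA k q) (AO k (Dom (Car A) q)) (AO k (Cod (Car A) q))" using h(1) by simp
   show "in_hom LC (AA k' q) (AO k (Dom (Car A) q)) (AO k (Cod (Car A) q))"
    using h(2) O k.A.Car.dom_obj[OF q] k.A.Car.cod_obj[OF q] by simp
   show "mc (AA k q) x j = mc (AA k' q) x j" if "x \<in> Cell0 D" "j \<in> O0 J x" for x j
    using comp_ev(3)[OF k(1) that q] comp_ev(3)[OF k(2) that q] o[OF that] by metis
  qed
 next
  fix w n ps assume w: "w \<in> words T n" and ps: "ps \<in> powO (Car A) n"
  note p = fun_obj[OF k.A.Phi_functor[OF w] ps]
  have m: "map (AO k') ps = map (AO k) ps" using ps O by (auto simp: powO_iff in_set_conv_nth)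
  show "rho k w ps = rho k' w ps"
  proof (rule LC_arr_eqI)
   show "in_hom LC (rho k w ps) (AO k (PhiO A w ps)) (FO (PhiL w) (map (AO k) ps))" using k.rho_hom[OF w ps] by simp
   show "in_hom LC (rho k' w ps) (AO k (PhiO A w ps)) (FO (PhiL w) (map (AO k) ps))"
    using k'.rho_hom[OF w ps] O[OF p] unfolding m by simp
   show "mc (rho k w ps) x j = mc (rho k' w ps) x j" if "x \<in> Cell0 D" "j \<in> O0 J x" for x j
    using comp_ev(4)[OF k(1) that w ps] comp_ev(4)[OF k(2) that w ps] o[OF that] by metis
  qed
 qed
qed

lemma ev_two_inj: assumes s: "algcell T A AlgL k k' si" and t: "algcell T A AlgL k k' ta"
  and e: "\<And>x j. x \<in> Cell0 D ==> j \<in> O0 J x ==>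
   cell_hcomp T (cell_id (ev x j)) si = cell_hcomp T (cell_id (ev x j)) ta" shows "si = ta"
proof (rule algcell_eqI[OF s t])
 fix p assume p: "p \<in> Obj (Car A)"
 show "cN si p = cN ta p"
 proof (rule LC_arr_eqI[OF algcell_NC_hom[OF s p, unfolded AlgL_simps] algcell_NC_hom[OF t p, unfolded AlgL_simps]])
  show "mc (cN si p) x j = mc (cN ta p) x j" if "x \<in> Cell0 D" "j \<in> O0 J x" for x j
   using comp_ev_cell(3)[OF p s that] comp_ev_cell(3)[OF p t that] e[OF that] by metis
 qed
qed

text \<open>By \<open>pm\<close> the values at \<open>p\<close> of the given 2-cells form a
  modification, which is taken as the component of \<open>si\<close> at \<open>p\<close>. Naturality
  and the 2-cell condition are tested by evaluation, where they hold for each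
  \<open>m x j\<close>.\<close>

lemma ev_two_surj: assumes k: "algmor T A AlgL k" and k': "algmor T A AlgL k'"
  and m: "\<And>x j. x \<in> Cell0 D ==> j \<in> O0 J x ==>
   algcell T A (P0 F x) (algmor_comp T (ev x j) k) (algmor_comp T (ev x j) k') (m x j)"
  and pm: "\<And>p. p \<in> Obj (Car A) ==> pmod D J U (ob (AO k p)) (ar (AO k p)) (tr (AO k p))
   (ob (AO k' p)) (ar (AO k' p)) (tr (AO k' p)) (\<lambda>x j. cN (m x j) p)"
 shows "\<exists>si. algcell T A AlgL k k' si \<and>
  (\<forall>x\<in>Cell0 D. \<forall>j\<in>O0 J x. cell_hcomp T (cell_id (ev x j)) si = m x j)"
proof -
 interpret k: algmor T A AlgL k by fact
 interpret k': algmor T A AlgL k' by fact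
 have kO: "AO k p \<in> Obj LC" "AO k' p \<in> Obj LC" if "p \<in> Obj (Car A)" for p
  using k.AFun.FO_obj[OF that] k'.AFun.FO_obj[OF that] by simp_all
 define si where "si = \<lparr>CDom = k, CCod = k', CNat = \<lparr>NDom = AFun k, NCod = AFun k',
  NC = (\<lambda>p\<in>Obj (Car A). mkA (AO k p) (AO k' p) (\<lambda>x j. cN (m x j) p))\<rparr>\<rparr>"
 have h: "in_hom LC (cN si p) (AO k p) (AO k' p)"
  and c: "\<And>x j. x \<in> Cell0 D ==> j \<in> O0 J x ==> mc (cN si p) x j = cN (m x j) p"
  if "p \<in> Obj (Car A)" for p using mkA[OF kO[OF that] pm[OF that]] that by (simp_all add: si_def)
 have s: "algcell T A AlgL k k' si"
 proof (rule algcellI[OF k k'])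
  show "nat_trans (Car A) (Car AlgL) (AFun k) (AFun k') (CNat si)"
  proof (rule nat_transI[OF k.AFun k'.AFun]; (unfold AlgL_simps)?)
   fix q p p' assume q: "chom A q p p'"
   note p = k.A.Car.in_hom_obj[OF q]
   note a = k.AFun.FA_in_hom[OF q, unfolded AlgL_simps] k'.AFun.FA_in_hom[OF q, unfolded AlgL_simps]
   show "Comp LC (cN si p') (AA k q) = Comp LC (AA k' q) (cN si p)"
   proof (rule LC_arr_eqI[OF LC.in_hom_comp[OF a(1) h[OF p(2)]] LC.in_hom_comp[OF h[OF p(1)] a(2)]])
    fix x j assume x: "x \<in> Cell0 D" and j: "j \<in> O0 J x"
    show "mc (Comp LC (cN si p') (AA k q)) x j = mc (Comp LC (AA k' q) (cN si p)) x j"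
     unfolding mc_comp[OF a(1) h[OF p(2)] x j] mc_comp[OF h[OF p(1)] a(2) x j] c[OF p(1) x j] c[OF p(2) x j]
     using nat_trans.naturality_hom[OF algcell_nat[OF m[OF x j]] q] in_homD(1)[OF q]
     by (simp only: comp_ev(3)[OF k x j] comp_ev(3)[OF k' x j])
   qed
  qed (use h in \<open>simp_all add: si_def\<close>)
  fix w n ps assume w: "w \<in> words T n" and ps: "ps \<in> powO (Car A) n"
  note p = fun_obj[OF k.A.Phi_functor[OF w] ps]
  note r = k.rho_hom[OF w ps, unfolded AlgL_simps] k'.rho_hom[OF w ps, unfolded AlgL_simps]
  have hs: "powH LC n (map (cN si) ps) (map (AO k) ps) (map (AO k') ps)" using ps h by (auto simp: powH_iff powO_iff)
  note P = fun_hom[OF PhiL_functor[OF w] hs]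
  have "Comp LC (rho k' w ps) (cN si (PhiO A w ps)) = Comp LC (FA (PhiL w) (map (cN si) ps)) (rho k w ps)"
  proof (rule LC_arr_eqI[OF LC.in_hom_comp[OF h[OF p] r(2)] LC.in_hom_comp[OF r(1) P]])
   fix x j assume x: "x \<in> Cell0 D" and j: "j \<in> O0 J x"
   have "Mcs (map (cN si) ps) x j = map (cN (m x j)) ps" using ps c x j by (auto simp: powO_iff in_set_conv_nth)
   then have "mc (FA (PhiL w) (map (cN si) ps)) x j = PhiF (P0 F x) w (map (cN (m x j)) ps)"
    using relF_PhiL[OF x j w] in_homD(1)[OF hs] by (simp add: relF_def del: map_map map_eq_conv)
   then show "mc (Comp LC (rho k' w ps) (cN si (PhiO A w ps))) x j =
     mc (Comp LC (FA (PhiL w) (map (cN si) ps)) (rho k w ps)) x j"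
    unfolding mc_comp[OF h[OF p] r(2) x j] mc_comp[OF r(1) P x j] c[OF p x j]
    using algcell.cell_rho[OF m[OF x j] w ps] by (simp only: comp_ev(4)[OF k x j w ps] comp_ev(4)[OF k' x j w ps])
  qed
  then show "cmp AlgL (rho k' w ps) (cN si (PhiO A w ps)) =
    cmp AlgL (PhiF AlgL w (map (cN si) ps)) (rho k w ps)" by simp
 qed (simp_all add: si_def)
 moreover have "cell_hcomp T (cell_id (ev x j)) si = m x j" if x: "x \<in> Cell0 D" and j: "j \<in> O0 J x" for x j
  by (rule algcell_eqI[OF cell_hcomp_cell[OF s algmor.cell_id_cell[OF ev_algmor[OF x j]]] m[OF x j]])
   (simp only: comp_ev_cell(3)[OF _ s x j] c[OF _ x j])
 ultimately show ?thesis by blast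
qed

text \<open>Translates the statements about \<open>ev\<close>, \<open>ev_ar\<close> and
  \<open>ev_tr\<close> into the clauses of \<open>universal_cone\<close>; surjectivity on 1-cells is
  witnessed by the induced morphism \<open>fM\<close>.\<close>

lemma AlgL_universal: "universal_cone D PA J F AlgL et"
proof (intro universal_cone.intro universal_cone_axioms.intro)
 show "rep_setting D PA J F" by (rule S.rep_setting_axioms)
 show "AlgL \<in> Cell0 PA" using AlgL_small by simp
 show "pseudo_nat D J (R AlgL) et" by (rule et)
 show "k = k'" if "k \<in> Cell1 PA" "k' \<in> Cell1 PA" "Src PA k = Src PA k'" "Trg PA k = AlgL" "Trg PA k' = AlgL"
   and o: "\<And>x j. x \<in> Cell0 D ==> j \<in> O0 J x ==> Comp1 PA (pob et x j) k = Comp1 PA (pob et x j) k'"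
   and a: "\<And>x u. x \<in> Cell0 D ==> u \<in> A0 J x ==>
    HComp PA (par et x u) (Ide2 PA k) = HComp PA (par et x u) (Ide2 PA k')"
   and t: "\<And>f j. f \<in> Cell1 D ==> j \<in> O0 J (Src D f) ==>
    HComp PA (ptr et f j) (Ide2 PA k) = HComp PA (ptr et f j) (Ide2 PA k')" for k k'
 proof (rule ev_one_inj)
  show "algmor T (ADom k) AlgL k" "algmor T (ADom k) AlgL k'" using that(1-5) by simp_all
  show "algmor_comp T (ev x j) k = algmor_comp T (ev x j) k'" if x: "x \<in> Cell0 D" "j \<in> O0 J x" for x j
   using o[OF x] by (simp only: PsAlg_simps et_simps(1)[OF x])
  show "cell_hcomp T (ev_ar x u) (cell_id k) = cell_hcomp T (ev_ar x u) (cell_id k')"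
   if x: "x \<in> Cell0 D" "u \<in> A0 J x" for x u using a[OF x] by (simp only: PsAlg_simps et_simps(2)[OF x])
  show "cell_hcomp T (ev_tr f j) (cell_id k) = cell_hcomp T (ev_tr f j) (cell_id k')"
   if f: "f \<in> Cell1 D" "j \<in> O0 J (Src D f)" for f j
   using t[OF f] by (simp only: PsAlg_simps et_simps(3)[OF f])
 qed
 show "\<exists>k\<in>Cell1 PA. Src PA k = A \<and> Trg PA k = AlgL \<and>
   (\<forall>x\<in>Cell0 D. \<forall>j\<in>O0 J x. Comp1 PA (pob et x j) k = pob al x j) \<and>
   (\<forall>x\<in>Cell0 D. \<forall>u\<in>A0 J x. HComp PA (par et x u) (Ide2 PA k) = par al x u) \<and>
   (\<forall>f\<in>Cell1 D. \<forall>j\<in>O0 J (Src D f). HComp PA (ptr et f j) (Ide2 PA k) = ptr al f j)"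
  if "A \<in> Cell0 PA" and al: "pseudo_nat D J (R A) al" for A al
 proof -
  have A: "small_algebra T A" using that by simp
  note c = S.R.pnat_pcone[OF al]
  show ?thesis
   using fM_ev[OF A c] fM_ev_ar[OF A c _ in_homI] fM_ev_tr[OF A c] algmor_cells[OF A fM_algmor[OF A c] AlgL_small]
   by (intro bexI[of _ "fM A (pob al) (par al) (ptr al)"]) (simp_all add: et_simps del: PsAlg_simps(2))
 qed
 show "si = ta" if "si \<in> Cell2 PA" "ta \<in> Cell2 PA" "Dom2 PA si = Dom2 PA ta"
   "Cod2 PA si = Cod2 PA ta" "Trg PA (Dom2 PA si) = AlgL" and e: "\<And>x j. x \<in> Cell0 D ==> j \<in> O0 J x ==>
    HComp PA (Ide2 PA (pob et x j)) si = HComp PA (Ide2 PA (pob et x j)) ta" for si ta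
 proof (rule ev_two_inj)
  show "algcell T (ADom (CDom si)) AlgL (CDom si) (CCod si) si" "algcell T (ADom (CDom si)) AlgL (CDom si) (CCod si) ta"
   using that(1-5) by simp_all
  show "cell_hcomp T (cell_id (ev x j)) si = cell_hcomp T (cell_id (ev x j)) ta" if x: "x \<in> Cell0 D" "j \<in> O0 J x" for x j
   using e[OF x] by (simp only: PsAlg_simps et_simps(1)[OF x])
 qed
 fix k k' m
 assume kk: "k \<in> Cell1 PA" "k' \<in> Cell1 PA" "Src PA k = Src PA k'" "Trg PA k = AlgL" "Trg PA k' = AlgL"
  and pm: "pmod D J (R (Src PA k))
    (pob (pnat_comp D (rep_pnat D PA F k) et)) (par (pnat_comp D (rep_pnat D PA F k) et))
    (ptr (pnat_comp D (rep_pnat D PA F k) et))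
    (pob (pnat_comp D (rep_pnat D PA F k') et)) (par (pnat_comp D (rep_pnat D PA F k') et))
    (ptr (pnat_comp D (rep_pnat D PA F k') et)) m"
 let ?A = "ADom k"
 have A: "small_algebra T ?A" and k: "algmor T ?A AlgL k" and k': "algmor T ?A AlgL k'" using kk by simp_all
 have cone: "pseudo_nat D J (R ?A) (pnat_comp D (rep_pnat D PA F l) et)"
  if "l \<in> Cell1 PA" "ADom l = ?A" "ACod l = AlgL" for l
  using strict_trans.strict_pseudo_nat[OF S.rep_strict_trans[OF that(1)], of et] that(2,3) et by (simp del: PsAlg_simps(2))
 note simps = S.rep_cone_simps[OF _ _ et]
 have s: "x \<in> Cell0 D ==> j \<in> O0 J x ==> pob (pnat_comp D (rep_pnat D PA F l) et) x j = algmor_comp T (ev x j) l"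
  "x \<in> Cell0 D ==> u \<in> A0 J x ==> par (pnat_comp D (rep_pnat D PA F l) et) x u = cell_hcomp T (ev_ar x u) (cell_id l)"
  "f \<in> Cell1 D ==> j \<in> O0 J (Src D f) ==>
   ptr (pnat_comp D (rep_pnat D PA F l) et) f j = cell_hcomp T (ev_tr f j) (cell_id l)"
  if "l \<in> Cell1 PA" "ACod l = AlgL" for l x j u f
  using simps[of l] that et_simps by (simp_all del: PsAlg_simps(2))
 note kl = kk[unfolded PsAlg_simps(4,5)]
 note s1 = s[OF kk(1) kl(4)] and s2 = s[OF kk(2) kl(5)]
 note c1 = S.R.pnat_pcone[OF cone[OF kk(1) refl kl(4)]] and c2 = S.R.pnat_pcone[OF cone[OF kk(2) kl(3)[symmetric] kl(5)]]
 have pm: "pmod D J (R ?A) (pob (pnat_comp D (rep_pnat D PA F k) et)) (par (pnat_comp D (rep_pnat D PA F k) et))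
    (ptr (pnat_comp D (rep_pnat D PA F k) et))
    (pob (pnat_comp D (rep_pnat D PA F k') et)) (par (pnat_comp D (rep_pnat D PA F k') et))
    (ptr (pnat_comp D (rep_pnat D PA F k') et)) m" using pm by (simp only: PsAlg_simps(4))
 have "\<exists>si. algcell T ?A AlgL k k' si \<and> (\<forall>x\<in>Cell0 D. \<forall>j\<in>O0 J x. cell_hcomp T (cell_id (ev x j)) si = m x j)"
 proof (rule ev_two_surj[OF k k'])
  show "algcell T ?A (P0 F x) (algmor_comp T (ev x j) k) (algmor_comp T (ev x j) k') (m x j)"
   if "x \<in> Cell0 D" "j \<in> O0 J x" for x j
   using pmod.m_hom[OF pm that] unfolding rep_in_hom[OF A that(1)] s1(1)[OF that] s2(1)[OF that] .
  fix p assume p: "p \<in> Obj (Car ?A)"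
  \<comment> \<open>The given modification is evaluated at \<open>p\<close>, and its boundary cones
    are recognised as those of \<open>k\<close> and \<open>k'\<close> by the formulas for composites
    with evaluations.\<close>
  show "pmod D J U (ob (AO k p)) (ar (AO k p)) (tr (AO k p))
   (ob (AO k' p)) (ar (AO k' p)) (tr (AO k' p)) (\<lambda>x j. cN (m x j) p)"
   by (rule pmod_cong[OF pmod_rep[OF A pm p c1 c2]])
    (simp_all only: s1 s2 comp_ev(2)[OF k _ _ p] comp_ev(2)[OF k' _ _ p] comp_ev_cell(1,2)[OF p k] comp_ev_cell(1,2)[OF p k'])
 qed
 then obtain si where s: "algcell T ?A AlgL k k' si" "\<forall>x\<in>Cell0 D. \<forall>j\<in>O0 J x. cell_hcomp T (cell_id (ev x j)) si = m x j"
  by blast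
 show "\<exists>si\<in>Cell2 PA. Dom2 PA si = k \<and> Cod2 PA si = k' \<and>
   (\<forall>x\<in>Cell0 D. \<forall>j\<in>O0 J x. HComp PA (Ide2 PA (pob et x j)) si = m x j)"
  using Cell2I[OF s(1) A AlgL_small] algcell_boundary[OF s(1)] s(2) et_simps
  by (intro bexI[of _ si]) (simp_all del: PsAlg_simps(3))
qed

end

theorem theorem8p12:
  fixes T :: "'t alg_theory"
    and D :: "('u::universe, 'u, 'u) two_cat"
    and J :: "('u, 'u, 'u, ('u, 'u) cat, ('u, 'u, 'u, 'u) func, ('u, 'u, 'u, 'u) ntrans) psfun"
    and F :: "('u, 'u, 'u, ('u, 'u, 't) psalg, ('u, 'u, 't) algmor, ('u, 'u, 't) algcell) psfun"
  assumes "is_theory T"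
    and "small_two_category D"
    and "pseudo_functor D Cat J"
    and "pseudo_functor D (PsAlg T) F"
  shows "\<exists>L. weighted_pseudo_limit D (PsAlg T) J F L"
proof -
  interpret limit_setting T D J F using assms by (intro limit_setting.intro limit_setting_axioms.intro)
  show ?thesis using universal_cone.weighted_pseudo_limit[OF AlgL_universal] by blast
qed

end
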